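(* Let $s=1$, $\lambda_n>0$, and let $\hat F_n$ be a minimizer of $R_n+\lambda_nJ_1$ over $\mathcal H^1(I,M)$, with $d_M(\hat F_n(t_i),Y_i)<\mathrm{inj}(M)$ for all $i=1,\dots,n$. Assume $(M,g)$ is a $C^k$ Riemannian manifold with $k\ge2$. Then: (a) $\hat F_n\in C^k(I\setminus\{t_1,\dots,t_n\},M)$. In particular, if $M$ is $C^\infty$ (resp. real analytic), then $\hat F_n$ is $C^\infty$ (resp. $C^\omega$) on each open interval between consecutive design points. (b) At each design point $t_i$, $\hat F_n$ is continuous but has a jump discontinuity in the first derivative; $\|\hat F_n'\|_{L^\infty}<\infty$, and $$\hat F_n'(t_i^+)-\hat F_n'(t_i^-)=-\frac1{n\lambda_n}\log_{\hat F_n(t_i)}(Y_i),$$ where the one-sided derivatives are one-sided limits in $\mathbb R^D$ and their difference lies in $T_{\hat F_n(t_i)}M$. (c) On each interval $(t_{(i)},t_{(i+1)})$, where $t_{(1)}<\dots<t_{(n)}$ are the order statistics of the design points, $\hat F_n$ is a harmonic map from the interval to $M$, hence a constant-speed geodesic. (For $M=\mathbb R^d$ this is an affine function; for $M=S^d$ it is an arc of a great circle traversed at constant speed.) (d) $\hat F_n'(0^+)=0$ and $\hat F_n'(1^-)=0$.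
   Context: $I=[0,1]$. $(M,g)$ is a compact connected Riemannian manifold without boundary, isometrically embedded in $\mathbb R^D$, with geodesic distance $d_M$ and injectivity radius $\mathrm{inj}(M)$. $\mathcal H^1(I,M)=\{F\in H^1(I,\mathbb R^D):F(t)\in M\ \forall t\in I\}$, $J_1(F)=\int_0^1|F'(t)|^2dt$. Observations $(t_i,Y_i)_{i=1}^n$ have distinct $t_i\in(0,1)$ and $Y_i\in M$; $R_n(F)=n^{-1}\sum_{i=1}^nd_M^2(Y_i,F(t_i))$. For $d_M(y,q)<\mathrm{inj}(M)$, $\log_y(q)\in T_yM\subset\mathbb R^D$ is the initial velocity of the unique minimizing unit-time geodesic from $y$ to $q$. A harmonic map from an interval to $M$ is a critical point of the Dirichlet energy $\frac12\int|F'|^2$.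
   Formalization: In (b), the first derivative is claimed to jump (nonzero) at t_i only when F̂_n(t_i) ≠ Y_i; if F̂_n(t_i) = Y_i (e.g. all Y_i equal and F̂_n constant) the displayed formula gives zero jump, so the unconditional claim is false. *)

theory Defs
  imports "HOL-Analysis.Analysis" "HOL-Probability.Essential_Supremum"
begin

section \<open>Regularity classes\<close>

text \<open>\<open>Ck_open k U f\<close>: \<open>f\<close> is of class \<open>C^k\<close> on \<open>U\<close>. Meaningful only for open \<open>U\<close>.\<close>

primrec Ck_open :: "nat \<Rightarrow> 'b::euclidean_space set \<Rightarrow> ('b \<Rightarrow> 'a::euclidean_space) \<Rightarrow> bool" where
  "Ck_open 0 U f \<longleftrightarrow> continuous_on U f"
| "Ck_open (Suc k) U f \<longleftrightarrow> (\<forall>x\<in>U. f differentiable (at x)) \<and>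
     (\<forall>v. Ck_open k U (\<lambda>x. frechet_derivative f (at x) v))"

text \<open>\<open>C^k\<close> on an arbitrary subset of a Euclidean space: locally the restriction of a \<open>C^k\<close> map
  defined on an open set of the ambient space.\<close>

definition Ck_on :: "nat \<Rightarrow> 'b::euclidean_space set \<Rightarrow> ('b \<Rightarrow> 'a::euclidean_space) \<Rightarrow> bool" where
  "Ck_on k S f \<longleftrightarrow>
     (\<forall>x\<in>S. \<exists>U g. open U \<and> x \<in> U \<and> Ck_open k U g \<and> (\<forall>y\<in>S \<inter> U. g y = f y))"

text \<open>The next two are used on open sets only.\<close>

definition smooth_on :: "'b::euclidean_space set \<Rightarrow> ('b \<Rightarrow> 'a::euclidean_space) \<Rightarrow> bool" where
  "smooth_on S f \<longleftrightarrow> (\<forall>k. Ck_on k S f)"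

text \<open>Near each point, \<open>f\<close> is the sum of a power series in the coordinates \<open>(x - x0) \<bullet> b\<close>,
  \<open>b \<in> Basis\<close>; a multi-index is a function \<open>\<alpha>\<close> vanishing off \<open>Basis\<close>.\<close>

definition real_analytic_on :: "'b::euclidean_space set \<Rightarrow> ('b \<Rightarrow> 'a::euclidean_space) \<Rightarrow> bool" where
  "real_analytic_on S f \<longleftrightarrow>
     (\<forall>x0\<in>S. \<exists>r>0. \<exists>c :: ('b \<Rightarrow> nat) \<Rightarrow> 'a. \<forall>x\<in>ball x0 r.
        ((\<lambda>\<alpha>. (\<Prod>b\<in>Basis. ((x - x0) \<bullet> b) ^ \<alpha> b) *\<^sub>R c \<alpha>) has_sum f x)
          {\<alpha>. \<forall>b. b \<notin> Basis \<longrightarrow> \<alpha> b = 0})"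

section \<open>Riemannian submanifolds of a Euclidean space\<close>

text \<open>Embedded submanifolds without boundary, via slice charts of regularity \<open>reg\<close> (in both
  directions). The dimension is that of the subspace \<open>E\<close>.\<close>

definition submanifold ::
    "('a::euclidean_space set \<Rightarrow> ('a \<Rightarrow> 'a) \<Rightarrow> bool) \<Rightarrow> 'a set \<Rightarrow> bool" where
  "submanifold reg M \<longleftrightarrow> (\<exists>m. \<forall>p\<in>M. \<exists>U V \<phi> \<psi> E.
     open U \<and> p \<in> U \<and> open V \<and> homeomorphism U V \<phi> \<psi> \<and> reg U \<phi> \<and> reg V \<psi> \<and>
     subspace E \<and> dim E = m \<and> \<phi> ` (U \<inter> M) = V \<inter> E)"

definition tangent_space :: "'a::euclidean_space set \<Rightarrow> 'a \<Rightarrow> 'a set" where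
  "tangent_space M p = {v. \<exists>\<gamma> e. e > 0 \<and> \<gamma> ` {-e<..<e} \<subseteq> M \<and> \<gamma> 0 = p \<and>
     (\<gamma> has_vector_derivative v) (at (0::real))}"

text \<open>\<open>L\<close> is the (finite) length of \<open>\<gamma>\<close>. Stated with \<open>has_integral\<close> because \<open>valid_path\<close> also admits
  paths of infinite length, for which the value of the total function \<open>integral\<close> would be \<open>0\<close>.\<close>

definition has_length :: "(real \<Rightarrow> 'a::euclidean_space) \<Rightarrow> real \<Rightarrow> bool" where
  "has_length \<gamma> L \<longleftrightarrow>
     ((\<lambda>t. norm (vector_derivative \<gamma> (at t within {0..1}))) has_integral L) {0..1}"

definition geo_dist :: "'a::euclidean_space set \<Rightarrow> 'a \<Rightarrow> 'a \<Rightarrow> real" where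
  "geo_dist M p q = Inf {L. \<exists>\<gamma>. valid_path \<gamma> \<and> path_image \<gamma> \<subseteq> M \<and>
     pathstart \<gamma> = p \<and> pathfinish \<gamma> = q \<and> has_length \<gamma> L}"

text \<open>The Levi-Civita connection of the induced metric is the tangential part of the ambient
  derivative, so \<open>\<gamma>\<close> is a geodesic iff its ambient acceleration is normal to \<open>M\<close>.
  \<open>J\<close> is a nondegenerate interval.\<close>

definition geodesic_on :: "'a::euclidean_space set \<Rightarrow> real set \<Rightarrow> (real \<Rightarrow> 'a) \<Rightarrow> bool" where
  "geodesic_on M J \<gamma> \<longleftrightarrow> \<gamma> ` J \<subseteq> M \<and> Ck_on 2 J \<gamma> \<and>
     (\<forall>t\<in>J. \<forall>w\<in>tangent_space M (\<gamma> t).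
        vector_derivative (\<lambda>s. vector_derivative \<gamma> (at s within J)) (at t within J) \<bullet> w = 0)"

text \<open>\<open>exp_rel M p v q\<close>: \<open>q\<close> is the time-one value of a geodesic with initial data \<open>(p, v)\<close>.\<close>

definition exp_rel :: "'a::euclidean_space set \<Rightarrow> 'a \<Rightarrow> 'a \<Rightarrow> 'a \<Rightarrow> bool" where
  "exp_rel M p v q \<longleftrightarrow> (\<exists>\<gamma>. geodesic_on M {0..1} \<gamma> \<and> \<gamma> 0 = p \<and>
     vector_derivative \<gamma> (at 0 within {0..1}) = v \<and> \<gamma> 1 = q)"

definition riem_exp :: "'a::euclidean_space set \<Rightarrow> 'a \<Rightarrow> 'a \<Rightarrow> 'a" where
  "riem_exp M p v = (THE q. exp_rel M p v q)"

text \<open>On the ball of radius \<open>r\<close> in the tangent space at \<open>p\<close>, the exponential map is defined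
  (the first conjunct) and is a diffeomorphism onto its image.\<close>

definition exp_diffeo :: "'a::euclidean_space set \<Rightarrow> 'a \<Rightarrow> real \<Rightarrow> bool" where
  "exp_diffeo M p r \<longleftrightarrow> (let B = {v \<in> tangent_space M p. norm v < r} in
     (\<forall>v\<in>B. \<exists>!q. exp_rel M p v q) \<and>
     (\<exists>\<psi>. homeomorphism B (riem_exp M p ` B) (riem_exp M p) \<psi> \<and>
        Ck_on 1 B (riem_exp M p) \<and> Ck_on 1 (riem_exp M p ` B) \<psi>))"

text \<open>Extended-real valued: the value is \<open>\<infinity>\<close> if \<open>M\<close> is a point or a Euclidean space.\<close>

definition inj_radius_at :: "'a::euclidean_space set \<Rightarrow> 'a \<Rightarrow> ereal" where
  "inj_radius_at M p = (SUP r\<in>{r. r > 0 \<and> exp_diffeo M p r}. ereal r)"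

definition inj_radius :: "'a::euclidean_space set \<Rightarrow> ereal" where
  "inj_radius M = (INF p\<in>M. inj_radius_at M p)"

definition minimizing_geodesic ::
    "'a::euclidean_space set \<Rightarrow> 'a \<Rightarrow> 'a \<Rightarrow> (real \<Rightarrow> 'a) \<Rightarrow> bool" where
  "minimizing_geodesic M y q \<gamma> \<longleftrightarrow> geodesic_on M {0..1} \<gamma> \<and> \<gamma> 0 = y \<and> \<gamma> 1 = q \<and>
     has_length \<gamma> (geo_dist M y q)"

definition riem_log :: "'a::euclidean_space set \<Rightarrow> 'a \<Rightarrow> 'a \<Rightarrow> 'a" where
  "riem_log M y q = (THE v. \<exists>\<gamma>. minimizing_geodesic M y q \<gamma> \<and>
     v = vector_derivative \<gamma> (at 0 within {0..1}))"

text \<open>Critical points of the Dirichlet energy on the open interval \<open>(a, b)\<close>, with respect to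
  compactly supported variations \<open>\<Phi>(s, t)\<close> through maps into \<open>M\<close>. Outside \<open>[c, d]\<close> a variation does
  not change the map, so only the energy on \<open>[c, d]\<close> (which is finite) is differentiated.\<close>

definition dirichlet_energy :: "real set \<Rightarrow> (real \<Rightarrow> 'a::euclidean_space) \<Rightarrow> real" where
  "dirichlet_energy J F = 1/2 * integral J (\<lambda>t. (norm (vector_derivative F (at t)))\<^sup>2)"

definition harmonic_map ::
    "'a::euclidean_space set \<Rightarrow> real \<Rightarrow> real \<Rightarrow> (real \<Rightarrow> 'a) \<Rightarrow> bool" where
  "harmonic_map M a b F \<longleftrightarrow> F ` {a<..<b} \<subseteq> M \<and> Ck_on 2 {a<..<b} F \<and>
     (\<forall>\<Phi> e c d. e > 0 \<and> a < c \<and> c < d \<and> d < b \<and>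
        Ck_on 2 ({-e<..<e} \<times> {a<..<b}) \<Phi> \<and> \<Phi> ` ({-e<..<e} \<times> {a<..<b}) \<subseteq> M \<and>
        (\<forall>t\<in>{a<..<b}. \<Phi> (0, t) = F t) \<and>
        (\<forall>s\<in>{-e<..<e}. \<forall>t\<in>{a<..<b} - {c..d}. \<Phi> (s, t) = F t)
        \<longrightarrow> ((\<lambda>s. dirichlet_energy {c..d} (\<lambda>t. \<Phi> (s, t))) has_real_derivative 0) (at 0))"

section \<open>The Sobolev space and the penalized functional\<close>

definition L2_I :: "(real \<Rightarrow> 'a::euclidean_space) \<Rightarrow> bool" where
  "L2_I f \<longleftrightarrow> f \<in> borel_measurable (lebesgue_on {0..1}) \<and>
     integrable (lebesgue_on {0..1}) (\<lambda>t. (norm (f t))\<^sup>2)"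

definition test_function :: "(real \<Rightarrow> real) \<Rightarrow> bool" where
  "test_function \<phi> \<longleftrightarrow> Ck_on 1 UNIV \<phi> \<and>
     (\<exists>a b. 0 < a \<and> b < 1 \<and> (\<forall>t. t \<notin> {a..b} \<longrightarrow> \<phi> t = 0))"

definition is_weak_derivative ::
    "(real \<Rightarrow> 'a::euclidean_space) \<Rightarrow> (real \<Rightarrow> 'a) \<Rightarrow> bool" where
  "is_weak_derivative F f \<longleftrightarrow> L2_I f \<and> (\<forall>\<phi>. test_function \<phi> \<longrightarrow>
     (LINT t|lebesgue_on {0..1}. deriv \<phi> t *\<^sub>R F t) =
     - (LINT t|lebesgue_on {0..1}. \<phi> t *\<^sub>R f t))"

text \<open>The square-integrable weak derivative; it is unique almost everywhere.\<close>

definition weak_derivative :: "(real \<Rightarrow> 'a::euclidean_space) \<Rightarrow> real \<Rightarrow> 'a" where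
  "weak_derivative F = (SOME f. is_weak_derivative F f)"

text \<open>Elements of \<open>H^1\<close> are represented by their continuous representatives, as is implicit in
  the pointwise constraint \<open>F t \<in> M\<close>. Values outside \<open>[0, 1]\<close> are irrelevant.\<close>

definition H1_maps :: "'a::euclidean_space set \<Rightarrow> (real \<Rightarrow> 'a) set" where
  "H1_maps M = {F. L2_I F \<and> (\<exists>f. is_weak_derivative F f) \<and> continuous_on {0..1} F \<and>
     (\<forall>t\<in>{0..1}. F t \<in> M)}"

definition J1 :: "(real \<Rightarrow> 'a::euclidean_space) \<Rightarrow> real" where
  "J1 F = (LINT t|lebesgue_on {0..1}. (norm (weak_derivative F t))\<^sup>2)"

definition emp_risk ::
    "'a::euclidean_space set \<Rightarrow> nat \<Rightarrow> (nat \<Rightarrow> real) \<Rightarrow> (nat \<Rightarrow> 'a) \<Rightarrow> (real \<Rightarrow> 'a) \<Rightarrow> real" where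
  "emp_risk M n t Y F = 1 / real n * (\<Sum>i=1..n. (geo_dist M (Y i) (F (t i)))\<^sup>2)"

definition is_penalized_minimizer ::
    "'a::euclidean_space set \<Rightarrow> nat \<Rightarrow> (nat \<Rightarrow> real) \<Rightarrow> (nat \<Rightarrow> 'a) \<Rightarrow> real \<Rightarrow> (real \<Rightarrow> 'a) \<Rightarrow> bool"
  where
  "is_penalized_minimizer M n t Y lam F \<longleftrightarrow> F \<in> H1_maps M \<and>
     (\<forall>G\<in>H1_maps M. emp_risk M n t Y F + lam * J1 F \<le> emp_risk M n t Y G + lam * J1 G)"

text \<open>The \<open>i\<close>-th order statistic of \<open>t 1, \<dots>, t n\<close> (for distinct values), with \<open>1 \<le> i \<le> n\<close>.\<close>

definition order_stat :: "(nat \<Rightarrow> real) \<Rightarrow> nat \<Rightarrow> nat \<Rightarrow> real" where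
  "order_stat t n i = sorted_list_of_set (t ` {1..n}) ! (i - 1)"

text \<open>The open interval between two consecutive design points.\<close>

definition gap :: "(nat \<Rightarrow> real) \<Rightarrow> nat \<Rightarrow> nat \<Rightarrow> real set" where
  "gap t n i = {order_stat t n i<..<order_stat t n (i + 1)}"

end

theory Submission
  imports Defs "HOL-Complex_Analysis.Complex_Analysis"
begin

text \<open>Replacing a minimizer \<open>F\<close> on an interval without design points by any competitor with the same end
  values shows that \<open>F\<close> minimizes length there and has constant speed. Such a curve is treated
  metrically: in a local retraction \<open>P\<close> onto \<open>M\<close>, the second differences of a minimizing Lipschitz curve
  \<open>\<gamma>\<close> are quadratically small, so \<open>\<gamma>\<close> is \<open>C\<^sup>1\<close>, and varying \<open>P (\<gamma> + s \<eta>)\<close> gives an acceleration normal to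
  \<open>M\<close>. Since \<open>P\<close> costs no derivative, the acceleration solves a linear system whose coefficients are of
  class \<open>C\<^bsup>k-2\<^esup>\<close> along \<open>\<gamma>\<close>, and \<open>\<gamma>\<close> is \<open>C\<^sup>k\<close>. In the analytic case Picard iteration for the same system
  runs on a complex disc. The jump at a design point comes from the first variation of the penalty on
  both sides of it, balanced against that of the squared distance, which is bounded from above by the
  energies of the variations of one minimizing geodesic and therefore needs no differentiability of the
  distance. Beyond the extreme design points, constants are admissible competitors.\<close>

section \<open>Calculus of the classes C^k\<close>

text \<open>The case k = 2 shapes the argument. There the Christoffel symbols are merely continuous,
  so Picard-Lindelof yields neither uniqueness of geodesics with a given initial velocity nor a
  smooth exponential map, and with them the usual differentiability of the squared distance is out
  of reach. Facts about geodesics are therefore extracted from minimality, by comparison with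
  explicit competitors. A second obstacle is the variety of curves: H^1 maps in the functional,
  piecewise C^1 paths in \<open>geo_dist\<close>, C^2 curves in \<open>geodesic_on\<close>. All are
  compared with curves in M that are 1-Lipschitz for the ambient norm, a class closed under uniform
  limits. Minimizers in that class turn out to be C^2, so the infima over the different classes
  coincide. A third point is the ends of an interval. One-sided velocities at design points exist
  because the acceleration is bounded by second derivatives of one fixed retraction, uniformly up to
  the end.\<close>

lemma frechet_derivative_cong_open:
  assumes "open U" "x \<in> U" "\<And>y. y \<in> U \<Longrightarrow> f y = g y"
  shows "frechet_derivative f (at x) = frechet_derivative g (at x)"
proof -
  have "(f has_derivative D) (at x) \<longleftrightarrow> (g has_derivative D) (at x)" for D
    using assms has_derivative_transform_within_open[of f D x UNIV U g]
      has_derivative_transform_within_open[of g D x UNIV U f] by metis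
  then show ?thesis by (simp add: frechet_derivative_def)
qed

lemma differentiable_cong_open:
  assumes "open U" "x \<in> U" "\<And>y. y \<in> U \<Longrightarrow> f y = g y"
  shows "f differentiable (at x) \<longleftrightarrow> g differentiable (at x)"
proof -
  have "(f has_derivative D) (at x) \<longleftrightarrow> (g has_derivative D) (at x)" for D
    using assms has_derivative_transform_within_open[of f D x UNIV U g]
      has_derivative_transform_within_open[of g D x UNIV U f] by metis
  then show ?thesis by (simp add: differentiable_def)
qed

lemma Ck_open_cong:
  assumes "open U" "\<And>y. y \<in> U \<Longrightarrow> f y = g y"
  shows "Ck_open k U f \<longleftrightarrow> Ck_open k U g"
  using assms(2)
proof (induction k arbitrary: f g)
  case 0
  then show ?case by (simp cong: continuous_on_cong)
next
  case (Suc k)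
  have "f differentiable (at x) \<longleftrightarrow> g differentiable (at x)" if "x \<in> U" for x
    using differentiable_cong_open assms(1) that Suc.prems by blast
  moreover have "Ck_open k U (\<lambda>x. frechet_derivative f (at x) v) \<longleftrightarrow>
      Ck_open k U (\<lambda>x. frechet_derivative g (at x) v)" for v
    using Suc.IH[of "\<lambda>x. frechet_derivative f (at x) v" "\<lambda>x. frechet_derivative g (at x) v"]
      frechet_derivative_cong_open[OF assms(1) _ Suc.prems] by simp
  ultimately show ?case by simp
qed

lemma Ck_open_subset: "Ck_open k U f \<Longrightarrow> V \<subseteq> U \<Longrightarrow> Ck_open k V f"
  by (induction k arbitrary: f) (auto intro: continuous_on_subset)

lemma Ck_open_local:
  assumes "\<And>x. x \<in> U \<Longrightarrow> \<exists>V. open V \<and> x \<in> V \<and> Ck_open k V f"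
  shows "Ck_open k U f"
  using assms
proof (induction k arbitrary: f)
  case 0
  have "isCont f x" if "x \<in> U" for x
    using 0[OF that] by (metis Ck_open.simps(1) continuous_on_eq_continuous_at)
  then show ?case by (simp add: continuous_at_imp_continuous_on)
next
  case (Suc k)
  have "f differentiable (at x)" if "x \<in> U" for x
    using Suc.prems[OF that] by auto
  moreover have "Ck_open k U (\<lambda>x. frechet_derivative f (at x) v)" for v
    using Suc.prems by (intro Suc.IH) fastforce
  ultimately show ?case by simp
qed

lemma Ck_on_open_iff:
  assumes "open U"
  shows "Ck_on k U f \<longleftrightarrow> Ck_open k U f"
proof
  assume L: "Ck_on k U f"
  show "Ck_open k U f"
  proof (rule Ck_open_local)
    fix x assume "x \<in> U"
    then obtain V g where V: "open V" "x \<in> V" "Ck_open k V g" "\<forall>y\<in>U \<inter> V. g y = f y"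
      using L unfolding Ck_on_def by blast
    have "Ck_open k (U \<inter> V) f"
      using Ck_open_cong[of "U \<inter> V" g f k] Ck_open_subset[OF V(3), of "U \<inter> V"] V assms by auto
    then show "\<exists>V. open V \<and> x \<in> V \<and> Ck_open k V f"
      using V \<open>x \<in> U\<close> assms by (intro exI[of _ "U \<inter> V"]) auto
  qed
next
  assume "Ck_open k U f"
  then show "Ck_on k U f" unfolding Ck_on_def using assms by blast
qed

lemma Ck_open_Suc_imp: "Ck_open (Suc k) U f \<Longrightarrow> Ck_open k U f"
proof (induction k arbitrary: f)
  case 0
  then have "isCont f x" if "x \<in> U" for x
    using that differentiable_imp_continuous_within by auto
  then show ?case by (simp add: continuous_at_imp_continuous_on)
next
  case (Suc k)
  then show ?case by (metis Ck_open.simps(2))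
qed

lemma Ck_open_mono: "Ck_open l U f \<Longrightarrow> k \<le> l \<Longrightarrow> Ck_open k U f"
  by (induction l) (auto simp: le_Suc_eq intro: Ck_open_Suc_imp simp del: Ck_open.simps)

lemma Ck_on_mono: "Ck_on l S f \<Longrightarrow> k \<le> l \<Longrightarrow> Ck_on k S f"
  unfolding Ck_on_def by (meson Ck_open_mono)

lemma Ck_open_imp_continuous_on: "Ck_open k U f \<Longrightarrow> continuous_on U f"
  using Ck_open_mono[of k U f 0] by simp

lemma Ck_open_SucI:
  assumes "open U" "\<And>x. x \<in> U \<Longrightarrow> (f has_derivative D x) (at x)"
    "\<And>v. Ck_open k U (\<lambda>x. D x v)"
  shows "Ck_open (Suc k) U f"
proof -
  have "frechet_derivative f (at x) = D x" if "x \<in> U" for x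
    using frechet_derivative_at[OF assms(2)[OF that]] by simp
  then have "Ck_open k U (\<lambda>x. frechet_derivative f (at x) v)" for v
    using Ck_open_cong[OF assms(1), of "\<lambda>x. frechet_derivative f (at x) v" "\<lambda>x. D x v"] assms(3) by simp
  then show ?thesis using assms(2) by (auto simp: differentiable_def)
qed

lemma Ck_open_SucD:
  assumes "Ck_open (Suc k) U f" "x \<in> U"
  shows "(f has_derivative frechet_derivative f (at x)) (at x)"
  using assms by (simp add: frechet_derivative_works)

lemma Ck_open_const [simp]: "Ck_open k U (\<lambda>x. c)"
  by (induction k arbitrary: c) (auto simp: frechet_derivative_const)

lemma Ck_open_bounded_linear:
  assumes "bounded_linear A"
  shows "Ck_open k U A"
proof (cases k)
  case 0
  then show ?thesis using assms by (simp add: linear_continuous_on)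
next
  case (Suc l)
  have "frechet_derivative A (at x) = A" for x
    using frechet_derivative_at[OF bounded_linear_imp_has_derivative[OF assms]] by simp
  then show ?thesis using assms Suc by (simp add: bounded_linear_imp_differentiable)
qed

lemma Ck_open_id [simp]: "Ck_open k U (\<lambda>x. x)"
  by (rule Ck_open_bounded_linear) (rule bounded_linear_ident)

lemma Ck_open_add:
  assumes "open U" "Ck_open k U f" "Ck_open k U g"
  shows "Ck_open k U (\<lambda>x. f x + g x)"
  using assms(2,3)
proof (induction k arbitrary: f g)
  case 0
  then show ?case by (auto intro: continuous_intros)
next
  case (Suc k)
  show ?case
    by (rule Ck_open_SucI[OF assms(1) has_derivative_add[OF Ck_open_SucD Ck_open_SucD]])
      (use Suc in auto)
qed

lemma Ck_open_sum:
  assumes "open U" "\<And>i. i \<in> I \<Longrightarrow> Ck_open k U (f i)"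
  shows "Ck_open k U (\<lambda>x. \<Sum>i\<in>I. f i x)"
  using assms(2)
  by (induction I rule: infinite_finite_induct) (auto intro: Ck_open_add[OF assms(1)])

lemma Ck_open_bounded_linear_comp:
  assumes "open U" "bounded_linear A" "Ck_open k U f"
  shows "Ck_open k U (\<lambda>x. A (f x))"
  using assms(3)
proof (induction k arbitrary: f)
  case 0
  then show ?case using assms(2) by (auto intro: bounded_linear.continuous_on)
next
  case (Suc k)
  show ?case
    by (rule Ck_open_SucI[OF assms(1) bounded_linear.has_derivative[OF assms(2) Ck_open_SucD]])
      (use Suc in auto)
qed

lemma Ck_open_bilinear:
  assumes "open U" "bounded_bilinear B" "Ck_open k U f" "Ck_open k U g"
  shows "Ck_open k U (\<lambda>x. B (f x) (g x))"
  using assms(3,4)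
proof (induction k arbitrary: f g)
  case 0
  then show ?case using assms(2) by (auto intro: bounded_bilinear.continuous_on)
next
  case (Suc k)
  have f: "Ck_open k U f" and g: "Ck_open k U g" using Suc.prems by (auto intro: Ck_open_Suc_imp simp del: Ck_open.simps)
  show ?case
    by (rule Ck_open_SucI[OF assms(1) bounded_bilinear.FDERIV[OF assms(2) Ck_open_SucD Ck_open_SucD]])
      (use Suc f g in \<open>auto intro!: Ck_open_add[OF assms(1)]\<close>)
qed

lemmas Ck_open_scaleR = Ck_open_bilinear[OF _ bounded_bilinear_scaleR]
  and Ck_open_inner = Ck_open_bilinear[OF _ bounded_bilinear_inner]

lemma Ck_open_minus: "open U \<Longrightarrow> Ck_open k U f \<Longrightarrow> Ck_open k U (\<lambda>x. - f x)"
  by (rule Ck_open_bounded_linear_comp) (auto intro: bounded_linear_minus bounded_linear_ident)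

lemma Ck_open_diff:
  "open U \<Longrightarrow> Ck_open k U f \<Longrightarrow> Ck_open k U g \<Longrightarrow> Ck_open k U (\<lambda>x. f x - g x)"
  using Ck_open_add[of U k f "\<lambda>x. - g x"] Ck_open_minus[of U k g] by simp

lemma Ck_open_componentwise:
  fixes f :: "'b::euclidean_space \<Rightarrow> 'a::euclidean_space"
  assumes "open U" "\<And>b. b \<in> Basis \<Longrightarrow> Ck_open k U (\<lambda>x. f x \<bullet> b)"
  shows "Ck_open k U f"
proof -
  have "Ck_open k U (\<lambda>x. \<Sum>b\<in>Basis. (f x \<bullet> b) *\<^sub>R b)"
    using assms by (intro Ck_open_sum Ck_open_scaleR) auto
  then show ?thesis by (simp add: euclidean_representation)
qed

text \<open>Trades a direction that varies with the point for the finitely many fixed directions in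
  \<open>Basis\<close>. \<open>Ck_open\<close> speaks of fixed directions only, so regularity in a
  moving direction is obtained through this expansion.\<close>

lemma linear_Basis_expansion:
  assumes "linear A"
  shows "A v = (\<Sum>b\<in>Basis. (v \<bullet> b) *\<^sub>R A b)"
  by (metis (mono_tags, lifting) assms euclidean_representation linear_sum linear_cmul sum.cong)

lemma Ck_open_compose:
  fixes f :: "'b::euclidean_space \<Rightarrow> 'c::euclidean_space" and g :: "'c \<Rightarrow> 'a::euclidean_space"
  assumes U: "open U" and V: "open V" and fV: "\<And>x. x \<in> U \<Longrightarrow> f x \<in> V"
    and "Ck_open k U f" "Ck_open k V g"
  shows "Ck_open k U (\<lambda>x. g (f x))"
  using assms(4,5)
proof (induction k arbitrary: g)
  case 0
  then show ?case using fV by (auto intro: continuous_on_compose2)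
next
  case (Suc k)
  \<comment> \<open>After expansion in \<open>Basis\<close> the derivative of \<open>g\<close>
    occurs in fixed directions only, so the induction hypothesis, which is general in
    \<open>g\<close>, applies to it with one class less.\<close>
  let ?D = "\<lambda>x v. \<Sum>b\<in>Basis. (frechet_derivative f (at x) v \<bullet> b) *\<^sub>R frechet_derivative g (at (f x)) b"
  have f: "Ck_open k U f" using Suc.prems by (auto intro: Ck_open_Suc_imp simp del: Ck_open.simps)
  show ?case
  proof (rule Ck_open_SucI[OF U])
    fix x assume x: "x \<in> U"
    have g: "(g has_derivative frechet_derivative g (at (f x))) (at (f x))"
      using Ck_open_SucD Suc.prems(2) fV x by blast
    have "((\<lambda>x. g (f x)) has_derivative (\<lambda>v. frechet_derivative g (at (f x)) (frechet_derivative f (at x) v))) (at x)"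
      using diff_chain_at[OF Ck_open_SucD[OF Suc.prems(1) x] g] by (simp add: o_def)
    moreover have "(\<lambda>v. frechet_derivative g (at (f x)) (frechet_derivative f (at x) v)) = ?D x"
      by (rule ext) (rule linear_Basis_expansion[OF has_derivative_linear[OF g]])
    ultimately show "((\<lambda>x. g (f x)) has_derivative ?D x) (at x)" by (simp only:)
  next
    fix v
    show "Ck_open k U (\<lambda>x. ?D x v)"
      using Suc.prems f by (intro Ck_open_sum[OF U] Ck_open_scaleR[OF U] Ck_open_inner[OF U] Suc.IH) auto
  qed
qed

lemma Ck_open_vector_derivativeI:
  fixes f :: "real \<Rightarrow> 'a::euclidean_space"
  assumes "open U" "\<And>x. x \<in> U \<Longrightarrow> (f has_vector_derivative g x) (at x)" "Ck_open k U g"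
  shows "Ck_open (Suc k) U f"
proof (rule Ck_open_SucI[OF assms(1)])
  show "(f has_derivative (\<lambda>v. v *\<^sub>R g x)) (at x)" if "x \<in> U" for x
    using assms(2)[OF that] by (simp add: has_vector_derivative_def)
  show "Ck_open k U (\<lambda>x. v *\<^sub>R g x)" for v
    by (intro Ck_open_scaleR assms) auto
qed

lemma Ck_open_vector_derivativeD:
  fixes f :: "real \<Rightarrow> 'a::euclidean_space"
  assumes "open U" "Ck_open (Suc k) U f"
  shows "\<And>x. x \<in> U \<Longrightarrow> (f has_vector_derivative vector_derivative f (at x)) (at x)"
    and "Ck_open k U (\<lambda>x. vector_derivative f (at x))"
proof -
  show 1: "(f has_vector_derivative vector_derivative f (at x)) (at x)" if "x \<in> U" for x
    using assms that by (simp add: vector_derivative_works[symmetric])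
  have "frechet_derivative f (at x) 1 = vector_derivative f (at x)" if "x \<in> U" for x
    using 1[OF that] frechet_derivative_at[of f "\<lambda>v. v *\<^sub>R vector_derivative f (at x)" x]
    by (metis has_vector_derivative_def scaleR_one)
  then have "Ck_open k U (\<lambda>x. frechet_derivative f (at x) 1) \<longleftrightarrow> Ck_open k U (\<lambda>x. vector_derivative f (at x))"
    by (intro Ck_open_cong[OF assms(1)])
  moreover have "Ck_open k U (\<lambda>x. frechet_derivative f (at x) 1)" using assms(2) by simp
  ultimately show "Ck_open k U (\<lambda>x. vector_derivative f (at x))" by blast
qed

section \<open>Directional derivatives\<close>

text \<open>The direction comes before the point, so that \<open>dird f v\<close> is again a
  function of the point and second derivatives are iterates
  \<open>dird (dird f v) w\<close>.\<close>

definition dird :: "('b::euclidean_space \<Rightarrow> 'a::euclidean_space) \<Rightarrow> 'b \<Rightarrow> 'b \<Rightarrow> 'a" where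
  "dird f v = (\<lambda>x. frechet_derivative f (at x) v)"

lemma Ck_open_dird: "Ck_open (Suc k) U f \<Longrightarrow> Ck_open k U (dird f v)"
  by (simp add: dird_def)

lemma dird_eqI: "(f has_derivative D) (at x) \<Longrightarrow> dird f v x = D v"
  using frechet_derivative_at[of f D x] by (simp add: dird_def)

lemma has_derivative_dird:
  "Ck_open (Suc k) U f \<Longrightarrow> x \<in> U \<Longrightarrow> (f has_derivative (\<lambda>v. dird f v x)) (at x)"
  using Ck_open_SucD[of k U f x] by (simp add: dird_def)

lemma linear_dird: "Ck_open (Suc k) U f \<Longrightarrow> x \<in> U \<Longrightarrow> linear (\<lambda>v. dird f v x)"
  using has_derivative_dird has_derivative_linear by blast

lemma dird_expand:
  "Ck_open (Suc k) U f \<Longrightarrow> x \<in> U \<Longrightarrow> dird f v x = (\<Sum>b\<in>Basis. (v \<bullet> b) *\<^sub>R dird f b x)"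
  using linear_Basis_expansion[OF linear_dird] by blast

lemma dird_cong_open:
  assumes "open U" "x \<in> U" "\<And>y. y \<in> U \<Longrightarrow> f y = g y"
  shows "dird f v x = dird g v x"
  using frechet_derivative_cong_open[OF assms] by (simp add: dird_def)

text \<open>Linearity in the inner direction is not immediate, because \<open>v\<close> is frozen
  while the outer derivative is taken. The first-order expansion holds on all of the open set and
  may be differentiated.\<close>

lemma dird_dird_expand:
  assumes U: "open U" and f: "Ck_open 2 U f" and x: "x \<in> U"
  shows "dird (dird f v) w x = (\<Sum>b\<in>Basis. (v \<bullet> b) *\<^sub>R dird (dird f b) w x)"
proof -
  have f2: "Ck_open (Suc (Suc 0)) U f" using f by (simp add: numeral_2_eq_2)
  have "((\<lambda>y. \<Sum>b\<in>Basis. (v \<bullet> b) *\<^sub>R dird f b y) has_derivative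
      (\<lambda>w. \<Sum>b\<in>Basis. (v \<bullet> b) *\<^sub>R dird (dird f b) w x)) (at x)"
    by (intro has_derivative_sum has_derivative_scaleR_right has_derivative_dird[OF Ck_open_dird[OF f2] x])
  from dird_eqI[OF this]
  have "dird (\<lambda>y. \<Sum>b\<in>Basis. (v \<bullet> b) *\<^sub>R dird f b y) w x = (\<Sum>b\<in>Basis. (v \<bullet> b) *\<^sub>R dird (dird f b) w x)" .
  moreover have "dird (dird f v) w x = dird (\<lambda>y. \<Sum>b\<in>Basis. (v \<bullet> b) *\<^sub>R dird f b y) w x"
    by (rule dird_cong_open[OF U x]) (rule dird_expand[OF f2])
  ultimately show ?thesis by (simp only:)
qed

lemma dird_dird_expand2:
  assumes U: "open U" and f: "Ck_open 2 U f" and x: "x \<in> U"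
  shows "dird (dird f v) w x = (\<Sum>b\<in>Basis. \<Sum>c\<in>Basis. (v \<bullet> b) *\<^sub>R (w \<bullet> c) *\<^sub>R dird (dird f b) c x)"
proof -
  have f2: "Ck_open (Suc (Suc 0)) U f" using f by (simp add: numeral_2_eq_2)
  have "(v \<bullet> b) *\<^sub>R dird (dird f b) w x = (\<Sum>c\<in>Basis. (v \<bullet> b) *\<^sub>R (w \<bullet> c) *\<^sub>R dird (dird f b) c x)" for b
    by (subst dird_expand[OF Ck_open_dird[OF f2] x]) (simp only: scaleR_sum_right)
  then show ?thesis by (rule trans[OF dird_dird_expand[OF assms] sum.cong[OF refl]])
qed

lemma linear_dird_dird:
  assumes U: "open U" and f: "Ck_open 2 U f" and x: "x \<in> U"
  shows "linear (\<lambda>v. dird (dird f v) w x)"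
proof -
  have "(\<lambda>v. dird (dird f v) w x) = (\<lambda>v. \<Sum>b\<in>Basis. (v \<bullet> b) *\<^sub>R dird (dird f b) w x)"
    by (rule ext) (rule dird_dird_expand[OF assms])
  moreover have "linear (\<lambda>v. \<Sum>b\<in>Basis. (v \<bullet> b) *\<^sub>R dird (dird f b) w x)"
    by (rule linearI) (simp_all add: inner_left_distrib scaleR_left_distrib sum.distrib scaleR_sum_right)
  ultimately show ?thesis by (simp only:)
qed

lemma has_vector_derivative_dird:
  assumes f: "Ck_open (Suc k) U f" and "\<gamma> t \<in> U" and "(\<gamma> has_vector_derivative g) (at t within S)"
  shows "((\<lambda>t. f (\<gamma> t)) has_vector_derivative dird f g (\<gamma> t)) (at t within S)"
proof -
  have "((\<lambda>t. f (\<gamma> t)) has_derivative (\<lambda>s. dird f (s *\<^sub>R g) (\<gamma> t))) (at t within S)"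
    using has_derivative_compose[OF assms(3)[unfolded has_vector_derivative_def] has_derivative_dird[OF f assms(2)]]
    by simp
  then show ?thesis
    unfolding has_vector_derivative_def by (simp add: linear_cmul[OF linear_dird[OF f assms(2)]])
qed

lemma has_vector_derivative_dird_dird:
  assumes U: "open U" and f: "Ck_open 2 U f" and "\<gamma> t \<in> U"
    and S: "\<And>t. t \<in> S \<Longrightarrow> \<gamma> t \<in> U" "t \<in> S"
    and g: "(\<gamma> has_vector_derivative g) (at t within S)"
    and e: "(\<eta> has_vector_derivative e) (at t within S)"
  shows "((\<lambda>t. dird f (\<eta> t) (\<gamma> t)) has_vector_derivative
    dird (dird f (\<eta> t)) g (\<gamma> t) + dird f e (\<gamma> t)) (at t within S)"
proof -
  have f2: "Ck_open (Suc (Suc 0)) U f" using f by (simp add: numeral_2_eq_2)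
  have "((\<lambda>t. \<Sum>b\<in>Basis. (\<eta> t \<bullet> b) *\<^sub>R dird f b (\<gamma> t)) has_vector_derivative
     (\<Sum>b\<in>Basis. (\<eta> t \<bullet> b) *\<^sub>R dird (dird f b) g (\<gamma> t) + (e \<bullet> b) *\<^sub>R dird f b (\<gamma> t))) (at t within S)"
    by (intro has_vector_derivative_sum has_vector_derivative_scaleR has_vector_derivative_dird[OF Ck_open_dird[OF f2]])
      (use assms(3) g e in \<open>auto simp: has_real_derivative_iff_has_vector_derivative
        intro!: bounded_linear.has_vector_derivative[OF bounded_linear_inner_left]\<close>)
  moreover have "(\<Sum>b\<in>Basis. (\<eta> t \<bullet> b) *\<^sub>R dird (dird f b) g (\<gamma> t) + (e \<bullet> b) *\<^sub>R dird f b (\<gamma> t))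
     = dird (dird f (\<eta> t)) g (\<gamma> t) + dird f e (\<gamma> t)"
    using dird_dird_expand[OF U f assms(3), of "\<eta> t" g] dird_expand[OF f2 assms(3), of e]
    by (simp add: sum.distrib)
  ultimately have "((\<lambda>t. \<Sum>b\<in>Basis. (\<eta> t \<bullet> b) *\<^sub>R dird f b (\<gamma> t)) has_vector_derivative
     dird (dird f (\<eta> t)) g (\<gamma> t) + dird f e (\<gamma> t)) (at t within S)" by (simp only:)
  then show ?thesis
    by (rule has_vector_derivative_transform[OF S(2) dird_expand[OF f2 S(1)], rotated])
qed

lemma continuous_on_dird:
  assumes f: "Ck_open (Suc k) U f" and "\<And>t. t \<in> S \<Longrightarrow> \<gamma> t \<in> U"
    and "continuous_on S \<gamma>" "continuous_on S \<eta>"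
  shows "continuous_on S (\<lambda>t. dird f (\<eta> t) (\<gamma> t))"
proof -
  have "continuous_on S (\<lambda>t. \<Sum>b\<in>Basis. (\<eta> t \<bullet> b) *\<^sub>R dird f b (\<gamma> t))"
    using assms by (intro continuous_intros continuous_on_compose2[OF Ck_open_imp_continuous_on[OF Ck_open_dird[OF f]]]) auto
  then show ?thesis by (rule continuous_on_eq) (rule dird_expand[OF f assms(2), symmetric])
qed

lemma continuous_on_dird_dird:
  assumes U: "open U" and f: "Ck_open 2 U f" and "\<And>t. t \<in> S \<Longrightarrow> \<gamma> t \<in> U"
    and "continuous_on S \<gamma>" "continuous_on S \<eta>" "continuous_on S \<zeta>"
  shows "continuous_on S (\<lambda>t. dird (dird f (\<eta> t)) (\<zeta> t) (\<gamma> t))"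
proof -
  have f2: "Ck_open (Suc (Suc 0)) U f" using f by (simp add: numeral_2_eq_2)
  have "continuous_on S (\<lambda>t. \<Sum>b\<in>Basis. (\<eta> t \<bullet> b) *\<^sub>R dird (dird f b) (\<zeta> t) (\<gamma> t))"
    using assms by (intro continuous_intros continuous_on_dird[OF Ck_open_dird[OF f2]]) auto
  then show ?thesis by (rule continuous_on_eq) (rule dird_dird_expand[OF U f assms(3), symmetric])
qed

text \<open>The increment of \<open>f\<close> in direction \<open>v\<close> is an integral of
  \<open>dird f v\<close>. Differentiating it in direction \<open>u\<close> under the integral sign,
  and then in the upper limit, produces \<open>dird (dird f v) u\<close>; differentiating the
  increment directly produces \<open>dird (dird f u) v\<close>. Both are one-sided derivatives at 0
  of the same function on \<open>{0..d/2}\<close>.\<close>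

lemma dird_dird_commute:
  assumes U: "open U" and f: "Ck_open 2 U f" and x: "x \<in> U"
  shows "dird (dird f u) v x = dird (dird f v) u x"
proof -
  have f2: "Ck_open (Suc (Suc 0)) U f" using f by (simp add: numeral_2_eq_2)
  note f1 = Ck_open_dird[OF f2]
  obtain r where r: "r > 0" "ball x r \<subseteq> U" using U x by (meson open_contains_ball)
  define d where "d = r / (1 + norm u + norm v)"
  have pos: "1 + norm u + norm v > 0" using norm_ge_zero[of u] norm_ge_zero[of v] by linarith
  have d: "d > 0" using r pos by (simp add: d_def)
  have in_U: "x + s *\<^sub>R u + t *\<^sub>R v \<in> U" if "s \<in> {0..d/2}" "t \<in> {0..d/2}" for s t
  proof -
    have "norm (s *\<^sub>R u + t *\<^sub>R v) \<le> s * norm u + t * norm v"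
      using norm_triangle_ineq[of "s *\<^sub>R u" "t *\<^sub>R v"] that by simp
    also have "\<dots> \<le> d/2 * norm u + d/2 * norm v"
      using that by (intro add_mono mult_right_mono) auto
    also have "\<dots> < d * (1 + norm u + norm v)"
    proof -
      have "0 \<le> d * norm u" "0 \<le> d * norm v" using d by auto
      then show ?thesis unfolding distrib_left mult_1_right using d by linarith
    qed
    also have "\<dots> = r" using pos by (simp add: d_def)
    finally have "x + s *\<^sub>R u + t *\<^sub>R v \<in> ball x r"
      by (simp add: dist_norm add.assoc norm_minus_commute) (simp add: add.commute)
    then show ?thesis using r by blast
  qed
  have L: "dird f u (x + t *\<^sub>R v) - dird f u x = integral {0..t} (\<lambda>\<tau>. dird (dird f v) u (x + \<tau> *\<^sub>R v))"
    if t: "t \<in> {0..d/2}" for t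
  proof -
    have tau: "\<tau> \<in> {0..d/2}" if "\<tau> \<in> {0..t}" for \<tau> using that t by auto
    have I: "integral {0..t} (\<lambda>\<tau>. dird f v (x + s *\<^sub>R u + \<tau> *\<^sub>R v)) = f (x + s *\<^sub>R u + t *\<^sub>R v) - f (x + s *\<^sub>R u)"
      if s: "s \<in> {0..d/2}" for s
    proof -
      have "((\<lambda>\<tau>. dird f v (x + s *\<^sub>R u + \<tau> *\<^sub>R v)) has_integral
          f (x + s *\<^sub>R u + t *\<^sub>R v) - f (x + s *\<^sub>R u + 0 *\<^sub>R v)) {0..t}"
        using t tau s in_U
        by (intro fundamental_theorem_of_calculus has_vector_derivative_dird[OF f2])
          (auto intro!: derivative_eq_intros)
      then show ?thesis by (simp add: integral_unique)
    qed
    have "((\<lambda>s. integral (cbox 0 t) (\<lambda>\<tau>. dird f v (x + s *\<^sub>R u + \<tau> *\<^sub>R v))) has_vector_derivative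
       integral (cbox 0 t) (\<lambda>\<tau>. dird (dird f v) u (x + 0 *\<^sub>R u + \<tau> *\<^sub>R v))) (at 0 within {0..d/2})"
    proof (rule leibniz_rule_vector_derivative)
      show "((\<lambda>s. dird f v (x + s *\<^sub>R u + \<tau> *\<^sub>R v)) has_vector_derivative dird (dird f v) u (x + s *\<^sub>R u + \<tau> *\<^sub>R v))
          (at s within {0..d/2})" if "s \<in> {0..d/2}" "\<tau> \<in> cbox 0 t" for s \<tau>
        using that tau in_U
        by (intro has_vector_derivative_dird[OF f1]) (auto intro!: derivative_eq_intros)
      show "(\<lambda>\<tau>. dird f v (x + s *\<^sub>R u + \<tau> *\<^sub>R v)) integrable_on cbox 0 t" if "s \<in> {0..d/2}" for s
        using that tau in_U
        by (intro integrable_continuous continuous_on_dird[OF f2]) (auto intro!: continuous_intros)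
      show "continuous_on ({0..d/2} \<times> cbox 0 t) (\<lambda>(s, \<tau>). dird (dird f v) u (x + s *\<^sub>R u + \<tau> *\<^sub>R v))"
        using tau in_U unfolding case_prod_unfold
        by (intro continuous_on_dird[OF f1]) (auto intro!: continuous_intros)
    qed (use d in auto)
    then have "((\<lambda>s. f (x + s *\<^sub>R u + t *\<^sub>R v) - f (x + s *\<^sub>R u)) has_vector_derivative
       integral (cbox 0 t) (\<lambda>\<tau>. dird (dird f v) u (x + 0 *\<^sub>R u + \<tau> *\<^sub>R v))) (at 0 within {0..d/2})"
      by (rule has_vector_derivative_transform[rotated 2]) (use I d in auto)
    moreover have "((\<lambda>s. f (x + s *\<^sub>R u + t *\<^sub>R v) - f (x + s *\<^sub>R u)) has_vector_derivative
       dird f u (x + 0 *\<^sub>R u + t *\<^sub>R v) - dird f u (x + 0 *\<^sub>R u)) (at 0 within {0..d/2})"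
      using in_U[of 0 t] in_U[of 0 0] t d
      by (intro has_vector_derivative_diff has_vector_derivative_dird[OF f2]) (auto intro!: derivative_eq_intros)
    moreover have "at 0 within {0..d/2} \<noteq> bot"
      using d by (simp add: trivial_limit_within islimpt_Icc)
    ultimately show ?thesis
      using vector_derivative_unique_within by fastforce
  qed
  have "continuous_on {0..d/2} (\<lambda>\<tau>. dird (dird f v) u (x + \<tau> *\<^sub>R v))"
    using in_U[of 0] d by (intro continuous_on_dird[OF f1]) (auto intro!: continuous_intros)
  then have "((\<lambda>t. integral {0..t} (\<lambda>\<tau>. dird (dird f v) u (x + \<tau> *\<^sub>R v))) has_vector_derivative
      dird (dird f v) u (x + 0 *\<^sub>R v)) (at 0 within {0..d/2})"
    using d by (intro integral_has_vector_derivative) auto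
  then have "((\<lambda>t. dird f u (x + t *\<^sub>R v) - dird f u x) has_vector_derivative dird (dird f v) u x) (at 0 within {0..d/2})"
    using has_vector_derivative_transform[of 0 "{0..d/2}" "\<lambda>t. dird f u (x + t *\<^sub>R v) - dird f u x"] L d by simp
  moreover have "((\<lambda>t. dird f u (x + t *\<^sub>R v) - dird f u x) has_vector_derivative dird (dird f u) v (x + 0 *\<^sub>R v) - 0) (at 0 within {0..d/2})"
    using x d
    by (intro has_vector_derivative_diff has_vector_derivative_dird[OF f1]) (auto intro!: derivative_eq_intros)
  moreover have "at 0 within {0..d/2} \<noteq> bot"
    using d by (simp add: trivial_limit_within islimpt_Icc)
  ultimately show ?thesis
    using vector_derivative_unique_within by fastforce
qed

text \<open>Compactness of the closed ball bounds the finitely many derivatives in basis directions;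
  the Lipschitz estimate is the mean value inequality on the convex open ball. The Lipschitz
  estimate feeds the comparison of length and chord, the bound on second derivatives feeds the bound
  on the acceleration.\<close>

lemma dird_bounds:
  assumes f: "Ck_open 2 U f" and c: "cball p r \<subseteq> U"
  obtains C where "C \<ge> 0" "\<And>x v. x \<in> cball p r \<Longrightarrow> norm (dird f v x) \<le> C * norm v"
    "\<And>x v w. x \<in> ball p r \<Longrightarrow> norm (dird (dird f v) w x) \<le> C * norm v * norm w"
    "\<And>x y v. x \<in> ball p r \<Longrightarrow> y \<in> ball p r \<Longrightarrow> norm (dird f v x - dird f v y) \<le> C * norm (x - y) * norm v"
proof -
  have f2: "Ck_open (Suc (Suc 0)) U f" using f by (simp add: numeral_2_eq_2)
  have fB: "Ck_open 2 (ball p r) f" "Ck_open (Suc (Suc 0)) (ball p r) f"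
    by (rule Ck_open_subset[OF f order_trans[OF ball_subset_cball c]], rule Ck_open_subset[OF f2 order_trans[OF ball_subset_cball c]])
  have "bounded ((\<lambda>x. dird f b x) ` cball p r)" for b
    using Ck_open_imp_continuous_on[OF Ck_open_dird[OF f2]] c
    by (intro compact_imp_bounded compact_continuous_image) (auto intro: continuous_on_subset)
  then have "\<exists>K. \<forall>x\<in>cball p r. norm (dird f b x) \<le> K" for b
    unfolding bounded_iff by auto
  then obtain K where K: "\<And>b x. x \<in> cball p r \<Longrightarrow> norm (dird f b x) \<le> K b" by metis
  have "bounded ((\<lambda>x. dird (dird f b) b' x) ` cball p r)" for b b'
    using Ck_open_imp_continuous_on[OF Ck_open_dird[OF Ck_open_dird[OF f2]]] c
    by (intro compact_imp_bounded compact_continuous_image) (auto intro: continuous_on_subset)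
  then have "\<exists>K. \<forall>x\<in>cball p r. norm (dird (dird f b) b' x) \<le> K" for b b'
    unfolding bounded_iff by auto
  then obtain K2 where K2: "\<And>b b' x. x \<in> cball p r \<Longrightarrow> norm (dird (dird f b) b' x) \<le> K2 b b'" by metis
  define C1 where "C1 = (\<Sum>b\<in>Basis. \<bar>K b\<bar>)"
  define C2 where "C2 = (\<Sum>b\<in>Basis. \<Sum>b'\<in>Basis. \<bar>K2 b b'\<bar>)"
  have 1: "norm (dird f v x) \<le> C1 * norm v" if "x \<in> cball p r" for x v
  proof -
    have "norm (dird f v x) = norm (\<Sum>b\<in>Basis. (v \<bullet> b) *\<^sub>R dird f b x)"
      by (subst dird_expand[OF f2]) (use that c in auto)
    also have "\<dots> \<le> (\<Sum>b\<in>Basis. norm v * \<bar>K b\<bar>)"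
      using K[OF that] by (intro sum_norm_le) (auto intro!: mult_mono simp: Basis_le_norm intro: order_trans[OF _ abs_ge_self])
    finally show ?thesis by (simp add: C1_def sum_distrib_left sum_distrib_right mult.commute)
  qed
  have 2: "norm (dird (dird f v) w x) \<le> C2 * norm v * norm w" if "x \<in> ball p r" for x v w
  proof -
    have xU: "x \<in> U" and xc: "x \<in> cball p r" using that c by auto
    have "norm (dird (dird f v) w x) = norm (\<Sum>b\<in>Basis. \<Sum>c\<in>Basis. (v \<bullet> b) *\<^sub>R (w \<bullet> c) *\<^sub>R dird (dird f b) c x)"
      by (subst dird_dird_expand2[OF open_ball fB(1) that]) simp
    also have "\<dots> \<le> (\<Sum>b\<in>Basis. \<Sum>c\<in>Basis. norm v * (norm w * \<bar>K2 b c\<bar>))"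
    proof (intro sum_norm_le)
      fix b c :: 'a assume b: "b \<in> Basis" "c \<in> Basis"
      have "norm (dird (dird f b) c x) \<le> \<bar>K2 b c\<bar>" using K2[OF xc, of b c] by linarith
      then show "norm ((v \<bullet> b) *\<^sub>R (w \<bullet> c) *\<^sub>R dird (dird f b) c x) \<le> norm v * (norm w * \<bar>K2 b c\<bar>)"
        using b unfolding norm_scaleR by (intro mult_mono) (auto simp: Basis_le_norm)
    qed
    finally show ?thesis by (simp add: C2_def sum_distrib_left sum_distrib_right mult_ac)
  qed
  have 3: "norm (dird f v x - dird f v y) \<le> C2 * norm (x - y) * norm v"
    if "x \<in> ball p r" "y \<in> ball p r" for x y v
  proof -
    have "norm (dird f v x - dird f v y) \<le> (C2 * norm v) * norm (x - y)"
    proof (rule differentiable_bound[OF convex_ball _ _ that])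
      show "(dird f v has_derivative (\<lambda>w. dird (dird f v) w z)) (at z within ball p r)" if "z \<in> ball p r" for z
        using has_derivative_dird[OF Ck_open_dird[OF fB(2)] that] has_derivative_at_withinI by blast
      show "onorm (\<lambda>w. dird (dird f v) w z) \<le> C2 * norm v" if "z \<in> ball p r" for z
        by (intro onorm_le) (rule 2[OF that])
    qed
    then show ?thesis by (simp add: mult_ac)
  qed
  have C: "C1 \<ge> 0" "C2 \<ge> 0" by (auto simp: C1_def C2_def intro!: sum_nonneg)
  show ?thesis
  proof (rule that[of "C1 + C2"])
    show "norm (dird f v x) \<le> (C1 + C2) * norm v" if "x \<in> cball p r" for x v
      by (rule order_trans[OF 1[OF that]]) (intro mult_right_mono, use C in auto)
    show "norm (dird (dird f v) w x) \<le> (C1 + C2) * norm v * norm w" if "x \<in> ball p r" for x v w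
      by (rule order_trans[OF 2[OF that]]) (intro mult_right_mono, use C in auto)
    show "norm (dird f v x - dird f v y) \<le> (C1 + C2) * norm (x - y) * norm v" if "x \<in> ball p r" "y \<in> ball p r" for x y v
      by (rule order_trans[OF 3[OF that]]) (intro mult_right_mono, use C in auto)
  qed (use C in auto)
qed

section \<open>Local retractions onto a submanifold\<close>

definition local_retraction :: "nat \<Rightarrow> 'a::euclidean_space set \<Rightarrow> ('a \<Rightarrow> 'a) \<Rightarrow> 'a \<Rightarrow> real \<Rightarrow> bool" where
  "local_retraction k M P p r \<longleftrightarrow> 0 < r \<and> p \<in> M \<and> Ck_open k (ball p r) P \<and>
     (\<forall>x\<in>ball p r. P x \<in> M) \<and> (\<forall>x\<in>M \<inter> ball p r. P x = x)"

text \<open>Flatten M by the chart, project linearly onto E, and go back: this composition stays in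
  class C^k. The linear projection is chosen so that the derivative of the retraction at p becomes
  the orthogonal projection onto the tangent space. The resulting symmetry at p is what makes the
  implicit analytic equation a contraction near p.\<close>

lemma retraction_of_chart:
  fixes M :: "'a::euclidean_space set"
  assumes p: "p \<in> M" "p \<in> U" and UV: "open U" "open V" and hom: "homeomorphism U V \<phi> \<psi>"
    and reg: "Ck_open k U \<phi>" "Ck_open k V \<psi>" and k: "k \<ge> 1"
    and E: "subspace E" and slice: "\<phi> ` (U \<inter> M) = V \<inter> E"
  obtains \<pi> r where "linear \<pi>" "\<pi> (\<phi> p) = \<phi> p" "ball p r \<subseteq> U" "(\<lambda>x. \<pi> (\<phi> x)) ` ball p r \<subseteq> V"
    "local_retraction k M (\<lambda>x. \<psi> (\<pi> (\<phi> x))) p r"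
    "\<And>u v. dird (\<lambda>x. \<psi> (\<pi> (\<phi> x))) u p \<bullet> v = u \<bullet> dird (\<lambda>x. \<psi> (\<pi> (\<phi> x))) v p"
proof -
  obtain l where l: "k = Suc l" using k by (metis Suc_le_D One_nat_def)
  let ?A = "\<lambda>v. dird \<phi> v p" and ?B = "\<lambda>v. dird \<psi> v (\<phi> p)"
  have phiV: "\<phi> x \<in> V" and psiphi: "\<psi> (\<phi> x) = x" if "x \<in> U" for x
    using hom that unfolding homeomorphism_def by auto
  have psiU: "\<psi> x \<in> U" and phipsi: "\<phi> (\<psi> x) = x" if "x \<in> V" for x
    using hom that unfolding homeomorphism_def by auto
  have A: "(\<phi> has_derivative ?A) (at p)" using has_derivative_dird reg(1) l p by blast
  have B: "(\<psi> has_derivative ?B) (at (\<phi> p))" using has_derivative_dird reg(2) l phiV p by blast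
  have linA: "linear ?A" and linB: "linear ?B" using A B has_derivative_linear by blast+
  have "((\<lambda>x. \<psi> (\<phi> x)) has_derivative (\<lambda>v. ?B (?A v))) (at p)"
    using has_derivative_compose[OF A B] by simp
  moreover have "((\<lambda>x. \<psi> (\<phi> x)) has_derivative (\<lambda>v. v)) (at p)"
    by (rule has_derivative_transform_within_open[OF has_derivative_ident UV(1)]) (use p psiphi in auto)
  ultimately have "(\<lambda>v. ?B (?A v)) = (\<lambda>v. v)" using has_derivative_unique by blast
  then have BA: "?B (?A v) = v" for v by meson
  have A': "(\<phi> has_derivative ?A) (at (\<psi> (\<phi> p)))" using A psiphi p by simp
  have "((\<lambda>x. \<phi> (\<psi> x)) has_derivative (\<lambda>v. ?A (?B v))) (at (\<phi> p))"
    using has_derivative_compose[OF B A'] by simp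
  moreover have "((\<lambda>x. \<phi> (\<psi> x)) has_derivative (\<lambda>v. v)) (at (\<phi> p))"
    by (rule has_derivative_transform_within_open[OF has_derivative_ident UV(2)]) (use p phiV phipsi in auto)
  ultimately have "(\<lambda>v. ?A (?B v)) = (\<lambda>v. v)" using has_derivative_unique by blast
  then have AB: "?A (?B v) = v" for v by meson
  have T: "subspace (?B ` E)" using linear_subspace_image[OF linB E] .
  obtain Bs where Bs: "Bs \<subseteq> ?B ` E" "pairwise orthogonal Bs" "\<And>x. x \<in> Bs \<Longrightarrow> norm x = 1"
      "independent Bs" "span Bs = ?B ` E"
    using orthonormal_basis_subspace[OF T] by metis
  have fin: "finite Bs" using Bs(4) independent_imp_finite by blast
  \<comment> \<open>The image of E under the derivative of \<psi> is the tangent space of M at p,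
    and \<pi>T is the orthogonal projection onto it. Conjugation with the derivative of the chart
    turns \<pi>T into a projection \<pi> onto E, in general an oblique one.\<close>
  define \<pi>T where "\<pi>T x = (\<Sum>b\<in>Bs. (x \<bullet> b) *\<^sub>R b)" for x
  have piT_lin: "linear \<pi>T" unfolding \<pi>T_def
    by (rule linearI) (simp_all add: inner_left_distrib scaleR_left_distrib sum.distrib scaleR_sum_right)
  have piT_sym: "\<pi>T u \<bullet> v = u \<bullet> \<pi>T v" for u v
    by (simp add: \<pi>T_def inner_sum_left inner_sum_right inner_commute mult.commute)
  have piT_in: "\<pi>T x \<in> ?B ` E" for x
    unfolding \<pi>T_def by (intro subspace_sum[OF T] subspace_scale[OF T]) (use Bs(1) in auto)
  have piT_id: "\<pi>T x = x" if "x \<in> ?B ` E" for x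
    unfolding \<pi>T_def using orthonormal_basis_expand[OF Bs(2,3) _ fin] that Bs(5) by simp
  define \<pi> where "\<pi> x = ?A (\<pi>T (?B x))" for x
  have pi_lin: "linear \<pi>" unfolding \<pi>_def
    using linear_compose[OF linear_compose[OF linB piT_lin] linA] by (simp add: o_def)
  have pi_in: "\<pi> x \<in> E" for x
    using piT_in[of "?B x"] AB by (auto simp: \<pi>_def)
  have pi_id: "\<pi> x = x" if "x \<in> E" for x
    using piT_id[of "?B x"] that AB by (auto simp: \<pi>_def)
  have phiE: "\<phi> x \<in> E" if "x \<in> U \<inter> M" for x using slice that by blast
  have pi_p: "\<pi> (\<phi> p) = \<phi> p" using pi_id phiE p by blast
  have bl: "bounded_linear \<pi>" using pi_lin linear_conv_bounded_linear by blast
  have "open (U \<inter> (\<lambda>x. \<pi> (\<phi> x)) -` V)"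
    by (rule continuous_open_preimage[OF bounded_linear.continuous_on[OF bl Ck_open_imp_continuous_on[OF reg(1)]] UV])
  moreover have "p \<in> U \<inter> (\<lambda>x. \<pi> (\<phi> x)) -` V" using p pi_p phiV by auto
  ultimately obtain r where r: "r > 0" "ball p r \<subseteq> U \<inter> (\<lambda>x. \<pi> (\<phi> x)) -` V"
    by (meson open_contains_ball)
  let ?P = "\<lambda>x. \<psi> (\<pi> (\<phi> x))"
  have rU: "ball p r \<subseteq> U" and rV: "(\<lambda>x. \<pi> (\<phi> x)) ` ball p r \<subseteq> V" using r by auto
  have "Ck_open k (ball p r) ?P"
    by (rule Ck_open_compose[OF open_ball UV(2) _ Ck_open_bounded_linear_comp[OF open_ball bl Ck_open_subset[OF reg(1) rU]] reg(2)])
      (use rV in auto)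
  moreover have "?P x \<in> M" if "x \<in> ball p r" for x
  proof -
    \<comment> \<open>Points of the slice are chart images of points of M, so \<psi> carries them
      back to M.\<close>
    have "\<pi> (\<phi> x) \<in> V \<inter> E" using rV that pi_in by auto
    then obtain y where "y \<in> U \<inter> M" "\<pi> (\<phi> x) = \<phi> y" using slice by blast
    then show ?thesis using psiphi by auto
  qed
  moreover have "?P x = x" if "x \<in> M \<inter> ball p r" for x
    using pi_id phiE psiphi rU that by auto
  ultimately have retr: "local_retraction k M ?P p r"
    unfolding local_retraction_def using r(1) p(1) by blast
  have B': "(\<psi> has_derivative ?B) (at (\<pi> (\<phi> p)))" using B pi_p by simp
  have "((\<lambda>x. \<pi> (\<phi> x)) has_derivative (\<lambda>v. \<pi> (?A v))) (at p)"
    using bounded_linear.has_derivative[OF bl A] .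
  from has_derivative_compose[OF this B']
  have "(?P has_derivative (\<lambda>v. ?B (\<pi> (?A v)))) (at p)" by simp
  then have "(?P has_derivative \<pi>T) (at p)" by (simp add: \<pi>_def BA)
  then have "dird ?P u p = \<pi>T u" for u using dird_eqI by blast
  then show ?thesis using that[OF pi_lin pi_p rU rV retr] piT_sym by simp
qed

lemma submanifold_chart:
  assumes "submanifold reg M" "p \<in> M"
  obtains U V \<phi> \<psi> E where "open U" "p \<in> U" "open V" "homeomorphism U V \<phi> \<psi>" "reg U \<phi>"
      "reg V \<psi>" "subspace E" "\<phi> ` (U \<inter> M) = V \<inter> E"
  using assms(1)[unfolded submanifold_def] assms(2)
  by (elim exE) (drule (1) bspec, elim exE conjE, rule that)

lemma submanifold_retraction:
  assumes "submanifold (Ck_on k) M" "k \<ge> 1" "p \<in> M"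
  obtains P r where "local_retraction k M P p r"
proof (rule submanifold_chart[OF assms(1,3)])
  fix U V \<phi> \<psi> E
  assume *: "open U" "p \<in> U" "open V" "homeomorphism U V \<phi> \<psi>" "Ck_on k U \<phi>"
      "Ck_on k V \<psi>" "subspace E" "\<phi> ` (U \<inter> M) = V \<inter> E"
  show thesis
    by (rule retraction_of_chart[OF assms(3) *(2,1,3,4) *(5)[unfolded Ck_on_open_iff[OF *(1)]]
        *(6)[unfolded Ck_on_open_iff[OF *(3)]] assms(2) *(7,8)]) (rule that)
qed

text \<open>Differentiating P \<gamma> = \<gamma> shows that tangent vectors are fixed by the
  derivative of P, and the curve \<open>P (q + s *\<^sub>R u)\<close> realizes every vector of its
  range. The curve definition of the tangent space thus becomes a linear condition, valid at every
  point of M in the ball and not only at its centre.\<close>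

lemma tangent_space_retraction:
  assumes R: "local_retraction k M P p r" and k: "k \<ge> 1" and q: "q \<in> M" "q \<in> ball p r"
  shows "v \<in> tangent_space M q \<longleftrightarrow> dird P v q = v" and "dird P u q \<in> tangent_space M q"
proof -
  obtain l where l: "k = Suc l" using k by (metis Suc_le_D One_nat_def)
  have P: "Ck_open (Suc l) (ball p r) P" "\<And>x. x \<in> ball p r \<Longrightarrow> P x \<in> M" "\<And>x. x \<in> M \<Longrightarrow> x \<in> ball p r \<Longrightarrow> P x = x"
    using R l unfolding local_retraction_def by auto
  show 1: "dird P u q \<in> tangent_space M q" for u
  proof -
    obtain d where d: "d > 0" "ball q d \<subseteq> ball p r" using q(2) by (meson open_ball open_contains_ball)
    define e where "e = d / (1 + norm u)"
    have pos: "1 + norm u > 0" by (smt (verit) norm_ge_zero)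
    have in_ball: "q + s *\<^sub>R u \<in> ball p r" if "s \<in> {-e<..<e}" for s
    proof -
      have "\<bar>s\<bar> * norm u \<le> \<bar>s\<bar> * (1 + norm u)" by (simp add: mult_left_mono)
      also have "\<dots> < e * (1 + norm u)" using that pos by (intro mult_strict_right_mono) auto
      also have "\<dots> = d" using pos by (simp add: e_def)
      finally have "q + s *\<^sub>R u \<in> ball q d" by (simp add: dist_norm)
      then show ?thesis using d by blast
    qed
    have e: "e > 0" using d pos by (simp add: e_def)
    have "((\<lambda>s. P (q + s *\<^sub>R u)) has_vector_derivative dird P u (q + 0 *\<^sub>R u)) (at 0)"
      by (rule has_vector_derivative_dird[OF P(1)]) (use in_ball[of 0] e in \<open>auto intro!: derivative_eq_intros\<close>)
    then show ?thesis
      unfolding tangent_space_def using e in_ball P q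
      by (intro CollectI exI[of _ "\<lambda>s. P (q + s *\<^sub>R u)"] exI[of _ e]) auto
  qed
  show "v \<in> tangent_space M q \<longleftrightarrow> dird P v q = v"
  proof
    assume "v \<in> tangent_space M q"
    then obtain \<gamma> e where g: "e > 0" "\<gamma> ` {-e<..<e} \<subseteq> M" "\<gamma> 0 = q" "(\<gamma> has_vector_derivative v) (at (0::real))"
      unfolding tangent_space_def by blast
    have "isCont \<gamma> 0" using g(4) has_vector_derivative_continuous by blast
    then have "\<forall>\<^sub>F s in at 0. \<gamma> s \<in> ball p r"
      using q g(3) by (metis isContD open_ball topological_tendstoD)
    then have ev: "\<forall>\<^sub>F s in nhds 0. \<gamma> s \<in> ball p r"
      using q g(3) by (simp add: eventually_nhds_conv_at)
    then obtain S where S: "open S" "(0::real) \<in> S" "\<And>s. s \<in> S \<Longrightarrow> \<gamma> s \<in> ball p r"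
      unfolding eventually_nhds by blast
    have "((\<lambda>s. P (\<gamma> s)) has_vector_derivative dird P v (\<gamma> 0)) (at 0)"
      by (rule has_vector_derivative_dird[OF P(1) _ g(4)]) (use q g in auto)
    then have "(\<gamma> has_vector_derivative dird P v (\<gamma> 0)) (at 0)"
      by (rule has_vector_derivative_transform_within_open[of _ _ _ "S \<inter> {-e<..<e}"])
        (use S g in \<open>auto intro!: P(3)\<close>)
    then show "dird P v q = v" using g(3,4) vector_derivative_unique_at by metis
  next
    assume "dird P v q = v"
    then show "v \<in> tangent_space M q" using 1[of v] by simp
  qed
qed

section \<open>Curves of finite energy\<close>

text \<open>The derivative is carried along as a gauge-integrable function that satisfies the
  fundamental theorem on every subinterval. This form restricts, glues and changes values at single
  points easily; its equivalence with weak derivatives is shown separately.\<close>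

definition H1_curve :: "real \<Rightarrow> real \<Rightarrow> (real \<Rightarrow> 'a::euclidean_space) \<Rightarrow> (real \<Rightarrow> 'a) \<Rightarrow> bool" where
  "H1_curve a b \<gamma> g \<longleftrightarrow>
     (\<forall>s t. a \<le> s \<and> s \<le> t \<and> t \<le> b \<longrightarrow> (g has_integral \<gamma> t - \<gamma> s) {s..t}) \<and>
     (\<lambda>t. (norm (g t))\<^sup>2) integrable_on {a..b}"

lemma H1_curveD:
  assumes "H1_curve a b \<gamma> g"
  shows "\<And>s t. a \<le> s \<Longrightarrow> s \<le> t \<Longrightarrow> t \<le> b \<Longrightarrow> (g has_integral \<gamma> t - \<gamma> s) {s..t}"
    and "(\<lambda>t. (norm (g t))\<^sup>2) integrable_on {a..b}"
  using assms by (auto simp: H1_curve_def)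

lemma H1_curve_subinterval:
  assumes "H1_curve a b \<gamma> g" "a \<le> s" "t \<le> b"
  shows "H1_curve s t \<gamma> g"
  using assms integrable_subinterval_real[of "\<lambda>t. (norm (g t))\<^sup>2" a b s t]
  by (auto simp: H1_curve_def)

lemma H1_curve_combine:
  assumes g1: "H1_curve a b \<gamma> g" and g2: "H1_curve b c \<gamma> g" and "a \<le> b" "b \<le> c"
  shows "H1_curve a c \<gamma> g"
proof -
  have "(g has_integral \<gamma> t - \<gamma> s) {s..t}" if "a \<le> s" "s \<le> t" "t \<le> c" for s t
  proof -
    consider "t \<le> b" | "b \<le> s" | "s \<le> b" "b \<le> t" by linarith
    then show ?thesis
    proof cases
      case 3
      have "(g has_integral (\<gamma> b - \<gamma> s) + (\<gamma> t - \<gamma> b)) {s..t}"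
        by (rule has_integral_combine[OF 3 H1_curveD(1)[OF g1] H1_curveD(1)[OF g2]]) (use 3 that in auto)
      then show ?thesis by simp
    qed (use that H1_curveD(1)[OF g1] H1_curveD(1)[OF g2] in auto)
  qed
  then show ?thesis
    using Henstock_Kurzweil_Integration.integrable_combine[OF assms(3,4) H1_curveD(2)[OF g1] H1_curveD(2)[OF g2]]
    by (auto simp: H1_curve_def)
qed

text \<open>The derivatives are compared in the open interval only. Curves glued by case
  distinctions have ambiguous derivatives at the joints, and these two points are
  negligible.\<close>

lemma H1_curve_cong:
  assumes "H1_curve a b \<gamma> g" "\<And>t. t \<in> {a..b} \<Longrightarrow> \<gamma> t = \<delta> t" "\<And>t. t \<in> {a<..<b} \<Longrightarrow> g t = h t"
  shows "H1_curve a b \<delta> h"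
proof -
  have ne: "negligible {a, b}" by simp
  have eq: "h x = g x" if "x \<in> {a..b} - {a, b}" for x
    using assms(3)[of x] that by auto
  have "(h has_integral \<delta> t - \<delta> s) {s..t}" if "a \<le> s" "s \<le> t" "t \<le> b" for s t
  proof -
    have "(g has_integral \<delta> t - \<delta> s) {s..t}"
      using H1_curveD(1)[OF assms(1), of s t] assms(2)[of s] assms(2)[of t] that by auto
    then show ?thesis
      by (rule has_integral_spike[OF ne, rotated]) (rule eq, use that in auto)
  qed
  moreover have "(\<lambda>t. (norm (h t))\<^sup>2) integrable_on {a..b}"
    by (rule integrable_spike[OF H1_curveD(2)[OF assms(1)] ne]) (simp add: eq)
  ultimately show ?thesis by (auto simp: H1_curve_def)
qed

lemma H1_curve_energy_cong:
  fixes a b :: real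
  assumes "\<And>t. t \<in> {a<..<b} \<Longrightarrow> g t = h t"
  shows "integral {a..b} (\<lambda>t. (norm (g t))\<^sup>2) = integral {a..b} (\<lambda>t. (norm (h t))\<^sup>2)"
proof (rule integral_spike[of "{a, b}"])
  show "(norm (h x))\<^sup>2 = (norm (g x))\<^sup>2" if "x \<in> {a..b} - {a, b}" for x
    using assms[of x, symmetric] that by auto
qed simp

lemma H1_curve_continuous_derivative:
  assumes "\<And>t. t \<in> {a..b} \<Longrightarrow> (\<gamma> has_vector_derivative g t) (at t within {a..b})" "continuous_on {a..b} g"
  shows "H1_curve a b \<gamma> g"
proof -
  have "(g has_integral \<gamma> t - \<gamma> s) {s..t}" if "a \<le> s" "s \<le> t" "t \<le> b" for s t
    using that by (intro fundamental_theorem_of_calculus has_vector_derivative_within_subset[OF assms(1)]) auto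
  moreover have "(\<lambda>t. (norm (g t))\<^sup>2) integrable_on {a..b}"
    by (intro integrable_continuous_real continuous_intros assms)
  ultimately show ?thesis by (auto simp: H1_curve_def)
qed

text \<open>Gauge integrability does not pass to the norm by itself. Here the norm is measurable and
  dominated by \<open>1 + (norm (g t))\<^sup>2\<close>, which is integrable.\<close>

lemma H1_curve_norm_integrable:
  assumes "H1_curve a b \<gamma> g"
  shows "(\<lambda>t. norm (g t)) integrable_on {a..b}"
proof (cases "a \<le> b")
  case True
  have "g integrable_on {a..b}" using H1_curveD(1)[OF assms, of a b] True by auto
  then have "g \<in> borel_measurable (lebesgue_on {a..b})" by (rule integrable_imp_measurable)
  then have "(\<lambda>t. norm (g t)) \<in> borel_measurable (lebesgue_on {a..b})" by measurable
  moreover have "(\<lambda>t. 1 + (norm (g t))\<^sup>2) integrable_on {a..b}"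
    by (intro integrable_add H1_curveD(2)[OF assms] integrable_const_ivl)
  moreover have "norm (norm (g t)) \<le> 1 + (norm (g t))\<^sup>2" for t
    using sum_squares_bound[of 1 "norm (g t)"] by (simp add: ) (smt (verit) norm_ge_zero)
  ultimately show ?thesis
    using measurable_bounded_by_integrable_imp_integrable[of "\<lambda>t. norm (g t)" "{a..b}" "\<lambda>t. 1 + (norm (g t))\<^sup>2"]
    by simp
qed (simp add: integrable_on_empty)

text \<open>With \<open>c\<close> the mean speed the left side is nonnegative, which is the
  Cauchy-Schwarz inequality; its equality case forces speed \<open>c\<close> almost everywhere. Both
  uses occur below.\<close>

lemma H1_curve_square_deviation:
  assumes "H1_curve a b \<gamma> g" "a \<le> b"
  shows "((\<lambda>t. (norm (g t) - c)\<^sup>2) has_integral integral {a..b} (\<lambda>t. (norm (g t))\<^sup>2)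
     - 2 * c * integral {a..b} (\<lambda>t. norm (g t)) + c\<^sup>2 * (b - a)) {a..b}"
proof -
  have "((\<lambda>t. (norm (g t))\<^sup>2 - 2 * c * norm (g t) + c\<^sup>2) has_integral integral {a..b} (\<lambda>t. (norm (g t))\<^sup>2)
     - 2 * c * integral {a..b} (\<lambda>t. norm (g t)) + (b - a) *\<^sub>R c\<^sup>2) {a..b}"
    by (intro has_integral_add has_integral_diff has_integral_mult_right integrable_integral
        H1_curveD(2)[OF assms(1)] H1_curve_norm_integrable[OF assms(1)])
      (use has_integral_const_real[of "c\<^sup>2" a b] assms(2) in simp)
  then show ?thesis by (simp add: power2_diff algebra_simps)
qed

lemma H1_curve_Cauchy_Schwarz:
  assumes "H1_curve a b \<gamma> g" "a \<le> b"
  shows "(integral {a..b} (\<lambda>t. norm (g t)))\<^sup>2 \<le> (b - a) * integral {a..b} (\<lambda>t. (norm (g t))\<^sup>2)"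
proof (cases "a = b")
  case False
  define l where "l = integral {a..b} (\<lambda>t. norm (g t))"
  have "0 \<le> integral {a..b} (\<lambda>t. (norm (g t))\<^sup>2) - 2 * (l / (b - a)) * l + (l / (b - a))\<^sup>2 * (b - a)"
    unfolding l_def by (rule has_integral_nonneg[OF H1_curve_square_deviation[OF assms]]) simp
  also have "\<dots> = integral {a..b} (\<lambda>t. (norm (g t))\<^sup>2) - l\<^sup>2 / (b - a)"
    using False by (simp add: power2_eq_square)
  finally show ?thesis using False assms(2) by (simp add: l_def field_simps)
qed simp

section \<open>Lipschitz connections\<close>

text \<open>An upper bound for intrinsic distance without derivatives: a curve in M over an interval
  of length \<open>l\<close>, 1-Lipschitz for the ambient norm. Rectifiable curves become such
  curves after reparametrization, and the condition survives uniform limits.\<close>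

definition lip_conn :: "'a::euclidean_space set \<Rightarrow> 'a \<Rightarrow> 'a \<Rightarrow> real \<Rightarrow> bool" where
  "lip_conn M p q l \<longleftrightarrow> 0 \<le> l \<and> (\<exists>\<gamma>. \<gamma> 0 = p \<and> \<gamma> l = q \<and> (\<forall>s\<in>{0..l}. \<gamma> s \<in> M) \<and>
     (\<forall>s\<in>{0..l}. \<forall>t\<in>{0..l}. norm (\<gamma> s - \<gamma> t) \<le> \<bar>s - t\<bar>))"

text \<open>Reparametrization by the distribution function \<open>\<sigma>\<close>: where \<open>\<sigma>\<close> is constant, so is \<open>\<gamma>\<close>, hence
  any choice of preimages works.\<close>

lemma lip_conn_reparam:
  fixes a b :: real
  assumes "a \<le> b" "\<And>t. t \<in> {a..b} \<Longrightarrow> \<gamma> t \<in> M" "continuous_on {a..b} \<sigma>"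
    and L: "\<And>s t. a \<le> s \<Longrightarrow> s \<le> t \<Longrightarrow> t \<le> b \<Longrightarrow> norm (\<gamma> t - \<gamma> s) \<le> \<sigma> t - \<sigma> s"
  shows "lip_conn M (\<gamma> a) (\<gamma> b) (\<sigma> b - \<sigma> a)"
proof -
  have L': "norm (\<gamma> t - \<gamma> s) \<le> \<bar>\<sigma> t - \<sigma> s\<bar>" if "s \<in> {a..b}" "t \<in> {a..b}" for s t
  proof (cases "s \<le> t")
    case False
    then have "t \<le> s" by simp
    then show ?thesis using L[of t s] that by (subst norm_minus_commute) auto
  qed (use L[of s t] that in auto)
  have "\<exists>t\<in>{a..b}. \<sigma> t = \<sigma> a + u" if "u \<in> {0..\<sigma> b - \<sigma> a}" for u
    using IVT'[of \<sigma> a "\<sigma> a + u" b] assms(1,3) that by auto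
  then obtain \<tau> where \<tau>: "\<And>u. u \<in> {0..\<sigma> b - \<sigma> a} \<Longrightarrow> \<tau> u \<in> {a..b} \<and> \<sigma> (\<tau> u) = \<sigma> a + u" by metis
  have nn: "0 \<le> \<sigma> b - \<sigma> a" using L[of a b] assms(1) norm_ge_zero order_trans by blast
  have "\<gamma> (\<tau> 0) = \<gamma> a" using L'[of a "\<tau> 0"] \<tau>[of 0] nn assms(1) by auto
  moreover have "\<gamma> (\<tau> (\<sigma> b - \<sigma> a)) = \<gamma> b"
    using L'[of b "\<tau> (\<sigma> b - \<sigma> a)"] \<tau>[of "\<sigma> b - \<sigma> a"] nn assms(1) by auto
  moreover have "norm (\<gamma> (\<tau> s) - \<gamma> (\<tau> t)) \<le> \<bar>s - t\<bar>" if "s \<in> {0..\<sigma> b - \<sigma> a}" "t \<in> {0..\<sigma> b - \<sigma> a}" for s t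
    using L'[of "\<tau> t" "\<tau> s"] \<tau>[OF that(1)] \<tau>[OF that(2)] by auto
  ultimately show ?thesis
    unfolding lip_conn_def using nn \<tau> assms(2)
    by (intro conjI exI[of _ "\<lambda>u. \<gamma> (\<tau> u)"]) auto
qed

lemma lip_conn_Lipschitz:
  assumes "a \<le> s" "s \<le> t" "t \<le> b" "\<And>t. t \<in> {a..b} \<Longrightarrow> \<gamma> t \<in> M"
    and "\<And>s t. a \<le> s \<Longrightarrow> s \<le> t \<Longrightarrow> t \<le> b \<Longrightarrow> norm (\<gamma> t - \<gamma> s) \<le> c * (t - s)"
  shows "lip_conn M (\<gamma> s) (\<gamma> t) (c * (t - s))"
proof -
  have "lip_conn M (\<gamma> s) (\<gamma> t) (c * t - c * s)"
    using assms by (intro lip_conn_reparam) (auto intro!: continuous_intros simp: right_diff_distrib[symmetric])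
  then show ?thesis by (simp add: right_diff_distrib)
qed

lemma lip_conn_norm_le: "lip_conn M p q l \<Longrightarrow> norm (p - q) \<le> l"
  unfolding lip_conn_def by (metis abs_0_eq abs_minus_commute abs_of_nonneg atLeastAtMost_iff diff_zero order_refl)

lemma lip_conn_in: "lip_conn M p q l \<Longrightarrow> p \<in> M \<and> q \<in> M \<and> 0 \<le> l"
  unfolding lip_conn_def by fastforce

lemma lip_conn_sym:
  assumes "lip_conn M p q l"
  shows "lip_conn M q p l"
proof -
  obtain \<gamma> where g: "0 \<le> l" "\<gamma> 0 = p" "\<gamma> l = q" "\<And>s. s \<in> {0..l} \<Longrightarrow> \<gamma> s \<in> M"
    "\<And>s t. s \<in> {0..l} \<Longrightarrow> t \<in> {0..l} \<Longrightarrow> norm (\<gamma> s - \<gamma> t) \<le> \<bar>s - t\<bar>"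
    using assms unfolding lip_conn_def by auto
  have "norm (\<gamma> (l - s) - \<gamma> (l - t)) \<le> \<bar>s - t\<bar>" if "s \<in> {0..l}" "t \<in> {0..l}" for s t
    using g(5)[of "l - s" "l - t"] that by auto
  then show ?thesis unfolding lip_conn_def using g
    by (intro conjI exI[of _ "\<lambda>s. \<gamma> (l - s)"]) auto
qed

lemma lip_conn_trans:
  assumes "lip_conn M p q l" "lip_conn M q r m"
  shows "lip_conn M p r (l + m)"
proof -
  obtain \<gamma> where g: "0 \<le> l" "\<gamma> 0 = p" "\<gamma> l = q" "\<And>s. s \<in> {0..l} \<Longrightarrow> \<gamma> s \<in> M"
    "\<And>s t. s \<in> {0..l} \<Longrightarrow> t \<in> {0..l} \<Longrightarrow> norm (\<gamma> s - \<gamma> t) \<le> \<bar>s - t\<bar>"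
    using assms(1) unfolding lip_conn_def by auto
  obtain \<delta> where d: "0 \<le> m" "\<delta> 0 = q" "\<delta> m = r" "\<And>s. s \<in> {0..m} \<Longrightarrow> \<delta> s \<in> M"
    "\<And>s t. s \<in> {0..m} \<Longrightarrow> t \<in> {0..m} \<Longrightarrow> norm (\<delta> s - \<delta> t) \<le> \<bar>s - t\<bar>"
    using assms(2) unfolding lip_conn_def by auto
  define \<eta> where "\<eta> s = (if s \<le> l then \<gamma> s else \<delta> (s - l))" for s
  have *: "norm (\<eta> t - \<eta> s) \<le> t - s" if "0 \<le> s" "s \<le> t" "t \<le> l + m" for s t
  proof -
    consider "t \<le> l" | "l < s" | "s \<le> l" "l < t" by linarith
    then show ?thesis
    proof cases
      case 1 then show ?thesis using g(5)[of t s] that by (auto simp: \<eta>_def)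
    next
      case 2 then show ?thesis using d(5)[of "t - l" "s - l"] that by (auto simp: \<eta>_def)
    next
      case 3
      have "norm (\<delta> (t - l) - \<gamma> s) \<le> norm (\<delta> (t - l) - \<delta> 0) + norm (\<gamma> l - \<gamma> s)"
        using norm_triangle_ineq[of "\<delta> (t - l) - \<delta> 0" "\<gamma> l - \<gamma> s"] g(3) d(2) by simp
      also have "\<dots> \<le> (t - l) + (l - s)"
        using d(5)[of "t - l" 0] g(5)[of l s] 3 that g(1) d(1) by (intro add_mono) auto
      finally show ?thesis using 3 by (simp add: \<eta>_def)
    qed
  qed
  have "lip_conn M (\<eta> 0) (\<eta> (l + m)) (1 * ((l + m) - 0))"
    by (rule lip_conn_Lipschitz[of 0 _ _ "l + m"]) (use * g d in \<open>auto simp: \<eta>_def\<close>)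
  moreover have "\<eta> (l + m) = r" using g(3) d by (cases "m = 0") (auto simp: \<eta>_def)
  ultimately show ?thesis using g by (simp add: \<eta>_def)
qed

lemma lip_conn_const: "p \<in> M \<Longrightarrow> 0 \<le> l \<Longrightarrow> lip_conn M p p l"
  unfolding lip_conn_def by (auto intro!: exI[of _ "\<lambda>s. p"])

lemma lip_conn_mono: "lip_conn M p q l \<Longrightarrow> l \<le> m \<Longrightarrow> lip_conn M p q m"
  using lip_conn_trans[of M p q l q "m - l"] lip_conn_const[of q M "m - l"] lip_conn_in by force

text \<open>The reparametrizing function is the indefinite integral of the speed. The velocity is
  only asked to be integrable, which covers H^1 curves as well as piecewise C^1 paths.\<close>

lemma lip_conn_integral:
  fixes a b :: real
  assumes g: "\<And>s t. a \<le> s \<Longrightarrow> s \<le> t \<Longrightarrow> t \<le> b \<Longrightarrow> (g has_integral \<gamma> t - \<gamma> s) {s..t}"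
    and ni: "(\<lambda>t. norm (g t)) integrable_on {a..b}"
    and "a \<le> b" "\<And>t. t \<in> {a..b} \<Longrightarrow> \<gamma> t \<in> M"
  shows "lip_conn M (\<gamma> a) (\<gamma> b) (integral {a..b} (\<lambda>t. norm (g t)))"
proof -
  have "lip_conn M (\<gamma> a) (\<gamma> b) (integral {a..b} (\<lambda>t. norm (g t)) - integral {a..a} (\<lambda>t. norm (g t)))"
  proof (rule lip_conn_reparam[of a b \<gamma> M "\<lambda>t. integral {a..t} (\<lambda>t. norm (g t))", OF assms(3,4)])
    show "continuous_on {a..b} (\<lambda>t. integral {a..t} (\<lambda>t. norm (g t)))"
      by (rule indefinite_integral_continuous_1[OF ni])
    fix s t assume st: "a \<le> s" "s \<le> t" "t \<le> b"
    have i: "(\<lambda>t. norm (g t)) integrable_on {u..v}" if "a \<le> u" "v \<le> b" for u v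
      using integrable_subinterval_real[OF ni, of u v] that by auto
    have hi: "(g has_integral \<gamma> t - \<gamma> s) {s..t}" using g st by auto
    have "norm (\<gamma> t - \<gamma> s) \<le> integral {s..t} (\<lambda>t. norm (g t))"
      using integral_norm_bound_integral[of g "{s..t}" "\<lambda>t. norm (g t)"] hi i[of s t] st
      by (simp add: integral_unique[OF hi] has_integral_integrable[OF hi])
    also have "\<dots> = integral {a..t} (\<lambda>t. norm (g t)) - integral {a..s} (\<lambda>t. norm (g t))"
      using Henstock_Kurzweil_Integration.integral_combine[of a s t "\<lambda>t. norm (g t)"] i[of a t] st by simp
    finally show "norm (\<gamma> t - \<gamma> s) \<le> integral {a..t} (\<lambda>t. norm (g t)) - integral {a..s} (\<lambda>t. norm (g t))" .
  qed auto
  then show ?thesis by simp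
qed

lemma lip_conn_H1_curve:
  assumes "H1_curve a b \<gamma> g" "a \<le> b" "\<And>t. t \<in> {a..b} \<Longrightarrow> \<gamma> t \<in> M"
  shows "lip_conn M (\<gamma> a) (\<gamma> b) (integral {a..b} (\<lambda>t. norm (g t)))"
  by (rule lip_conn_integral[OF H1_curveD(1)[OF assms(1)] H1_curve_norm_integrable[OF assms(1)] assms(2,3)])

text \<open>Cauchy-Schwarz turns an energy bound into a length bound. Minimality of length is played
  against energies of varied curves through this lemma.\<close>

lemma lip_conn_energy:
  assumes g: "H1_curve a b \<gamma> g" and "a \<le> b" "\<And>t. t \<in> {a..b} \<Longrightarrow> \<gamma> t \<in> M"
    and "(b - a) * integral {a..b} (\<lambda>t. (norm (g t))\<^sup>2) \<le> e"
  shows "lip_conn M (\<gamma> a) (\<gamma> b) (sqrt e)"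
  by (rule lip_conn_mono[OF lip_conn_H1_curve[OF assms(1-3)]])
    (use H1_curve_Cauchy_Schwarz[OF g assms(2)] assms(4) in \<open>auto intro!: real_le_rsqrt\<close>)

text \<open>Arzela-Ascoli: almost optimal connections, brought to a common parameter interval, have
  a uniformly convergent subsequence, and compactness of M keeps the limit in M.\<close>

lemma lip_conn_closed:
  fixes M :: "'a::euclidean_space set"
  assumes M: "compact M" and l: "0 \<le> l" and conn: "\<And>e. e > 0 \<Longrightarrow> lip_conn M p q (l + e)"
  shows "lip_conn M p q l"
proof -
  define d where "d n = l + inverse (real (Suc n))" for n
  have d: "d n > l" "d n \<le> l + 1" for n by (auto simp: d_def field_simps)
  have "\<exists>\<gamma>. \<gamma> 0 = p \<and> \<gamma> (d n) = q \<and> (\<forall>s\<in>{0..d n}. \<gamma> s \<in> M) \<and>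
     (\<forall>s\<in>{0..d n}. \<forall>t\<in>{0..d n}. norm (\<gamma> s - \<gamma> t) \<le> \<bar>s - t\<bar>)" for n
    using conn[of "inverse (real (Suc n))"] unfolding lip_conn_def d_def by auto
  then obtain \<gamma> where g: "\<And>n. \<gamma> n 0 = p" "\<And>n. \<gamma> n (d n) = q" "\<And>n s. s \<in> {0..d n} \<Longrightarrow> \<gamma> n s \<in> M"
     "\<And>n s t. s \<in> {0..d n} \<Longrightarrow> t \<in> {0..d n} \<Longrightarrow> norm (\<gamma> n s - \<gamma> n t) \<le> \<bar>s - t\<bar>"
    by metis
  \<comment> \<open>Rescaling to the unit interval puts the varying lengths \<open>d n\<close> into
    the Lipschitz constants, which tend to \<open>l\<close>.\<close>
  define \<delta> where "\<delta> n u = \<gamma> n (d n * u)" for n u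
  have du: "d n * u \<in> {0..d n}" if "u \<in> {0..1}" for n u
    using that d[of n] l by (auto intro: mult_left_le)
  have lipd: "norm (\<delta> n u - \<delta> n v) \<le> d n * \<bar>u - v\<bar>" if "u \<in> {0..1}" "v \<in> {0..1}" for n u v
  proof -
    have "\<bar>d n * u - d n * v\<bar> = d n * \<bar>u - v\<bar>"
      using d[of n] l by (simp add: right_diff_distrib[symmetric] abs_mult)
    then show ?thesis using g(4)[OF du[OF that(1)] du[OF that(2)], of n] by (simp add: \<delta>_def)
  qed
  have dM: "\<delta> n u \<in> M" if "u \<in> {0..1}" for n u using g(3)[OF du[OF that]] by (simp add: \<delta>_def)
  obtain B where B: "\<And>x. x \<in> M \<Longrightarrow> norm x \<le> B" using compact_imp_bounded[OF M] unfolding bounded_iff by auto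
  obtain h k where hk: "continuous_on {0..1} h" "strict_mono (k :: nat \<Rightarrow> nat)"
      "\<And>e. 0 < e \<Longrightarrow> \<exists>N. \<forall>n x. n \<ge> N \<and> x \<in> {0..1::real} \<longrightarrow> norm (\<delta> (k n) x - h x) < e"
  proof (rule Arzela_Ascoli[of "{0..1::real}" \<delta> B])
    show "norm (\<delta> n u) \<le> B" if "u \<in> {0..1}" for n u using B dM that by auto
    show "\<exists>r>0. \<forall>n v. v \<in> {0..1} \<and> norm (u - v) < r \<longrightarrow> norm (\<delta> n u - \<delta> n v) < e"
      if "u \<in> {0..1}" "0 < e" for u e
    proof (intro exI conjI allI impI)
      show "e / (l + 1) > 0" using that l by simp
      fix n v assume v: "v \<in> {0..1} \<and> norm (u - v) < e / (l + 1)"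
      have "norm (\<delta> n u - \<delta> n v) \<le> d n * \<bar>u - v\<bar>" using lipd that v by blast
      also have "\<dots> \<le> (l + 1) * \<bar>u - v\<bar>" using d[of n] by (intro mult_right_mono) auto
      also have "\<dots> < e" using v l by (simp add: field_simps)
      finally show "norm (\<delta> n u - \<delta> n v) < e" .
    qed
  qed auto
  have lim: "(\<lambda>n. \<delta> (k n) u) \<longlonglongrightarrow> h u" if "u \<in> {0..1}" for u
    unfolding LIMSEQ_iff using hk(3) that by blast
  have dlim: "(\<lambda>n. d (k n)) \<longlonglongrightarrow> l"
    using LIMSEQ_subseq_LIMSEQ[OF LIMSEQ_inverse_real_of_nat_add[of l] hk(2)] by (simp add: d_def o_def)
  have "lip_conn M (h 0) (h 1) (l * (1 - 0))"
  proof (rule lip_conn_Lipschitz[of 0 0 1 1])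
    show "h u \<in> M" if "u \<in> {0..1}" for u
      by (rule closed_sequentially[OF compact_imp_closed[OF M] _ lim[OF that]]) (rule dM[OF that])
    show "norm (h v - h u) \<le> l * (v - u)" if "0 \<le> u" "u \<le> v" "v \<le> 1" for u v
    proof (rule LIMSEQ_le)
      show "(\<lambda>n. norm (\<delta> (k n) v - \<delta> (k n) u)) \<longlonglongrightarrow> norm (h v - h u)"
        using that by (intro tendsto_intros lim) auto
      show "(\<lambda>n. d (k n) * (v - u)) \<longlonglongrightarrow> l * (v - u)" by (intro tendsto_intros dlim)
      show "\<exists>N. \<forall>n\<ge>N. norm (\<delta> (k n) v - \<delta> (k n) u) \<le> d (k n) * (v - u)"
        using lipd[of v u] that by auto
    qed
  qed auto
  moreover have "h 0 = p" using LIMSEQ_unique[OF lim[of 0]] g(1) by (simp add: \<delta>_def)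
  moreover have "h 1 = q" using LIMSEQ_unique[OF lim[of 1]] g(2) by (simp add: \<delta>_def)
  ultimately show ?thesis by simp
qed

text \<open>The intrinsic distance over a class of curves in which the infimum is attained.
  \<open>geo_dist_eq_lip_dist\<close> identifies it with \<open>geo_dist\<close>.\<close>

definition lip_dist :: "'a::euclidean_space set \<Rightarrow> 'a \<Rightarrow> 'a \<Rightarrow> real" where
  "lip_dist M p q = Inf {l. lip_conn M p q l}"

lemma lip_dist_le: "lip_conn M p q l \<Longrightarrow> lip_dist M p q \<le> l"
  unfolding lip_dist_def by (rule cInf_lower) (use lip_conn_in in \<open>auto intro!: bdd_belowI[of _ 0]\<close>)

lemma lip_dist_attained:
  assumes M: "compact M" and l: "lip_conn M p q l"
  shows "lip_conn M p q (lip_dist M p q)"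
proof (rule lip_conn_closed[OF M])
  show "0 \<le> lip_dist M p q"
    unfolding lip_dist_def by (rule cInf_greatest) (use l lip_conn_in in auto)
  fix e :: real assume "e > 0"
  then have "\<exists>x\<in>{l. lip_conn M p q l}. x < lip_dist M p q + e"
    unfolding lip_dist_def using l by (intro cInf_lessD) auto
  then show "lip_conn M p q (lip_dist M p q + e)" using lip_conn_mono less_imp_le by blast
qed

text \<open>Minimality is demanded between any two points of the curve, so that it passes to
  subintervals. The number \<open>c\<close> is a bound for the speed here and proves to be the exact
  speed later.\<close>

definition lip_min :: "'a::euclidean_space set \<Rightarrow> real \<Rightarrow> real \<Rightarrow> real \<Rightarrow> (real \<Rightarrow> 'a) \<Rightarrow> bool" where
  "lip_min M a b c \<gamma> \<longleftrightarrow> 0 \<le> c \<and> (\<forall>t\<in>{a..b}. \<gamma> t \<in> M) \<and>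
     (\<forall>s t. a \<le> s \<and> s \<le> t \<and> t \<le> b \<longrightarrow> norm (\<gamma> t - \<gamma> s) \<le> c * (t - s) \<and>
        (\<forall>l. lip_conn M (\<gamma> s) (\<gamma> t) l \<longrightarrow> c * (t - s) \<le> l))"

lemma lip_minD:
  assumes "lip_min M a b c \<gamma>"
  shows "0 \<le> c" "\<And>t. t \<in> {a..b} \<Longrightarrow> \<gamma> t \<in> M"
    "\<And>s t. a \<le> s \<Longrightarrow> s \<le> t \<Longrightarrow> t \<le> b \<Longrightarrow> norm (\<gamma> t - \<gamma> s) \<le> c * (t - s)"
    "\<And>s t l. a \<le> s \<Longrightarrow> s \<le> t \<Longrightarrow> t \<le> b \<Longrightarrow> lip_conn M (\<gamma> s) (\<gamma> t) l \<Longrightarrow> c * (t - s) \<le> l"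
  using assms unfolding lip_min_def by auto

lemma lip_min_subinterval: "lip_min M a b c \<gamma> \<Longrightarrow> a \<le> a' \<Longrightarrow> b' \<le> b \<Longrightarrow> lip_min M a' b' c \<gamma>"
  unfolding lip_min_def by (auto dest: order_trans)

lemma lip_min_continuous:
  assumes "lip_min M a b c \<gamma>"
  shows "continuous_on {a..b} \<gamma>"
proof (rule lipschitz_on_continuous_on)
  show "c-lipschitz_on {a..b} \<gamma>"
  proof (rule lipschitz_onI)
    fix s t assume "s \<in> {a..b}" "t \<in> {a..b}"
    then show "dist (\<gamma> s) (\<gamma> t) \<le> c * dist s t"
      using lip_minD(3)[OF assms, of s t] lip_minD(3)[OF assms, of t s]
      by (cases "s \<le> t") (auto simp: dist_norm norm_minus_commute)
  qed (rule lip_minD(1)[OF assms])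
qed

lemma lip_min_exists:
  assumes M: "compact M" and l: "lip_conn M p q l"
  obtains \<gamma> where "lip_min M 0 1 (lip_dist M p q) \<gamma>" "\<gamma> 0 = p" "\<gamma> 1 = q"
proof -
  define L where "L = lip_dist M p q"
  have "lip_conn M p q L" using lip_dist_attained[OF assms] by (simp add: L_def)
  then obtain \<delta> where g: "0 \<le> L" "\<delta> 0 = p" "\<delta> L = q" "\<And>s. s \<in> {0..L} \<Longrightarrow> \<delta> s \<in> M"
    "\<And>s t. s \<in> {0..L} \<Longrightarrow> t \<in> {0..L} \<Longrightarrow> norm (\<delta> s - \<delta> t) \<le> \<bar>s - t\<bar>"
    unfolding lip_conn_def by auto
  have Lu: "L * u \<in> {0..L}" if "0 \<le> u" "u \<le> 1" for u
    using that g(1) by (auto intro: mult_left_le)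
  have lip: "norm (\<delta> (L * t) - \<delta> (L * s)) \<le> L * (t - s)" if "0 \<le> s" "s \<le> t" "t \<le> 1" for s t
  proof -
    have "\<bar>L * t - L * s\<bar> = L * (t - s)" using g(1) that by (simp add: right_diff_distrib[symmetric])
    then show ?thesis using g(5)[OF Lu[of t] Lu[of s]] that by simp
  qed
  have "lip_min M 0 1 L (\<lambda>t. \<delta> (L * t))"
    unfolding lip_min_def
  proof (intro conjI ballI allI impI)
    fix s t assume st: "0 \<le> s \<and> s \<le> t \<and> t \<le> (1::real)"
    show "norm (\<delta> (L * t) - \<delta> (L * s)) \<le> L * (t - s)" using lip st by blast
    fix l assume "lip_conn M (\<delta> (L * s)) (\<delta> (L * t)) l"
    moreover have "lip_conn M (\<delta> (L * 0)) (\<delta> (L * s)) (L * (s - 0))"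
      using lip_conn_Lipschitz[of 0 0 s 1 "\<lambda>t. \<delta> (L * t)" M L] lip st g(4) Lu by auto
    moreover have "lip_conn M (\<delta> (L * t)) (\<delta> (L * 1)) (L * (1 - t))"
      using lip_conn_Lipschitz[of 0 t 1 1 "\<lambda>t. \<delta> (L * t)" M L] lip st g(4) Lu by auto
    \<comment> \<open>A connection of the two inner points, completed by the two outer pieces, joins
      \<open>p\<close> and \<open>q\<close> and cannot be shorter than the distance.\<close>
    ultimately have "lip_conn M p q (L * s + l + L * (1 - t))"
      using lip_conn_trans[OF lip_conn_trans[of M p "\<delta> (L * s)" "L * s" "\<delta> (L * t)" l] , of q "L * (1 - t)"] g(2,3)
      by simp
    then have "L \<le> L * s + l + L * (1 - t)" using lip_dist_le L_def by blast
    then show "L * (t - s) \<le> l" by (simp add: algebra_simps)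
  qed (use g Lu in auto)
  then show ?thesis using that[of "\<lambda>t. \<delta> (L * t)"] g by (simp add: L_def)
qed

section \<open>Differentiability of minimizing Lipschitz curves\<close>

lemma local_retractionD:
  assumes "local_retraction k M P p r"
  shows "0 < r" "p \<in> M" "Ck_open k (ball p r) P" "\<And>x. x \<in> ball p r \<Longrightarrow> P x \<in> M"
    "\<And>x. x \<in> M \<Longrightarrow> x \<in> ball p r \<Longrightarrow> P x = x"
  using assms by (auto simp: local_retraction_def)

text \<open>The form in which the submanifold hypothesis enters the arguments for class C^k; the
  analytic case returns to the charts themselves.\<close>

definition locally_retractable :: "nat \<Rightarrow> 'a::euclidean_space set \<Rightarrow> bool" where
  "locally_retractable k M \<longleftrightarrow> (\<forall>p\<in>M. \<exists>P r. local_retraction k M P p r)"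

lemma locally_retractableD:
  assumes "locally_retractable k M" "p \<in> M"
  obtains P r where "local_retraction k M P p r"
  using assms unfolding locally_retractable_def by blast

lemma segment_in_ball:
  fixes x y :: "'a::euclidean_space"
  assumes "x \<in> ball p \<rho>" "y \<in> ball p \<rho>" "\<tau> \<in> {0..1}"
  shows "x + \<tau> *\<^sub>R (y - x) \<in> ball p \<rho>"
proof -
  have "(1 - \<tau>) *\<^sub>R x + \<tau> *\<^sub>R y \<in> ball p \<rho>"
    using convexD[OF convex_ball assms(1,2), of "1 - \<tau>" \<tau>] assms(3) by auto
  then show ?thesis by (simp add: algebra_simps)
qed

text \<open>The deviation of \<open>g\<close> from its mean \<open>h\<close> is orthogonal to \<open>h\<close> in \<open>L\<^sup>2\<close>, so it contributes only at fourth order.\<close>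

lemma local_length:
  assumes R: "local_retraction k M P p r" and k: "k \<ge> 2"
  obtains \<rho> C where "\<rho> > 0" "C \<ge> 0"
    "\<And>x y. x \<in> M \<inter> ball p \<rho> \<Longrightarrow> y \<in> M \<inter> ball p \<rho> \<Longrightarrow>
       lip_conn M x y (sqrt ((norm (y - x))\<^sup>2 + C * (norm (y - x)) ^ 4))"
proof -
  note P = local_retractionD[OF R]
  have f: "Ck_open 2 (ball p r) P" using Ck_open_mono[OF P(3) k] .
  have f2: "Ck_open (Suc (Suc 0)) (ball p r) P" using f by (simp add: numeral_2_eq_2)
  define \<rho> where "\<rho> = r / 2"
  have rho: "\<rho> > 0" "cball p \<rho> \<subseteq> ball p r" "ball p \<rho> \<subseteq> ball p r" using P(1) by (auto simp: \<rho>_def)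
  obtain C where C: "C \<ge> 0"
    "\<And>x y v. x \<in> ball p \<rho> \<Longrightarrow> y \<in> ball p \<rho> \<Longrightarrow> norm (dird P v x - dird P v y) \<le> C * norm (x - y) * norm v"
    using dird_bounds[OF f rho(2)] by metis
  show ?thesis
  proof (rule that[of \<rho> "C\<^sup>2"])
    fix x y assume x: "x \<in> M \<inter> ball p \<rho>" and y: "y \<in> M \<inter> ball p \<rho>"
    define h where "h = y - x"
    have seg: "x + \<tau> *\<^sub>R h \<in> ball p \<rho>" if "\<tau> \<in> {0..1}" for \<tau>
      using segment_in_ball[of x p \<rho> y \<tau>] x y that by (simp add: h_def)
    have segr: "x + \<tau> *\<^sub>R h \<in> ball p r" if "\<tau> \<in> {0..1}" for \<tau> using seg[OF that] rho(3) by blast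
    define c where "c \<tau> = P (x + \<tau> *\<^sub>R h)" for \<tau>
    define g where "g \<tau> = dird P h (x + \<tau> *\<^sub>R h)" for \<tau>
    have H: "H1_curve 0 1 c g"
      unfolding c_def g_def
      by (rule H1_curve_continuous_derivative;
          (rule has_vector_derivative_dird[OF f2] | rule continuous_on_dird[OF f2]))
        (use segr in \<open>auto intro!: derivative_eq_intros continuous_intros\<close>)
    have c01: "c 0 = x" "c 1 = y" using P(5) x y rho by (auto simp: c_def h_def)
    have gi: "(g has_integral h) {0..1}" using H1_curveD(1)[OF H, of 0 1] c01 by (simp add: h_def)
    \<comment> \<open>Since \<open>h\<close> is the mean of \<open>g\<close> over the unit interval,
      \<open>g \<tau> - h\<close> is the mean of the differences
      \<open>g \<tau> - g \<tau>'\<close>, and these are controlled by the Lipschitz bound for the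
      derivative of P. One factor \<open>norm h\<close> comes from the distance of the two points,
      the other from the direction.\<close>
    have dev: "norm (g \<tau> - h) \<le> C * (norm h)\<^sup>2" if t: "\<tau> \<in> {0..1}" for \<tau>
    proof -
      have "((\<lambda>\<tau>'. g \<tau> - g \<tau>') has_integral (1 - 0) *\<^sub>R g \<tau> - h) (cbox 0 (1::real))"
        using has_integral_diff[OF has_integral_const_real[of "g \<tau>" 0 1] gi] by simp
      then have "norm ((1 - 0) *\<^sub>R g \<tau> - h) \<le> (C * (norm h)\<^sup>2) * measure lborel (cbox 0 (1::real))"
      proof (rule has_integral_bound[rotated])
        fix \<tau>' :: real assume t': "\<tau>' \<in> cbox 0 1"
        have "norm (g \<tau> - g \<tau>') \<le> C * norm ((x + \<tau> *\<^sub>R h) - (x + \<tau>' *\<^sub>R h)) * norm h"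
          unfolding g_def using seg t t' by (intro C(2)) auto
        also have "(x + \<tau> *\<^sub>R h) - (x + \<tau>' *\<^sub>R h) = (\<tau> - \<tau>') *\<^sub>R h" by (simp add: algebra_simps)
        also have "C * norm ((\<tau> - \<tau>') *\<^sub>R h) * norm h \<le> C * (1 * norm h) * norm h"
          using t t' C(1) by (intro mult_right_mono mult_left_mono) (auto intro!: mult_left_le_one_le)
        finally show "norm (g \<tau> - g \<tau>') \<le> C * (norm h)\<^sup>2" by (simp add: power2_eq_square)
      qed (use C in auto)
      then show ?thesis by simp
    qed
    \<comment> \<open>The square is expanded around \<open>h\<close>. The mixed term has integral
      \<open>2 * (h \<bullet> h)\<close>, so only the square of the deviation exceeds
      \<open>(norm h)\<^sup>2\<close>.\<close>
    have "integral {0..1} (\<lambda>t. (norm (g t))\<^sup>2) \<le> (C * (norm h)\<^sup>2)\<^sup>2 + 2 * (h \<bullet> h) - (norm h)\<^sup>2"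
    proof (rule has_integral_le[OF integrable_integral[OF H1_curveD(2)[OF H]]])
      have "((\<lambda>t. h \<bullet> g t) has_integral h \<bullet> h) {0..1}"
        using has_integral_linear[OF gi bounded_linear_inner_right[of h]] by (simp add: o_def)
      from has_integral_diff[OF has_integral_add[OF has_integral_const_real[of "(C * (norm h)\<^sup>2)\<^sup>2" 0 1]
            has_integral_mult_right[OF this, of 2]] has_integral_const_real[of "(norm h)\<^sup>2" 0 1]]
      show "((\<lambda>t. (C * (norm h)\<^sup>2)\<^sup>2 + 2 * (h \<bullet> g t) - (norm h)\<^sup>2) has_integral
          (C * (norm h)\<^sup>2)\<^sup>2 + 2 * (h \<bullet> h) - (norm h)\<^sup>2) {0..1}" by simp
      fix t :: real assume t: "t \<in> {0..1}"
      have "(norm (g t))\<^sup>2 = (norm (g t - h))\<^sup>2 + 2 * (h \<bullet> g t) - (norm h)\<^sup>2"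
        by (simp add: power2_norm_eq_inner inner_diff_left inner_diff_right inner_commute)
      also have "(norm (g t - h))\<^sup>2 \<le> (C * (norm h)\<^sup>2)\<^sup>2" using dev[OF t] by (intro power_mono) auto
      finally show "(norm (g t))\<^sup>2 \<le> (C * (norm h)\<^sup>2)\<^sup>2 + 2 * (h \<bullet> g t) - (norm h)\<^sup>2" by simp
    qed
    also have "\<dots> = (norm h)\<^sup>2 + C\<^sup>2 * norm h ^ 4"
      by (simp add: dot_square_norm power_mult_distrib flip: power_mult)
    finally have "lip_conn M (c 0) (c 1) (sqrt ((norm h)\<^sup>2 + C\<^sup>2 * norm h ^ 4))"
      by (intro lip_conn_energy[OF H]) (use P(4) segr in \<open>auto simp: c_def\<close>)
    then show "lip_conn M x y (sqrt ((norm (y - x))\<^sup>2 + C\<^sup>2 * (norm (y - x)) ^ 4))"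
      using c01 by (simp add: h_def)
  qed (use rho C in auto)
qed

text \<open>Parallelogram law for the two half chords A and B: each has norm at most
  \<open>c * (t - s) / 2\<close>, whereas by minimality the full chord falls short of
  \<open>c * (t - s)\<close> only at fourth order in the squares. Hence A and B are nearly
  equal.\<close>

lemma lip_min_midpoint:
  assumes m: "lip_min M a b c \<gamma>" and st: "a \<le> s" "s \<le> t" "t \<le> b" and C: "C \<ge> 0"
    and conn: "lip_conn M (\<gamma> s) (\<gamma> t) (sqrt ((norm (\<gamma> t - \<gamma> s))\<^sup>2 + C * (norm (\<gamma> t - \<gamma> s)) ^ 4))"
  shows "norm (\<gamma> s + \<gamma> t - 2 *\<^sub>R \<gamma> ((s + t) / 2)) \<le> (sqrt C * c\<^sup>2) * (t - s)\<^sup>2"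
proof -
  define A where "A = \<gamma> ((s + t) / 2) - \<gamma> s"
  define B where "B = \<gamma> t - \<gamma> ((s + t) / 2)"
  define D where "D = norm (\<gamma> t - \<gamma> s)"
  have AB: "\<gamma> s + \<gamma> t - 2 *\<^sub>R \<gamma> ((s + t) / 2) = B - A" by (simp add: A_def B_def algebra_simps scaleR_2)
  have c: "0 \<le> c" using lip_minD(1)[OF m] .
  have A: "norm A \<le> c * (t - s) / 2" and B: "norm B \<le> c * (t - s) / 2"
    using lip_minD(3)[OF m, of s "(s + t) / 2"] lip_minD(3)[OF m, of "(s + t) / 2" t] st
    by (auto simp: A_def B_def field_simps)
  have D: "D \<le> c * (t - s)" using lip_minD(3)[OF m, of s t] st by (simp add: D_def)
  have "c * (t - s) \<le> sqrt (D\<^sup>2 + C * D ^ 4)"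
    using lip_minD(4)[OF m st conn] by (simp add: D_def)
  then have "(c * (t - s))\<^sup>2 \<le> D\<^sup>2 + C * D ^ 4"
    using c st C by (metis abs_of_nonneg mult_nonneg_nonneg diff_ge_0_iff_ge real_sqrt_abs real_sqrt_le_iff)
  also have "C * D ^ 4 \<le> C * (c * (t - s)) ^ 4"
    using D C by (intro mult_left_mono power_mono) (auto simp: D_def)
  finally have 1: "(c * (t - s))\<^sup>2 - D\<^sup>2 \<le> C * (c * (t - s)) ^ 4" by simp
  have "(norm (B - A))\<^sup>2 = 2 * (norm A)\<^sup>2 + 2 * (norm B)\<^sup>2 - D\<^sup>2"
  proof -
    have "\<gamma> t - \<gamma> s = A + B" by (simp add: A_def B_def)
    then show ?thesis unfolding D_def
      by (simp add: power2_norm_eq_inner inner_diff_left inner_diff_right inner_add_left inner_add_right inner_commute)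
  qed
  also have "\<dots> \<le> 2 * (c * (t - s) / 2)\<^sup>2 + 2 * (c * (t - s) / 2)\<^sup>2 - D\<^sup>2"
    using A B by (intro diff_right_mono add_mono mult_left_mono power_mono) auto
  also have "\<dots> = (c * (t - s))\<^sup>2 - D\<^sup>2" by (simp add: power2_eq_square)
  also have "\<dots> \<le> ((sqrt C * c\<^sup>2) * (t - s)\<^sup>2)\<^sup>2"
    using 1 C by (simp add: power_mult_distrib flip: power_mult)
  finally have "norm (B - A) \<le> (sqrt C * c\<^sup>2) * (t - s)\<^sup>2"
    by (rule power2_le_imp_le) (use C in auto)
  then show ?thesis using AB by simp
qed

text \<open>The dyadic difference quotients \<open>D j\<close> converge uniformly, and they are the derivatives of the
  moving averages of \<open>\<gamma>\<close>.\<close>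

lemma second_difference_C1_aux:
  fixes \<gamma> :: "real \<Rightarrow> 'a::euclidean_space"
  assumes cont: "continuous_on {a..b} \<gamma>"
    and sd: "\<And>s t. a \<le> s \<Longrightarrow> s \<le> t \<Longrightarrow> t \<le> b \<Longrightarrow> norm (\<gamma> s + \<gamma> t - 2 *\<^sub>R \<gamma> ((s + t) / 2)) \<le> K * (t - s)\<^sup>2"
    and b': "a < b'" "b' < b"
  obtains g where "continuous_on {a..b'} g"
    "\<And>t. t \<in> {a..b'} \<Longrightarrow> (\<gamma> has_vector_derivative g t) (at t within {a..b'})"
proof -
  \<comment> \<open>The largest step is \<open>b - b'\<close>, so that \<open>t + h j\<close> stays
    in \<open>{a..b}\<close> for every t up to \<open>b'\<close>.\<close>
  define h where "h j = (b - b') / 2 ^ j" for j :: nat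
  have h: "h j > 0" "h j \<le> b - b'" for j
    using b' by (auto simp: h_def divide_le_eq intro: order_trans[OF _ mult_left_mono[of 1]])
  have hS: "h (Suc j) = h j / 2" for j by (simp add: h_def)
  define D where "D j t = (1 / h j) *\<^sub>R (\<gamma> (t + h j) - \<gamma> t)" for j t
  have step: "norm (D (Suc j) t - D j t) \<le> K * (b - b') * (1/2) ^ j" if t: "t \<in> {a..b'}" for j t
  proof -
    \<comment> \<open>Consecutive dyadic quotients differ by a second difference divided by the
      step, so the quadratic hypothesis leaves a bound linear in the step, and the bounds are
      summable.\<close>
    have "D (Suc j) t - D j t = - (1 / h j) *\<^sub>R (\<gamma> t + \<gamma> (t + h j) - 2 *\<^sub>R \<gamma> ((t + (t + h j)) / 2))"
    proof -
      have k: "1 / (h j / 2) = 1 / h j + 1 / h j" by simp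
      have "\<gamma> (t + h j / 2) = \<gamma> ((t + (t + h j)) / 2)" by (simp add: field_simps)
      then show ?thesis
        unfolding D_def hS k scaleR_2 by (simp only: scaleR_left_distrib scaleR_diff_right scaleR_add_right scaleR_minus_left) simp
    qed
    then have "norm (D (Suc j) t - D j t) = (1 / h j) * norm (\<gamma> t + \<gamma> (t + h j) - 2 *\<^sub>R \<gamma> ((t + (t + h j)) / 2))"
      using h(1)[of j] by simp
    also have "\<dots> \<le> (1 / h j) * (K * (t + h j - t)\<^sup>2)"
      using h[of j] t by (intro mult_left_mono sd) auto
    also have "\<dots> = K * h j" using h(1)[of j] by (simp add: power2_eq_square)
    finally show ?thesis by (simp add: h_def power_divide)
  qed
  define g where "g t = D 0 t + (\<Sum>i. D (Suc i) t - D i t)" for t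
  have "summable (\<lambda>j. K * (b - b') * (1/2::real) ^ j)" by (intro summable_mult) simp
  then have "uniform_limit {a..b'} (\<lambda>n t. \<Sum>i<n. D (Suc i) t - D i t) (\<lambda>t. \<Sum>i. D (Suc i) t - D i t) sequentially"
    by (rule Weierstrass_m_test[where M="\<lambda>j. K * (b - b') * (1/2) ^ j", rotated]) (rule step)
  then have "uniform_limit {a..b'} (\<lambda>n t. D 0 t + (\<Sum>i<n. D (Suc i) t - D i t)) g sequentially"
    unfolding g_def by (intro uniform_limit_intros)
  moreover have "D 0 t + (\<Sum>i<n. D (Suc i) t - D i t) = D n t" for n t
    using sum_lessThan_telescope[of "\<lambda>n. D n t" n] by simp
  ultimately have unif: "uniform_limit {a..b'} D g sequentially" by simp
  have gcont: "continuous_on {a..b'} g"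
  proof (rule uniform_limit_theorem[OF _ unif])
    show "\<forall>\<^sub>F n in sequentially. continuous_on {a..b'} (D n)"
    proof (intro always_eventually allI)
      fix n
      have "(\<lambda>t. t + h n) ` {a..b'} \<subseteq> {a..b}" "{a..b'} \<subseteq> {a..b}" using h[of n] b' by auto
      then show "continuous_on {a..b'} (D n)"
        unfolding D_def[abs_def] by (intro continuous_intros continuous_on_compose2[OF cont]) auto
    qed
  qed simp
  obtain I where I: "\<And>x. x \<in> {a..b} \<Longrightarrow> (I has_vector_derivative \<gamma> x) (at x within {a..b})"
    using antiderivative_continuous[OF cont] by blast
  define \<Gamma> where "\<Gamma> j t = (1 / h j) *\<^sub>R (I (t + h j) - I t)" for j t
  have G': "(\<Gamma> j has_vector_derivative D j t) (at t within {a..b'})" if t: "t \<in> {a..b'}" for j t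
  proof -
    have sub: "(\<lambda>t. t + h j) ` {a..b'} \<subseteq> {a..b}" using h[of j] by auto
    have "((I \<circ> (\<lambda>t. t + h j)) has_vector_derivative 1 *\<^sub>R \<gamma> (t + h j)) (at t within {a..b'})"
      by (rule vector_diff_chain_within)
        (use t sub in \<open>auto intro!: derivative_eq_intros has_vector_derivative_within_subset[OF I]\<close>)
    moreover have "(I has_vector_derivative \<gamma> t) (at t within {a..b'})"
      using t b' by (intro has_vector_derivative_within_subset[OF I]) auto
    ultimately show ?thesis unfolding \<Gamma>_def[abs_def] D_def
      by (intro bounded_linear.has_vector_derivative[OF bounded_linear_scaleR_right] has_vector_derivative_diff)
        (simp_all add: o_def)
  qed
  have Glim: "(\<lambda>j. \<Gamma> j t) \<longlonglongrightarrow> \<gamma> t" if t: "t \<in> {a..b'}" for t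
  proof (rule LIMSEQ_I)
    fix e :: real assume e: "e > 0"
    have "t \<in> {a..b}" using t b' by auto
    from I[OF this] e obtain d where d: "d > 0"
        "\<And>y. y \<in> {a..b} \<Longrightarrow> norm (y - t) < d \<Longrightarrow> norm (I y - I t - (y - t) *\<^sub>R \<gamma> t) \<le> (e/2) * norm (y - t)"
      unfolding has_vector_derivative_def has_derivative_within_alt by (meson half_gt_zero)
    have "h \<longlonglongrightarrow> 0" unfolding h_def by (rule LIMSEQ_divide_realpow_zero) simp
    then obtain N where N: "\<And>n. n \<ge> N \<Longrightarrow> norm (h n - 0) < d" using LIMSEQ_D[OF _ d(1)] by blast
    show "\<exists>N. \<forall>n\<ge>N. norm (\<Gamma> n t - \<gamma> t) < e"
    proof (intro exI allI impI)
      fix n assume n: "n \<ge> N"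
      have "\<Gamma> n t - \<gamma> t = (1 / h n) *\<^sub>R (I (t + h n) - I t - h n *\<^sub>R \<gamma> t)"
        using h(1)[of n] by (simp add: \<Gamma>_def algebra_simps)
      then have "norm (\<Gamma> n t - \<gamma> t) = (1 / h n) * norm (I (t + h n) - I t - h n *\<^sub>R \<gamma> t)"
        using h(1)[of n] by simp
      also have "\<dots> \<le> (1 / h n) * ((e/2) * h n)"
        using d(2)[of "t + h n"] N[OF n] h[of n] t by (intro mult_left_mono) auto
      also have "\<dots> < e" using h(1)[of n] e by simp
      finally show "norm (\<Gamma> n t - \<gamma> t) < e" .
    qed
  qed
  \<comment> \<open>The moving averages are differentiable, although \<gamma> is not yet known to
    be. They converge to \<gamma> and their derivatives \<open>D j\<close> converge uniformly, so
    the limit is differentiable with derivative \<open>g\<close>.\<close>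
  have "\<exists>G. \<forall>t\<in>{a..b'}. (\<lambda>n. \<Gamma> n t) \<longlonglongrightarrow> G t \<and> (G has_derivative (\<lambda>s. s *\<^sub>R g t)) (at t within {a..b'})"
  proof (rule has_derivative_sequence[of "{a..b'}" \<Gamma> "\<lambda>n t s. s *\<^sub>R D n t" _ a])
    show "(\<Gamma> n has_derivative (\<lambda>s. s *\<^sub>R D n t)) (at t within {a..b'})" if "t \<in> {a..b'}" for n t
      using G'[OF that] by (simp add: has_vector_derivative_def)
    show "\<forall>\<^sub>F n in sequentially. \<forall>t\<in>{a..b'}. \<forall>s. norm (s *\<^sub>R D n t - s *\<^sub>R g t) \<le> e * norm s" if "e > 0" for e
      using uniform_limitD[OF unif that]
    proof eventually_elim
      case (elim n)
      show ?case
      proof (intro ballI allI)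
        fix t s :: real assume "t \<in> {a..b'}"
        then have "norm (D n t - g t) \<le> e" using elim by (auto simp: dist_norm less_imp_le)
        then have "\<bar>s\<bar> * norm (D n t - g t) \<le> \<bar>s\<bar> * e" by (rule mult_left_mono) simp
        then show "norm (s *\<^sub>R D n t - s *\<^sub>R g t) \<le> e * norm s"
          unfolding scaleR_diff_right[symmetric] norm_scaleR by (simp add: mult.commute)
      qed
    qed
    show "(\<lambda>n. \<Gamma> n a) \<longlonglongrightarrow> \<gamma> a" using Glim b' by simp
  qed (use b' in auto)
  then obtain G where G: "\<And>t. t \<in> {a..b'} \<Longrightarrow> (\<lambda>n. \<Gamma> n t) \<longlonglongrightarrow> G t"
    "\<And>t. t \<in> {a..b'} \<Longrightarrow> (G has_vector_derivative g t) (at t within {a..b'})"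
    unfolding has_vector_derivative_def by blast
  have "G t = \<gamma> t" if "t \<in> {a..b'}" for t using LIMSEQ_unique[OF G(1) Glim] that by blast
  then show ?thesis
    by (intro that[OF gcont] has_vector_derivative_transform[OF _ _ G(2)]) auto
qed

lemma second_difference_C1:
  fixes \<gamma> :: "real \<Rightarrow> 'a::euclidean_space"
  assumes cont: "continuous_on {a..b} \<gamma>"
    and sd: "\<And>s t. a \<le> s \<Longrightarrow> s \<le> t \<Longrightarrow> t \<le> b \<Longrightarrow> norm (\<gamma> s + \<gamma> t - 2 *\<^sub>R \<gamma> ((s + t) / 2)) \<le> K * (t - s)\<^sup>2"
    and t: "t \<in> {a<..<b}"
  shows "(\<gamma> has_vector_derivative vector_derivative \<gamma> (at t)) (at t)"
    and "isCont (\<lambda>t. vector_derivative \<gamma> (at t)) t"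
proof -
  define b' where "b' = (t + b) / 2"
  have b': "a < b'" "b' < b" "t < b'" using t by (auto simp: b'_def)
  obtain g where g: "continuous_on {a..b'} g"
    "\<And>t. t \<in> {a..b'} \<Longrightarrow> (\<gamma> has_vector_derivative g t) (at t within {a..b'})"
    using second_difference_C1_aux[OF cont sd b'(1,2)] by blast
  have d: "(\<gamma> has_vector_derivative g s) (at s)" if "s \<in> {a<..<b'}" for s
    using has_vector_derivative_within_subset[OF g(2)[of s], of "{a<..<b'}"] that
      has_vector_derivative_within_open[of s "{a<..<b'}" \<gamma>] by fastforce
  have eq: "vector_derivative \<gamma> (at s) = g s" if "s \<in> {a<..<b'}" for s
    using d[OF that] vector_derivative_at by blast
  show "(\<gamma> has_vector_derivative vector_derivative \<gamma> (at t)) (at t)" using d[of t] eq[of t] t b' by simp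
  have "continuous_on {a<..<b'} g" by (rule continuous_on_subset[OF g(1)]) auto
  then have "continuous_on {a<..<b'} (\<lambda>t. vector_derivative \<gamma> (at t))"
    by (rule continuous_on_eq) (use eq in auto)
  then show "isCont (\<lambda>t. vector_derivative \<gamma> (at t)) t"
    using t b' by (simp add: continuous_on_eq_continuous_at)
qed

text \<open>The quadratic bound on second differences is available between points of one retraction
  ball, hence the passage to a small interval around the given parameter.\<close>

lemma lip_min_C1:
  assumes m: "lip_min M a b c \<gamma>" and R: "locally_retractable k M" and k: "k \<ge> 2"
    and t: "t \<in> {a<..<b}"
  shows "(\<gamma> has_vector_derivative vector_derivative \<gamma> (at t)) (at t)"
    and "isCont (\<lambda>t. vector_derivative \<gamma> (at t)) t"
proof -
  have tM: "\<gamma> t \<in> M" using lip_minD(2)[OF m] t by auto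
  obtain P r where PR: "local_retraction k M P (\<gamma> t) r" by (rule locally_retractableD[OF R tM])
  obtain \<rho> C where rho: "\<rho> > 0" "C \<ge> 0"
    "\<And>x y. x \<in> M \<inter> ball (\<gamma> t) \<rho> \<Longrightarrow> y \<in> M \<inter> ball (\<gamma> t) \<rho> \<Longrightarrow>
       lip_conn M x y (sqrt ((norm (y - x))\<^sup>2 + C * (norm (y - x)) ^ 4))"
    using local_length[OF PR k] by metis
  have cont: "continuous_on {a..b} \<gamma>" using lip_min_continuous[OF m] .
  have "open ({a<..<b} \<inter> \<gamma> -` ball (\<gamma> t) \<rho>)"
    by (rule continuous_open_preimage[OF continuous_on_subset[OF cont]]) auto
  moreover have "t \<in> {a<..<b} \<inter> \<gamma> -` ball (\<gamma> t) \<rho>" using t rho(1) by simp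
  ultimately obtain e where e: "e > 0" "ball t e \<subseteq> {a<..<b} \<inter> \<gamma> -` ball (\<gamma> t) \<rho>"
    by (rule openE)
  define a' b' where "a' = t - e/2" and "b' = t + e/2"
  have ab: "{a'..b'} \<subseteq> ball t e" "t \<in> {a'<..<b'}" using e(1) by (auto simp: a'_def b'_def dist_real_def)
  have in_b: "\<gamma> s \<in> M \<inter> ball (\<gamma> t) \<rho>" "s \<in> {a..b}" if "s \<in> {a'..b'}" for s
    using ab(1) e(2) that lip_minD(2)[OF m, of s] by (auto dest!: subsetD[OF ab(1)] subsetD[OF e(2)])
  have sd: "norm (\<gamma> s + \<gamma> u - 2 *\<^sub>R \<gamma> ((s + u) / 2)) \<le> (sqrt C * c\<^sup>2) * (u - s)\<^sup>2"
    if "a' \<le> s" "s \<le> u" "u \<le> b'" for s u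
    using that in_b[of s] in_b[of u] by (intro lip_min_midpoint[OF m _ that(2) _ rho(2)] rho(3)) auto
  have "continuous_on {a'..b'} \<gamma>" using in_b by (intro continuous_on_subset[OF cont]) auto
  note * = second_difference_C1[OF this _ ab(2)]
  show "(\<gamma> has_vector_derivative vector_derivative \<gamma> (at t)) (at t)" by (rule *(1)[OF sd])
  show "isCont (\<lambda>t. vector_derivative \<gamma> (at t)) t" by (rule *(2)[OF sd])
qed

section \<open>First variation of the energy\<close>

lemma continuous_on_has_vector_derivative:
  assumes "\<And>t. t \<in> S \<Longrightarrow> (f has_vector_derivative g t) (at t within S)"
  shows "continuous_on S f"
  unfolding continuous_on_eq_continuous_within using has_vector_derivative_continuous[OF assms] by blast

lemma first_variation:
  fixes \<gamma> \<eta> :: "real \<Rightarrow> 'a::euclidean_space" and P :: "'a \<Rightarrow> 'b::euclidean_space"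
  assumes U: "open U" and P: "Ck_open 2 U P" and \<gamma>U: "\<And>t. t \<in> {a..b} \<Longrightarrow> \<gamma> t \<in> U"
    and \<gamma>: "\<And>t. t \<in> {a..b} \<Longrightarrow> (\<gamma> has_vector_derivative g t) (at t within {a..b})" and g: "continuous_on {a..b} g"
    and \<eta>: "\<And>t. t \<in> {a..b} \<Longrightarrow> (\<eta> has_vector_derivative e t) (at t within {a..b})" and e: "continuous_on {a..b} e"
  obtains s0 where "s0 > 0"
    "\<And>s t. \<bar>s\<bar> < s0 \<Longrightarrow> t \<in> {a..b} \<Longrightarrow> \<gamma> t + s *\<^sub>R \<eta> t \<in> U"
    "\<And>s. \<bar>s\<bar> < s0 \<Longrightarrow> H1_curve a b (\<lambda>t. P (\<gamma> t + s *\<^sub>R \<eta> t)) (\<lambda>t. dird P (g t + s *\<^sub>R e t) (\<gamma> t + s *\<^sub>R \<eta> t))"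
    "((\<lambda>s. integral {a..b} (\<lambda>t. (norm (dird P (g t + s *\<^sub>R e t) (\<gamma> t + s *\<^sub>R \<eta> t)))\<^sup>2)) has_real_derivative
       integral {a..b} (\<lambda>t. 2 * (dird P (g t) (\<gamma> t) \<bullet> (dird (dird P (g t)) (\<eta> t) (\<gamma> t) + dird P (e t) (\<gamma> t))))) (at 0)"
proof -
  have P2: "Ck_open (Suc (Suc 0)) U P" using P by (simp add: numeral_2_eq_2)
  have \<gamma>c: "continuous_on {a..b} \<gamma>" and \<eta>c: "continuous_on {a..b} \<eta>"
    using continuous_on_has_vector_derivative \<gamma> \<eta> by blast+
  obtain d where d: "d > 0" "(\<Union>x\<in>\<gamma> ` {a..b}. ball x d) \<subseteq> U"
    using compact_subset_open_imp_ball_epsilon_subset[of "\<gamma> ` {a..b}" U] U \<gamma>U \<gamma>c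
    by (metis compact_Icc compact_continuous_image image_subsetI)
  have "bounded (\<eta> ` {a..b})" using \<eta>c by (intro compact_imp_bounded compact_continuous_image) auto
  then obtain B where B: "\<And>t. t \<in> {a..b} \<Longrightarrow> norm (\<eta> t) \<le> B" "B > 0"
    unfolding bounded_pos by (metis imageI)
  \<comment> \<open>A tube of radius \<open>d\<close> around the compact image of \<gamma> lies in
    U, and \<open>B\<close> bounds \<eta>, so variations of size below \<open>d / B\<close> do not
    leave the tube.\<close>
  define s0 where "s0 = d / B"
  have s0: "s0 > 0" using d B by (simp add: s0_def)
  have inU: "\<gamma> t + s *\<^sub>R \<eta> t \<in> U" if "\<bar>s\<bar> < s0" "t \<in> {a..b}" for s t
  proof -
    have "\<bar>s\<bar> * norm (\<eta> t) \<le> \<bar>s\<bar> * B" using B(1)[OF that(2)] by (intro mult_left_mono) auto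
    also have "\<dots> < s0 * B" using that B(2) by (intro mult_strict_right_mono) auto
    also have "\<dots> = d" using B(2) by (simp add: s0_def)
    finally have "\<gamma> t + s *\<^sub>R \<eta> t \<in> ball (\<gamma> t) d" by (simp add: dist_norm)
    then show ?thesis using d(2) that(2) by blast
  qed
  define G where "G s t = dird P (g t + s *\<^sub>R e t) (\<gamma> t + s *\<^sub>R \<eta> t)" for s t
  define G' where "G' s t = dird (dird P (g t + s *\<^sub>R e t)) (\<eta> t) (\<gamma> t + s *\<^sub>R \<eta> t) + dird P (e t) (\<gamma> t + s *\<^sub>R \<eta> t)" for s t
  have H: "H1_curve a b (\<lambda>t. P (\<gamma> t + s *\<^sub>R \<eta> t)) (G s)" if s: "\<bar>s\<bar> < s0" for s
  proof (rule H1_curve_continuous_derivative)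
    show "((\<lambda>t. P (\<gamma> t + s *\<^sub>R \<eta> t)) has_vector_derivative G s t) (at t within {a..b})" if "t \<in> {a..b}" for t
      unfolding G_def
      by (rule has_vector_derivative_dird[OF P2]) (use inU[OF s] that in \<open>auto intro!: derivative_eq_intros \<gamma> \<eta>\<close>)
    show "continuous_on {a..b} (G s)"
      unfolding G_def[abs_def] by (rule continuous_on_dird[OF P2]) (use inU[OF s] in \<open>auto intro!: continuous_intros \<gamma>c \<eta>c g e\<close>)
  qed
  have Gd: "((\<lambda>s. G s t) has_vector_derivative G' s t) (at s within {-s0<..<s0})" if "s \<in> {-s0<..<s0}" "t \<in> cbox a b" for s t
    unfolding G_def G'_def
    by (rule has_vector_derivative_dird_dird[OF U P])
      (use that inU in \<open>auto intro!: derivative_eq_intros simp: abs_less_iff\<close>)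
  have comp: "continuous_on (S \<times> cbox a b) (\<lambda>x. f (snd x))" if "continuous_on {a..b} f" for f :: "real \<Rightarrow> 'c::topological_space" and S :: "real set"
    by (rule continuous_on_compose2[OF that continuous_on_snd]) (auto intro: continuous_on_id)
  note cs = comp[OF \<gamma>c] comp[OF \<eta>c] comp[OF g] comp[OF e]
  have "((\<lambda>s. integral (cbox a b) (\<lambda>t. (norm (G s t))\<^sup>2)) has_real_derivative
       integral (cbox a b) (\<lambda>t. 2 * (G 0 t \<bullet> G' 0 t))) (at 0 within {-s0<..<s0})"
  proof (rule leibniz_rule_field_derivative)
    show "((\<lambda>s. (norm (G s t))\<^sup>2) has_real_derivative 2 * (G s t \<bullet> G' s t)) (at s within {-s0<..<s0})"
      if "s \<in> {-s0<..<s0}" "t \<in> cbox a b" for s t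
    proof -
      have "((\<lambda>s. G s t \<bullet> G s t) has_derivative (\<lambda>h. G s t \<bullet> (h *\<^sub>R G' s t) + (h *\<^sub>R G' s t) \<bullet> G s t)) (at s within {-s0<..<s0})"
        using Gd[OF that] unfolding has_vector_derivative_def by (intro has_derivative_inner)
      moreover have "(\<lambda>h. G s t \<bullet> (h *\<^sub>R G' s t) + (h *\<^sub>R G' s t) \<bullet> G s t) = (*) (2 * (G s t \<bullet> G' s t))"
        by (auto simp: inner_commute)
      ultimately show ?thesis unfolding has_field_derivative_def power2_norm_eq_inner by simp
    qed
    show "(\<lambda>t. (norm (G s t))\<^sup>2) integrable_on cbox a b" if "s \<in> {-s0<..<s0}" for s
      using H1_curveD(2)[OF H, of s] that by (simp add: abs_less_iff)
    have inU': "\<gamma> (snd x) + fst x *\<^sub>R \<eta> (snd x) \<in> U" if "x \<in> {-s0<..<s0} \<times> cbox a b" for x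
      using inU[of "fst x" "snd x"] that by auto
    show "continuous_on ({-s0<..<s0} \<times> cbox a b) (\<lambda>(s, t). 2 * (G s t \<bullet> G' s t))"
      unfolding case_prod_unfold G_def G'_def
      by (intro continuous_on_mult continuous_on_const continuous_on_inner continuous_on_add
          continuous_on_dird[OF P2 inU'] continuous_on_dird_dird[OF U P inU'] continuous_on_scaleR
          continuous_on_fst continuous_on_id cs)
  qed (use s0 in auto)
  then have "((\<lambda>s. integral {a..b} (\<lambda>t. (norm (G s t))\<^sup>2)) has_real_derivative
       integral {a..b} (\<lambda>t. 2 * (G 0 t \<bullet> G' 0 t))) (at 0)"
    unfolding box_real by (subst (asm) at_within_open) (use s0 in auto)
  moreover have "(\<lambda>t. 2 * (G 0 t \<bullet> G' 0 t)) =
      (\<lambda>t. 2 * (dird P (g t) (\<gamma> t) \<bullet> (dird (dird P (g t)) (\<eta> t) (\<gamma> t) + dird P (e t) (\<gamma> t))))"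
    by (simp add: G_def G'_def)
  ultimately have "((\<lambda>s. integral {a..b} (\<lambda>t. (norm (dird P (g t + s *\<^sub>R e t) (\<gamma> t + s *\<^sub>R \<eta> t)))\<^sup>2)) has_real_derivative
       integral {a..b} (\<lambda>t. 2 * (dird P (g t) (\<gamma> t) \<bullet> (dird (dird P (g t)) (\<eta> t) (\<gamma> t) + dird P (e t) (\<gamma> t))))) (at 0)"
    by (simp only: G_def)
  from that[OF s0 inU H[unfolded G_def[abs_def]] this] show ?thesis .
qed

text \<open>Choose the test function whose derivative is \<open>e = w - H - m\<close>, with H a
  primitive of \<open>h\<close> and \<open>m\<close> the mean of \<open>w - H\<close>; the choice of
  \<open>m\<close> makes it vanish at both ends. Integration by parts then leaves the integral of
  \<open>e \<bullet> e\<close>, which is 0, so \<open>w\<close> is \<open>H\<close> up to a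
  constant.\<close>

lemma du_Bois_Reymond:
  fixes h w :: "real \<Rightarrow> 'a::euclidean_space"
  assumes ab: "a < b" and h: "continuous_on {a..b} h" and w: "continuous_on {a..b} w"
    and zero: "\<And>\<eta> e. (\<And>t. t \<in> {a..b} \<Longrightarrow> (\<eta> has_vector_derivative e t) (at t within {a..b})) \<Longrightarrow>
      continuous_on {a..b} e \<Longrightarrow> \<eta> a = 0 \<Longrightarrow> \<eta> b = 0 \<Longrightarrow> integral {a..b} (\<lambda>t. h t \<bullet> \<eta> t + w t \<bullet> e t) = 0"
    and t: "t \<in> {a..b}"
  shows "(w has_vector_derivative h t) (at t within {a..b})"
proof -
  obtain H where H: "\<And>t. t \<in> {a..b} \<Longrightarrow> (H has_vector_derivative h t) (at t within {a..b})"
    using antiderivative_continuous[OF h] by blast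
  have Hc: "continuous_on {a..b} H" using continuous_on_has_vector_derivative H by blast
  define m where "m = (1 / (b - a)) *\<^sub>R integral {a..b} (\<lambda>t. w t - H t)"
  define e where "e t = w t - H t - m" for t
  have ec: "continuous_on {a..b} e" unfolding e_def[abs_def] by (intro continuous_intros w Hc)
  define \<eta> where "\<eta> t = integral {a..t} e" for t
  have \<eta>: "(\<eta> has_vector_derivative e t) (at t within {a..b})" if "t \<in> {a..b}" for t
    unfolding \<eta>_def[abs_def] by (rule integral_has_vector_derivative[OF ec that])
  have \<eta>c: "continuous_on {a..b} \<eta>" using continuous_on_has_vector_derivative \<eta> by blast
  have wH: "(\<lambda>t. w t - H t) integrable_on {a..b}" by (intro integrable_continuous_real continuous_intros w Hc)
  have "\<eta> b = integral {a..b} (\<lambda>t. w t - H t) - (b - a) *\<^sub>R m"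
    unfolding \<eta>_def e_def using ab integral_diff[OF wH integrable_const_ivl[of m a b]] by simp
  also have "\<dots> = 0" using ab by (simp add: m_def)
  finally have \<eta>b: "\<eta> b = 0" .
  have \<eta>a: "\<eta> a = 0" by (simp add: \<eta>_def)
  have "((\<lambda>t. H t \<bullet> e t + h t \<bullet> \<eta> t) has_integral H b \<bullet> \<eta> b - H a \<bullet> \<eta> a) {a..b}"
  proof (rule fundamental_theorem_of_calculus)
    fix t assume t: "t \<in> {a..b}"
    show "((\<lambda>t. H t \<bullet> \<eta> t) has_vector_derivative H t \<bullet> e t + h t \<bullet> \<eta> t) (at t within {a..b})"
      using has_derivative_inner[OF H[OF t, unfolded has_vector_derivative_def] \<eta>[OF t, unfolded has_vector_derivative_def]]
      unfolding has_vector_derivative_def by (rule has_derivative_eq_rhs) (simp add: algebra_simps)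
  qed (use ab in auto)
  then have 1: "((\<lambda>t. H t \<bullet> e t + h t \<bullet> \<eta> t) has_integral 0) {a..b}" using \<eta>a \<eta>b by simp
  have "(e has_integral \<eta> b - \<eta> a) {a..b}"
    by (rule fundamental_theorem_of_calculus[OF _ \<eta>]) (use ab in auto)
  then have 2: "((\<lambda>t. m \<bullet> e t) has_integral 0) {a..b}"
    using has_integral_linear[of e "\<eta> b - \<eta> a" "{a..b}" "\<lambda>x. m \<bullet> x"] \<eta>a \<eta>b by (simp add: bounded_linear_inner_right o_def)
  have "(\<lambda>t. h t \<bullet> \<eta> t + w t \<bullet> e t) integrable_on {a..b}"
    by (intro integrable_continuous_real continuous_intros h w \<eta>c ec)
  then have 3: "((\<lambda>t. h t \<bullet> \<eta> t + w t \<bullet> e t) has_integral 0) {a..b}"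
    using zero[OF \<eta> ec \<eta>a \<eta>b] by (metis integrable_integral)
  have "((\<lambda>t. (h t \<bullet> \<eta> t + w t \<bullet> e t) - (H t \<bullet> e t + h t \<bullet> \<eta> t) - m \<bullet> e t) has_integral 0 - 0 - 0) {a..b}"
    by (intro has_integral_diff 1 2 3)
  moreover have "(h t \<bullet> \<eta> t + w t \<bullet> e t) - (H t \<bullet> e t + h t \<bullet> \<eta> t) - m \<bullet> e t = e t \<bullet> e t" for t
    by (simp add: e_def inner_diff_left inner_diff_right)
  ultimately have "((\<lambda>t. e t \<bullet> e t) has_integral 0) {a..b}" by simp
  moreover have "continuous_on {a..b} (\<lambda>t. e t \<bullet> e t)" by (intro continuous_intros ec)
  ultimately have "e t \<bullet> e t = 0" if "t \<in> {a..b}" for t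
    using has_integral_0_cbox_imp_0[of a b "\<lambda>t. e t \<bullet> e t" t] ab that by auto
  then have "e t = 0" if "t \<in> {a..b}" for t using that inner_eq_zero_iff by blast
  then have "w t = H t + m" if "t \<in> {a..b}" for t using that by (simp add: e_def algebra_simps)
  then show ?thesis
    using has_vector_derivative_transform[OF t, of w "\<lambda>t. H t + m" "h t"] H[OF t]
    by (simp add: has_vector_derivative_add_const)
qed

section \<open>Linear equations with a monotone operator\<close>

text \<open>Below, \<open>A\<close> is the identity plus an antisymmetric map.\<close>

lemma monotone_linear_norm_le:
  assumes "norm x * norm x \<le> A x \<bullet> x"
  shows "norm (x::'a::euclidean_space) \<le> norm (A x)"
proof (cases "x = 0")
  case False
  have "norm x * norm x \<le> norm (A x) * norm x"
    using assms Cauchy_Schwarz_ineq2[of "A x" x] by linarith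
  then show ?thesis using False by simp
qed simp

lemma monotone_linear_surj:
  fixes A :: "'a::euclidean_space \<Rightarrow> 'a"
  assumes A: "linear A" and mono: "\<And>x. norm x * norm x \<le> A x \<bullet> x"
  obtains x where "A x = y"
proof -
  have "x = 0" if "A x = 0" for x using monotone_linear_norm_le[of x A] mono[of x] that by simp
  then have "inj A" using linear_injective_0[OF A] by blast
  then have "surj A" using linear_injective_imp_surjective[OF A] by blast
  then show ?thesis using that by (metis surjD)
qed

text \<open>Monotonicity bounds \<open>v y - v t\<close> by its image under \<open>A y\<close>,
  which is \<open>w y - A y (v t)\<close>. This tends to 0, because the argument \<open>v t\<close>
  is frozen and \<open>A y x\<close> is continuous in y for each fixed x.\<close>

lemma monotone_linear_solution_continuous:
  fixes A :: "'b::topological_space \<Rightarrow> 'a::euclidean_space \<Rightarrow> 'a"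
  assumes A: "\<And>t. t \<in> S \<Longrightarrow> linear (A t)" and mono: "\<And>t x. t \<in> S \<Longrightarrow> norm x * norm x \<le> A t x \<bullet> x"
    and cA: "\<And>x. continuous_on S (\<lambda>t. A t x)" and w: "continuous_on S w" and eq: "\<And>t. t \<in> S \<Longrightarrow> A t (v t) = w t"
  shows "continuous_on S v"
  unfolding continuous_on_def
proof
  fix t assume t: "t \<in> S"
  have "((\<lambda>y. w y - A y (v t)) \<longlongrightarrow> w t - A t (v t)) (at t within S)"
    using w cA t unfolding continuous_on_def by (intro tendsto_diff) auto
  then have "((\<lambda>y. norm (w y - A y (v t))) \<longlongrightarrow> 0) (at t within S)"
    using tendsto_norm_zero eq[OF t] by fastforce
  moreover have "\<forall>\<^sub>F y in at t within S. norm (v y - v t) \<le> norm (w y - A y (v t))"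
  proof (rule eventually_at_topological[THEN iffD2], intro exI[of _ UNIV] conjI ballI impI)
    fix y assume y: "y \<in> S"
    show "norm (v y - v t) \<le> norm (w y - A y (v t))"
      using monotone_linear_norm_le[of "v y - v t" "A y"] mono[OF y] linear_diff[OF A[OF y]] eq[OF y] by metis
  qed auto
  ultimately have "((\<lambda>y. v y - v t) \<longlongrightarrow> 0) (at t within S)"
    by (rule Lim_null_comparison[rotated])
  then show "(v \<longlongrightarrow> v t) (at t within S)" by (simp add: LIM_zero_iff)
qed

text \<open>The candidate \<open>u\<close> comes from formally differentiating the equation.
  \<open>A y\<close> maps the remainder of the expansion of \<open>v\<close> to \<open>r y\<close>,
  which is of smaller order than \<open>y - t\<close>, and monotonicity carries this back to the
  remainder itself.\<close>

lemma monotone_linear_solution_derivative: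
  fixes A :: "real \<Rightarrow> 'a::euclidean_space \<Rightarrow> 'a"
  assumes A: "\<And>t. t \<in> S \<Longrightarrow> linear (A t)" and mono: "\<And>t x. t \<in> S \<Longrightarrow> norm x * norm x \<le> A t x \<bullet> x"
    and dA: "\<And>x. ((\<lambda>t. A t x) has_vector_derivative A' x) (at t within S)"
    and dw: "(w has_vector_derivative w') (at t within S)"
    and eq: "\<And>t. t \<in> S \<Longrightarrow> A t (v t) = w t" and t: "t \<in> S" and u: "A t u = w' - A' (v t)"
  shows "(v has_vector_derivative u) (at t within S)"
proof -
  define r where "r y = w y - A y (v t) - (y - t) *\<^sub>R A y u" for y
  have "(r has_vector_derivative w' - A' (v t) - ((t - t) *\<^sub>R A' u + 1 *\<^sub>R A t u)) (at t within S)"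
    unfolding r_def[abs_def]
    by (intro has_vector_derivative_diff has_vector_derivative_scaleR dA dw) (auto intro!: derivative_eq_intros)
  then have rd: "(r has_derivative (\<lambda>s. 0)) (at t within S)" using u by (simp add: has_vector_derivative_def)
  have rt: "r t = 0" using eq[OF t] by (simp add: r_def)
  show ?thesis
    unfolding has_vector_derivative_def has_derivative_within_alt
  proof (intro conjI allI impI)
    fix e :: real assume "e > 0"
    then obtain d where d: "d > 0" "\<And>y. y \<in> S \<Longrightarrow> norm (y - t) < d \<Longrightarrow> norm (r y - r t - 0) \<le> e * norm (y - t)"
      using rd unfolding has_derivative_within_alt by blast
    have "norm (v y - v t - (y - t) *\<^sub>R u) \<le> e * norm (y - t)" if y: "y \<in> S" "norm (y - t) < d" for y
    proof -
      have "A y (v y - v t - (y - t) *\<^sub>R u) = r y"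
        by (simp add: r_def linear_diff[OF A[OF y(1)]] linear_cmul[OF A[OF y(1)]] eq[OF y(1)])
      then show ?thesis
        using monotone_linear_norm_le[of "v y - v t - (y - t) *\<^sub>R u" "A y"] mono[OF y(1)] d(2)[OF y] rt by fastforce
    qed
    then show "\<exists>d>0. \<forall>y\<in>S. norm (y - t) < d \<longrightarrow> norm (v y - v t - (y - t) *\<^sub>R u) \<le> e * norm (y - t)"
      using d(1) by blast
  qed (simp add: bounded_linear_scaleR_left)
qed

text \<open>The derivative of the solution solves a system with the same operator and the right side
  \<open>w' - A' v\<close>, of one class less; the induction is therefore over all right
  sides.\<close>

lemma monotone_linear_solution_Ck:
  fixes A :: "real \<Rightarrow> 'a::euclidean_space \<Rightarrow> 'a"
  assumes U: "open U" and A: "\<And>t. t \<in> U \<Longrightarrow> linear (A t)"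
    and mono: "\<And>t x. t \<in> U \<Longrightarrow> norm x * norm x \<le> A t x \<bullet> x"
    and "\<And>x. Ck_open k U (\<lambda>t. A t x)" "Ck_open k U w" and "\<And>t. t \<in> U \<Longrightarrow> A t (v t) = w t"
  shows "Ck_open k U v"
  using assms(4-6)
proof (induction k arbitrary: v w)
  case 0
  then show ?case using monotone_linear_solution_continuous[where S = U and A = A and w = w and v = v, OF A mono] by simp
next
  case (Suc k)
  let ?A' = "\<lambda>x t. vector_derivative (\<lambda>t. A t x) (at t)" and ?w' = "\<lambda>t. vector_derivative w (at t)"
  note dA = Ck_open_vector_derivativeD[OF U Suc.prems(1)] and dw = Ck_open_vector_derivativeD[OF U Suc.prems(2)]
  have lin': "linear (\<lambda>x. ?A' x t)" if t: "t \<in> U" for t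
  proof (rule linearI)
    show "?A' (x + y) t = ?A' x t + ?A' y t" for x y
    proof (rule vector_derivative_at)
      show "((\<lambda>t. A t (x + y)) has_vector_derivative ?A' x t + ?A' y t) (at t)"
        by (rule has_vector_derivative_transform_within_open[OF has_vector_derivative_add[OF dA(1)[OF t, of x] dA(1)[OF t, of y]] U t])
          (simp add: linear_add[OF A])
    qed
    show "?A' (c *\<^sub>R x) t = c *\<^sub>R ?A' x t" for c x
    proof (rule vector_derivative_at)
      show "((\<lambda>t. A t (c *\<^sub>R x)) has_vector_derivative c *\<^sub>R ?A' x t) (at t)"
        by (rule has_vector_derivative_transform_within_open[OF
            bounded_linear.has_vector_derivative[OF bounded_linear_scaleR_right dA(1)[OF t, of x]] U t])
          (simp add: linear_cmul[OF A])
    qed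
  qed
  have v: "Ck_open k U v"
    by (rule Suc.IH[OF _ _ Suc.prems(3)]) (use Suc.prems Ck_open_Suc_imp in blast)+
  have "\<exists>u. A t u = ?w' t - ?A' (v t) t" if "t \<in> U" for t
    using monotone_linear_surj[OF A[OF that] mono[OF that]] by metis
  then obtain u where u: "\<And>t. t \<in> U \<Longrightarrow> A t (u t) = ?w' t - ?A' (v t) t" by metis
  have "Ck_open k U (\<lambda>t. \<Sum>b\<in>Basis. (v t \<bullet> b) *\<^sub>R ?A' b t)"
    by (intro Ck_open_sum[OF U] Ck_open_scaleR[OF U] Ck_open_inner[OF U] v dA(2)) auto
  then have "Ck_open k U (\<lambda>t. ?A' (v t) t)"
    by (rule Ck_open_cong[OF U, THEN iffD1, rotated]) (rule linear_Basis_expansion[OF lin', symmetric])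
  then have "Ck_open k U (\<lambda>t. ?w' t - ?A' (v t) t)"
    by (rule Ck_open_diff[OF U dw(2)])
  then have "Ck_open k U u"
    by (rule Suc.IH[rotated]) (use Suc.prems(1) Ck_open_Suc_imp u in blast)+
  moreover have "(v has_vector_derivative u t) (at t)" if "t \<in> U" for t
    using monotone_linear_solution_derivative[where S = U and A = A and t = t and A' = "\<lambda>x. ?A' x t" and w = w and w' = "?w' t" and v = v and u = "u t"]
      A mono Suc.prems(3) u[OF that] that dA(1)[OF that] dw(1)[OF that]
    by (simp add: at_within_open[OF that U])
  ultimately show ?case by (intro Ck_open_vector_derivativeI[OF U])
qed

section \<open>The geodesic equation\<close>

text \<open>The transpose of the derivative of P at q, written in coordinates so that its regularity
  in q can be read off from the derivatives of P.\<close>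

definition dird_adj :: "('a::euclidean_space \<Rightarrow> 'a) \<Rightarrow> 'a \<Rightarrow> 'a \<Rightarrow> 'a" where
  "dird_adj P q x = (\<Sum>b\<in>Basis. (x \<bullet> dird P b q) *\<^sub>R b)"

lemma inner_sum_Basis_linear:
  fixes A :: "'b::euclidean_space \<Rightarrow> 'a::euclidean_space"
  assumes "linear A"
  shows "(\<Sum>b\<in>Basis. (x \<bullet> A b) *\<^sub>R b) \<bullet> y = x \<bullet> A y"
proof -
  have "(\<Sum>b\<in>Basis. (x \<bullet> A b) *\<^sub>R b) \<bullet> y = (\<Sum>b\<in>Basis. (y \<bullet> b) * (x \<bullet> A b))"
    by (simp add: inner_sum_left inner_commute[of y] mult.commute)
  also have "\<dots> = x \<bullet> (\<Sum>b\<in>Basis. (y \<bullet> b) *\<^sub>R A b)" by (simp add: inner_sum_right)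
  also have "(\<Sum>b\<in>Basis. (y \<bullet> b) *\<^sub>R A b) = A y" by (rule linear_Basis_expansion[OF assms, symmetric])
  finally show ?thesis .
qed

lemma dird_adj_inner:
  "Ck_open (Suc k) U P \<Longrightarrow> q \<in> U \<Longrightarrow> dird_adj P q x \<bullet> y = x \<bullet> dird P y q"
  unfolding dird_adj_def by (rule inner_sum_Basis_linear[OF linear_dird])

text \<open>A normal acceleration satisfies \<open>dird_adj P (\<gamma> t) (\<gamma>'' t) = 0\<close> and determines \<open>\<gamma>'' - dird P \<gamma>'' \<gamma>\<close>;
  adding the two equations makes the operator invertible also at points where \<open>dird P\<close> is not symmetric.\<close>

definition geo_op :: "('a::euclidean_space \<Rightarrow> 'a) \<Rightarrow> 'a \<Rightarrow> 'a \<Rightarrow> 'a" where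
  "geo_op P q x = x + dird_adj P q x - dird P x q"

lemma linear_geo_op:
  assumes "Ck_open (Suc k) U P" "q \<in> U"
  shows "linear (geo_op P q)"
proof -
  have l: "linear (\<lambda>x. dird P x q)" by (rule linear_dird[OF assms])
  show ?thesis
    unfolding geo_op_def dird_adj_def
    by (intro linearI)
      (simp_all add: inner_left_distrib scaleR_left_distrib sum.distrib scaleR_sum_right linear_add[OF l] linear_cmul[OF l] algebra_simps)
qed

lemma geo_op_monotone:
  assumes "Ck_open (Suc k) U P" "q \<in> U"
  shows "norm x * norm x \<le> geo_op P q x \<bullet> x"
proof -
  have "geo_op P q x \<bullet> x = x \<bullet> x"
    by (simp add: geo_op_def inner_diff_left inner_add_left dird_adj_inner[OF assms] inner_commute[of "dird P x q"])
  then show ?thesis by (simp add: norm_eq_sqrt_inner)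
qed

lemma retraction_velocity:
  assumes R: "local_retraction k M P p r" and k: "k \<ge> 1" and t: "t \<in> S" "at t within S \<noteq> bot"
    and S: "\<And>y. y \<in> S \<Longrightarrow> \<gamma> y \<in> M \<and> \<gamma> y \<in> ball p r" and g: "(\<gamma> has_vector_derivative g) (at t within S)"
  shows "dird P g (\<gamma> t) = g"
proof -
  note P = local_retractionD[OF R]
  obtain l where l: "k = Suc l" using k by (metis Suc_le_D One_nat_def)
  have "((\<lambda>t. P (\<gamma> t)) has_vector_derivative dird P g (\<gamma> t)) (at t within S)"
    by (rule has_vector_derivative_dird[OF P(3)[unfolded l] _ g]) (use S t in auto)
  then have "(\<gamma> has_vector_derivative dird P g (\<gamma> t)) (at t within S)"
    by (rule has_vector_derivative_transform[OF t(1), rotated]) (use P(5) S in auto)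
  then show ?thesis using vector_derivative_unique_within[OF t(2)] g by blast
qed

lemma Lipschitz_velocity_le:
  assumes g: "(\<gamma> has_vector_derivative v) (at t within {a..b})" and t: "t \<in> {a..b}" "a < b"
    and L: "\<And>s. s \<in> {a..b} \<Longrightarrow> norm (\<gamma> s - \<gamma> t) \<le> c * \<bar>s - t\<bar>"
  shows "norm v \<le> (c::real)"
proof (rule field_le_epsilon)
  fix e :: real assume "e > 0"
  then obtain d where d: "d > 0" "\<And>y. y \<in> {a..b} \<Longrightarrow> norm (y - t) < d \<Longrightarrow> norm (\<gamma> y - \<gamma> t - (y - t) *\<^sub>R v) \<le> e * norm (y - t)"
    using g unfolding has_vector_derivative_def has_derivative_within_alt by blast
  have "\<exists>y\<in>{a..b}. y \<noteq> t \<and> norm (y - t) < d"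
  proof (cases "t < b")
    case True
    then show ?thesis using t d(1) by (intro bexI[of _ "min b (t + d/2)"]) auto
  next
    case False
    then show ?thesis using t d(1) by (intro bexI[of _ "max a (t - d/2)"]) auto
  qed
  then obtain y where y: "y \<in> {a..b}" "y \<noteq> t" "norm (y - t) < d" by blast
  have "norm ((y - t) *\<^sub>R v) \<le> norm (\<gamma> y - \<gamma> t) + norm (\<gamma> y - \<gamma> t - (y - t) *\<^sub>R v)"
    by (metis diff_add_cancel add.commute norm_triangle_ineq4 minus_diff_eq norm_minus_commute diff_diff_eq2 add_diff_cancel_left')
  also have "\<dots> \<le> c * \<bar>y - t\<bar> + e * \<bar>y - t\<bar>"
    using L[OF y(1)] d(2)[OF y(1,3)] by simp
  finally have "\<bar>y - t\<bar> * norm v \<le> c * \<bar>y - t\<bar> + e * \<bar>y - t\<bar>" unfolding norm_scaleR real_norm_def .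
  then have "\<bar>y - t\<bar> * norm v \<le> \<bar>y - t\<bar> * (c + e)" by (simp add: algebra_simps)
  then show "norm v \<le> c + e" using y(2) by simp
qed

lemma lip_min_Lipschitz_abs:
  assumes "lip_min M a b c \<gamma>" "s \<in> {a..b}" "t \<in> {a..b}"
  shows "norm (\<gamma> s - \<gamma> t) \<le> c * \<bar>s - t\<bar>"
  using lip_minD(3)[OF assms(1), of s t] lip_minD(3)[OF assms(1), of t s] assms(2,3)
  by (cases "s \<le> t") (auto simp: norm_minus_commute)

lemma at_within_Icc_nontrivial: "a < b \<Longrightarrow> t \<in> {a..b} \<Longrightarrow> at t within {a..b::real} \<noteq> bot"
  by (simp add: trivial_limit_within islimpt_Icc)

text \<open>The vanishing first variation yields, by du Bois-Reymond, differentiability of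
  \<open>w\<close>, the transposed derivative of P applied to the velocity, and not of the velocity
  \<open>g\<close> itself. But \<open>dird P (g t) (\<gamma> t) = g t\<close>, so \<open>g\<close>
  solves the linear system with operator \<open>geo_op\<close> and right side \<open>w\<close>, and
  such solutions inherit differentiability. The equations for the acceleration come from
  differentiating \<open>w\<close> and the tangency relation.\<close>

lemma lip_min_geodesic_closed:
  assumes R: "local_retraction k M P p r" and k: "k \<ge> 2" and m: "lip_min M a b c \<gamma>" and ab: "a < b"
    and ball: "\<And>t. t \<in> {a..b} \<Longrightarrow> \<gamma> t \<in> ball p r"
    and g: "\<And>t. t \<in> {a..b} \<Longrightarrow> (\<gamma> has_vector_derivative g t) (at t within {a..b})" and gc: "continuous_on {a..b} g"
  obtains g2 where "continuous_on {a..b} g2"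
    "\<And>t. t \<in> {a..b} \<Longrightarrow> (g has_vector_derivative g2 t) (at t within {a..b})"
    "\<And>t \<xi>. t \<in> {a..b} \<Longrightarrow> g2 t \<bullet> dird P \<xi> (\<gamma> t) = 0"
    "\<And>t. t \<in> {a..b} \<Longrightarrow> g2 t = dird P (g2 t) (\<gamma> t) + dird (dird P (g t)) (g t) (\<gamma> t)"
proof -
  note P = local_retractionD[OF R]
  have f: "Ck_open 2 (ball p r) P" using Ck_open_mono[OF P(3) k] .
  have f2: "Ck_open (Suc (Suc 0)) (ball p r) P" using f by (simp add: numeral_2_eq_2)
  have \<gamma>c: "continuous_on {a..b} \<gamma>" by (rule lip_min_continuous[OF m])
  note nt = at_within_Icc_nontrivial[OF ab]
  have vel: "dird P (g t) (\<gamma> t) = g t" if "t \<in> {a..b}" for t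
    by (rule retraction_velocity[OF R _ that nt[OF that] _ g[OF that]]) (use k ball lip_minD(2)[OF m] in auto)
  have gle: "norm (g t) \<le> c" if "t \<in> {a..b}" for t
    by (rule Lipschitz_velocity_le[OF g[OF that] that ab]) (rule lip_min_Lipschitz_abs[OF m _ that])
  \<comment> \<open>\<open>h\<close> and \<open>w\<close> represent, as inner products, the two
    linear terms of the first variation: the one in \<eta> and the one in its derivative.\<close>
  define h where "h t = (\<Sum>b\<in>Basis. (g t \<bullet> dird (dird P (g t)) b (\<gamma> t)) *\<^sub>R b)" for t
  define w where "w t = dird_adj P (\<gamma> t) (g t)" for t
  have h_inner: "h t \<bullet> y = g t \<bullet> dird (dird P (g t)) y (\<gamma> t)" if "t \<in> {a..b}" for t y
    unfolding h_def by (rule inner_sum_Basis_linear) (rule linear_dird[OF Ck_open_dird[OF f2] ball[OF that]])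
  have w_inner: "w t \<bullet> y = g t \<bullet> dird P y (\<gamma> t)" if "t \<in> {a..b}" for t y
    unfolding w_def by (rule dird_adj_inner[OF f2 ball[OF that]])
  have hc: "continuous_on {a..b} h"
    unfolding h_def[abs_def] by (intro continuous_intros continuous_on_dird_dird[OF open_ball f ball] gc \<gamma>c)
  have wc: "continuous_on {a..b} w"
    unfolding w_def[abs_def] dird_adj_def by (intro continuous_intros continuous_on_dird[OF f2 ball] gc \<gamma>c)
  have wd: "(w has_vector_derivative h t) (at t within {a..b})" if t: "t \<in> {a..b}" for t
  proof (rule du_Bois_Reymond[OF ab hc wc _ t])
    fix \<eta> e :: "real \<Rightarrow> 'a" assume \<eta>: "\<And>t. t \<in> {a..b} \<Longrightarrow> (\<eta> has_vector_derivative e t) (at t within {a..b})"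
      and e: "continuous_on {a..b} e" and \<eta>0: "\<eta> a = 0" "\<eta> b = 0"
    define E where "E s = integral {a..b} (\<lambda>t. (norm (dird P (g t + s *\<^sub>R e t) (\<gamma> t + s *\<^sub>R \<eta> t)))\<^sup>2)" for s
    define I where "I t = g t \<bullet> (dird (dird P (g t)) (\<eta> t) (\<gamma> t) + dird P (e t) (\<gamma> t))" for t
    note fv = first_variation[OF open_ball f ball g gc \<eta> e, folded E_def]
    obtain s0 where s0: "s0 > 0" "\<And>s t. \<bar>s\<bar> < s0 \<Longrightarrow> t \<in> {a..b} \<Longrightarrow> \<gamma> t + s *\<^sub>R \<eta> t \<in> ball p r"
      "\<And>s. \<bar>s\<bar> < s0 \<Longrightarrow> H1_curve a b (\<lambda>t. P (\<gamma> t + s *\<^sub>R \<eta> t)) (\<lambda>t. dird P (g t + s *\<^sub>R e t) (\<gamma> t + s *\<^sub>R \<eta> t))"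
      "(E has_real_derivative integral {a..b} (\<lambda>t. 2 * (dird P (g t) (\<gamma> t) \<bullet> (dird (dird P (g t)) (\<eta> t) (\<gamma> t) + dird P (e t) (\<gamma> t))))) (at 0)"
      by (rule fv) (assumption | rule that | assumption)+
    have "integral {a..b} (\<lambda>t. 2 * (dird P (g t) (\<gamma> t) \<bullet> (dird (dird P (g t)) (\<eta> t) (\<gamma> t) + dird P (e t) (\<gamma> t))))
        = integral {a..b} (\<lambda>t. 2 * I t)"
      by (rule Henstock_Kurzweil_Integration.integral_cong) (simp add: vel I_def)
    also have "\<dots> = 2 * integral {a..b} I" by simp
    finally have DE: "(E has_real_derivative 2 * integral {a..b} I) (at 0)" using s0(4) by simp
    have "E 0 = integral {a..b} (\<lambda>t. (norm (g t))\<^sup>2)"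
      unfolding E_def by (rule Henstock_Kurzweil_Integration.integral_cong) (simp add: vel)
    also have "\<dots> \<le> integral {a..b} (\<lambda>t. c\<^sup>2)"
      by (rule integral_le) (use gle in \<open>auto intro!: integrable_continuous_real continuous_intros gc power_mono\<close>)
    finally have E0: "E 0 \<le> c\<^sup>2 * (b - a)" using ab by (simp add: mult.commute)
    \<comment> \<open>Varied curves keep their end points and stay in M, so minimality of length
      bounds their energy from below. Together with the bound on \<open>E 0\<close> this makes 0 a
      local minimum of E.\<close>
    have Es: "c\<^sup>2 * (b - a) \<le> E s" if s: "\<bar>s\<bar> < s0" for s
    proof -
      have "lip_conn M (P (\<gamma> a + s *\<^sub>R \<eta> a)) (P (\<gamma> b + s *\<^sub>R \<eta> b)) (sqrt ((b - a) * E s))"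
        unfolding E_def by (rule lip_conn_energy[OF s0(3)[OF s]]) (use ab P(4) s0(2)[OF s] in auto)
      then have "lip_conn M (\<gamma> a) (\<gamma> b) (sqrt ((b - a) * E s))"
        using P(5) ball[of a] ball[of b] lip_minD(2)[OF m] ab by (simp add: \<eta>0)
      then have "c * (b - a) \<le> sqrt ((b - a) * E s)" using lip_minD(4)[OF m, of a b] ab by auto
      then have "(c * (b - a))\<^sup>2 \<le> (b - a) * E s"
        using lip_minD(1)[OF m] ab by (metis abs_of_nonneg diff_ge_0_iff_ge less_imp_le mult_nonneg_nonneg real_sqrt_abs real_sqrt_le_iff)
      then have "(b - a) * (c\<^sup>2 * (b - a)) \<le> (b - a) * E s" by (simp add: power2_eq_square mult_ac)
      then show ?thesis using ab by simp
    qed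
    have "2 * integral {a..b} I = 0"
      by (rule DERIV_local_min[OF DE s0(1)]) (use E0 Es in \<open>force intro: order_trans\<close>)
    then have "integral {a..b} I = 0" by simp
    moreover have "integral {a..b} (\<lambda>t. h t \<bullet> \<eta> t + w t \<bullet> e t) = integral {a..b} I"
      by (rule Henstock_Kurzweil_Integration.integral_cong) (simp add: h_inner w_inner I_def inner_add_right)
    ultimately show "integral {a..b} (\<lambda>t. h t \<bullet> \<eta> t + w t \<bullet> e t) = 0" by simp
  qed
  note lin = linear_geo_op[OF f2 ball] and mono = geo_op_monotone[OF f2 ball]
  have dird_d: "((\<lambda>t. dird P x (\<gamma> t)) has_vector_derivative dird (dird P x) (g t) (\<gamma> t)) (at t within {a..b})"
    if "t \<in> {a..b}" for x t
    by (rule has_vector_derivative_dird[OF Ck_open_dird[OF f2] ball[OF that] g[OF that]])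
  define A' where "A' x t = (\<Sum>b\<in>Basis. (x \<bullet> dird (dird P b) (g t) (\<gamma> t)) *\<^sub>R b) - dird (dird P x) (g t) (\<gamma> t)" for x t
  have Ad: "((\<lambda>t. geo_op P (\<gamma> t) x) has_vector_derivative A' x t) (at t within {a..b})" if t: "t \<in> {a..b}" for x t
  proof -
    have "((\<lambda>t. x + (\<Sum>b\<in>Basis. (x \<bullet> dird P b (\<gamma> t)) *\<^sub>R b) - dird P x (\<gamma> t)) has_vector_derivative
       0 + (\<Sum>b\<in>Basis. (x \<bullet> dird (dird P b) (g t) (\<gamma> t)) *\<^sub>R b) - dird (dird P x) (g t) (\<gamma> t)) (at t within {a..b})"
      by (intro has_vector_derivative_diff has_vector_derivative_add has_vector_derivative_sum
          has_vector_derivative_const dird_d[OF t]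
          bounded_linear.has_vector_derivative[OF bounded_linear_compose[OF bounded_linear_scaleR_left bounded_linear_inner_right]])
    then show ?thesis by (simp add: geo_op_def dird_adj_def A'_def)
  qed
  have geq: "geo_op P (\<gamma> t) (g t) = w t" if "t \<in> {a..b}" for t
    using vel[OF that] by (simp add: geo_op_def w_def)
  have "\<exists>u. geo_op P (\<gamma> t) u = h t - A' (g t) t" if "t \<in> {a..b}" for t
    using monotone_linear_surj[OF lin[OF that] mono[OF that]] by metis
  then obtain g2 where g2: "\<And>t. t \<in> {a..b} \<Longrightarrow> geo_op P (\<gamma> t) (g2 t) = h t - A' (g t) t" by metis
  have g2d: "(g has_vector_derivative g2 t) (at t within {a..b})" if t: "t \<in> {a..b}" for t
    by (rule monotone_linear_solution_derivative[where A = "\<lambda>t. geo_op P (\<gamma> t)" and w = w and A' = "\<lambda>x. A' x t", OF lin mono Ad[OF t] wd[OF t] geq t g2[OF t]])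
  have perp: "g2 t \<bullet> dird P \<xi> (\<gamma> t) = 0" if t: "t \<in> {a..b}" for t \<xi>
  proof -
    \<comment> \<open>The function \<open>w t \<bullet> \<xi>\<close> is differentiated in two ways.
      The terms with second derivatives of P cancel by symmetry, and what remains is orthogonality
      of the acceleration to the range of the derivative of P.\<close>
    have "((\<lambda>t. g t \<bullet> dird P \<xi> (\<gamma> t)) has_vector_derivative g t \<bullet> dird (dird P \<xi>) (g t) (\<gamma> t) + g2 t \<bullet> dird P \<xi> (\<gamma> t)) (at t within {a..b})"
      using has_derivative_inner[OF g2d[OF t, unfolded has_vector_derivative_def] dird_d[OF t, unfolded has_vector_derivative_def]]
      unfolding has_vector_derivative_def by (rule has_derivative_eq_rhs) (simp add: algebra_simps)
    moreover have "((\<lambda>t. w t \<bullet> \<xi>) has_vector_derivative h t \<bullet> \<xi>) (at t within {a..b})"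
      by (rule bounded_linear.has_vector_derivative[OF bounded_linear_inner_left wd[OF t]])
    then have "((\<lambda>t. g t \<bullet> dird P \<xi> (\<gamma> t)) has_vector_derivative h t \<bullet> \<xi>) (at t within {a..b})"
      by (rule has_vector_derivative_transform[OF t, rotated]) (simp add: w_inner)
    ultimately have "g t \<bullet> dird (dird P \<xi>) (g t) (\<gamma> t) + g2 t \<bullet> dird P \<xi> (\<gamma> t) = h t \<bullet> \<xi>"
      by (rule vector_derivative_unique_within[OF nt[OF t]])
    moreover have "dird (dird P \<xi>) (g t) (\<gamma> t) = dird (dird P (g t)) \<xi> (\<gamma> t)"
      by (rule dird_dird_commute[OF open_ball f ball[OF t]])
    ultimately show ?thesis using h_inner[OF t] by simp
  qed
  have eq: "g2 t = dird P (g2 t) (\<gamma> t) + dird (dird P (g t)) (g t) (\<gamma> t)" if t: "t \<in> {a..b}" for t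
  proof -
    have "((\<lambda>t. dird P (g t) (\<gamma> t)) has_vector_derivative dird (dird P (g t)) (g t) (\<gamma> t) + dird P (g2 t) (\<gamma> t)) (at t within {a..b})"
      by (rule has_vector_derivative_dird_dird[OF open_ball f ball[OF t] ball t g[OF t] g2d[OF t]])
    then have "(g has_vector_derivative dird (dird P (g t)) (g t) (\<gamma> t) + dird P (g2 t) (\<gamma> t)) (at t within {a..b})"
      by (rule has_vector_derivative_transform[OF t, rotated]) (simp add: vel)
    from vector_derivative_unique_within[OF nt[OF t] g2d[OF t] this] show ?thesis
      by (rule trans) (rule add.commute)
  qed
  have "continuous_on {a..b} g2"
  proof (rule monotone_linear_solution_continuous[where A = "\<lambda>t. geo_op P (\<gamma> t)" and S = "{a..b}", OF lin mono])
    show "continuous_on {a..b} (\<lambda>t. geo_op P (\<gamma> t) x)" for x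
      using Ad by (rule continuous_on_has_vector_derivative)
    show "continuous_on {a..b} (\<lambda>t. h t - A' (g t) t)"
      unfolding A'_def by (intro continuous_intros hc continuous_on_dird_dird[OF open_ball f ball] gc \<gamma>c)
  qed (use g2 in auto)
  then show ?thesis by (rule that[OF _ g2d perp eq])
qed

section \<open>Bounded acceleration, and extension of velocity and acceleration to the ends of the
  interval\<close>

lemma geodesic_equation_norm_le:
  assumes "u = Q + y" "u \<bullet> Q = 0"
  shows "norm (u::'a::real_inner) \<le> norm y"
proof (cases "u = 0")
  case False
  have "norm u * norm u = u \<bullet> u" by (simp add: norm_eq_sqrt_inner)
  also have "\<dots> = u \<bullet> y" using assms by (metis add.left_neutral inner_add_right)
  also have "\<dots> \<le> norm u * norm y" using Cauchy_Schwarz_ineq2[of u y] by linarith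
  finally show ?thesis using False by simp
qed simp

text \<open>The bound on the acceleration refers to a retraction around a prescribed p instead of
  one around \<open>\<gamma> t\<close>. It is therefore uniform when t approaches an end of the
  interval and p is the end point.\<close>

lemma lip_min_interior:
  assumes m: "lip_min M a b c \<gamma>" and R: "locally_retractable k M" and k: "k \<ge> 2"
    and t: "t \<in> {a<..<b}" and PR: "local_retraction k M P p r" "\<gamma> t \<in> ball p r"
  defines "v \<equiv> \<lambda>t. vector_derivative \<gamma> (at t)"
  obtains u where "(v has_vector_derivative u) (at t)" "u \<bullet> dird P (v t) (\<gamma> t) = 0"
    "norm u \<le> norm (dird (dird P (v t)) (v t) (\<gamma> t))"
proof -
  have cont: "continuous_on {a..b} \<gamma>" by (rule lip_min_continuous[OF m])
  have "open ({a<..<b} \<inter> \<gamma> -` ball p r)"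
    by (rule continuous_open_preimage[OF continuous_on_subset[OF cont]]) auto
  moreover have "t \<in> {a<..<b} \<inter> \<gamma> -` ball p r" using t PR by simp
  ultimately obtain e where e: "e > 0" "ball t e \<subseteq> {a<..<b} \<inter> \<gamma> -` ball p r"
    by (rule openE)
  define a' b' where "a' = t - e/2" and "b' = t + e/2"
  have ab: "{a'..b'} \<subseteq> ball t e" "t \<in> {a'<..<b'}" "a' < b'" using e(1) by (auto simp: a'_def b'_def dist_real_def)
  have in_b: "s \<in> {a<..<b}" "\<gamma> s \<in> ball p r" if "s \<in> {a'..b'}" for s
    using subsetD[OF e(2) subsetD[OF ab(1) that]] by auto
  have m': "lip_min M a' b' c \<gamma>"
    by (rule lip_min_subinterval[OF m]) (use in_b[of a'] in_b[of b'] ab(3) in auto)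
  note C1 = lip_min_C1[OF m R k]
  have vd: "(\<gamma> has_vector_derivative v s) (at s within {a'..b'})" if "s \<in> {a'..b'}" for s
    unfolding v_def by (rule has_vector_derivative_at_within[OF C1(1)[OF in_b(1)[OF that]]])
  have vc: "continuous_on {a'..b'} v"
    unfolding v_def by (rule continuous_at_imp_continuous_on) (intro ballI C1(2) in_b(1))
  obtain g2 where "continuous_on {a'..b'} g2" and g2: "\<And>s. s \<in> {a'..b'} \<Longrightarrow> (v has_vector_derivative g2 s) (at s within {a'..b'})"
    "\<And>s \<xi>. s \<in> {a'..b'} \<Longrightarrow> g2 s \<bullet> dird P \<xi> (\<gamma> s) = 0"
    "\<And>s. s \<in> {a'..b'} \<Longrightarrow> g2 s = dird P (g2 s) (\<gamma> s) + dird (dird P (v s)) (v s) (\<gamma> s)"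
    by (rule lip_min_geodesic_closed[OF PR(1) k m' ab(3) in_b(2) vd vc]) (assumption | rule that)+
  have t': "t \<in> {a'..b'}" using ab by auto
  have "(v has_vector_derivative g2 t) (at t)"
    using g2(1)[OF t'] at_within_Icc_at[of a' t b'] ab(2) by simp
  then show ?thesis
    using that[of "g2 t"] g2(2)[OF t'] geodesic_equation_norm_le[OF g2(3)[OF t'] g2(2)[OF t']] by blast
qed

text \<open>Near t0 the acceleration is bounded, so the velocity is Lipschitz on the adjacent open
  interval and extends continuously to t0, also when t0 is an end.\<close>

lemma lip_min_velocity_limit:
  assumes m: "lip_min M a b c \<gamma>" and R: "locally_retractable k M" and k: "k \<ge> 2"
    and ab: "a < b" and t0: "t0 \<in> {a..b}"
  obtains l where "((\<lambda>t. vector_derivative \<gamma> (at t)) \<longlongrightarrow> l) (at t0 within {a<..<b})"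
proof -
  define v where "v = (\<lambda>t. vector_derivative \<gamma> (at t))"
  have cont: "continuous_on {a..b} \<gamma>" by (rule lip_min_continuous[OF m])
  obtain P r where PR: "local_retraction k M P (\<gamma> t0) r" by (rule locally_retractableD[OF R lip_minD(2)[OF m t0]])
  note P = local_retractionD[OF PR]
  have f: "Ck_open 2 (ball (\<gamma> t0) r) P" using Ck_open_mono[OF P(3) k] .
  have rr: "cball (\<gamma> t0) (r/2) \<subseteq> ball (\<gamma> t0) r" using P(1) by auto
  obtain C where C: "C \<ge> 0" "\<And>x v w. x \<in> ball (\<gamma> t0) (r/2) \<Longrightarrow> norm (dird (dird P v) w x) \<le> C * norm v * norm w"
    using dird_bounds[OF f rr] by metis
  obtain d where d: "d > 0" "\<And>t. t \<in> {a..b} \<Longrightarrow> dist t t0 < d \<Longrightarrow> dist (\<gamma> t) (\<gamma> t0) < r/2"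
    using cont[unfolded continuous_on_iff, rule_format, OF t0, of "r/2"] P(1) by auto
  define X where "X = {max a (t0 - d)<..<min b (t0 + d)}"
  have X: "t \<in> {a<..<b}" "\<gamma> t \<in> ball (\<gamma> t0) (r/2)" if "t \<in> X" for t
    using that d(2)[of t] by (auto simp: X_def dist_real_def dist_commute)
  have X3: "\<gamma> t \<in> ball (\<gamma> t0) r" if "t \<in> X" for t
    using X(2)[OF that] P(1) subset_ball[of "r/2" r "\<gamma> t0"] by auto
  have vle: "norm (v t) \<le> c" if "t \<in> X" for t
  proof (rule Lipschitz_velocity_le[where a = a and b = b])
    show "(\<gamma> has_vector_derivative v t) (at t within {a..b})"
      unfolding v_def by (rule has_vector_derivative_at_within[OF lip_min_C1(1)[OF m R k X(1)[OF that]]])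
  qed (use X(1)[OF that] in \<open>auto intro!: lip_min_Lipschitz_abs[OF m]\<close>)
  have "\<exists>u. (v has_vector_derivative u) (at t) \<and> norm u \<le> C * c * c" if t: "t \<in> X" for t
  proof -
    obtain u where u: "(v has_vector_derivative u) (at t)" "norm u \<le> norm (dird (dird P (v t)) (v t) (\<gamma> t))"
      using lip_min_interior[OF m R k X(1)[OF t] PR X3[OF t]] unfolding v_def by metis
    have "norm (dird (dird P (v t)) (v t) (\<gamma> t)) \<le> C * norm (v t) * norm (v t)"
      by (rule C(2)[OF X(2)[OF t]])
    also have "\<dots> \<le> C * c * c" using vle[OF t] C(1) lip_minD(1)[OF m] by (intro mult_mono) auto
    finally show ?thesis using u by force
  qed
  then obtain u where u: "\<And>t. t \<in> X \<Longrightarrow> (v has_vector_derivative u t) (at t)" "\<And>t. t \<in> X \<Longrightarrow> norm (u t) \<le> C * c * c"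
    by metis
  have lip: "norm (v x - v y) \<le> (C * c * c) * norm (x - y)" if "x \<in> X" "y \<in> X" for x y
  proof (rule differentiable_bound[OF _ _ _ that])
    show "convex X" by (simp add: X_def)
    show "(v has_derivative (\<lambda>s. s *\<^sub>R u t)) (at t within X)" if "t \<in> X" for t
      using has_vector_derivative_at_within[OF u(1)[OF that]] by (simp add: has_vector_derivative_def)
    show "onorm (\<lambda>s. s *\<^sub>R u t) \<le> C * c * c" if "t \<in> X" for t
    proof (intro onorm_le)
      fix s :: real
      show "norm (s *\<^sub>R u t) \<le> C * c * c * norm s"
        using mult_right_mono[OF u(2)[OF that], of "norm s"] by (simp add: mult.commute)
    qed
  qed
  have "(C * c * c)-lipschitz_on X v"
    using lip C lip_minD(1)[OF m] by (intro lipschitz_onI) (auto simp: dist_norm)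
  then have uc: "uniformly_continuous_on X v" by (rule lipschitz_on_uniformly_continuous)
  have ne: "max a (t0 - d) < min b (t0 + d)" using ab t0 d(1) by auto
  have "t0 \<in> closure X" unfolding X_def closure_greaterThanLessThan[OF ne] using t0 d(1) by auto
  then obtain l where "(v \<longlongrightarrow> l) (at t0 within X)"
    using uniformly_continuous_on_extension_at_closure[OF uc] by blast
  moreover have "at t0 within X = at t0 within {a<..<b}"
    by (rule at_within_nhd[of t0 "ball t0 d"]) (use d(1) in \<open>auto simp: X_def dist_real_def\<close>)
  ultimately show ?thesis using that unfolding v_def by metis
qed

lemma at_within_Ioo:
  assumes "a < (b::real)"
  shows "at a within {a<..<b} = at_right a" "at b within {a<..<b} = at_left b"
  using assms by (auto intro!: at_within_nhd[of a "{..<b}"] at_within_nhd[of b "{a<..}"])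

lemma continuous_on_Icc_has_vector_derivative_interior:
  fixes \<gamma> :: "real \<Rightarrow> 'a::euclidean_space"
  assumes "continuous_on {a..b} \<gamma>" "continuous_on {a..b} g"
    and "\<And>t. t \<in> {a<..<b} \<Longrightarrow> (\<gamma> has_vector_derivative g t) (at t)" and t: "t \<in> {a..b}"
  shows "(\<gamma> has_vector_derivative g t) (at t within {a..b})"
proof -
  have eq: "\<gamma> s = \<gamma> a + integral {a..s} g" if "s \<in> {a..b}" for s
  proof -
    have "(g has_integral \<gamma> s - \<gamma> a) {a..s}"
      by (rule fundamental_theorem_of_calculus_interior)
        (use that assms in \<open>auto intro: continuous_on_subset\<close>)
    then show ?thesis by (simp add: integral_unique)
  qed
  have "((\<lambda>s. \<gamma> a + integral {a..s} g) has_vector_derivative g t) (at t within {a..b})"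
    using integral_has_vector_derivative[OF assms(2) t] has_vector_derivative_add[OF has_vector_derivative_const[of "\<gamma> a"]]
    by fastforce
  then show ?thesis by (rule has_vector_derivative_transform[OF t eq, rotated])
qed

text \<open>The first two derivatives are named and taken one-sided at the ends: the boundary terms
  of the first variation and the one-sided velocities at design points are end values of
  \<open>g\<close>.\<close>

definition geodesic_data :: "'a::euclidean_space set \<Rightarrow> real \<Rightarrow> real \<Rightarrow> (real \<Rightarrow> 'a) \<Rightarrow> (real \<Rightarrow> 'a) \<Rightarrow> (real \<Rightarrow> 'a) \<Rightarrow> bool" where
  "geodesic_data M a b \<gamma> g g2 \<longleftrightarrow> continuous_on {a..b} g \<and> continuous_on {a..b} g2 \<and>
     (\<forall>t\<in>{a..b}. \<gamma> t \<in> M \<and> (\<gamma> has_vector_derivative g t) (at t within {a..b}) \<and>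
       (g has_vector_derivative g2 t) (at t within {a..b}) \<and> (\<forall>w\<in>tangent_space M (\<gamma> t). g2 t \<bullet> w = 0))"

lemma geodesic_dataD:
  assumes "geodesic_data M a b \<gamma> g g2"
  shows "continuous_on {a..b} g" "continuous_on {a..b} g2"
    "\<And>t. t \<in> {a..b} \<Longrightarrow> \<gamma> t \<in> M"
    "\<And>t. t \<in> {a..b} \<Longrightarrow> (\<gamma> has_vector_derivative g t) (at t within {a..b})"
    "\<And>t. t \<in> {a..b} \<Longrightarrow> (g has_vector_derivative g2 t) (at t within {a..b})"
    "\<And>t w. t \<in> {a..b} \<Longrightarrow> w \<in> tangent_space M (\<gamma> t) \<Longrightarrow> g2 t \<bullet> w = 0"
  using assms unfolding geodesic_data_def by blast+

text \<open>At an end of the interval the curve itself is no witness, since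
  \<open>tangent_space\<close> asks for a curve on both sides of 0. The one-sided derivative is
  fixed by the derivative of the retraction, and this characterizes tangent vectors.\<close>

lemma velocity_in_tangent_space:
  assumes R: "locally_retractable k M" and k: "k \<ge> 1" and ab: "a < b" and t: "t \<in> {a..b}"
    and M: "\<And>t. t \<in> {a..b} \<Longrightarrow> \<gamma> t \<in> M" and \<gamma>: "continuous_on {a..b} \<gamma>"
    and g: "(\<gamma> has_vector_derivative g) (at t within {a..b})"
  shows "g \<in> tangent_space M (\<gamma> t)"
proof -
  obtain P r where PR: "local_retraction k M P (\<gamma> t) r" by (rule locally_retractableD[OF R M[OF t]])
  note P = local_retractionD[OF PR]
  obtain d where d: "d > 0" "\<And>s. s \<in> {a..b} \<Longrightarrow> dist s t < d \<Longrightarrow> dist (\<gamma> s) (\<gamma> t) < r"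
    using \<gamma>[unfolded continuous_on_iff, rule_format, OF t P(1)] by auto
  define a' b' where "a' = max a (t - d/2)" and "b' = min b (t + d/2)"
  have ab': "a' < b'" "t \<in> {a'..b'}" "{a'..b'} \<subseteq> {a..b}" using ab t d(1) by (auto simp: a'_def b'_def)
  have bl: "\<gamma> s \<in> M \<and> \<gamma> s \<in> ball (\<gamma> t) r" if "s \<in> {a'..b'}" for s
  proof -
    have "s \<in> {a..b}" "dist s t < d" using that d(1) by (auto simp: a'_def b'_def dist_real_def)
    then show ?thesis using d(2)[of s] M[of s] by (simp add: dist_commute)
  qed
  have "dird P g (\<gamma> t) = g"
    by (rule retraction_velocity[OF PR k ab'(2) at_within_Icc_nontrivial[OF ab'(1,2)] bl
        has_vector_derivative_within_subset[OF g ab'(3)]])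
  then show ?thesis using tangent_space_retraction(1)[OF PR k P(2)] P(1) by simp
qed

lemma lip_min_geodesic_data:
  assumes m: "lip_min M a b c \<gamma>" and R: "locally_retractable k M" and k: "k \<ge> 2" and ab: "a < b"
  obtains g g2 where "geodesic_data M a b \<gamma> g g2" "\<And>t. t \<in> {a<..<b} \<Longrightarrow> vector_derivative \<gamma> (at t) = g t"
proof -
  have cont: "continuous_on {a..b} \<gamma>" by (rule lip_min_continuous[OF m])
  define v where "v = (\<lambda>t. vector_derivative \<gamma> (at t))"
  obtain la where la: "(v \<longlongrightarrow> la) (at a within {a<..<b})"
    using lip_min_velocity_limit[OF m R k ab, of a] ab unfolding v_def by auto
  obtain lb where lb: "(v \<longlongrightarrow> lb) (at b within {a<..<b})"
    using lip_min_velocity_limit[OF m R k ab, of b] ab unfolding v_def by auto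
  \<comment> \<open>At the ends the interior limits are taken;
    \<open>vector_derivative \<gamma> (at a)\<close> would depend on values of \<gamma> outside the
    interval.\<close>
  define g where "g t = (if t = a then la else if t = b then lb else v t)" for t
  have gv: "g t = v t" if "t \<in> {a<..<b}" for t using that by (simp add: g_def)
  have vg: "(v \<longlongrightarrow> l) (at t within {a<..<b}) \<longleftrightarrow> (g \<longlongrightarrow> l) (at t within {a<..<b})" for l t
    by (rule filterlim_cong[OF refl refl]) (use gv in \<open>auto simp: eventually_at_filter\<close>)
  have gc: "continuous_on {a..b} g"
  proof (rule continuous_on_IccI[OF _ _ _ ab])
    show "(g \<longlongrightarrow> g a) (at_right a)"
      using la vg[of la a] at_within_Ioo(1)[OF ab] by (simp add: g_def[of a])
    show "(g \<longlongrightarrow> g b) (at_left b)"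
      using lb vg[of lb b] at_within_Ioo(2)[OF ab] ab by (simp add: g_def[of b])
    fix t assume "a < t" "t < b"
    then have t: "t \<in> {a<..<b}" by simp
    have "(v \<longlongrightarrow> v t) (at t)"
      using lip_min_C1(2)[OF m R k t] by (simp add: v_def isCont_def)
    then have "(v \<longlongrightarrow> v t) (at t within {a<..<b})" by (rule tendsto_within_subset) simp
    then have "(g \<longlongrightarrow> v t) (at t within {a<..<b})" by (rule vg[THEN iffD1])
    then show "(g \<longlongrightarrow> g t) (at t)"
      unfolding at_within_open[OF t open_greaterThanLessThan] gv[OF t] .
  qed
  have gd: "(\<gamma> has_vector_derivative g t) (at t within {a..b})" if "t \<in> {a..b}" for t
    by (rule continuous_on_Icc_has_vector_derivative_interior[OF cont gc _ that])
      (use lip_min_C1(1)[OF m R k] gv in \<open>simp add: v_def\<close>)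
  \<comment> \<open>The acceleration is obtained on a short interval around each t, on which one
    retraction covers the curve. The radius of the neighbourhood is recorded so that different local
    choices can be compared.\<close>
  have "\<exists>a' b' g2. t \<in> {a'..b'} \<and> at t within {a'..b'} = at t within {a..b} \<and> continuous_on {a'..b'} g2 \<and> a' < b' \<and>
      {a'..b'} \<subseteq> {a..b} \<and> (\<exists>\<delta>>0. {a..b} \<inter> ball t \<delta> \<subseteq> {a'..b'} \<and>
      (\<forall>s\<in>{a..b} \<inter> ball t \<delta>. (g has_vector_derivative g2 s) (at s within {a..b}))) \<and>
      (\<forall>w\<in>tangent_space M (\<gamma> t). g2 t \<bullet> w = 0)" if t: "t \<in> {a..b}" for t
  proof -
    obtain P r where PR: "local_retraction k M P (\<gamma> t) r" by (rule locally_retractableD[OF R lip_minD(2)[OF m t]])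
    note P = local_retractionD[OF PR]
    obtain d where d: "d > 0" "\<And>s. s \<in> {a..b} \<Longrightarrow> dist s t < d \<Longrightarrow> dist (\<gamma> s) (\<gamma> t) < r"
      using cont[unfolded continuous_on_iff, rule_format, OF t P(1)] by auto
    define a' b' where "a' = max a (t - d/2)" and "b' = min b (t + d/2)"
    have ab': "a' < b'" "t \<in> {a'..b'}" "{a'..b'} \<subseteq> {a..b}" using ab t d(1) by (auto simp: a'_def b'_def)
    have bl: "\<gamma> s \<in> ball (\<gamma> t) r" if "s \<in> {a'..b'}" for s
    proof -
      have "s \<in> {a..b}" "dist s t < d" using that d(1) by (auto simp: a'_def b'_def dist_real_def)
      then show ?thesis using d(2)[of s] by (simp add: dist_commute)
    qed
    have m': "lip_min M a' b' c \<gamma>" by (rule lip_min_subinterval[OF m]) (auto simp: a'_def b'_def)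
    have gd': "(\<gamma> has_vector_derivative g s) (at s within {a'..b'})" if "s \<in> {a'..b'}" for s
      by (rule has_vector_derivative_within_subset[OF gd ab'(3)]) (use that ab'(3) in blast)
    have gc': "continuous_on {a'..b'} g" by (rule continuous_on_subset[OF gc ab'(3)])
    obtain g2 where g2: "continuous_on {a'..b'} g2"
      "\<And>t. t \<in> {a'..b'} \<Longrightarrow> (g has_vector_derivative g2 t) (at t within {a'..b'})"
      "\<And>t \<xi>. t \<in> {a'..b'} \<Longrightarrow> g2 t \<bullet> dird P \<xi> (\<gamma> t) = 0"
      "\<And>t. t \<in> {a'..b'} \<Longrightarrow> g2 t = dird P (g2 t) (\<gamma> t) + dird (dird P (g t)) (g t) (\<gamma> t)"
      by (rule lip_min_geodesic_closed[OF PR k m' ab'(1) bl gd' gc']) (assumption | rule that)+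
    have inb: "t - d/2 \<le> x \<and> x \<le> t + d/2" if "x \<in> ball t (d/2)" for x
      using that unfolding mem_ball dist_real_def by linarith
    have wi: "at s within {a'..b'} = at s within {a..b}" if "s \<in> ball t (d/2)" for s
    proof (rule at_within_nhd[of s "ball t (d/2)"])
      show "{a'..b'} \<inter> ball t (d/2) - {s} = {a..b} \<inter> ball t (d/2) - {s}"
        using inb ab'(3) by (auto simp: a'_def b'_def simp del: mem_ball)
    qed (use that in auto)
    have sub: "{a..b} \<inter> ball t (d/2) \<subseteq> {a'..b'}" using inb by (auto simp: a'_def b'_def simp del: mem_ball)
    have perp: "g2 t \<bullet> w = 0" if "w \<in> tangent_space M (\<gamma> t)" for w
    proof -
      have "dird P w (\<gamma> t) = w"
        using that tangent_space_retraction(1)[OF PR _ P(2)] P(1) k by simp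
      then show ?thesis using g2(3)[OF ab'(2), of w] by simp
    qed
    have der: "(g has_vector_derivative g2 s) (at s within {a..b})" if "s \<in> {a..b} \<inter> ball t (d/2)" for s
      using g2(2)[of s] wi[of s] that sub by auto
    show ?thesis
      using ab' wi[of t] g2(1) sub perp der d(1)
      by (intro exI[of _ a'] exI[of _ b'] exI[of _ g2] conjI exI[of _ "d/2"] ballI) auto
  qed
  then obtain A B G where loc: "\<And>t. t \<in> {a..b} \<Longrightarrow> t \<in> {A t..B t} \<and> at t within {A t..B t} = at t within {a..b} \<and>
      continuous_on {A t..B t} (G t) \<and> A t < B t \<and> {A t..B t} \<subseteq> {a..b} \<and> (\<exists>\<delta>>0. {a..b} \<inter> ball t \<delta> \<subseteq> {A t..B t} \<and>
      (\<forall>s\<in>{a..b} \<inter> ball t \<delta>. (g has_vector_derivative G t s) (at s within {a..b}))) \<and>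
      (\<forall>w\<in>tangent_space M (\<gamma> t). G t t \<bullet> w = 0)"
    by metis
  \<comment> \<open>On overlaps the local choices agree, being derivatives of the same
    \<open>g\<close>, so the diagonal inherits their continuity.\<close>
  define g2 where "g2 t = G t t" for t
  have d2: "(g has_vector_derivative g2 t) (at t within {a..b})" if "t \<in> {a..b}" for t
    using loc[OF that] that by (auto simp: g2_def)
  have "continuous_on {a..b} g2"
    unfolding continuous_on_eq_continuous_within
  proof
    fix t assume t: "t \<in> {a..b}"
    obtain \<delta> where \<delta>: "\<delta> > 0" "{a..b} \<inter> ball t \<delta> \<subseteq> {A t..B t}"
      "\<And>s. s \<in> {a..b} \<inter> ball t \<delta> \<Longrightarrow> (g has_vector_derivative G t s) (at s within {a..b})"
      using loc[OF t] by blast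
    have eq: "G t s = g2 s" if "s \<in> {a..b} \<inter> ball t \<delta>" for s
      using vector_derivative_unique_within[OF at_within_Icc_nontrivial[OF ab] \<delta>(3)[OF that] d2] that by auto
    have "continuous (at t within {A t..B t}) (G t)"
      using loc[OF t] unfolding continuous_on_eq_continuous_within by blast
    moreover have "at t within {A t..B t} = at t within {a..b}" using loc[OF t] by blast
    ultimately have "continuous (at t within {a..b}) (G t)" by (simp only:)
    then show "continuous (at t within {a..b}) g2"
      by (rule continuous_transform_within[OF _ \<delta>(1) t]) (use eq in \<open>auto simp: dist_commute\<close>)
  qed
  then have "geodesic_data M a b \<gamma> g g2"
    unfolding geodesic_data_def using gc gd d2 loc lip_minD(2)[OF m] by (simp add: g2_def)
  then show ?thesis using that gv by (simp add: v_def)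
qed

lemma geodesic_data_constant_speed:
  assumes G: "geodesic_data M a b \<gamma> g g2" and R: "locally_retractable k M" and k: "k \<ge> 1" and ab: "a < b"
    and t: "t \<in> {a..b}"
  shows "norm (g t) = norm (g a)"
proof -
  note D = geodesic_dataD[OF G]
  have \<gamma>c: "continuous_on {a..b} \<gamma>" using D(4) by (rule continuous_on_has_vector_derivative)
  have "\<exists>c. \<forall>t\<in>{a..b}. g t \<bullet> g t = c"
  proof (rule has_derivative_zero_constant)
    show "((\<lambda>t. g t \<bullet> g t) has_derivative (\<lambda>h. 0)) (at t within {a..b})" if "t \<in> {a..b}" for t
    proof -
      have "g t \<in> tangent_space M (\<gamma> t)"
        by (rule velocity_in_tangent_space[OF R k ab that D(3) \<gamma>c D(4)[OF that]])
      then have "g2 t \<bullet> g t = 0" using D(6)[OF that] by blast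
      then show ?thesis
        using has_derivative_inner[OF D(5)[OF that, unfolded has_vector_derivative_def] D(5)[OF that, unfolded has_vector_derivative_def]]
        by (simp add: inner_commute)
    qed
  qed simp
  then show ?thesis using t ab unfolding norm_eq_sqrt_inner by fastforce
qed

lemma lip_min_speed:
  assumes m: "lip_min M a b c \<gamma>" and G: "geodesic_data M a b \<gamma> g g2" and R: "locally_retractable k M"
    and k: "k \<ge> 1" and ab: "a < b" and t: "t \<in> {a..b}"
  shows "norm (g t) = c"
proof -
  note D = geodesic_dataD[OF G]
  have H: "H1_curve a b \<gamma> g" by (rule H1_curve_continuous_derivative[OF D(4,1)])
  have "lip_conn M (\<gamma> a) (\<gamma> b) (integral {a..b} (\<lambda>t. norm (g t)))"
    by (rule lip_conn_H1_curve[OF H _ D(3)]) (use ab in auto)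
  also have "integral {a..b} (\<lambda>t. norm (g t)) = integral {a..b} (\<lambda>t. norm (g a))"
    by (rule Henstock_Kurzweil_Integration.integral_cong) (rule geodesic_data_constant_speed[OF G R k ab])
  finally have "c * (b - a) \<le> (b - a) * norm (g a)"
    using lip_minD(4)[OF m, of a b] ab by auto
  then have "c \<le> norm (g a)" using ab by (simp add: mult.commute)
  moreover have "norm (g a) \<le> c"
    by (rule Lipschitz_velocity_le[OF D(4) _ ab lip_min_Lipschitz_abs[OF m]]) (use ab in auto)
  ultimately show ?thesis using geodesic_data_constant_speed[OF G R k ab t] by simp
qed

section \<open>Geodesics as curves of class C^k\<close>

text \<open>\<open>Ck_on\<close> on a closed interval asks for an extension to an open set. The
  second derivative is continued by its end values and integrated twice.\<close>

lemma Ck_on_Icc_extension: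
  fixes \<gamma> :: "real \<Rightarrow> 'a::euclidean_space"
  assumes ab: "a \<le> b" and \<gamma>: "\<And>t. t \<in> {a..b} \<Longrightarrow> (\<gamma> has_vector_derivative g t) (at t within {a..b})"
    and g: "\<And>t. t \<in> {a..b} \<Longrightarrow> (g has_vector_derivative g2 t) (at t within {a..b})"
    and g2: "continuous_on {a..b} g2"
  shows "Ck_on 2 {a..b} \<gamma>"
proof -
  define e2 where "e2 t = g2 (max a (min b t))" for t
  have e2: "continuous_on {a-1..b+1} e2"
    unfolding e2_def[abs_def] by (intro continuous_on_compose2[OF g2] continuous_intros) (use ab in auto)
  obtain e1' where e1': "\<And>t. t \<in> {a-1..b+1} \<Longrightarrow> (e1' has_vector_derivative e2 t) (at t within {a-1..b+1})"
    using antiderivative_continuous[OF e2] by blast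
  define e1 where "e1 t = e1' t + (g a - e1' a)" for t
  have e1: "(e1 has_vector_derivative e2 t) (at t within {a-1..b+1})" if "t \<in> {a-1..b+1}" for t
    unfolding e1_def[abs_def] using e1'[OF that] by (simp add: has_vector_derivative_add_const)
  have e1c: "continuous_on {a-1..b+1} e1" using e1 by (rule continuous_on_has_vector_derivative)
  obtain e0' where e0': "\<And>t. t \<in> {a-1..b+1} \<Longrightarrow> (e0' has_vector_derivative e1 t) (at t within {a-1..b+1})"
    using antiderivative_continuous[OF e1c] by blast
  define e0 where "e0 t = e0' t + (\<gamma> a - e0' a)" for t
  have e0: "(e0 has_vector_derivative e1 t) (at t within {a-1..b+1})" if "t \<in> {a-1..b+1}" for t
    unfolding e0_def[abs_def] using e0'[OF that] by (simp add: has_vector_derivative_add_const)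
  have sub: "{a..b} \<subseteq> {a-1..b+1}" by auto
  have eq1: "e1 t = g t" if t: "t \<in> {a..b}" for t
  proof -
    have "(g2 has_integral g t - g a) {a..t}" "(g2 has_integral e1 t - e1 a) {a..t}"
    proof -
      show "(g2 has_integral g t - g a) {a..t}"
        by (rule fundamental_theorem_of_calculus) (use t in \<open>auto intro!: has_vector_derivative_within_subset[OF g]\<close>)
      have "(e2 has_integral e1 t - e1 a) {a..t}"
        by (rule fundamental_theorem_of_calculus) (use t in \<open>auto intro!: has_vector_derivative_within_subset[OF e1]\<close>)
      then show "(g2 has_integral e1 t - e1 a) {a..t}"
        by (rule has_integral_eq[rotated]) (use t in \<open>simp add: e2_def max_absorb2 min_absorb2\<close>)
    qed
    then have "g t - g a = e1 t - e1 a" by (rule has_integral_unique)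
    moreover have "e1 a = g a" by (simp add: e1_def)
    ultimately show ?thesis by simp
  qed
  have eq0: "e0 t = \<gamma> t" if t: "t \<in> {a..b}" for t
  proof -
    have "(g has_integral \<gamma> t - \<gamma> a) {a..t}" "(g has_integral e0 t - e0 a) {a..t}"
    proof -
      show "(g has_integral \<gamma> t - \<gamma> a) {a..t}"
        by (rule fundamental_theorem_of_calculus) (use t in \<open>auto intro!: has_vector_derivative_within_subset[OF \<gamma>]\<close>)
      have "(e1 has_integral e0 t - e0 a) {a..t}"
        by (rule fundamental_theorem_of_calculus) (use t in \<open>auto intro!: has_vector_derivative_within_subset[OF e0]\<close>)
      then show "(g has_integral e0 t - e0 a) {a..t}"
        by (rule has_integral_eq[rotated]) (use t in \<open>auto simp: eq1\<close>)
    qed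
    then have "\<gamma> t - \<gamma> a = e0 t - e0 a" by (rule has_integral_unique)
    moreover have "e0 a = \<gamma> a" by (simp add: e0_def)
    ultimately show ?thesis by simp
  qed
  let ?U = "{a-1<..<b+1}"
  have wi: "(f has_vector_derivative f') (at t within {a-1..b+1}) \<Longrightarrow> (f has_vector_derivative f') (at t)" if "t \<in> ?U" for f and f' :: 'a and t
    using that at_within_Icc_at[of "a-1" t "b+1"] by simp
  have "Ck_open 0 ?U e2" using continuous_on_subset[OF e2] by (simp add: greaterThanLessThan_subseteq_atLeastAtMost_iff)
  then have "Ck_open (Suc 0) ?U e1"
    by (rule Ck_open_vector_derivativeI[rotated 2]) (use wi e1 in auto)
  then have "Ck_open (Suc (Suc 0)) ?U e0"
    by (rule Ck_open_vector_derivativeI[rotated 2]) (use wi e0 in auto)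
  then have e02: "Ck_open 2 ?U e0" by (simp only: numeral_2_eq_2)
  show ?thesis
    unfolding Ck_on_def
  proof
    fix t assume "t \<in> {a..b}"
    then show "\<exists>U g. open U \<and> t \<in> U \<and> Ck_open 2 U g \<and> (\<forall>y\<in>{a..b} \<inter> U. g y = \<gamma> y)"
      using e02 eq0 by (intro exI[of _ ?U] exI[of _ e0]) auto
  qed
qed

lemma geodesic_data_geodesic_on:
  assumes G: "geodesic_data M a b \<gamma> g g2" and ab: "a < b"
  shows "geodesic_on M {a..b} \<gamma>" "\<And>t. t \<in> {a..b} \<Longrightarrow> vector_derivative \<gamma> (at t within {a..b}) = g t"
proof -
  note D = geodesic_dataD[OF G]
  show v: "vector_derivative \<gamma> (at t within {a..b}) = g t" if "t \<in> {a..b}" for t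
    using D(4)[OF that] vector_derivative_within_cbox[of a b t \<gamma> "g t"] ab that by simp
  have "vector_derivative (\<lambda>s. vector_derivative \<gamma> (at s within {a..b})) (at t within {a..b}) = g2 t" if "t \<in> {a..b}" for t
  proof -
    have "((\<lambda>s. vector_derivative \<gamma> (at s within {a..b})) has_vector_derivative g2 t) (at t within {a..b})"
      by (rule has_vector_derivative_transform[OF that v D(5)[OF that]])
    then show ?thesis
      using vector_derivative_within_cbox[of a b t _ "g2 t"] ab that by simp
  qed
  then show "geodesic_on M {a..b} \<gamma>"
    unfolding geodesic_on_def using D(3,6) Ck_on_Icc_extension[OF _ D(4,5,2)] ab by auto
qed

lemma Ck_on_2_Icc_derivatives:
  fixes \<gamma> :: "real \<Rightarrow> 'a::euclidean_space"
  assumes \<gamma>: "Ck_on 2 {a..b} \<gamma>" and ab: "a < b"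
  defines "g \<equiv> \<lambda>t. vector_derivative \<gamma> (at t within {a..b})"
  defines "g2 \<equiv> \<lambda>t. vector_derivative g (at t within {a..b})"
  shows "\<And>t. t \<in> {a..b} \<Longrightarrow> (\<gamma> has_vector_derivative g t) (at t within {a..b})"
    "\<And>t. t \<in> {a..b} \<Longrightarrow> (g has_vector_derivative g2 t) (at t within {a..b})"
    "continuous_on {a..b} g2"
proof -
  have *: "(\<gamma> has_vector_derivative g t) (at t within {a..b}) \<and> (g has_vector_derivative g2 t) (at t within {a..b}) \<and>
      continuous (at t within {a..b}) g2" if t: "t \<in> {a..b}" for t
  proof -
    obtain U f where U: "open U" "t \<in> U" "Ck_open 2 U f" "\<forall>y\<in>{a..b} \<inter> U. f y = \<gamma> y"
      using \<gamma> t unfolding Ck_on_def by blast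
    have f2: "Ck_open (Suc (Suc 0)) U f" using U(3) by (simp only: numeral_2_eq_2)
    obtain d where d: "d > 0" "ball t d \<subseteq> U" using U(1,2) by (meson openE)
    let ?f1 = "\<lambda>x. vector_derivative f (at x)" and ?f2 = "\<lambda>x. vector_derivative (\<lambda>x. vector_derivative f (at x)) (at x)"
    note f = Ck_open_vector_derivativeD[OF U(1) f2]
    note f' = Ck_open_vector_derivativeD[OF U(1) f(2)]
    have e1: "(\<gamma> has_vector_derivative ?f1 s) (at s within {a..b})" if "s \<in> {a..b}" "dist s t < d" for s
    proof (rule has_vector_derivative_transform_within[OF has_vector_derivative_at_within[OF f(1)] _ that(1)])
      show "s \<in> U" using that d by (auto simp: dist_commute)
      show "0 < d - dist s t" using that by simp
      fix x assume x: "x \<in> {a..b}" "dist x s < d - dist s t"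
      have "dist x t < d" using dist_triangle[of x t s] x(2) by linarith
      then show "f x = \<gamma> x" using U(4) x(1) d(2) by (auto simp: dist_commute)
    qed
    have g1: "g s = ?f1 s" if "s \<in> {a..b}" "dist s t < d" for s
      unfolding g_def using e1[OF that] vector_derivative_within_cbox[of a b s \<gamma>] ab that(1) by simp
    have e2: "(g has_vector_derivative ?f2 s) (at s within {a..b})" if "s \<in> {a..b}" "dist s t < d" for s
    proof (rule has_vector_derivative_transform_within[OF has_vector_derivative_at_within[OF f'(1)] _ that(1)])
      show "s \<in> U" using that d by (auto simp: dist_commute)
      show "0 < d - dist s t" using that by simp
      fix x assume x: "x \<in> {a..b}" "dist x s < d - dist s t"
      have "dist x t < d" using dist_triangle[of x t s] x(2) by linarith
      then show "?f1 x = g x" using g1 x(1) by simp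
    qed
    have g2': "g2 s = ?f2 s" if "s \<in> {a..b}" "dist s t < d" for s
      unfolding g2_def using e2[OF that] vector_derivative_within_cbox[of a b s g] ab that(1) by simp
    have "continuous_on U ?f2" using f'(2) by simp
    then have "continuous (at t within {a..b}) ?f2"
      using U(1,2) by (metis continuous_at_imp_continuous_at_within continuous_on_eq_continuous_at)
    then have "continuous (at t within {a..b}) g2"
      by (rule continuous_transform_within[OF _ d(1) t]) (use g2' in auto)
    then show ?thesis using e1[of t] e2[of t] g1[of t] g2'[of t] t d(1) by simp
  qed
  show "\<And>t. t \<in> {a..b} \<Longrightarrow> (\<gamma> has_vector_derivative g t) (at t within {a..b})"
    "\<And>t. t \<in> {a..b} \<Longrightarrow> (g has_vector_derivative g2 t) (at t within {a..b})"
    using * by blast+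
  show "continuous_on {a..b} g2" using * by (auto simp: continuous_on_eq_continuous_within)
qed

lemma geodesic_on_geodesic_data:
  assumes G: "geodesic_on M {a..b} \<gamma>" and ab: "a < b"
  obtains g2 where "geodesic_data M a b \<gamma> (\<lambda>t. vector_derivative \<gamma> (at t within {a..b})) g2"
proof -
  have C: "Ck_on 2 {a..b} \<gamma>" using G by (simp add: geodesic_on_def)
  note * = Ck_on_2_Icc_derivatives[OF C ab]
  show ?thesis
    by (rule that) (use G * continuous_on_has_vector_derivative[OF *(2)] in
      \<open>auto simp: geodesic_data_def geodesic_on_def image_subset_iff\<close>)
qed

text \<open>Bootstrap: if \<gamma> is of class C^(j+1), the operator and the right side of the
  equation are of class C^j along \<gamma>, hence so is the acceleration, and \<gamma> is of class
  C^(j+2). The right side contains second derivatives of P, which stops the induction at k.\<close>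

lemma geodesic_Ck:
  fixes \<gamma> :: "real \<Rightarrow> 'a::euclidean_space"
  assumes I: "open I" and PR: "local_retraction k M P p r"
    and ball: "\<And>t. t \<in> I \<Longrightarrow> \<gamma> t \<in> ball p r" and k: "k \<ge> 2"
    and g: "\<And>t. t \<in> I \<Longrightarrow> (\<gamma> has_vector_derivative g t) (at t)"
    and g2: "\<And>t. t \<in> I \<Longrightarrow> (g has_vector_derivative g2 t) (at t)"
    and eq: "\<And>t. t \<in> I \<Longrightarrow> geo_op P (\<gamma> t) (g2 t) = dird (dird P (g t)) (g t) (\<gamma> t)"
  shows "Ck_open k I \<gamma>"
proof -
  note P = local_retractionD[OF PR]
  have f: "Ck_open 2 (ball p r) P" using Ck_open_mono[OF P(3) k] .
  have f2: "Ck_open (Suc (Suc 0)) (ball p r) P" using f by (simp add: numeral_2_eq_2)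
  have "Ck_open (Suc j) I \<gamma>" if "Suc j \<le> k" for j
    using that
  proof (induction j)
    case 0
    have "Ck_open 0 I g"
      using continuous_on_has_vector_derivative[of I g g2] g2 has_vector_derivative_at_within by fastforce
    then show ?case by (intro Ck_open_vector_derivativeI[OF I, of \<gamma> g] g)
  next
    case (Suc j)
    then have \<gamma>: "Ck_open (Suc j) I \<gamma>" by simp
    have "Ck_open j I (\<lambda>t. vector_derivative \<gamma> (at t))" by (rule Ck_open_vector_derivativeD[OF I \<gamma>])
    then have gj: "Ck_open j I g"
      by (rule Ck_open_cong[OF I, THEN iffD1, rotated]) (use g vector_derivative_at in blast)
    have \<gamma>j: "Ck_open j I \<gamma>" using \<gamma> by (rule Ck_open_mono) simp
    have Pj: "Ck_open (Suc (Suc j)) (ball p r) P" using Ck_open_mono[OF P(3) Suc.prems] .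
    have D1: "Ck_open j I (\<lambda>t. dird P x (\<gamma> t))" for x
      by (rule Ck_open_compose[OF I open_ball ball \<gamma>j Ck_open_mono[OF Ck_open_dird[OF Pj]]]) simp_all
    have D2: "Ck_open j I (\<lambda>t. dird (dird P x) y (\<gamma> t))" for x y
      by (rule Ck_open_compose[OF I open_ball ball \<gamma>j Ck_open_dird[OF Ck_open_dird[OF Pj]]])
    have "Ck_open j I g2"
    proof (rule monotone_linear_solution_Ck[where A = "\<lambda>t. geo_op P (\<gamma> t)" and w = "\<lambda>t. dird (dird P (g t)) (g t) (\<gamma> t)", OF I linear_geo_op[OF f2 ball] geo_op_monotone[OF f2 ball]])
      show "Ck_open j I (\<lambda>t. geo_op P (\<gamma> t) x)" for x
        unfolding geo_op_def dird_adj_def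
        by (intro Ck_open_add[OF I] Ck_open_diff[OF I] Ck_open_sum[OF I] Ck_open_scaleR[OF I] Ck_open_inner[OF I] D1 Ck_open_const)
      have "Ck_open j I (\<lambda>t. \<Sum>b\<in>Basis. \<Sum>c\<in>Basis. (g t \<bullet> b) *\<^sub>R (g t \<bullet> c) *\<^sub>R dird (dird P b) c (\<gamma> t))"
        by (intro Ck_open_sum[OF I] Ck_open_scaleR[OF I] Ck_open_inner[OF I] D2 gj Ck_open_const)
      then show "Ck_open j I (\<lambda>t. dird (dird P (g t)) (g t) (\<gamma> t))"
        by (rule Ck_open_cong[OF I, THEN iffD1, rotated]) (rule dird_dird_expand2[OF open_ball f ball, symmetric])
    qed (use eq in auto)
    then show ?case
      by (intro Ck_open_vector_derivativeI[OF I, of \<gamma> g] Ck_open_vector_derivativeI[OF I, of g g2] g g2)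
  qed
  from this[of "k - 1"] show ?thesis using k by simp
qed

lemma geodesic_equation:
  assumes I: "open I" and PR: "local_retraction k M P p r" and k: "k \<ge> 2"
    and M: "\<And>t. t \<in> I \<Longrightarrow> \<gamma> t \<in> M" and ball: "\<And>t. t \<in> I \<Longrightarrow> \<gamma> t \<in> ball p r"
    and g: "\<And>t. t \<in> I \<Longrightarrow> (\<gamma> has_vector_derivative g t) (at t)"
    and g2: "\<And>t. t \<in> I \<Longrightarrow> (g has_vector_derivative g2 t) (at t)"
    and perp: "\<And>t w. t \<in> I \<Longrightarrow> w \<in> tangent_space M (\<gamma> t) \<Longrightarrow> g2 t \<bullet> w = 0"
    and t: "t \<in> I"
  shows "dird_adj P (\<gamma> t) (g2 t) = 0" "g2 t - dird P (g2 t) (\<gamma> t) = dird (dird P (g t)) (g t) (\<gamma> t)"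
    "geo_op P (\<gamma> t) (g2 t) = dird (dird P (g t)) (g t) (\<gamma> t)"
proof -
  note P = local_retractionD[OF PR]
  have f: "Ck_open 2 (ball p r) P" using Ck_open_mono[OF P(3) k] .
  have f2: "Ck_open (Suc (Suc 0)) (ball p r) P" using f by (simp add: numeral_2_eq_2)
  have wi: "at s within I = at s" if "s \<in> I" for s using at_within_open[OF that I] .
  have vel: "dird P (g s) (\<gamma> s) = g s" if s: "s \<in> I" for s
    by (rule retraction_velocity[OF PR _ s, of \<gamma>]) (use k M ball g[OF s] wi[OF s] in auto)
  have "dird_adj P (\<gamma> t) (g2 t) \<bullet> y = 0" for y
    unfolding dird_adj_inner[OF f2 ball[OF t]]
    by (rule perp[OF t tangent_space_retraction(2)[OF PR _ M[OF t] ball[OF t]]]) (use k in simp)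
  then show 1: "dird_adj P (\<gamma> t) (g2 t) = 0" using inner_eq_zero_iff by blast
  have "((\<lambda>t. dird P (g t) (\<gamma> t)) has_vector_derivative dird (dird P (g t)) (g t) (\<gamma> t) + dird P (g2 t) (\<gamma> t)) (at t within I)"
    by (rule has_vector_derivative_dird_dird[OF open_ball f, of \<gamma> t I "g t" g "g2 t"]) (use ball t g[OF t] g2[OF t] wi[OF t] in auto)
  then have "(g has_vector_derivative dird (dird P (g t)) (g t) (\<gamma> t) + dird P (g2 t) (\<gamma> t)) (at t within I)"
    by (rule has_vector_derivative_transform[OF t, rotated]) (rule vel[symmetric])
  then have "(g has_vector_derivative dird (dird P (g t)) (g t) (\<gamma> t) + dird P (g2 t) (\<gamma> t)) (at t)"
    unfolding wi[OF t] .
  then have "g2 t = dird (dird P (g t)) (g t) (\<gamma> t) + dird P (g2 t) (\<gamma> t)"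
    by (rule vector_derivative_unique_at[OF g2[OF t]])
  then show 2: "g2 t - dird P (g2 t) (\<gamma> t) = dird (dird P (g t)) (g t) (\<gamma> t)" by (metis add_diff_cancel_right')
  show "geo_op P (\<gamma> t) (g2 t) = dird (dird P (g t)) (g t) (\<gamma> t)"
    using 1 2 by (simp add: geo_op_def)
qed

section \<open>Geodesic distance and minimizing geodesics\<close>

lemma lip_conn_exists:
  assumes M: "connected M" and R: "locally_retractable k M" and k: "k \<ge> 2" and pq: "p \<in> M" "q \<in> M"
  shows "\<exists>l. lip_conn M p q l"
proof (rule connected_equivalence_relation[OF M pq])
  fix a assume a: "a \<in> M"
  obtain P r where PR: "local_retraction k M P a r" by (rule locally_retractableD[OF R a])
  obtain \<rho> C where rho: "\<rho> > 0" "C \<ge> 0"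
    "\<And>x y. x \<in> M \<inter> ball a \<rho> \<Longrightarrow> y \<in> M \<inter> ball a \<rho> \<Longrightarrow>
       lip_conn M x y (sqrt ((norm (y - x))\<^sup>2 + C * (norm (y - x)) ^ 4))"
    by (rule local_length[OF PR k]) (rule that)
  show "\<exists>T. openin (top_of_set M) T \<and> a \<in> T \<and> (\<forall>x\<in>T. \<exists>l. lip_conn M a x l)"
  proof (intro exI[of _ "M \<inter> ball a \<rho>"] conjI ballI)
    show "\<exists>l. lip_conn M a x l" if "x \<in> M \<inter> ball a \<rho>" for x
      using rho(3)[OF _ that, of a] rho(1) a by auto
  qed (use rho(1) a in auto)
qed (use lip_conn_sym lip_conn_trans in blast)+

lemma lip_dist_sym: "lip_dist M p q = lip_dist M q p"
  unfolding lip_dist_def by (rule arg_cong[of _ _ Inf]) (use lip_conn_sym in blast)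

lemma valid_path_lip_conn:
  fixes \<gamma> :: "real \<Rightarrow> 'a::euclidean_space"
  assumes \<gamma>: "valid_path \<gamma>" "path_image \<gamma> \<subseteq> M" and L: "has_length \<gamma> L"
  shows "lip_conn M (pathstart \<gamma>) (pathfinish \<gamma>) L"
proof -
  let ?g = "\<lambda>t. vector_derivative \<gamma> (at t within {0..1})"
  obtain S where S: "continuous_on {0..1} \<gamma>" "finite S" "\<gamma> C1_differentiable_on ({0..1} - S)"
    using \<gamma>(1) unfolding valid_path_def piecewise_C1_differentiable_on_def by blast
  have d: "(\<gamma> has_vector_derivative ?g t) (at t)" if "t \<in> {0..1} - S" for t
  proof -
    obtain D where "\<forall>x\<in>{0..1} - S. (\<gamma> has_vector_derivative D x) (at x)"
      using S(3) unfolding C1_differentiable_on_def by (elim exE conjE)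
    then have D: "(\<gamma> has_vector_derivative D t) (at t)" using that by (rule bspec)
    have "?g t = D t"
      using vector_derivative_within_cbox[OF _ _ has_vector_derivative_at_within[OF D], of 0 1] that by simp
    then show ?thesis using D by (simp only:)
  qed
  have "(?g has_integral \<gamma> t - \<gamma> s) {s..t}" if "0 \<le> s" "s \<le> t" "t \<le> 1" for s t
    by (rule fundamental_theorem_of_calculus_interior_strong[OF S(2) that(2)])
      (use d S(1) that in \<open>auto intro: continuous_on_subset\<close>)
  moreover have "((\<lambda>t. norm (?g t)) has_integral L) {0..1}" using L by (simp add: has_length_def)
  ultimately have "lip_conn M (\<gamma> 0) (\<gamma> 1) (integral {0..1} (\<lambda>t. norm (?g t)))"
    by (intro lip_conn_integral) (use \<gamma>(2) in \<open>auto simp: path_image_def\<close>)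
  then show ?thesis
    using L by (simp add: has_length_def integral_unique pathstart_def pathfinish_def)
qed

lemma geodesic_data_has_length:
  assumes G: "geodesic_data M 0 1 \<gamma> g g2" and c: "\<And>t. t \<in> {0..1} \<Longrightarrow> norm (g t) = c"
  shows "valid_path \<gamma>" "has_length \<gamma> c"
proof -
  note D = geodesic_dataD[OF G]
  have d: "(\<gamma> has_vector_derivative g t) (at t)" if "t \<in> {0..1} - {0, 1}" for t
    using D(4)[of t] that at_within_Icc_at[of 0 t 1] by simp
  have "continuous_on ({0..1} - {0, 1}) g" by (rule continuous_on_subset[OF D(1)]) auto
  then have "\<gamma> C1_differentiable_on ({0..1} - {0, 1})"
    unfolding C1_differentiable_on_def using d by blast
  then show "valid_path \<gamma>"
    unfolding valid_path_def piecewise_C1_differentiable_on_def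
    by (intro conjI exI[of _ "{0, 1}"] continuous_on_has_vector_derivative[OF D(4)]) auto
  have "((\<lambda>t::real. c) has_integral c) {0..1}" using has_integral_const_real[of c 0 1] by simp
  then show "has_length \<gamma> c"
    unfolding has_length_def
  proof (rule has_integral_eq[rotated])
    fix t :: real assume t: "t \<in> {0..1}"
    show "c = norm (vector_derivative \<gamma> (at t within {0..1}))"
      unfolding geodesic_data_geodesic_on(2)[OF G zero_less_one t] c[OF t] ..
  qed
qed

lemma lip_min_geodesic_exists:
  assumes M: "compact M" "connected M" and R: "locally_retractable k M" and k: "k \<ge> 2" and pq: "p \<in> M" "q \<in> M"
  obtains \<gamma> g g2 where "geodesic_data M 0 1 \<gamma> g g2" "\<gamma> 0 = p" "\<gamma> 1 = q"
    "\<And>t. t \<in> {0..1} \<Longrightarrow> norm (g t) = lip_dist M p q"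
proof -
  obtain l where l: "lip_conn M p q l" using lip_conn_exists[OF M(2) R k pq] by blast
  obtain \<gamma> where \<gamma>: "lip_min M 0 1 (lip_dist M p q) \<gamma>" "\<gamma> 0 = p" "\<gamma> 1 = q"
    by (rule lip_min_exists[OF M(1) l])
  obtain g g2 where G: "geodesic_data M 0 1 \<gamma> g g2"
    using lip_min_geodesic_data[OF \<gamma>(1) R k] by (metis zero_less_one)
  show ?thesis
    by (rule that[OF G \<gamma>(2,3) lip_min_speed[OF \<gamma>(1) G R _ zero_less_one]]) (use k in auto)
qed

text \<open>A Lipschitz minimizer is a C^2 geodesic and thereby an admissible path for
  \<open>geo_dist\<close>; conversely every admissible path yields a Lipschitz connection of the
  same length. So the infimum in \<open>geo_dist\<close> is a minimum.\<close>

lemma geo_dist_eq_lip_dist: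
  assumes M: "compact M" "connected M" and R: "locally_retractable k M" and k: "k \<ge> 2" and pq: "p \<in> M" "q \<in> M"
  shows "geo_dist M p q = lip_dist M p q"
proof -
  obtain \<gamma> g g2 where G: "geodesic_data M 0 1 \<gamma> g g2" "\<gamma> 0 = p" "\<gamma> 1 = q"
    "\<And>t. t \<in> {0..1} \<Longrightarrow> norm (g t) = lip_dist M p q"
    by (rule lip_min_geodesic_exists[OF assms]) (rule that)
  have vp: "valid_path \<gamma>" "has_length \<gamma> (lip_dist M p q)"
    using geodesic_data_has_length[OF G(1,4)] by auto
  have "path_image \<gamma> \<subseteq> M" using geodesic_dataD(3)[OF G(1)] by (auto simp: path_image_def)
  then have mem: "lip_dist M p q \<in> {L. \<exists>\<gamma>. valid_path \<gamma> \<and> path_image \<gamma> \<subseteq> M \<and>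
     pathstart \<gamma> = p \<and> pathfinish \<gamma> = q \<and> has_length \<gamma> L}"
    using vp G(2,3) by (auto simp: pathstart_def pathfinish_def)
  have le: "lip_dist M p q \<le> L" if "valid_path \<gamma>" "path_image \<gamma> \<subseteq> M" "pathstart \<gamma> = p" "pathfinish \<gamma> = q" "has_length \<gamma> L" for \<gamma> L
    using valid_path_lip_conn[OF that(1,2,5)] that(3,4) lip_dist_le by blast
  show ?thesis
    unfolding geo_dist_def by (rule cInf_eq_minimum[OF mem]) (use le in blast)
qed

text \<open>Uniqueness in \<open>riem_log\<close> is drawn from injectivity of the exponential map:
  below the injectivity radius the initial velocity of any minimizing geodesic lies in a ball on
  which \<open>riem_exp\<close> is injective, its norm being the distance, and it is mapped to
  \<open>y\<close>.\<close>

lemma riem_log_eq: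
  assumes M: "compact M" "connected M" and R: "locally_retractable k M" and k: "k \<ge> 2" and pq: "q \<in> M" "y \<in> M"
    and inj: "ereal (geo_dist M q y) < inj_radius M"
    and G: "geodesic_data M 0 1 \<gamma> g g2" "\<gamma> 0 = q" "\<gamma> 1 = y" "\<And>t. t \<in> {0..1} \<Longrightarrow> norm (g t) = lip_dist M q y"
  shows "riem_log M q y = g 0"
proof -
  have eq: "geo_dist M q y = lip_dist M q y" by (rule geo_dist_eq_lip_dist[OF M R k pq])
  have "inj_radius M \<le> inj_radius_at M q" unfolding inj_radius_def using pq(1) by (rule INF_lower)
  then have "ereal (geo_dist M q y) < inj_radius_at M q" using inj by simp
  then obtain r where r: "exp_diffeo M q r" "geo_dist M q y < r"
    unfolding inj_radius_at_def less_SUP_iff by auto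
  define B where "B = {v \<in> tangent_space M q. norm v < r}"
  obtain \<psi> where B: "\<And>v. v \<in> B \<Longrightarrow> \<exists>!q'. exp_rel M q v q'" "homeomorphism B (riem_exp M q ` B) (riem_exp M q) \<psi>"
    using r(1) unfolding exp_diffeo_def B_def Let_def by blast
  have *: "vector_derivative \<delta> (at 0 within {0..1}) \<in> B \<and> riem_exp M q (vector_derivative \<delta> (at 0 within {0..1})) = y"
    if m: "minimizing_geodesic M q y \<delta>" for \<delta>
  proof -
    let ?v = "\<lambda>t. vector_derivative \<delta> (at t within {0..1})"
    have m: "geodesic_on M {0..1} \<delta>" "\<delta> 0 = q" "\<delta> 1 = y" "has_length \<delta> (geo_dist M q y)"
      using m by (auto simp: minimizing_geodesic_def)
    obtain d2 where D: "geodesic_data M 0 1 \<delta> ?v d2"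
      by (rule geodesic_on_geodesic_data[OF m(1) zero_less_one])
    note DD = geodesic_dataD[OF D]
    have "?v 0 \<in> tangent_space M (\<delta> 0)"
      by (rule velocity_in_tangent_space[OF R _ zero_less_one _ DD(3) continuous_on_has_vector_derivative[OF DD(4)] DD(4)])
        (use k in auto)
    moreover have "norm (?v 0) = geo_dist M q y"
    proof (rule has_integral_unique)
      show "((\<lambda>t. norm (?v t)) has_integral geo_dist M q y) {0..1}" using m(4) by (simp add: has_length_def)
      have const: "norm (?v 0) = norm (?v t)" if "t \<in> {0..1}" for t
        by (rule sym, rule geodesic_data_constant_speed[OF D R _ zero_less_one that]) (use k in auto)
      have "((\<lambda>t::real. norm (?v 0)) has_integral norm (?v 0)) {0..1}"
        using has_integral_const_real[of "norm (?v 0)" 0 1] by simp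
      then show "((\<lambda>t. norm (?v t)) has_integral norm (?v 0)) {0..1}"
        by (rule has_integral_eq[rotated]) (rule const)
    qed
    ultimately have vB: "?v 0 \<in> B" using r(2) m(2) by (simp add: B_def)
    have "exp_rel M q (?v 0) y" unfolding exp_rel_def using m by blast
    then have "riem_exp M q (?v 0) = y" unfolding riem_exp_def by (rule the1_equality[OF B(1)[OF vB]])
    then show ?thesis using vB by (intro conjI)
  qed
  have mg: "minimizing_geodesic M q y \<gamma>"
    unfolding minimizing_geodesic_def eq
    using geodesic_data_geodesic_on(1)[OF G(1) zero_less_one] G(2,3) geodesic_data_has_length(2)[OF G(1,4)] by blast
  have g0: "vector_derivative \<gamma> (at 0 within {0..1}) = g 0"
    by (rule geodesic_data_geodesic_on(2)[OF G(1) zero_less_one]) simp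
  show ?thesis
    unfolding riem_log_def
  proof (rule the_equality)
    show "\<exists>\<gamma>. minimizing_geodesic M q y \<gamma> \<and> g 0 = vector_derivative \<gamma> (at 0 within {0..1})"
      using mg g0 by metis
    fix v assume "\<exists>\<gamma>. minimizing_geodesic M q y \<gamma> \<and> v = vector_derivative \<gamma> (at 0 within {0..1})"
    then have "v \<in> B" "riem_exp M q v = y" using * by blast+
    moreover have "g 0 \<in> B" "riem_exp M q (g 0) = y" using *[OF mg] g0 by auto
    ultimately show "v = g 0" using homeomorphism_apply1[OF B(2)] by metis
  qed
qed

section \<open>Weak derivatives\<close>

text \<open>Henstock's lemma: in the sums over fine partitions the integrals of \<open>d\<close>
  over the pieces vanish, so what is small is the Riemann sum of the norm itself.\<close>

lemma has_integral_norm_0: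
  fixes d :: "real \<Rightarrow> 'a::euclidean_space"
  assumes d: "\<And>s t. a \<le> s \<Longrightarrow> s \<le> t \<Longrightarrow> t \<le> b \<Longrightarrow> (d has_integral 0) {s..t}" and ab: "a \<le> b"
  shows "((\<lambda>t. norm (d t)) has_integral 0) {a..b}"
  unfolding has_integral_real
proof (intro allI impI)
  fix e :: real assume e: "e > 0"
  have "d integrable_on cbox a b" using d[of a b] ab by auto
  then obtain \<gamma> where g: "gauge \<gamma>" "\<And>p. p tagged_partial_division_of (cbox a b) \<Longrightarrow> \<gamma> fine p \<Longrightarrow>
             sum (\<lambda>(x,k). norm(measure lborel k *\<^sub>R d x - integral k d)) p < e"
    using Henstock_lemma[OF _ e] by blast
  show "\<exists>\<gamma>. gauge \<gamma> \<and> (\<forall>\<D>. \<D> tagged_division_of {a..b} \<and> \<gamma> fine \<D> \<longrightarrow>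
        norm (sum (\<lambda>(x,k). measure lborel k *\<^sub>R norm (d x)) \<D> - 0) < e)"
  proof (intro exI[of _ \<gamma>] conjI allI impI g(1), elim conjE)
    fix p assume p: "p tagged_division_of {a..b}" "\<gamma> fine p"
    have eq: "norm (measure lborel k *\<^sub>R d x - integral k d) = measure lborel k *\<^sub>R norm (d x)" if xk: "(x, k) \<in> p" for x k
    proof -
      obtain u v where k: "k = cbox u v" using tagged_division_ofD(4)[OF p(1) xk] by blast
      note k = k tagged_division_ofD(2,3)[OF p(1) xk]
      then have "a \<le> u" "u \<le> v" "v \<le> b" by auto
      then have "integral k d = 0" using d[of u v] k(1) by (simp add: integral_unique)
      then show ?thesis by simp
    qed
    have "sum (\<lambda>(x,k). norm(measure lborel k *\<^sub>R d x - integral k d)) p < e"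
      using p by (intro g(2)) (auto simp: tagged_division_of_def)
    also have "sum (\<lambda>(x,k). norm(measure lborel k *\<^sub>R d x - integral k d)) p = sum (\<lambda>(x,k). measure lborel k *\<^sub>R norm (d x)) p"
      by (rule sum.cong[OF refl]) (use eq in auto)
    finally have "sum (\<lambda>(x,k). measure lborel k *\<^sub>R norm (d x)) p < e" .
    moreover have "0 \<le> sum (\<lambda>(x,k). measure lborel k *\<^sub>R norm (d x)) p"
      by (rule sum_nonneg) auto
    ultimately show "norm (sum (\<lambda>(x,k). measure lborel k *\<^sub>R norm (d x)) p - 0) < e" by simp
  qed
qed

lemma has_integral_0_negligible:
  fixes h :: "real \<Rightarrow> real"
  assumes h: "(h has_integral 0) S" "\<And>t. t \<in> S \<Longrightarrow> 0 \<le> h t" and S: "S \<in> sets lebesgue"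
  shows "negligible {t \<in> S. h t \<noteq> 0}"
proof -
  have "h absolutely_integrable_on S"
    using h by (subst absolutely_integrable_on_iff_nonneg) auto
  then have i: "integrable (lebesgue_on S) h" by (rule absolutely_integrable_imp_integrable[OF _ S])
  have "integral\<^sup>L (lebesgue_on S) h = 0"
    using lebesgue_integral_eq_integral[OF i S] integral_unique[OF h(1)] by simp
  moreover have "AE t in lebesgue_on S. 0 \<le> h t" by (rule AE_I2) (use h(2) in simp)
  ultimately have "AE t in lebesgue_on S. h t = 0"
    using integral_nonneg_eq_0_iff_AE[OF i] by simp
  moreover have "{t \<in> space (lebesgue_on S). \<not> h t = 0} \<in> sets (lebesgue_on S)"
    using borel_measurable_integrable[OF i] by measurable
  ultimately have "{t \<in> S. h t \<noteq> 0} \<in> null_sets (lebesgue_on S)"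
    using AE_iff_null[of "lebesgue_on S" "\<lambda>t. h t = 0"] by simp
  then show ?thesis
    using null_sets_restrict_space[OF S] by (simp add: negligible_iff_null_sets)
qed

lemma H1_curve_derivative_unique:
  fixes f :: "real \<Rightarrow> 'a::euclidean_space"
  assumes f: "H1_curve a b F f" and g: "H1_curve a b F g" and ab: "a \<le> b"
  shows "negligible {t \<in> {a..b}. f t \<noteq> g t}"
proof -
  have "((\<lambda>t. f t - g t) has_integral 0) {s..t}" if "a \<le> s" "s \<le> t" "t \<le> b" for s t
    using has_integral_diff[OF H1_curveD(1)[OF f that] H1_curveD(1)[OF g that]] by simp
  then have "((\<lambda>t. norm (f t - g t)) has_integral 0) {a..b}" by (rule has_integral_norm_0[OF _ ab])
  then have "negligible {t \<in> {a..b}. norm (f t - g t) \<noteq> 0}"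
    by (rule has_integral_0_negligible) auto
  then show ?thesis by simp
qed

lemma H1_curve_energy_unique:
  fixes f :: "real \<Rightarrow> 'a::euclidean_space"
  assumes f: "H1_curve a b F f" and g: "H1_curve a b F g" and ab: "a \<le> b"
  shows "integral {a..b} (\<lambda>t. (norm (f t))\<^sup>2) = integral {a..b} (\<lambda>t. (norm (g t))\<^sup>2)"
  by (rule integral_spike[OF H1_curve_derivative_unique[OF assms]]) auto

lemma L2_I_abs_integrable:
  assumes "L2_I f"
  shows "f absolutely_integrable_on {0..1}" "(\<lambda>t. (norm (f t))\<^sup>2) integrable_on {0..1}"
proof -
  have m: "f \<in> borel_measurable (lebesgue_on {0..1})" and i: "integrable (lebesgue_on {0..1}) (\<lambda>t. (norm (f t))\<^sup>2)"
    using assms by (auto simp: L2_I_def)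
  show 1: "(\<lambda>t. (norm (f t))\<^sup>2) integrable_on {0..1}" by (rule integrable_on_lebesgue_on[OF i]) simp
  have "(\<lambda>t. 1 + (norm (f t))\<^sup>2) integrable_on {0..1}"
    by (intro integrable_add 1 integrable_const_ivl)
  moreover have "norm (f t) \<le> 1 + (norm (f t))\<^sup>2" for t
    using sum_squares_bound[of 1 "norm (f t)"] norm_ge_zero[of "f t"] unfolding mult_1_right power_one by linarith
  ultimately show "f absolutely_integrable_on {0..1}"
    by (intro measurable_bounded_by_integrable_imp_absolutely_integrable[OF m]) auto
qed

lemma H1_curve_L2_I:
  assumes "H1_curve 0 1 F f"
  shows "L2_I f"
proof -
  have "f integrable_on {0..1}" using H1_curveD(1)[OF assms, of 0 1] by auto
  then have m: "f \<in> borel_measurable (lebesgue_on {0..1})" by (rule integrable_imp_measurable)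
  have "(\<lambda>t. (norm (f t))\<^sup>2) absolutely_integrable_on {0..1}"
    using H1_curveD(2)[OF assms] by (subst absolutely_integrable_on_iff_nonneg) auto
  then have "integrable (lebesgue_on {0..1}) (\<lambda>t. (norm (f t))\<^sup>2)"
    by (rule absolutely_integrable_imp_integrable) simp
  then show ?thesis using m by (simp add: L2_I_def)
qed

lemma H1_curve_continuous_on:
  assumes "H1_curve a b \<gamma> g"
  shows "continuous_on {a..b} \<gamma>"
proof (cases "a \<le> b")
  case True
  have gi: "g integrable_on {a..b}" using H1_curveD(1)[OF assms, of a b] True by auto
  have "continuous_on {a..b} (\<lambda>t. \<gamma> a + integral {a..t} g)"
    by (intro continuous_intros indefinite_integral_continuous_1 gi)
  then show ?thesis
    by (rule continuous_on_eq) (use integral_unique[OF H1_curveD(1)[OF assms, of a]] in auto)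
qed simp

text \<open>Telescoping over N equal steps bounds the total increment by \<epsilon> times an
  increment of \<sigma>. A substitute for the mean value theorem for functions built from indefinite
  integrals, where a pointwise derivative is not at hand.\<close>

lemma constant_of_small_increments:
  fixes D :: "real \<Rightarrow> 'a::real_normed_vector"
  assumes "\<And>\<epsilon>. \<epsilon> > 0 \<Longrightarrow> \<exists>\<delta>>0. \<forall>s t. 0 \<le> s \<and> s \<le> t \<and> t \<le> 1 \<and> t - s < \<delta> \<longrightarrow> norm (D t - D s) \<le> \<epsilon> * (\<sigma> t - \<sigma> s)"
  shows "D 1 = D (0::real)"
proof -
  define S where "S = \<bar>\<sigma> 1 - \<sigma> 0\<bar> + 1"
  have S: "S > 0" by (simp add: S_def)
  have "norm (D 1 - D 0) \<le> 0 + \<epsilon>" if e: "\<epsilon> > 0" for \<epsilon>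
  proof -
    obtain \<delta> where d: "\<delta> > 0" "\<And>s t. 0 \<le> s \<Longrightarrow> s \<le> t \<Longrightarrow> t \<le> 1 \<Longrightarrow> t - s < \<delta> \<Longrightarrow> norm (D t - D s) \<le> (\<epsilon> / S) * (\<sigma> t - \<sigma> s)"
      using assms[of "\<epsilon> / S"] e S by auto
    obtain N :: nat where N: "N \<noteq> 0" "1 / real N < \<delta>"
      using reals_Archimedean[OF d(1)] by (metis inverse_eq_divide nat.distinct(1))
    define x where "x i = real i / real N" for i
    have "D 1 - D 0 = (\<Sum>i<N. D (x (Suc i)) - D (x i))"
      using sum_lessThan_telescope[of "\<lambda>i. D (x i)" N] N by (simp add: x_def)
    also have "norm \<dots> \<le> (\<Sum>i<N. (\<epsilon> / S) * (\<sigma> (x (Suc i)) - \<sigma> (x i)))"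
      using N by (intro sum_norm_le d(2)) (auto simp: x_def divide_simps simp flip: diff_divide_distrib)
    also have "\<dots> = (\<epsilon> / S) * (\<sigma> 1 - \<sigma> 0)"
    proof -
      have T: "(\<Sum>i<N. \<sigma> (x (Suc i)) - \<sigma> (x i)) = \<sigma> 1 - \<sigma> 0"
        using sum_lessThan_telescope[of "\<lambda>i. \<sigma> (x i)" N] N by (simp add: x_def)
      show ?thesis unfolding sum_distrib_left[symmetric] T ..
    qed
    also have "\<dots> \<le> (\<epsilon> / S) * S" using e S by (intro mult_left_mono) (auto simp: S_def)
    also have "\<dots> = 0 + \<epsilon>" using S by simp
    finally show ?thesis .
  qed
  then have "norm (D 1 - D 0) \<le> 0" by (rule field_le_epsilon)
  then show ?thesis by simp
qed

text \<open>As \<open>g\<close> is merely integrable, the product rule is replaced by a look at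
  increments. Freezing G at the right end and \<phi> at the left end makes the increment of the
  product exact; uniform continuity bounds the error of freezing by \<epsilon> times the increment
  of \<sigma>.\<close>

lemma H1_curve_by_parts:
  fixes G g :: "real \<Rightarrow> 'a::euclidean_space" and \<phi> :: "real \<Rightarrow> real"
  assumes G: "H1_curve 0 1 G g"
    and \<phi>: "\<And>t. t \<in> {0..1} \<Longrightarrow> (\<phi> has_vector_derivative \<psi> t) (at t within {0..1})" "continuous_on {0..1} \<psi>"
    and \<phi>0: "\<phi> 0 = 0" "\<phi> 1 = 0"
  shows "(\<lambda>t. \<psi> t *\<^sub>R G t) absolutely_integrable_on {0..1}" "(\<lambda>t. \<phi> t *\<^sub>R g t) absolutely_integrable_on {0..1}"
    "integral {0..1} (\<lambda>t. \<psi> t *\<^sub>R G t) = - integral {0..1} (\<lambda>t. \<phi> t *\<^sub>R g t)"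
proof -
  have \<phi>c: "continuous_on {0..1} \<phi>" by (rule continuous_on_has_vector_derivative[OF \<phi>(1)])
  have Gc: "continuous_on {0..1} G" by (rule H1_curve_continuous_on[OF G])
  have ga: "g absolutely_integrable_on {0..1}" by (rule L2_I_abs_integrable(1)[OF H1_curve_L2_I[OF G]])
  show i1: "(\<lambda>t. \<psi> t *\<^sub>R G t) absolutely_integrable_on {0..1}"
    by (intro absolutely_integrable_continuous_real continuous_intros \<phi>(2) Gc)
  show i2: "(\<lambda>t. \<phi> t *\<^sub>R g t) absolutely_integrable_on {0..1}"
  proof (rule absolutely_integrable_bounded_measurable_product[where h = scaleR and f = \<phi>, OF _ _ _ _ ga])
    show "bilinear (scaleR :: real \<Rightarrow> 'a \<Rightarrow> 'a)" by (simp add: bilinear_def linear_iff scaleR_left_distrib scaleR_right_distrib)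
    show "\<phi> \<in> borel_measurable (lebesgue_on {0..1})"
      by (rule continuous_imp_measurable_on_sets_lebesgue[OF \<phi>c]) simp
    show "bounded (\<phi> ` {0..1})" by (intro compact_imp_bounded compact_continuous_image \<phi>c) auto
  qed simp
  have sub: "f integrable_on {s..t}" if "f integrable_on {0..1}" "0 \<le> s" "t \<le> 1" for f :: "real \<Rightarrow> 'c::euclidean_space" and s t
    using integrable_subinterval_real[OF that(1), of s t] that by auto
  have j1: "(\<lambda>t. \<psi> t *\<^sub>R G t) integrable_on {0..1}" and j2: "(\<lambda>t. \<phi> t *\<^sub>R g t) integrable_on {0..1}"
    and j3: "(\<lambda>t. norm (g t)) integrable_on {0..1}"
    using i1 i2 ga by (auto simp: absolutely_integrable_on_def)
  have j4: "(\<lambda>t. \<bar>\<psi> t\<bar> + norm (g t)) integrable_on {0..1}"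
    by (intro integrable_add j3 integrable_continuous_real continuous_intros \<phi>(2))
  define D where "D t = \<phi> t *\<^sub>R G t - integral {0..t} (\<lambda>t. \<psi> t *\<^sub>R G t + \<phi> t *\<^sub>R g t)" for t
  define \<sigma> where "\<sigma> t = integral {0..t} (\<lambda>t. \<bar>\<psi> t\<bar> + norm (g t))" for t
  have "D 1 = D 0"
  proof (rule constant_of_small_increments)
    fix \<epsilon> :: real assume e: "\<epsilon> > 0"
    have "uniformly_continuous_on {0..1} G" "uniformly_continuous_on {0..1} \<phi>"
      using Gc \<phi>c by (auto intro: compact_uniformly_continuous)
    then obtain d1 d2 where d: "d1 > 0" "d2 > 0"
      "\<And>x y. x \<in> {0..1} \<Longrightarrow> y \<in> {0..1} \<Longrightarrow> dist y x < d1 \<Longrightarrow> dist (G y) (G x) < \<epsilon>"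
      "\<And>x y. x \<in> {0..1} \<Longrightarrow> y \<in> {0..1} \<Longrightarrow> dist y x < d2 \<Longrightarrow> dist (\<phi> y) (\<phi> x) < \<epsilon>"
      unfolding uniformly_continuous_on_def using e by metis
    show "\<exists>\<delta>>0. \<forall>s t. 0 \<le> s \<and> s \<le> t \<and> t \<le> 1 \<and> t - s < \<delta> \<longrightarrow> norm (D t - D s) \<le> \<epsilon> * (\<sigma> t - \<sigma> s)"
    proof (intro exI[of _ "min d1 d2"] conjI allI impI)
      fix s t :: real assume st: "0 \<le> s \<and> s \<le> t \<and> t \<le> 1 \<and> t - s < min d1 d2"
      have near: "norm (G u - G t) \<le> \<epsilon>" "\<bar>\<phi> u - \<phi> s\<bar> \<le> \<epsilon>" if u: "u \<in> {s..t}" for u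
        using d(3)[of t u] d(4)[of s u] u st by (auto simp: dist_norm)
      have ii: "integral {0..t} f - integral {0..s} f = integral {s..t} f" if "f integrable_on {0..1}" for f :: "real \<Rightarrow> 'c::euclidean_space"
        using Henstock_Kurzweil_Integration.integral_combine[of 0 s t f] sub[OF that, of 0 t] st by (simp add: diff_eq_eq add.commute)
      have h1: "((\<lambda>u. \<psi> u *\<^sub>R G u + \<phi> u *\<^sub>R g u) has_integral
          integral {0..t} (\<lambda>t. \<psi> t *\<^sub>R G t + \<phi> t *\<^sub>R g t) - integral {0..s} (\<lambda>t. \<psi> t *\<^sub>R G t + \<phi> t *\<^sub>R g t)) {s..t}"
        unfolding ii[OF integrable_add[OF j1 j2]] using st by (intro integrable_integral sub[OF integrable_add[OF j1 j2]]) auto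
      have "(\<psi> has_integral \<phi> t - \<phi> s) {s..t}"
        by (rule fundamental_theorem_of_calculus) (use st in \<open>auto intro!: has_vector_derivative_within_subset[OF \<phi>(1)]\<close>)
      then have h2: "((\<lambda>u. \<psi> u *\<^sub>R G t) has_integral (\<phi> t - \<phi> s) *\<^sub>R G t) {s..t}"
        by (rule has_integral_scaleR_left)
      have h3: "((\<lambda>u. \<phi> s *\<^sub>R g u) has_integral \<phi> s *\<^sub>R (G t - G s)) {s..t}"
        using st by (intro has_integral_cmul H1_curveD(1)[OF G]) auto
      have h4: "((\<lambda>u. \<psi> u *\<^sub>R (G t - G u) + (\<phi> s - \<phi> u) *\<^sub>R g u) has_integral D t - D s) {s..t}"
        using has_integral_diff[OF has_integral_add[OF h2 h3] h1]
        by (simp add: D_def algebra_simps)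
      have "norm (D t - D s) \<le> integral {s..t} (\<lambda>u. \<epsilon> * (\<bar>\<psi> u\<bar> + norm (g u)))"
      proof (rule order_trans[OF eq_refl[OF arg_cong[OF integral_unique[OF h4, symmetric], of norm]] integral_norm_bound_integral])
        show "(\<lambda>u. \<epsilon> * (\<bar>\<psi> u\<bar> + norm (g u))) integrable_on {s..t}"
          using st by (intro integrable_on_mult_right sub[OF j4]) auto
        fix u assume u: "u \<in> {s..t}"
        have "norm (\<psi> u *\<^sub>R (G t - G u) + (\<phi> s - \<phi> u) *\<^sub>R g u) \<le> \<bar>\<psi> u\<bar> * norm (G t - G u) + \<bar>\<phi> s - \<phi> u\<bar> * norm (g u)"
          by (rule order_trans[OF norm_triangle_ineq]) simp
        also have "\<dots> \<le> \<bar>\<psi> u\<bar> * \<epsilon> + \<epsilon> * norm (g u)"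
          using near[OF u] by (intro add_mono mult_left_mono mult_right_mono) (auto simp: norm_minus_commute abs_minus_commute)
        finally show "norm (\<psi> u *\<^sub>R (G t - G u) + (\<phi> s - \<phi> u) *\<^sub>R g u) \<le> \<epsilon> * (\<bar>\<psi> u\<bar> + norm (g u))"
          by (simp add: algebra_simps)
      qed (use h4 in auto)
      also have "\<dots> = \<epsilon> * (\<sigma> t - \<sigma> s)" unfolding \<sigma>_def ii[OF j4] by simp
      finally show "norm (D t - D s) \<le> \<epsilon> * (\<sigma> t - \<sigma> s)" .
    qed (use d in auto)
  qed
  then have "integral {0..1} (\<lambda>t. \<psi> t *\<^sub>R G t + \<phi> t *\<^sub>R g t) = 0" using \<phi>0 by (simp add: D_def)
  then show "integral {0..1} (\<lambda>t. \<psi> t *\<^sub>R G t) = - integral {0..1} (\<lambda>t. \<phi> t *\<^sub>R g t)"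
    unfolding Henstock_Kurzweil_Integration.integral_add[OF j1 j2] by (simp add: eq_neg_iff_add_eq_0)
qed

lemma test_functionD:
  assumes "test_function \<phi>"
  shows "\<And>t. (\<phi> has_vector_derivative deriv \<phi> t) (at t)" "continuous_on UNIV (deriv \<phi>)" "\<phi> 0 = 0" "\<phi> 1 = 0"
proof -
  have C: "Ck_open (Suc 0) UNIV \<phi>" using assms by (simp add: test_function_def Ck_on_open_iff del: Ck_open.simps)
  note * = Ck_open_vector_derivativeD[OF open_UNIV C]
  have eq: "deriv \<phi> t = vector_derivative \<phi> (at t)" for t
    using *(1)[of t] by (intro DERIV_imp_deriv) (simp add: has_real_derivative_iff_has_vector_derivative)
  show "(\<phi> has_vector_derivative deriv \<phi> t) (at t)" for t using *(1)[of t] eq by simp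
  have "deriv \<phi> = (\<lambda>t. vector_derivative \<phi> (at t))" by (rule ext) (rule eq)
  then show "continuous_on UNIV (deriv \<phi>)" using *(2) by simp
  show "\<phi> 0 = 0" "\<phi> 1 = 0" using assms by (auto simp: test_function_def)
qed

lemma H1_curve_is_weak_derivative:
  assumes G: "H1_curve 0 1 G g"
  shows "is_weak_derivative G g"
  unfolding is_weak_derivative_def
proof (intro conjI allI impI H1_curve_L2_I[OF G])
  fix \<phi> assume "test_function \<phi>"
  note \<phi> = test_functionD[OF this]
  have c: "continuous_on {0..1} (deriv \<phi>)" using \<phi>(2) continuous_on_subset by blast
  note bp = H1_curve_by_parts[OF G has_vector_derivative_at_within[OF \<phi>(1)] c \<phi>(3,4)]
  have "(LINT t|lebesgue_on {0..1}. deriv \<phi> t *\<^sub>R G t) = integral {0..1} (\<lambda>t. deriv \<phi> t *\<^sub>R G t)"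
    by (rule lebesgue_integral_eq_integral[OF absolutely_integrable_imp_integrable[OF bp(1)]]) auto
  moreover have "(LINT t|lebesgue_on {0..1}. \<phi> t *\<^sub>R g t) = integral {0..1} (\<lambda>t. \<phi> t *\<^sub>R g t)"
    by (rule lebesgue_integral_eq_integral[OF absolutely_integrable_imp_integrable[OF bp(2)]]) auto
  ultimately show "(LINT t|lebesgue_on {0..1}. deriv \<phi> t *\<^sub>R G t) = - (LINT t|lebesgue_on {0..1}. \<phi> t *\<^sub>R g t)"
    using bp(3) by simp
qed

text \<open>The test function has derivative \<open>\<kappa> (D - m)\<close>, where \<open>m\<close> is the mean of \<open>D\<close> for the weight \<open>\<kappa>\<close>.\<close>

lemma weakly_constant:
  fixes D :: "real \<Rightarrow> real"
  assumes D: "continuous_on {0..1} D"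
    and zero: "\<And>\<phi>. test_function \<phi> \<Longrightarrow> integral {0..1} (\<lambda>t. deriv \<phi> t * D t) = 0"
    and ab: "0 < a" "a < b" "b < 1"
  shows "\<exists>m. \<forall>t\<in>{a<..<b}. D t = m"
proof -
  \<comment> \<open>A continuous weight, positive exactly on the open interval from \<open>a\<close>
    to \<open>b\<close>.\<close>
  define \<kappa> where "\<kappa> t = max 0 ((t - a) * (b - t))" for t
  \<comment> \<open>D continued by its end values, so that the primitive \<phi> is of class C^1 on
    the whole line.\<close>
  define E where "E t = D (max 0 (min 1 t))" for t
  have \<kappa>c: "continuous_on S \<kappa>" for S unfolding \<kappa>_def[abs_def] by (intro continuous_intros)
  have \<kappa>0: "\<kappa> t = 0" if "t \<notin> {a..b}" for t
  proof -
    have "(t - a) * (b - t) \<le> 0" using that ab by (auto intro: mult_nonpos_nonneg mult_nonneg_nonpos)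
    then show ?thesis by (simp add: \<kappa>_def)
  qed
  have \<kappa>pos: "\<kappa> t > 0" if "t \<in> {a<..<b}" for t using that by (simp add: \<kappa>_def)
  have \<kappa>nn: "\<kappa> t \<ge> 0" for t by (simp add: \<kappa>_def)
  have Ec: "continuous_on S E" for S
    unfolding E_def[abs_def] by (intro continuous_on_compose2[OF D] continuous_intros) auto
  have I\<kappa>: "integral {0..1} \<kappa> > 0"
  proof (rule ccontr)
    assume "\<not> integral {0..1} \<kappa> > 0"
    moreover have "integral {0..1} \<kappa> \<ge> 0"
      by (rule Henstock_Kurzweil_Integration.integral_nonneg[OF integrable_continuous_real[OF \<kappa>c]]) (rule \<kappa>nn)
    ultimately have "integral {0..1} \<kappa> = 0" by simp
    then have "\<kappa> ((a + b) / 2) = 0" using integral_eq_0_iff[OF \<kappa>c, of 0 1] \<kappa>nn ab by auto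
    then show False using \<kappa>pos[of "(a + b) / 2"] ab by auto
  qed
  define m where "m = integral {0..1} (\<lambda>t. \<kappa> t * E t) / integral {0..1} \<kappa>"
  define \<psi> where "\<psi> t = \<kappa> t * (E t - m)" for t
  have \<psi>c: "continuous_on S \<psi>" for S unfolding \<psi>_def[abs_def] by (intro continuous_intros \<kappa>c Ec)
  have \<psi>int: "\<psi> integrable_on {x..y}" for x y by (rule integrable_continuous_real[OF \<psi>c])
  have ci: "(\<lambda>t. \<kappa> t * E t) integrable_on {0..1}" by (intro integrable_continuous_real continuous_intros \<kappa>c Ec)
  have "integral {0..1} \<psi> = integral {0..1} (\<lambda>t. \<kappa> t * E t - m * \<kappa> t)"
    unfolding \<psi>_def[abs_def] by (simp add: algebra_simps)
  also have "\<dots> = integral {0..1} (\<lambda>t. \<kappa> t * E t) - m * integral {0..1} \<kappa>"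
    using Henstock_Kurzweil_Integration.integral_diff[OF ci integrable_on_mult_right[OF integrable_continuous_real[OF \<kappa>c], of m]]
    by simp
  finally have \<psi>0: "integral {0..1} \<psi> = 0" using I\<kappa> by (simp add: m_def)
  define \<phi> where "\<phi> t = integral {-1..t} \<psi>" for t
  have outL: "\<phi> t = 0" if "t < a" for t
  proof -
    have "integral {-1..t} \<psi> = integral {-1..t} (\<lambda>t. 0)"
      by (rule Henstock_Kurzweil_Integration.integral_cong) (use that \<kappa>0 in \<open>auto simp: \<psi>_def\<close>)
    then show ?thesis by (simp add: \<phi>_def)
  qed
  have comb: "\<phi> t = \<phi> s + integral {s..t} \<psi>" if "-1 \<le> s" "s \<le> t" for s t
    unfolding \<phi>_def using Henstock_Kurzweil_Integration.integral_combine[OF that \<psi>int] by simp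
  have zr: "integral {s..t} \<psi> = 0" if "b < s" for s t
  proof -
    have "integral {s..t} \<psi> = integral {s..t} (\<lambda>t. 0)"
      by (rule Henstock_Kurzweil_Integration.integral_cong) (use that \<kappa>0 in \<open>auto simp: \<psi>_def\<close>)
    then show ?thesis by simp
  qed
  have phi1: "\<phi> 1 = 0" using comb[of 0 1] outL[of 0] \<psi>0 ab by simp
  have outR: "\<phi> t = 0" if "b < t" for t
  proof (cases "t \<le> 1")
    case True
    then show ?thesis using comb[of t 1] zr[of t 1] phi1 that ab by simp
  next
    case False
    then show ?thesis using comb[of 1 t] zr[of 1 t] phi1 ab by simp
  qed
  have d: "(\<phi> has_vector_derivative \<psi> t) (at t)" for t
  proof (cases "t < a")
    case True
    have "((\<lambda>t. 0) has_vector_derivative \<psi> t) (at t)"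
      using \<kappa>0[of t] True by (simp add: \<psi>_def)
    then show ?thesis
      by (rule has_vector_derivative_transform_within_open[of _ _ _ "{..<a}"]) (use True outL in auto)
  next
    case False
    have "(\<phi> has_vector_derivative \<psi> t) (at t within {-1..t+1})"
      unfolding \<phi>_def[abs_def] by (rule integral_has_vector_derivative[OF \<psi>c]) (use False ab in auto)
    moreover have "at t within {-1..t+1} = at t" using False ab by (intro at_within_Icc_at) auto
    ultimately show ?thesis by simp
  qed
  have der: "deriv \<phi> t = \<psi> t" for t
    using d[of t] by (simp add: DERIV_imp_deriv has_real_derivative_iff_has_vector_derivative)
  have "Ck_open (Suc 0) UNIV \<phi>"
    by (rule Ck_open_vector_derivativeI[OF open_UNIV d]) (simp add: \<psi>c)
  then have "test_function \<phi>"
    unfolding test_function_def Ck_on_open_iff[OF open_UNIV] One_nat_def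
    using outL outR ab by (intro conjI exI[of _ a] exI[of _ b]) auto
  from zero[OF this] have z: "integral {0..1} (\<lambda>t. \<psi> t * E t) = 0"
    unfolding der by (subst (asm) Henstock_Kurzweil_Integration.integral_cong[of _ _ "\<lambda>t. \<psi> t * E t"]) (auto simp: E_def)
  \<comment> \<open>Subtracting \<open>m * \<psi>\<close>, whose integral is 0, turns the tested
    expression into a weighted square, which must then vanish wherever the weight is
    positive.\<close>
  have "integral {0..1} (\<lambda>t. \<kappa> t * (E t - m)\<^sup>2) = integral {0..1} (\<lambda>t. \<psi> t * E t - m * \<psi> t)"
    by (rule Henstock_Kurzweil_Integration.integral_cong) (simp add: \<psi>_def power2_eq_square algebra_simps)
  also have "\<dots> = integral {0..1} (\<lambda>t. \<psi> t * E t) - m * integral {0..1} \<psi>"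
    using Henstock_Kurzweil_Integration.integral_diff[of "\<lambda>t. \<psi> t * E t" "{0..1}" "\<lambda>t. m * \<psi> t"]
      integrable_continuous_real[of 0 1 "\<lambda>t. \<psi> t * E t"] \<psi>c[of "{0..1}"] Ec[of "{0..1}"]
      integrable_on_mult_right[OF \<psi>int[of 0 1], of m]
    by (simp add: continuous_on_mult)
  finally have "integral {0..1} (\<lambda>t. \<kappa> t * (E t - m)\<^sup>2) = 0" using z \<psi>0 by simp
  moreover have "continuous_on {0..1} (\<lambda>t. \<kappa> t * (E t - m)\<^sup>2)" by (intro continuous_intros \<kappa>c Ec)
  ultimately have *: "\<kappa> t * (E t - m)\<^sup>2 = 0" if "t \<in> {0..1}" for t
    using integral_eq_0_iff[of 0 1 "\<lambda>t. \<kappa> t * (E t - m)\<^sup>2"] \<kappa>nn that by auto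
  have "D t = m" if "t \<in> {a<..<b}" for t
    using *[of t] \<kappa>pos[OF that] that ab by (auto simp: E_def)
  then show ?thesis by blast
qed

text \<open>Let G be the primitive of \<open>f\<close>. By integration by parts \<open>f\<close> is
  also a weak derivative of G, so F - G is orthogonal to the derivatives of all test functions; it
  is constant inside the interval, and by continuity up to the ends.\<close>

lemma is_weak_derivative_H1_curve:
  fixes F :: "real \<Rightarrow> 'a::euclidean_space"
  assumes F: "continuous_on {0..1} F" and f: "is_weak_derivative F f"
  shows "H1_curve 0 1 F f"
proof -
  have L: "L2_I f" using f by (simp add: is_weak_derivative_def)
  note fa = L2_I_abs_integrable[OF L]
  have fi: "f integrable_on {0..1}" using fa(1) by (simp add: absolutely_integrable_on_def)
  define G where "G t = integral {0..t} f" for t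
  have sub: "f integrable_on {s..t}" if "0 \<le> s" "t \<le> 1" for s t
    using integrable_subinterval_real[OF fi, of s t] that by auto
  have G: "H1_curve 0 1 G f"
    unfolding H1_curve_def
  proof (intro conjI allI impI fa(2))
    fix s t :: real assume st: "0 \<le> s \<and> s \<le> t \<and> t \<le> 1"
    have "G t - G s = integral {s..t} f"
      using Henstock_Kurzweil_Integration.integral_combine[of 0 s t f] sub[of 0 t] st by (simp add: G_def diff_eq_eq add.commute)
    then show "(f has_integral G t - G s) {s..t}" using sub[of s t] st by (simp add: integrable_integral)
  qed
  have Gc: "continuous_on {0..1} G" unfolding G_def[abs_def] by (rule indefinite_integral_continuous_1[OF fi])
  define D where "D t = F t - G t" for t
  have Dc: "continuous_on {0..1} D" unfolding D_def[abs_def] by (intro continuous_intros F Gc)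
  have zero: "integral {0..1} (\<lambda>t. deriv \<phi> t *\<^sub>R D t) = 0" if \<phi>: "test_function \<phi>" for \<phi>
  proof -
    have c: "continuous_on {0..1} (deriv \<phi>)" using test_functionD(2)[OF \<phi>] continuous_on_subset by blast
    have i: "(\<lambda>t. deriv \<phi> t *\<^sub>R F t) absolutely_integrable_on {0..1}" "(\<lambda>t. deriv \<phi> t *\<^sub>R G t) absolutely_integrable_on {0..1}"
      by (intro absolutely_integrable_continuous_real continuous_intros c F Gc)+
    have e: "(LINT t|lebesgue_on {0..1}. deriv \<phi> t *\<^sub>R F t) = (LINT t|lebesgue_on {0..1}. deriv \<phi> t *\<^sub>R G t)"
      using f H1_curve_is_weak_derivative[OF G] \<phi> unfolding is_weak_derivative_def by simp
    have "integral {0..1} (\<lambda>t. deriv \<phi> t *\<^sub>R F t) = integral {0..1} (\<lambda>t. deriv \<phi> t *\<^sub>R G t)"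
      using e lebesgue_integral_eq_integral[OF absolutely_integrable_imp_integrable[OF i(1)]]
        lebesgue_integral_eq_integral[OF absolutely_integrable_imp_integrable[OF i(2)]] by simp
    then show ?thesis
      using Henstock_Kurzweil_Integration.integral_diff[of "\<lambda>t. deriv \<phi> t *\<^sub>R F t" "{0..1}" "\<lambda>t. deriv \<phi> t *\<^sub>R G t"] i
      by (simp add: D_def scaleR_diff_right absolutely_integrable_on_def)
  qed
  have const: "D t \<bullet> i = D (1/2) \<bullet> i" if t: "t \<in> {0<..<1}" for t i
  proof -
    have z: "integral {0..1} (\<lambda>t. deriv \<phi> t * (D t \<bullet> i)) = 0" if \<phi>: "test_function \<phi>" for \<phi>
    proof -
      have c: "continuous_on {0..1} (deriv \<phi>)" using test_functionD(2)[OF \<phi>] continuous_on_subset by blast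
      have "((\<lambda>t. deriv \<phi> t *\<^sub>R D t) has_integral 0) {0..1}"
        using zero[OF \<phi>] integrable_continuous_real[of 0 1 "\<lambda>t. deriv \<phi> t *\<^sub>R D t"] c Dc
        by (metis continuous_on_scaleR integrable_integral)
      from has_integral_linear[OF this bounded_linear_inner_left[of i]]
      show ?thesis by (simp add: o_def integral_unique)
    qed
    have Dic: "continuous_on {0..1} (\<lambda>t. D t \<bullet> i)" by (intro continuous_intros Dc)
    define a b where "a = min t (1/2) / 2" and "b = (1 + max t (1/2)) / 2"
    have ab: "0 < a" "a < b" "b < 1" "t \<in> {a<..<b}" "1/2 \<in> {a<..<b}" using t by (auto simp: a_def b_def)
    from weakly_constant[OF Dic z ab(1-3)] show ?thesis using ab(4,5) by metis
  qed
  have inn: "D t = D (1/2)" if "t \<in> {0<..<1}" for t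
    by (rule euclidean_eqI) (rule const[OF that])
  have "D t = D (1/2)" if t: "t \<in> {0..1}" for t
  proof -
    have cl: "closure {0<..<1::real} = {0..1}" by (rule closure_greaterThanLessThan) simp
    show ?thesis
      by (rule continuous_constant_on_closure[of "{0<..<1::real}" D, unfolded cl, OF Dc inn t])
  qed
  note Dconst = this
  have "F t - F s = G t - G s" if "s \<in> {0..1}" "t \<in> {0..1}" for s t
  proof -
    have "D t = D s" by (rule trans[OF Dconst[OF that(2)] Dconst[OF that(1), symmetric]])
    then show ?thesis by (simp add: D_def algebra_simps)
  qed
  then show ?thesis using G unfolding H1_curve_def by auto
qed

text \<open>\<open>weak_derivative\<close> is an arbitrary choice. Two derivatives of one curve
  differ on a negligible set, so the energy may be computed with any of them.\<close>

lemma J1_eq: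
  assumes F: "continuous_on {0..1} F" and f: "H1_curve 0 1 F f"
  shows "J1 F = integral {0..1} (\<lambda>t. (norm (f t))\<^sup>2)" "H1_curve 0 1 F (weak_derivative F)"
proof -
  have "is_weak_derivative F (weak_derivative F)"
    unfolding weak_derivative_def
    by (rule someI[where P = "is_weak_derivative F", OF H1_curve_is_weak_derivative[OF f]])
  then show w: "H1_curve 0 1 F (weak_derivative F)" by (rule is_weak_derivative_H1_curve[OF F])
  have "integrable (lebesgue_on {0..1}) (\<lambda>t. (norm (weak_derivative F t))\<^sup>2)"
    using H1_curve_L2_I[OF w] by (simp add: L2_I_def)
  then have "J1 F = integral {0..1} (\<lambda>t. (norm (weak_derivative F t))\<^sup>2)"
    unfolding J1_def by (intro lebesgue_integral_eq_integral) auto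
  also have "\<dots> = integral {0..1} (\<lambda>t. (norm (f t))\<^sup>2)"
    by (rule H1_curve_energy_unique[OF w f]) simp
  finally show "J1 F = integral {0..1} (\<lambda>t. (norm (f t))\<^sup>2)" .
qed

lemma H1_maps_iff:
  "F \<in> H1_maps M \<longleftrightarrow> (\<exists>f. H1_curve 0 1 F f) \<and> (\<forall>t\<in>{0..1}. F t \<in> M)"
proof
  assume "F \<in> H1_maps M"
  then show "(\<exists>f. H1_curve 0 1 F f) \<and> (\<forall>t\<in>{0..1}. F t \<in> M)"
    using is_weak_derivative_H1_curve unfolding H1_maps_def by blast
next
  assume L: "(\<exists>f. H1_curve 0 1 F f) \<and> (\<forall>t\<in>{0..1}. F t \<in> M)"
  then obtain f where f: "H1_curve 0 1 F f" by blast
  have Fc: "continuous_on {0..1} F" by (rule H1_curve_continuous_on[OF f])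
  have "F \<in> borel_measurable (lebesgue_on {0..1})"
    by (rule continuous_imp_measurable_on_sets_lebesgue[OF Fc]) simp
  moreover have "integrable (lebesgue_on {0..1}) (\<lambda>t. (norm (F t))\<^sup>2)"
    by (rule absolutely_integrable_imp_integrable[OF absolutely_integrable_continuous_real])
      (auto intro!: continuous_intros Fc)
  ultimately have "L2_I F" by (simp add: L2_I_def)
  then show "F \<in> H1_maps M"
    using L Fc H1_curve_is_weak_derivative[OF f] unfolding H1_maps_def by blast
qed

lemma penalized_minimizer_le:
  assumes F: "is_penalized_minimizer M n t Y lam F" and G: "H1_curve 0 1 G g" "\<And>s. s \<in> {0..1} \<Longrightarrow> G s \<in> M"
    and f: "H1_curve 0 1 F f"
  shows "emp_risk M n t Y F + lam * integral {0..1} (\<lambda>s. (norm (f s))\<^sup>2)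
       \<le> emp_risk M n t Y G + lam * integral {0..1} (\<lambda>s. (norm (g s))\<^sup>2)"
proof -
  have "G \<in> H1_maps M" using G H1_maps_iff by blast
  then have "emp_risk M n t Y F + lam * J1 F \<le> emp_risk M n t Y G + lam * J1 G"
    using F by (simp add: is_penalized_minimizer_def)
  then show ?thesis
    using J1_eq(1)[OF H1_curve_continuous_on[OF f] f] J1_eq(1)[OF H1_curve_continuous_on[OF G(1)] G(1)] by simp
qed

section \<open>Minimizers of the penalized functional\<close>

lemma local_retraction_mono: "local_retraction k M P p r \<Longrightarrow> l \<le> k \<Longrightarrow> local_retraction l M P p r"
  unfolding local_retraction_def using Ck_open_mono by blast

lemma locally_retractable_mono: "locally_retractable k M \<Longrightarrow> l \<le> k \<Longrightarrow> locally_retractable l M"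
  unfolding locally_retractable_def using local_retraction_mono by blast

lemma submanifold_locally_retractable:
  assumes "submanifold (Ck_on k) M" "k \<ge> 1"
  shows "locally_retractable k M"
  unfolding locally_retractable_def using submanifold_retraction[OF assms] by blast

lemma geodesic_data_interior:
  assumes G: "geodesic_data M a b \<gamma> g g2" and t: "t \<in> {a<..<b}"
  shows "(\<gamma> has_vector_derivative g t) (at t)" "(g has_vector_derivative g2 t) (at t)"
  using geodesic_dataD(4,5)[OF G, of t] at_within_Icc_at[of a t b] t by auto

lemma lip_min_Ck:
  assumes m: "lip_min M a b c \<gamma>" and R: "locally_retractable k M" and k: "k \<ge> 2" and ab: "a < b"
  shows "Ck_open k {a<..<b} \<gamma>"
proof (rule Ck_open_local)
  fix t assume t: "t \<in> {a<..<b}"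
  obtain g g2 where G: "geodesic_data M a b \<gamma> g g2"
    using lip_min_geodesic_data[OF m R k ab] by metis
  note D = geodesic_dataD[OF G]
  have "\<gamma> t \<in> M" using D(3) t by auto
  then obtain P r where PR: "local_retraction k M P (\<gamma> t) r" by (rule locally_retractableD[OF R])
  note P = local_retractionD[OF PR]
  define I where "I = {a<..<b} \<inter> \<gamma> -` ball (\<gamma> t) r"
  have I: "open I"
    unfolding I_def by (rule continuous_open_preimage[OF continuous_on_subset[OF lip_min_continuous[OF m]]]) auto
  have sub: "s \<in> {a<..<b}" "s \<in> {a..b}" "\<gamma> s \<in> ball (\<gamma> t) r" if "s \<in> I" for s using that by (auto simp: I_def)
  note eq = geodesic_equation(3)[OF I PR k D(3)[OF sub(2)] sub(3) geodesic_data_interior[OF G sub(1)] D(6)[OF sub(2)]]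
  have "Ck_open k I \<gamma>"
    by (rule geodesic_Ck[OF I PR sub(3) k geodesic_data_interior[OF G sub(1)] eq]) (assumption+)
  moreover have "t \<in> I" using t P(1) by (simp add: I_def)
  ultimately show "\<exists>V. open V \<and> t \<in> V \<and> Ck_open k V \<gamma>" using I by blast
qed

text \<open>After integration by parts only boundary terms remain, the acceleration being normal to \<open>M\<close>.\<close>

lemma geodesic_first_variation:
  assumes PR: "local_retraction k M P p r" and k: "k \<ge> 2" and G: "geodesic_data M a b \<gamma> g g2" and ab: "a < b"
    and ball: "\<And>t. t \<in> {a..b} \<Longrightarrow> \<gamma> t \<in> ball p r"
    and \<eta>: "\<And>t. t \<in> {a..b} \<Longrightarrow> (\<eta> has_vector_derivative e t) (at t within {a..b})" and e: "continuous_on {a..b} e"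
  obtains s0 E where "s0 > 0" "E 0 = integral {a..b} (\<lambda>t. (norm (g t))\<^sup>2)"
    "\<And>s t. \<bar>s\<bar> < s0 \<Longrightarrow> t \<in> {a..b} \<Longrightarrow> P (\<gamma> t + s *\<^sub>R \<eta> t) \<in> M"
    "\<And>s. \<bar>s\<bar> < s0 \<Longrightarrow> \<exists>h. H1_curve a b (\<lambda>t. P (\<gamma> t + s *\<^sub>R \<eta> t)) h \<and> integral {a..b} (\<lambda>t. (norm (h t))\<^sup>2) = E s"
    "(E has_real_derivative 2 * (g b \<bullet> dird P (\<eta> b) (\<gamma> b) - g a \<bullet> dird P (\<eta> a) (\<gamma> a))) (at 0)"
proof -
  note P = local_retractionD[OF PR] and D = geodesic_dataD[OF G]
  have f: "Ck_open 2 (ball p r) P" using Ck_open_mono[OF P(3) k] .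
  define E where "E s = integral {a..b} (\<lambda>t. (norm (dird P (g t + s *\<^sub>R e t) (\<gamma> t + s *\<^sub>R \<eta> t)))\<^sup>2)" for s
  note nt = at_within_Icc_nontrivial[OF ab]
  have vel: "dird P (g t) (\<gamma> t) = g t" if "t \<in> {a..b}" for t
    by (rule retraction_velocity[OF PR _ that nt[OF that] _ D(4)[OF that]]) (use k ball D(3) in auto)
  note fv = first_variation[OF open_ball f ball D(4,1) \<eta> e, folded E_def]
  obtain s0 where s0: "s0 > 0" "\<And>s t. \<bar>s\<bar> < s0 \<Longrightarrow> t \<in> {a..b} \<Longrightarrow> \<gamma> t + s *\<^sub>R \<eta> t \<in> ball p r"
    "\<And>s. \<bar>s\<bar> < s0 \<Longrightarrow> H1_curve a b (\<lambda>t. P (\<gamma> t + s *\<^sub>R \<eta> t)) (\<lambda>t. dird P (g t + s *\<^sub>R e t) (\<gamma> t + s *\<^sub>R \<eta> t))"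
    "(E has_real_derivative integral {a..b} (\<lambda>t. 2 * (dird P (g t) (\<gamma> t) \<bullet> (dird (dird P (g t)) (\<eta> t) (\<gamma> t) + dird P (e t) (\<gamma> t))))) (at 0)"
    by (rule fv) (assumption | rule that | assumption)+
  have perp: "g2 t \<bullet> dird P y (\<gamma> t) = 0" if "t \<in> {a..b}" for t y
    by (rule D(6)[OF that tangent_space_retraction(2)[OF PR _ D(3)[OF that] ball[OF that]]]) (use k in simp)
  \<comment> \<open>The integrand is the derivative of
    \<open>2 * (g t \<bullet> dird P (\<eta> t) (\<gamma> t))\<close>: symmetry of second
    derivatives matches the first terms, and normality of \<open>g2\<close> removes the other
    one.\<close>
  have "((\<lambda>t. 2 * (dird P (g t) (\<gamma> t) \<bullet> (dird (dird P (g t)) (\<eta> t) (\<gamma> t) + dird P (e t) (\<gamma> t)))) has_integral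
     2 * (g b \<bullet> dird P (\<eta> b) (\<gamma> b)) - 2 * (g a \<bullet> dird P (\<eta> a) (\<gamma> a))) {a..b}"
  proof (rule fundamental_theorem_of_calculus)
    fix t assume t: "t \<in> {a..b}"
    have d: "((\<lambda>t. dird P (\<eta> t) (\<gamma> t)) has_vector_derivative dird (dird P (\<eta> t)) (g t) (\<gamma> t) + dird P (e t) (\<gamma> t)) (at t within {a..b})"
      by (rule has_vector_derivative_dird_dird[OF open_ball f, of \<gamma> t "{a..b}" "g t" \<eta> "e t"]) (use ball t D(4)[OF t] \<eta>[OF t] in auto)
    have c: "dird (dird P (\<eta> t)) (g t) (\<gamma> t) = dird (dird P (g t)) (\<eta> t) (\<gamma> t)"
      by (rule dird_dird_commute[OF open_ball f ball[OF t]])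
    have "((\<lambda>t. g t \<bullet> dird P (\<eta> t) (\<gamma> t)) has_vector_derivative
        g t \<bullet> (dird (dird P (\<eta> t)) (g t) (\<gamma> t) + dird P (e t) (\<gamma> t)) + g2 t \<bullet> dird P (\<eta> t) (\<gamma> t)) (at t within {a..b})"
      using has_derivative_inner[OF D(5)[OF t, unfolded has_vector_derivative_def] d[unfolded has_vector_derivative_def]]
      unfolding has_vector_derivative_def by (rule has_derivative_eq_rhs) (simp add: algebra_simps)
    then have "((\<lambda>t. g t \<bullet> dird P (\<eta> t) (\<gamma> t)) has_vector_derivative
        dird P (g t) (\<gamma> t) \<bullet> (dird (dird P (g t)) (\<eta> t) (\<gamma> t) + dird P (e t) (\<gamma> t))) (at t within {a..b})"
      unfolding perp[OF t] c vel[OF t] by simp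
    from bounded_linear.has_vector_derivative[OF bounded_linear_mult_right this, of 2]
    show "((\<lambda>t. 2 * (g t \<bullet> dird P (\<eta> t) (\<gamma> t))) has_vector_derivative
        2 * (dird P (g t) (\<gamma> t) \<bullet> (dird (dird P (g t)) (\<eta> t) (\<gamma> t) + dird P (e t) (\<gamma> t)))) (at t within {a..b})" .
  qed (use ab in simp)
  from integral_unique[OF this] have "(E has_real_derivative 2 * (g b \<bullet> dird P (\<eta> b) (\<gamma> b) - g a \<bullet> dird P (\<eta> a) (\<gamma> a))) (at 0)"
    using s0(4) by (simp add: right_diff_distrib)
  moreover have "E 0 = integral {a..b} (\<lambda>t. (norm (g t))\<^sup>2)"
    unfolding E_def by (rule Henstock_Kurzweil_Integration.integral_cong) (simp add: vel)
  moreover have "\<exists>h. H1_curve a b (\<lambda>t. P (\<gamma> t + s *\<^sub>R \<eta> t)) h \<and> integral {a..b} (\<lambda>t. (norm (h t))\<^sup>2) = E s" if "\<bar>s\<bar> < s0" for s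
    using s0(3)[OF that] unfolding E_def by blast
  ultimately show ?thesis using that[OF s0(1), of E] P(4) s0(2) by blast
qed

text \<open>M is an arbitrary set here, so that the comparison arguments also serve minimizers into
  the whole Euclidean space.\<close>

locale penalized_setup =
  fixes M :: "'a::euclidean_space set" and F :: "real \<Rightarrow> 'a" and Y :: "nat \<Rightarrow> 'a" and t :: "nat \<Rightarrow> real"
    and n :: nat and lam :: real
  assumes n: "n \<ge> 1" and t: "inj_on t {1..n}" "\<And>i. i \<in> {1..n} \<Longrightarrow> 0 < t i \<and> t i < 1"
    and lam: "lam > 0" and F: "is_penalized_minimizer M n t Y lam F"
begin

definition "f = weak_derivative F"

lemma H1_F: "H1_curve 0 1 F f" and F_in: "\<And>s. s \<in> {0..1} \<Longrightarrow> F s \<in> M"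
proof -
  have H: "F \<in> H1_maps M" using F by (simp add: is_penalized_minimizer_def)
  then obtain f' where "H1_curve 0 1 F f'" unfolding H1_maps_iff by blast
  then show "H1_curve 0 1 F f" unfolding f_def by (intro J1_eq(2) H1_curve_continuous_on)
  show "\<And>s. s \<in> {0..1} \<Longrightarrow> F s \<in> M" using H unfolding H1_maps_iff by blast
qed

lemma F_continuous: "continuous_on {0..1} F" by (rule H1_curve_continuous_on[OF H1_F])

text \<open>The competitor need not match F at an end of the unit interval. This freedom is the
  natural boundary condition behind the vanishing end derivatives. The empirical risk is kept in the
  inequality because the replaced piece may move the curve at a design point.\<close>

lemma replacement:
  assumes ab: "0 \<le> a" "a \<le> b" "b \<le> 1" and G: "H1_curve a b G g" "\<And>s. s \<in> {a..b} \<Longrightarrow> G s \<in> M"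
    and ends: "a = 0 \<or> G a = F a" "b = 1 \<or> G b = F b"
  shows "emp_risk M n t Y F + lam * integral {a..b} (\<lambda>s. (norm (f s))\<^sup>2)
     \<le> emp_risk M n t Y (\<lambda>s. if s \<in> {a..b} then G s else F s) + lam * integral {a..b} (\<lambda>s. (norm (g s))\<^sup>2)"
proof -
  define G' where "G' s = (if s \<in> {a..b} then G s else F s)" for s
  define h where "h s = (if s \<in> {a..b} then g s else f s)" for s
  have m: "H1_curve a b G' h" by (rule H1_curve_cong[OF G(1)]) (auto simp: G'_def h_def)
  have l: "H1_curve 0 b G' h"
  proof (cases "a = 0")
    case False
    have "H1_curve 0 a G' h"
      by (rule H1_curve_cong[OF H1_curve_subinterval[OF H1_F, of 0 a]])
        (use ab False ends(1) in \<open>auto simp: G'_def h_def\<close>)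
    then show ?thesis by (rule H1_curve_combine[OF _ m ab(1,2)])
  qed (use m in simp)
  have G'h: "H1_curve 0 1 G' h"
  proof (cases "b = 1")
    case False
    have "H1_curve b 1 G' h"
      by (rule H1_curve_cong[OF H1_curve_subinterval[OF H1_F, of b 1]])
        (use ab False ends(2) in \<open>auto simp: G'_def h_def\<close>)
    then show ?thesis by (rule H1_curve_combine[OF l _ _ ab(3)]) (use ab in simp)
  qed (use l in simp)
  have split: "integral {0..1} (\<lambda>s. (norm (u s))\<^sup>2) = integral {0..a} (\<lambda>s. (norm (u s))\<^sup>2)
      + integral {a..b} (\<lambda>s. (norm (u s))\<^sup>2) + integral {b..1} (\<lambda>s. (norm (u s))\<^sup>2)"
    if u: "H1_curve 0 1 U u" for U u
  proof -
    have i: "(\<lambda>s. (norm (u s))\<^sup>2) integrable_on {0..1}" by (rule H1_curveD(2)[OF u])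
    have i2: "(\<lambda>s. (norm (u s))\<^sup>2) integrable_on {0..b}" using integrable_subinterval_real[OF i, of 0 b] ab by auto
    show ?thesis
      using Henstock_Kurzweil_Integration.integral_combine[of 0 b 1, OF _ _ i] Henstock_Kurzweil_Integration.integral_combine[of 0 a b, OF _ _ i2] ab
      by simp
  qed
  have e1: "integral {0..a} (\<lambda>s. (norm (h s))\<^sup>2) = integral {0..a} (\<lambda>s. (norm (f s))\<^sup>2)"
    by (rule H1_curve_energy_cong) (auto simp: h_def)
  have e2: "integral {a..b} (\<lambda>s. (norm (h s))\<^sup>2) = integral {a..b} (\<lambda>s. (norm (g s))\<^sup>2)"
    by (rule H1_curve_energy_cong) (auto simp: h_def)
  have e3: "integral {b..1} (\<lambda>s. (norm (h s))\<^sup>2) = integral {b..1} (\<lambda>s. (norm (f s))\<^sup>2)"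
    by (rule H1_curve_energy_cong) (auto simp: h_def)
  have "emp_risk M n t Y F + lam * integral {0..1} (\<lambda>s. (norm (f s))\<^sup>2)
       \<le> emp_risk M n t Y G' + lam * integral {0..1} (\<lambda>s. (norm (h s))\<^sup>2)"
    by (rule penalized_minimizer_le[OF F G'h _ H1_F]) (use F_in G(2) ab in \<open>auto simp: G'_def\<close>)
  then show ?thesis
    unfolding split[OF H1_F] split[OF G'h] e1 e2 e3 by (simp add: algebra_simps G'_def[abs_def])
qed

lemma energy_minimal:
  assumes ab: "0 \<le> a" "a \<le> b" "b \<le> 1" and G: "H1_curve a b G g" "\<And>s. s \<in> {a..b} \<Longrightarrow> G s \<in> M"
    and ends: "a = 0 \<or> G a = F a" "b = 1 \<or> G b = F b"
    and des: "\<And>i. i \<in> {1..n} \<Longrightarrow> t i \<in> {a..b} \<Longrightarrow> G (t i) = F (t i)"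
  shows "integral {a..b} (\<lambda>s. (norm (f s))\<^sup>2) \<le> integral {a..b} (\<lambda>s. (norm (g s))\<^sup>2)"
proof -
  have "emp_risk M n t Y (\<lambda>s. if s \<in> {a..b} then G s else F s) = emp_risk M n t Y F"
    unfolding emp_risk_def using des by (auto intro!: sum.cong arg_cong[of _ _ "\<lambda>x. x / real n"])
  then show ?thesis using replacement[OF assms(1-7)] lam by simp
qed

lemma F_constant_left:
  assumes b: "0 < b" "b \<le> 1" and free: "\<And>i. i \<in> {1..n} \<Longrightarrow> b \<le> t i" and s: "s \<in> {0..b}"
  shows "F s = F b"
proof -
  have "H1_curve 0 b (\<lambda>s. F b) (\<lambda>s. 0)"
    by (rule H1_curve_continuous_derivative) (auto intro: derivative_eq_intros)
  then have "integral {0..b} (\<lambda>s. (norm (f s))\<^sup>2) \<le> integral {0..b} (\<lambda>s. (norm (0::'a))\<^sup>2)"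
    by (rule energy_minimal[rotated 3]) (use b F_in free in \<open>force+\<close>)
  then have e: "integral {0..b} (\<lambda>s. (norm (f s))\<^sup>2) = 0"
    using Henstock_Kurzweil_Integration.integral_nonneg[OF H1_curveD(2)[OF H1_curve_subinterval[OF H1_F, of 0 b]]] b by force
  \<comment> \<open>Zero energy gives a connection of length 0, of which only the bound on the chord
    matters; hence UNIV in place of M.\<close>
  have "lip_conn UNIV (F s) (F b) (sqrt 0)"
  proof (rule lip_conn_energy[OF H1_curve_subinterval[OF H1_F]])
    have "integral {s..b} (\<lambda>s. (norm (f s))\<^sup>2) \<le> integral {0..b} (\<lambda>s. (norm (f s))\<^sup>2)"
      by (rule integral_subset_le) (use s b H1_curveD(2)[OF H1_curve_subinterval[OF H1_F]] in auto)
    then show "(b - s) * integral {s..b} (\<lambda>s. (norm (f s))\<^sup>2) \<le> 0" using e s by (simp add: mult_nonneg_nonpos)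
  qed (use s b in auto)
  then show ?thesis using lip_conn_norm_le by fastforce
qed

lemma F_constant_right:
  assumes a: "0 \<le> a" "a < 1" and free: "\<And>i. i \<in> {1..n} \<Longrightarrow> t i \<le> a" and s: "s \<in> {a..1}"
  shows "F s = F a"
proof -
  have "H1_curve a 1 (\<lambda>s. F a) (\<lambda>s. 0)"
    by (rule H1_curve_continuous_derivative) (auto intro: derivative_eq_intros)
  then have "integral {a..1} (\<lambda>s. (norm (f s))\<^sup>2) \<le> integral {a..1} (\<lambda>s. (norm (0::'a))\<^sup>2)"
    by (rule energy_minimal[rotated 3]) (use a F_in free in \<open>force+\<close>)
  then have e: "integral {a..1} (\<lambda>s. (norm (f s))\<^sup>2) = 0"
    using Henstock_Kurzweil_Integration.integral_nonneg[OF H1_curveD(2)[OF H1_curve_subinterval[OF H1_F, of a 1]]] a by force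
  have "lip_conn UNIV (F a) (F s) (sqrt 0)"
  proof (rule lip_conn_energy[OF H1_curve_subinterval[OF H1_F]])
    have "integral {a..s} (\<lambda>s. (norm (f s))\<^sup>2) \<le> integral {a..1} (\<lambda>s. (norm (f s))\<^sup>2)"
      by (rule integral_subset_le) (use s a H1_curveD(2)[OF H1_curve_subinterval[OF H1_F]] in auto)
    then show "(s - a) * integral {a..s} (\<lambda>s. (norm (f s))\<^sup>2) \<le> 0" using e s by (simp add: mult_nonneg_nonpos)
  qed (use s a in auto)
  then show ?thesis using lip_conn_norm_le by fastforce
qed

end

text \<open>Class 2 is built in; higher classes enter as hypotheses of the regularity
  lemmas.\<close>

locale penalized_manifold = penalized_setup +
  assumes M: "compact M" "connected M" and R: "locally_retractable 2 M" and Y: "\<And>i. i \<in> {1..n} \<Longrightarrow> Y i \<in> M"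
begin

text \<open>The competitor is a minimizing geodesic between the two values of F, run through
  affinely on the given interval; its energy is the squared distance divided by
  \<open>b - a\<close>.\<close>

lemma energy_le_lip_dist:
  assumes ab: "0 \<le> a" "a < b" "b \<le> 1" and free: "\<And>i. i \<in> {1..n} \<Longrightarrow> t i \<notin> {a<..<b}"
  shows "(b - a) * integral {a..b} (\<lambda>s. (norm (f s))\<^sup>2) \<le> (lip_dist M (F a) (F b))\<^sup>2"
proof -
  obtain \<gamma> g g2 where G: "geodesic_data M 0 1 \<gamma> g g2" "\<gamma> 0 = F a" "\<gamma> 1 = F b"
    "\<And>t. t \<in> {0..1} \<Longrightarrow> norm (g t) = lip_dist M (F a) (F b)"
    by (rule lip_min_geodesic_exists[OF M R order_refl F_in F_in, of a b]) (use ab that in auto)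
  note D = geodesic_dataD[OF G(1)]
  define L where "L = lip_dist M (F a) (F b)"
  define k where "k = 1 / (b - a)"
  define w where "w s = k * (s - a)" for s
  have k: "k > 0" "k * (b - a) = 1" using ab by (auto simp: k_def)
  have w: "w s \<in> {0..1}" if "s \<in> {a..b}" for s
    using that k mult_left_mono[of "s - a" "b - a" k] by (auto simp: w_def)
  have "H1_curve a b (\<lambda>s. \<gamma> (w s)) (\<lambda>s. k *\<^sub>R g (w s))"
  proof (rule H1_curve_continuous_derivative)
    show "((\<lambda>s. \<gamma> (w s)) has_vector_derivative k *\<^sub>R g (w s)) (at s within {a..b})" if "s \<in> {a..b}" for s
    proof -
      have "(w has_vector_derivative k) (at s within {a..b})"
        unfolding w_def[abs_def] has_real_derivative_iff_has_vector_derivative[symmetric] by (auto intro!: derivative_eq_intros)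
      moreover have "(\<gamma> has_vector_derivative g (w s)) (at (w s) within w ` {a..b})"
        by (rule has_vector_derivative_within_subset[OF D(4)[OF w[OF that]]]) (use w in auto)
      ultimately show ?thesis using vector_diff_chain_within by (fastforce simp: o_def)
    qed
    have "continuous_on {a..b} w" unfolding w_def[abs_def] by (intro continuous_intros)
    then show "continuous_on {a..b} (\<lambda>s. k *\<^sub>R g (w s))"
      by (intro continuous_intros continuous_on_compose2[OF D(1)]) (use w in auto)
  qed
  then have "integral {a..b} (\<lambda>s. (norm (f s))\<^sup>2) \<le> integral {a..b} (\<lambda>s. (norm (k *\<^sub>R g (w s)))\<^sup>2)"
  proof (rule energy_minimal[rotated 3])
    show "\<gamma> (w (t i)) = F (t i)" if "i \<in> {1..n}" "t i \<in> {a..b}" for i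
    proof -
      have "t i = a \<or> t i = b" using free[OF that(1)] that(2) by auto
      then show ?thesis using G(2,3) k by (auto simp: w_def)
    qed
  qed (use ab D(3) w G(2,3) k in \<open>auto simp: w_def\<close>)
  also have "\<dots> = integral {a..b} (\<lambda>s. (k * L)\<^sup>2)"
    by (rule Henstock_Kurzweil_Integration.integral_cong) (use G(4) w k in \<open>simp add: L_def\<close>)
  also have "\<dots> = (b - a) * (k * L)\<^sup>2" using ab by simp
  finally have "(b - a) * integral {a..b} (\<lambda>s. (norm (f s))\<^sup>2) \<le> (b - a) * ((b - a) * (k * L)\<^sup>2)"
    using ab by (intro mult_left_mono) auto
  also have "\<dots> = ((k * (b - a)) * L)\<^sup>2" by (simp add: power2_eq_square)
  finally show ?thesis using k by (simp add: L_def)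
qed

text \<open>The chain (b - a) * energy \<le> distance^2 \<le> length^2 \<le> (b - a) * energy closes
  up. Equality in Cauchy-Schwarz makes the speed constant almost everywhere, and the energy bound,
  used again on every subinterval, gives minimality between any two points.\<close>

lemma F_lip_min:
  assumes ab: "0 \<le> a" "a < b" "b \<le> 1" and free: "\<And>i. i \<in> {1..n} \<Longrightarrow> t i \<notin> {a<..<b}"
  obtains c where "lip_min M a b c F" "negligible {s \<in> {a..b}. norm (f s) \<noteq> c}"
proof -
  have H: "H1_curve a b F f" using H1_curve_subinterval[OF H1_F] ab by auto
  define E where "E s u = integral {s..u} (\<lambda>s. (norm (f s))\<^sup>2)" for s u
  define l where "l s u = integral {s..u} (\<lambda>s. norm (f s))" for s u
  have conn: "lip_conn M (F s) (F u) (l s u)" if "a \<le> s" "s \<le> u" "u \<le> b" for s u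
    unfolding l_def by (rule lip_conn_H1_curve[OF H1_curve_subinterval[OF H that(1,3)] that(2)]) (use F_in that ab in auto)
  define c where "c = l a b / (b - a)"
  have c: "c \<ge> 0" using lip_conn_in[OF conn[of a b]] ab by (auto simp: c_def)
  have L: "lip_dist M (F a) (F b) \<le> l a b" "0 \<le> lip_dist M (F a) (F b)"
    using lip_dist_le[OF conn[of a b]] lip_conn_in[OF lip_dist_attained[OF M(1) conn[of a b]]] ab by auto
  have "(b - a) * E a b \<le> (lip_dist M (F a) (F b))\<^sup>2"
    unfolding E_def by (rule energy_le_lip_dist[OF ab free])
  also have "\<dots> \<le> (l a b)\<^sup>2" using L by (intro power_mono)
  finally have El: "E a b \<le> (l a b)\<^sup>2 / (b - a)" using ab by (simp add: field_simps)
  have dev: "((\<lambda>s. (norm (f s) - c)\<^sup>2) has_integral E a b - 2 * c * l a b + c\<^sup>2 * (b - a)) {a..b}"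
    unfolding E_def l_def by (rule H1_curve_square_deviation[OF H]) (use ab in simp)
  have "E a b - 2 * c * l a b + c\<^sup>2 * (b - a) = E a b - (l a b)\<^sup>2 / (b - a)"
    using ab by (simp add: c_def power2_eq_square)
  then have "E a b - 2 * c * l a b + c\<^sup>2 * (b - a) \<le> 0" using El by simp
  moreover have "0 \<le> E a b - 2 * c * l a b + c\<^sup>2 * (b - a)"
    by (rule has_integral_nonneg[OF dev]) simp
  ultimately have "((\<lambda>s. (norm (f s) - c)\<^sup>2) has_integral 0) {a..b}" using dev by simp
  then have "negligible {s \<in> {a..b}. (norm (f s) - c)\<^sup>2 \<noteq> 0}"
    by (rule has_integral_0_negligible) auto
  then have neg: "negligible {s \<in> {a..b}. norm (f s) \<noteq> c}" by simp
  have eq: "l s u = c * (u - s)" "E s u = c\<^sup>2 * (u - s)" if "a \<le> s" "s \<le> u" "u \<le> b" for s u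
  proof -
    have "l s u = integral {s..u} (\<lambda>s. c)"
      unfolding l_def by (rule integral_spike[OF neg]) (use that in auto)
    then show "l s u = c * (u - s)" using that by (simp add: mult.commute)
    have "E s u = integral {s..u} (\<lambda>s. c\<^sup>2)"
      unfolding E_def by (rule integral_spike[OF neg]) (use that in auto)
    then show "E s u = c\<^sup>2 * (u - s)" using that by (simp add: mult.commute)
  qed
  have "lip_min M a b c F"
    unfolding lip_min_def
  proof (intro conjI allI impI ballI c)
    show "F s \<in> M" if "s \<in> {a..b}" for s using F_in that ab by auto
    fix s u assume su: "a \<le> s \<and> s \<le> u \<and> u \<le> b"
    show "norm (F u - F s) \<le> c * (u - s)"
      using lip_conn_norm_le[OF conn[of s u]] eq(1)[of s u] su by (simp add: norm_minus_commute)
    fix l' assume l': "lip_conn M (F s) (F u) l'"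
    show "c * (u - s) \<le> l'"
    proof (cases "s = u")
      case False
      have fr: "\<And>i. i \<in> {1..n} \<Longrightarrow> t i \<notin> {s<..<u}" using free su by fastforce
      have "(u - s) * E s u \<le> (lip_dist M (F s) (F u))\<^sup>2"
        unfolding E_def by (rule energy_le_lip_dist[OF _ _ _ fr]) (use su False ab in auto)
      also have "\<dots> \<le> l'\<^sup>2"
        using lip_dist_le[OF l'] lip_conn_in[OF lip_dist_attained[OF M(1) l']] by (intro power_mono) auto
      finally have "(c * (u - s))\<^sup>2 \<le> l'\<^sup>2" using eq(2)[of s u] su by (simp add: power2_eq_square mult_ac)
      then show ?thesis using lip_conn_in[OF l'] power2_le_imp_le by blast
    qed (use lip_conn_in[OF l'] in simp)
  qed
  then show ?thesis using that neg by blast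
qed

lemma F_geodesic:
  assumes ab: "0 \<le> a" "a < b" "b \<le> 1" and free: "\<And>i. i \<in> {1..n} \<Longrightarrow> t i \<notin> {a<..<b}"
  obtains g g2 where "geodesic_data M a b F g g2" "\<And>s. s \<in> {a<..<b} \<Longrightarrow> vector_derivative F (at s) = g s"
proof -
  obtain c where "lip_min M a b c F" by (rule F_lip_min[OF ab free])
  from lip_min_geodesic_data[OF this R order_refl ab(2)] that show ?thesis by blast
qed

end

lemma geodesic_data_subinterval:
  assumes "geodesic_data M a b \<gamma> g g2" "a \<le> a'" "b' \<le> b"
  shows "geodesic_data M a' b' \<gamma> g g2"
proof -
  note D = geodesic_dataD[OF assms(1)]
  have sub: "{a'..b'} \<subseteq> {a..b}" using assms by auto
  show ?thesis
    unfolding geodesic_data_def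
  proof (intro conjI ballI)
    show "continuous_on {a'..b'} g" "continuous_on {a'..b'} g2"
      using D(1,2) sub by (auto intro: continuous_on_subset)
    fix t assume "t \<in> {a'..b'}"
    then have t: "t \<in> {a..b}" using sub by blast
    show "\<gamma> t \<in> M" using D(3) t by blast
    show "(\<gamma> has_vector_derivative g t) (at t within {a'..b'})" "(g has_vector_derivative g2 t) (at t within {a'..b'})"
      using D(4,5)[OF t] sub has_vector_derivative_within_subset by blast+
    show "g2 t \<bullet> w = 0" if "w \<in> tangent_space M (\<gamma> t)" for w using D(6)[OF t that] .
  qed
qed

context penalized_setup
begin

lemma design_gap:
  obtains \<delta> where "\<delta> > 0" "\<And>j. j \<in> {1..n} \<Longrightarrow> t j \<noteq> x \<Longrightarrow> \<delta> < \<bar>t j - x\<bar>"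
proof -
  obtain d where d: "d > 0" "\<forall>y\<in>t ` {1..n}. y \<noteq> x \<longrightarrow> d \<le> dist x y"
    using finite_set_avoid[of "t ` {1..n}" x] by auto
  show ?thesis
  proof (rule that[of "d/2"])
    show "d / 2 < \<bar>t j - x\<bar>" if "j \<in> {1..n}" "t j \<noteq> x" for j
      using bspec[OF d(2) imageI[OF that(1)]] that(2) d(1) by (simp add: dist_real_def abs_minus_commute)
  qed (use d(1) in simp)
qed

end

section \<open>The jump at a design point, regularity away from the design points, and the bound on
  the derivative\<close>

context penalized_manifold
begin

text \<open>The value at the design point is moved along \<open>P (q + s *\<^sub>R \<xi>)\<close>.
  The change of the objective is bounded above by the change of a differentiable function \<Phi>
  that involves energies only, and minimality of F makes 0 a minimum of \<Phi>. The first variation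
  formula, applied to the two arcs of F and to a geodesic towards \<open>Y i\<close>, evaluates the
  derivative of \<Phi>.\<close>

lemma derivative_jump:
  assumes i: "i \<in> {1..n}" and inj: "ereal (geo_dist M (F (t i)) (Y i)) < inj_radius M"
  obtains vp vm where "((\<lambda>s. vector_derivative F (at s)) \<longlongrightarrow> vp) (at_right (t i))"
    "((\<lambda>s. vector_derivative F (at s)) \<longlongrightarrow> vm) (at_left (t i))"
    "vp - vm = - (1 / (real n * lam)) *\<^sub>R riem_log M (F (t i)) (Y i)"
    "vp - vm \<in> tangent_space M (F (t i))"
    "F (t i) \<noteq> Y i \<Longrightarrow> vp \<noteq> vm"
proof -
  define \<tau> q where "\<tau> = t i" and "q = F (t i)"
  have \<tau>01: "0 < \<tau>" "\<tau> < 1" using t(2)[OF i] by (auto simp: \<tau>_def)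
  have qM: "q \<in> M" using F_in[of \<tau>] \<tau>01 by (simp add: q_def \<tau>_def)
  have F\<tau>: "F \<tau> = q" by (simp add: q_def \<tau>_def)
  obtain P r where PR: "local_retraction 2 M P q r" by (rule locally_retractableD[OF R qM])
  note P = local_retractionD[OF PR]
  have P2: "Ck_open (Suc (Suc 0)) (ball q r) P" using P(3) by (simp add: numeral_2_eq_2)
  have dP0: "dird P 0 x = 0" if "x \<in> ball q r" for x using linear_0[OF linear_dird[OF P2 that]] .
  obtain d0 where d0: "d0 > 0" "\<And>s. s \<in> {0..1} \<Longrightarrow> dist s \<tau> < d0 \<Longrightarrow> dist (F s) q < r"
    using F_continuous[unfolded continuous_on_iff, rule_format, of \<tau> r] \<tau>01 P(1) F\<tau> by auto
  obtain d1 where d1: "d1 > 0" "\<And>j. j \<in> {1..n} \<Longrightarrow> t j \<noteq> \<tau> \<Longrightarrow> d1 < \<bar>t j - \<tau>\<bar>" by (rule design_gap[of \<tau>]) (rule that)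
  \<comment> \<open>Small enough for F to stay in the retraction ball, for no other design point to
    be met, and for the interval to lie in the unit interval.\<close>
  define \<delta> where "\<delta> = min (min (d0/2) d1) (min \<tau> (1 - \<tau>))"
  have \<delta>: "\<delta> > 0" "\<delta> < d0" "\<delta> \<le> d1" "\<delta> \<le> \<tau>" "\<delta> \<le> 1 - \<tau>"
    using d0(1) d1(1) \<tau>01 by (auto simp: \<delta>_def)
  define a b where "a = \<tau> - \<delta>" and "b = \<tau> + \<delta>"
  have ab: "0 \<le> a" "a < \<tau>" "\<tau> < b" "b \<le> 1" using \<delta> by (auto simp: a_def b_def)
  have Fball: "F s \<in> ball q r" if "s \<in> {a..b}" for s
    using d0(2)[of s] that ab \<delta> by (auto simp: a_def b_def dist_real_def dist_commute)
  have free: "t j \<notin> {a..b}" if "j \<in> {1..n}" "j \<noteq> i" for j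
  proof -
    have "t j \<noteq> \<tau>" using inj_onD[OF t(1), of j i] that i unfolding \<tau>_def by blast
    then have "d1 < \<bar>t j - \<tau>\<bar>" using d1(2)[OF that(1)] by simp
    then show ?thesis using \<delta>(3) by (auto simp: a_def b_def)
  qed
  have freeL: "t j \<notin> {a<..<\<tau>}" and freeR: "t j \<notin> {\<tau><..<b}" if "j \<in> {1..n}" for j
  proof -
    have "t j = \<tau> \<or> t j \<notin> {a..b}" using free[OF that] by (cases "j = i") (simp_all add: \<tau>_def)
    then show "t j \<notin> {a<..<\<tau>}" "t j \<notin> {\<tau><..<b}" using ab by auto
  qed
  obtain gL hL where L: "geodesic_data M a \<tau> F gL hL" "\<And>s. s \<in> {a<..<\<tau>} \<Longrightarrow> vector_derivative F (at s) = gL s"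
    by (rule F_geodesic[OF ab(1,2) less_imp_le[OF \<tau>01(2)] freeL]) (assumption | rule that)+
  obtain gR hR where R': "geodesic_data M \<tau> b F gR hR" "\<And>s. s \<in> {\<tau><..<b} \<Longrightarrow> vector_derivative F (at s) = gR s"
    by (rule F_geodesic[OF less_imp_le[OF \<tau>01(1)] ab(3,4) freeR]) (assumption | rule that)+
  obtain \<gamma> g g2 where G: "geodesic_data M 0 1 \<gamma> g g2" "\<gamma> 0 = q" "\<gamma> 1 = Y i"
    "\<And>t. t \<in> {0..1} \<Longrightarrow> norm (g t) = lip_dist M q (Y i)"
    by (rule lip_min_geodesic_exists[OF M R order_refl qM Y[OF i]]) (use that in blast)
  have log: "riem_log M q (Y i) = g 0"
    by (rule riem_log_eq[OF M R order_refl qM Y[OF i] _ G]) (use inj in \<open>simp_all add: q_def\<close>)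
  note D = geodesic_dataD[OF G(1)]
  define l where "l = lip_dist M q (Y i)"
  have \<gamma>c: "continuous_on {0..1} \<gamma>" by (rule continuous_on_has_vector_derivative[OF D(4)])
  obtain d2 where d2: "d2 > 0" "\<And>s. s \<in> {0..1} \<Longrightarrow> dist s 0 < d2 \<Longrightarrow> dist (\<gamma> s) q < r"
    using \<gamma>c[unfolded continuous_on_iff, rule_format, of 0 r] P(1) G(2) by auto
  \<comment> \<open>Only an initial piece of the geodesic to \<open>Y i\<close> that fits into the
    retraction ball is varied; the rest is kept together with its energy.\<close>
  define \<epsilon> where "\<epsilon> = min (d2/2) (1/2)"
  have \<epsilon>: "0 < \<epsilon>" "\<epsilon> < 1" "\<epsilon> < d2" using d2(1) by (auto simp: \<epsilon>_def)
  have \<gamma>ball: "\<gamma> s \<in> ball q r" if "s \<in> {0..\<epsilon>}" for s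
    using d2(2)[of s] that \<epsilon> by (auto simp: dist_commute)
  have G\<epsilon>: "geodesic_data M 0 \<epsilon> \<gamma> g g2" by (rule geodesic_data_subinterval[OF G(1)]) (use \<epsilon> in auto)
  have H\<gamma>: "H1_curve \<epsilon> 1 \<gamma> g"
    by (rule H1_curve_subinterval[OF H1_curve_continuous_derivative[OF D(4,1)]]) (use \<epsilon> in auto)
  have E\<gamma>: "integral {\<epsilon>..1} (\<lambda>t. (norm (g t))\<^sup>2) = (1 - \<epsilon>) * l\<^sup>2" "integral {0..\<epsilon>} (\<lambda>t. (norm (g t))\<^sup>2) = \<epsilon> * l\<^sup>2"
  proof -
    have "integral {\<epsilon>..1} (\<lambda>t. (norm (g t))\<^sup>2) = integral {\<epsilon>..1} (\<lambda>t. l\<^sup>2)"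
      by (rule Henstock_Kurzweil_Integration.integral_cong) (use G(4) \<epsilon> in \<open>simp add: l_def\<close>)
    then show "integral {\<epsilon>..1} (\<lambda>t. (norm (g t))\<^sup>2) = (1 - \<epsilon>) * l\<^sup>2" using \<epsilon> by simp
    have "integral {0..\<epsilon>} (\<lambda>t. (norm (g t))\<^sup>2) = integral {0..\<epsilon>} (\<lambda>t. l\<^sup>2)"
      by (rule Henstock_Kurzweil_Integration.integral_cong) (use G(4) \<epsilon> in \<open>simp add: l_def\<close>)
    then show "integral {0..\<epsilon>} (\<lambda>t. (norm (g t))\<^sup>2) = \<epsilon> * l\<^sup>2" using \<epsilon> by simp
  qed
  \<comment> \<open>The balance of forces at the design point: the pull of the datum, and the
    difference of the tensions of the two arcs.\<close>
  define z where "z = (1 / real n) *\<^sub>R g 0 + lam *\<^sub>R (gR \<tau> - gL \<tau>)"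
  have main: "z \<bullet> dird P \<xi> q = 0" for \<xi>
  proof -
    \<comment> \<open>The three fields are affine, equal \<xi> at the design point and vanish at the
      other ends, so the varied arcs of F and the varied geodesic all meet in
      \<open>P (q + s *\<^sub>R \<xi>)\<close>.\<close>
    define \<eta>L \<eta>R \<eta>G \<eta> where "\<eta>L x = ((x - a) / \<delta>) *\<^sub>R \<xi>" and "\<eta>R x = ((b - x) / \<delta>) *\<^sub>R \<xi>"
      and "\<eta>G x = ((\<epsilon> - x) / \<epsilon>) *\<^sub>R \<xi>" and "\<eta> x = (if x \<le> \<tau> then \<eta>L x else \<eta>R x)" for x
    have ends: "\<eta>L a = 0" "\<eta>L \<tau> = \<xi>" "\<eta>R \<tau> = \<xi>" "\<eta>R b = 0" "\<eta>G 0 = \<xi>" "\<eta>G \<epsilon> = 0"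
      using \<delta>(1) \<epsilon>(1) by (auto simp: \<eta>L_def \<eta>R_def \<eta>G_def a_def b_def)
    have dL: "(\<eta>L has_vector_derivative (1 / \<delta>) *\<^sub>R \<xi>) (at x within S)" for x S
      unfolding \<eta>L_def[abs_def]
      by (rule bounded_linear.has_vector_derivative[OF bounded_linear_scaleR_left])
        (use \<delta>(1) \<epsilon>(1) in \<open>auto simp: has_real_derivative_iff_has_vector_derivative[symmetric] intro!: derivative_eq_intros\<close>)
    have dR: "(\<eta>R has_vector_derivative (- 1 / \<delta>) *\<^sub>R \<xi>) (at x within S)" for x S
      unfolding \<eta>R_def[abs_def]
      by (rule bounded_linear.has_vector_derivative[OF bounded_linear_scaleR_left])
        (use \<delta>(1) \<epsilon>(1) in \<open>auto simp: has_real_derivative_iff_has_vector_derivative[symmetric] intro!: derivative_eq_intros\<close>)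
    have dG: "(\<eta>G has_vector_derivative (- 1 / \<epsilon>) *\<^sub>R \<xi>) (at x within S)" for x S
      unfolding \<eta>G_def[abs_def]
      by (rule bounded_linear.has_vector_derivative[OF bounded_linear_scaleR_left])
        (use \<delta>(1) \<epsilon>(1) in \<open>auto simp: has_real_derivative_iff_has_vector_derivative[symmetric] intro!: derivative_eq_intros\<close>)
    obtain sA A where A: "sA > 0" "A 0 = integral {a..\<tau>} (\<lambda>t. (norm (gL t))\<^sup>2)"
      "\<And>s x. \<bar>s\<bar> < sA \<Longrightarrow> x \<in> {a..\<tau>} \<Longrightarrow> P (F x + s *\<^sub>R \<eta>L x) \<in> M"
      "\<And>s. \<bar>s\<bar> < sA \<Longrightarrow> \<exists>h. H1_curve a \<tau> (\<lambda>x. P (F x + s *\<^sub>R \<eta>L x)) h \<and> integral {a..\<tau>} (\<lambda>x. (norm (h x))\<^sup>2) = A s"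
      "(A has_real_derivative 2 * (gL \<tau> \<bullet> dird P (\<eta>L \<tau>) (F \<tau>) - gL a \<bullet> dird P (\<eta>L a) (F a))) (at 0)"
      by (rule geodesic_first_variation[OF PR order_refl L(1) ab(2) _ dL continuous_on_const])
        (use Fball ab in \<open>simp\<close>, rule that)
    obtain sB B where B: "sB > 0" "B 0 = integral {\<tau>..b} (\<lambda>t. (norm (gR t))\<^sup>2)"
      "\<And>s x. \<bar>s\<bar> < sB \<Longrightarrow> x \<in> {\<tau>..b} \<Longrightarrow> P (F x + s *\<^sub>R \<eta>R x) \<in> M"
      "\<And>s. \<bar>s\<bar> < sB \<Longrightarrow> \<exists>h. H1_curve \<tau> b (\<lambda>x. P (F x + s *\<^sub>R \<eta>R x)) h \<and> integral {\<tau>..b} (\<lambda>x. (norm (h x))\<^sup>2) = B s"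
      "(B has_real_derivative 2 * (gR b \<bullet> dird P (\<eta>R b) (F b) - gR \<tau> \<bullet> dird P (\<eta>R \<tau>) (F \<tau>))) (at 0)"
      by (rule geodesic_first_variation[OF PR order_refl R'(1) ab(3) _ dR continuous_on_const])
        (use Fball ab in \<open>simp\<close>, rule that)
    obtain sC C where C: "sC > 0" "C 0 = integral {0..\<epsilon>} (\<lambda>t. (norm (g t))\<^sup>2)"
      "\<And>s x. \<bar>s\<bar> < sC \<Longrightarrow> x \<in> {0..\<epsilon>} \<Longrightarrow> P (\<gamma> x + s *\<^sub>R \<eta>G x) \<in> M"
      "\<And>s. \<bar>s\<bar> < sC \<Longrightarrow> \<exists>h. H1_curve 0 \<epsilon> (\<lambda>x. P (\<gamma> x + s *\<^sub>R \<eta>G x)) h \<and> integral {0..\<epsilon>} (\<lambda>x. (norm (h x))\<^sup>2) = C s"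
      "(C has_real_derivative 2 * (g \<epsilon> \<bullet> dird P (\<eta>G \<epsilon>) (\<gamma> \<epsilon>) - g 0 \<bullet> dird P (\<eta>G 0) (\<gamma> 0))) (at 0)"
      by (rule geodesic_first_variation[OF PR order_refl G\<epsilon> \<epsilon>(1) \<gamma>ball dG continuous_on_const])
        (assumption | rule that)+
    define \<Phi> where "\<Phi> s = lam * (A s + B s) + (1 / real n) * C s" for s
    \<comment> \<open>Over the unit interval the squared length is at most the energy, so the varied
      geodesic bounds the squared distance; at \<open>s = 0\<close> constant speed gives
      equality.\<close>
    have dist: "(geo_dist M (Y i) (P (q + s *\<^sub>R \<xi>)))\<^sup>2 \<le> C s + (1 - \<epsilon>) * l\<^sup>2" and PM: "P (q + s *\<^sub>R \<xi>) \<in> M" if s: "\<bar>s\<bar> < sC" for s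
    proof -
      obtain h where h: "H1_curve 0 \<epsilon> (\<lambda>x. P (\<gamma> x + s *\<^sub>R \<eta>G x)) h" "integral {0..\<epsilon>} (\<lambda>x. (norm (h x))\<^sup>2) = C s"
        using C(4)[OF s] by blast
      define \<Gamma> where "\<Gamma> x = (if x \<le> \<epsilon> then P (\<gamma> x + s *\<^sub>R \<eta>G x) else \<gamma> x)" for x
      define k where "k x = (if x \<le> \<epsilon> then h x else g x)" for x
      have \<Gamma>\<epsilon>: "P (\<gamma> \<epsilon> + s *\<^sub>R \<eta>G \<epsilon>) = \<gamma> \<epsilon>" using P(5) D(3)[of \<epsilon>] \<gamma>ball[of \<epsilon>] \<epsilon> ends(6) by simp
      have h1: "H1_curve 0 \<epsilon> \<Gamma> k" by (rule H1_curve_cong[OF h(1)]) (auto simp: \<Gamma>_def k_def)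
      have h2: "H1_curve \<epsilon> 1 \<Gamma> k" by (rule H1_curve_cong[OF H\<gamma>]) (use \<Gamma>\<epsilon> in \<open>auto simp: \<Gamma>_def k_def\<close>)
      have h3: "H1_curve 0 1 \<Gamma> k" by (rule H1_curve_combine[OF h1 h2]) (use \<epsilon> in auto)
      have e1: "integral {0..\<epsilon>} (\<lambda>x. (norm (k x))\<^sup>2) = C s"
        unfolding h(2)[symmetric] by (rule H1_curve_energy_cong) (simp add: k_def)
      have e2: "integral {\<epsilon>..1} (\<lambda>x. (norm (k x))\<^sup>2) = (1 - \<epsilon>) * l\<^sup>2"
        unfolding E\<gamma>(1)[symmetric] by (rule H1_curve_energy_cong) (simp add: k_def)
      have e3: "integral {0..1} (\<lambda>x. (norm (k x))\<^sup>2) = C s + (1 - \<epsilon>) * l\<^sup>2"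
        using Henstock_Kurzweil_Integration.integral_combine[of 0 \<epsilon> 1, OF _ _ H1_curveD(2)[OF h3]] e1 e2 \<epsilon> by simp
      have \<Gamma>M: "\<Gamma> x \<in> M" if "x \<in> {0..1}" for x using C(3)[OF s, of x] D(3)[OF that] that by (auto simp: \<Gamma>_def)
      have "lip_conn M (\<Gamma> 0) (\<Gamma> 1) (sqrt (C s + (1 - \<epsilon>) * l\<^sup>2))"
        by (rule lip_conn_energy[OF h3 _ \<Gamma>M]) (use e3 in auto)
      moreover have "\<Gamma> 0 = P (q + s *\<^sub>R \<xi>)" "\<Gamma> 1 = Y i" using \<epsilon> G(2,3) ends(5) by (auto simp: \<Gamma>_def)
      ultimately have c: "lip_conn M (P (q + s *\<^sub>R \<xi>)) (Y i) (sqrt (C s + (1 - \<epsilon>) * l\<^sup>2))" by simp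
      then show PM: "P (q + s *\<^sub>R \<xi>) \<in> M" using lip_conn_in by blast
      have "geo_dist M (Y i) (P (q + s *\<^sub>R \<xi>)) = lip_dist M (P (q + s *\<^sub>R \<xi>)) (Y i)"
        using geo_dist_eq_lip_dist[OF M R order_refl Y[OF i] PM] lip_dist_sym by metis
      moreover have "0 \<le> lip_dist M (P (q + s *\<^sub>R \<xi>)) (Y i)"
        using lip_conn_in[OF lip_dist_attained[OF M(1) c]] by simp
      moreover have "0 \<le> C s + (1 - \<epsilon>) * l\<^sup>2" using lip_conn_in[OF c] by simp
      ultimately show "(geo_dist M (Y i) (P (q + s *\<^sub>R \<xi>)))\<^sup>2 \<le> C s + (1 - \<epsilon>) * l\<^sup>2"
        using lip_dist_le[OF c] by (metis power_mono real_sqrt_pow2)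
    qed
    have dist0: "(geo_dist M (Y i) q)\<^sup>2 = C 0 + (1 - \<epsilon>) * l\<^sup>2"
      using geo_dist_eq_lip_dist[OF M R order_refl Y[OF i] qM] lip_dist_sym[of M q "Y i"] C(2) E\<gamma>(2)
      by (simp add: l_def algebra_simps)
    define s0 where "s0 = min sA (min sB sC)"
    have s0: "s0 > 0" using A(1) B(1) C(1) by (simp add: s0_def)
    \<comment> \<open>The glued competitor W changes the risk in the term with index
      \<open>i\<close> alone, by at most \<open>C s - C 0\<close> before averaging, and the energy
      by exactly \<open>A s + B s - A 0 - B 0\<close>.\<close>
    have min: "\<Phi> 0 \<le> \<Phi> s" if s: "\<bar>s\<bar> < s0" for s
    proof -
      have sABC: "\<bar>s\<bar> < sA" "\<bar>s\<bar> < sB" "\<bar>s\<bar> < sC" using s by (auto simp: s0_def)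
      obtain hA where hA: "H1_curve a \<tau> (\<lambda>x. P (F x + s *\<^sub>R \<eta>L x)) hA" "integral {a..\<tau>} (\<lambda>x. (norm (hA x))\<^sup>2) = A s"
        using A(4)[OF sABC(1)] by blast
      obtain hB where hB: "H1_curve \<tau> b (\<lambda>x. P (F x + s *\<^sub>R \<eta>R x)) hB" "integral {\<tau>..b} (\<lambda>x. (norm (hB x))\<^sup>2) = B s"
        using B(4)[OF sABC(2)] by blast
      define V where "V x = P (F x + s *\<^sub>R \<eta> x)" for x
      define v where "v x = (if x < \<tau> then hA x else hB x)" for x
      have v1: "H1_curve a \<tau> V v" by (rule H1_curve_cong[OF hA(1)]) (auto simp: V_def v_def \<eta>_def)
      have v2: "H1_curve \<tau> b V v" by (rule H1_curve_cong[OF hB(1)]) (use ends in \<open>auto simp: V_def v_def \<eta>_def\<close>)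
      have v3: "H1_curve a b V v" by (rule H1_curve_combine[OF v1 v2]) (use ab in auto)
      have split: "integral {a..b} (\<lambda>x. (norm (u x))\<^sup>2) = integral {a..\<tau>} (\<lambda>x. (norm (u x))\<^sup>2) + integral {\<tau>..b} (\<lambda>x. (norm (u x))\<^sup>2)"
        if "H1_curve a b U u" for U and u :: "real \<Rightarrow> 'a"
        using Henstock_Kurzweil_Integration.integral_combine[of a \<tau> b, OF _ _ H1_curveD(2)[OF that]] ab by simp
      have ev: "integral {a..b} (\<lambda>x. (norm (v x))\<^sup>2) = A s + B s"
      proof -
        have "integral {a..\<tau>} (\<lambda>x. (norm (v x))\<^sup>2) = A s"
          unfolding hA(2)[symmetric] by (rule H1_curve_energy_cong) (simp add: v_def)
        moreover have "integral {\<tau>..b} (\<lambda>x. (norm (v x))\<^sup>2) = B s"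
          unfolding hB(2)[symmetric] by (rule H1_curve_energy_cong) (simp add: v_def)
        ultimately show ?thesis using split[OF v3] by simp
      qed
      have Hf: "H1_curve a b F f" "H1_curve a \<tau> F f" "H1_curve \<tau> b F f"
        using ab by (auto intro!: H1_curve_subinterval[OF H1_F])
      have ef: "integral {a..b} (\<lambda>x. (norm (f x))\<^sup>2) = A 0 + B 0"
        using split[OF Hf(1)] A(2) B(2) ab
          H1_curve_energy_unique[OF Hf(2) H1_curve_continuous_derivative[OF geodesic_dataD(4,1)[OF L(1)]]]
          H1_curve_energy_unique[OF Hf(3) H1_curve_continuous_derivative[OF geodesic_dataD(4,1)[OF R'(1)]]]
        by simp
      have VM: "V x \<in> M" if "x \<in> {a..b}" for x
        using that A(3)[OF sABC(1), of x] B(3)[OF sABC(2), of x] by (auto simp: V_def \<eta>_def)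
      have Vends: "V a = F a" "V b = F b" "V \<tau> = P (q + s *\<^sub>R \<xi>)"
        using P(5) F_in[of a] F_in[of b] Fball[of a] Fball[of b] ab ends F\<tau> by (auto simp: V_def \<eta>_def)
      define W where "W x = (if x \<in> {a..b} then V x else F x)" for x
      have rep: "emp_risk M n t Y F + lam * (A 0 + B 0) \<le> emp_risk M n t Y W + lam * (A s + B s)"
        using replacement[OF ab(1) _ ab(4) v3 VM] Vends ab unfolding ef ev W_def[abs_def] by auto
      have Wj: "W (t j) = F (t j)" if "j \<in> {1..n} - {i}" for j using free[of j] that by (auto simp: W_def)
      have Wi: "W (t i) = P (q + s *\<^sub>R \<xi>)" using Vends ab by (simp add: W_def \<tau>_def)
      have "(\<Sum>j=1..n. (geo_dist M (Y j) (W (t j)))\<^sup>2)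
          = (geo_dist M (Y i) (W (t i)))\<^sup>2 + (\<Sum>j\<in>{1..n} - {i}. (geo_dist M (Y j) (F (t j)))\<^sup>2)"
        using i Wj by (subst sum.remove[of _ i]) auto
      moreover have "(\<Sum>j=1..n. (geo_dist M (Y j) (F (t j)))\<^sup>2)
          = (geo_dist M (Y i) q)\<^sup>2 + (\<Sum>j\<in>{1..n} - {i}. (geo_dist M (Y j) (F (t j)))\<^sup>2)"
        using i by (subst sum.remove[of _ i]) (auto simp: q_def)
      ultimately have "(\<Sum>j=1..n. (geo_dist M (Y j) (W (t j)))\<^sup>2) \<le> (\<Sum>j=1..n. (geo_dist M (Y j) (F (t j)))\<^sup>2) + (C s - C 0)"
        using dist[OF sABC(3)] dist0 Wi by simp
      then have "emp_risk M n t Y W \<le> emp_risk M n t Y F + (1 / real n) * (C s - C 0)"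
        unfolding emp_risk_def distrib_left[symmetric] by (rule mult_left_mono) simp
      then show ?thesis using rep by (simp add: \<Phi>_def algebra_simps)
    qed
    have "(\<Phi> has_real_derivative lam * (2 * (gL \<tau> \<bullet> dird P (\<eta>L \<tau>) (F \<tau>) - gL a \<bullet> dird P (\<eta>L a) (F a))
        + 2 * (gR b \<bullet> dird P (\<eta>R b) (F b) - gR \<tau> \<bullet> dird P (\<eta>R \<tau>) (F \<tau>)))
        + (1 / real n) * (2 * (g \<epsilon> \<bullet> dird P (\<eta>G \<epsilon>) (\<gamma> \<epsilon>) - g 0 \<bullet> dird P (\<eta>G 0) (\<gamma> 0)))) (at 0)"
      unfolding \<Phi>_def[abs_def] by (intro DERIV_add DERIV_cmult A(5) B(5) C(5))
    then have "(\<Phi> has_real_derivative - 2 * (z \<bullet> dird P \<xi> q)) (at 0)"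
      unfolding ends G(2) F\<tau> using dP0 Fball[of a] Fball[of b] \<gamma>ball[of \<epsilon>] ab \<epsilon>
      by (simp add: z_def inner_add_left inner_diff_left algebra_simps)
    then have "- 2 * (z \<bullet> dird P \<xi> q) = 0"
      by (rule DERIV_local_min[OF _ s0]) (use min in auto)
    then show ?thesis by simp
  qed
  have tan: "v \<in> tangent_space M q \<longleftrightarrow> dird P v q = v" for v
    by (rule tangent_space_retraction(1)[OF PR _ qM]) (use P(1) in auto)
  have gLt: "gL \<tau> \<in> tangent_space M (F \<tau>)"
    by (rule velocity_in_tangent_space[OF R _ ab(2) _ geodesic_dataD(3)[OF L(1)] continuous_on_has_vector_derivative[OF geodesic_dataD(4)[OF L(1)]] geodesic_dataD(4)[OF L(1)]]) (use ab in auto)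
  have gRt: "gR \<tau> \<in> tangent_space M (F \<tau>)"
    by (rule velocity_in_tangent_space[OF R _ ab(3) _ geodesic_dataD(3)[OF R'(1)] continuous_on_has_vector_derivative[OF geodesic_dataD(4)[OF R'(1)]] geodesic_dataD(4)[OF R'(1)]]) (use ab in auto)
  have g0t: "g 0 \<in> tangent_space M (\<gamma> 0)"
    by (rule velocity_in_tangent_space[OF R _ zero_less_one _ D(3) \<gamma>c D(4)]) auto
  note lin = linear_dird[OF P2, of q]
  have qb: "q \<in> ball q r" using P(1) by simp
  have fixd: "dird P (gL \<tau>) q = gL \<tau>" "dird P (gR \<tau>) q = gR \<tau>" "dird P (g 0) q = g 0"
    using gLt gRt g0t G(2) F\<tau> tan by auto
  have "dird P z q = z"
    unfolding z_def linear_add[OF lin[OF qb]] linear_cmul[OF lin[OF qb]] linear_diff[OF lin[OF qb]] fixd ..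
  \<comment> \<open>All three velocities are tangent at q, hence so is z, and it may be tested
    against itself.\<close>
  then have "z = 0" using main[of z] inner_eq_zero_iff by metis
  then have "lam *\<^sub>R (gR \<tau> - gL \<tau>) = - (1 / real n) *\<^sub>R g 0"
    by (simp add: z_def eq_neg_iff_add_eq_0 add.commute)
  then have "(1 / lam) *\<^sub>R lam *\<^sub>R (gR \<tau> - gL \<tau>) = (1 / lam) *\<^sub>R (- (1 / real n) *\<^sub>R g 0)" by simp
  then have jump: "gR \<tau> - gL \<tau> = - (1 / (real n * lam)) *\<^sub>R g 0" using lam by (simp add: mult.commute)
  show ?thesis
  proof (rule that[of "gR \<tau>" "gL \<tau>"])
    have "(gR \<longlongrightarrow> gR \<tau>) (at \<tau> within {\<tau>..b})" using geodesic_dataD(1)[OF R'(1)] ab by (simp add: continuous_on_def)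
    then have "(gR \<longlongrightarrow> gR \<tau>) (at_right \<tau>)" using at_within_Icc_at_right[OF ab(3)] by simp
    then show "((\<lambda>s. vector_derivative F (at s)) \<longlongrightarrow> gR \<tau>) (at_right (t i))"
      unfolding \<tau>_def[symmetric]
      by (rule Lim_transform_eventually) (use R'(2) ab in \<open>auto simp: eventually_at_right intro!: exI[of _ b]\<close>)
    have "(gL \<longlongrightarrow> gL \<tau>) (at \<tau> within {a..\<tau>})" using geodesic_dataD(1)[OF L(1)] ab by (simp add: continuous_on_def)
    then have "(gL \<longlongrightarrow> gL \<tau>) (at_left \<tau>)" using at_within_Icc_at_left[OF ab(2)] by simp
    then show "((\<lambda>s. vector_derivative F (at s)) \<longlongrightarrow> gL \<tau>) (at_left (t i))"
      unfolding \<tau>_def[symmetric]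
      by (rule Lim_transform_eventually) (use L(2) ab in \<open>auto simp: eventually_at_left intro!: exI[of _ a]\<close>)
    show "gR \<tau> - gL \<tau> = - (1 / (real n * lam)) *\<^sub>R riem_log M (F (t i)) (Y i)"
      using jump log by (simp add: q_def)
    have "gR \<tau> - gL \<tau> \<in> tangent_space M q"
      unfolding tan linear_diff[OF lin[OF qb]] fixd ..
    then show "gR \<tau> - gL \<tau> \<in> tangent_space M (F (t i))" by (simp add: q_def)
    assume "F (t i) \<noteq> Y i"
    then have "norm (q - Y i) > 0" by (simp add: q_def)
    moreover obtain l' where l': "lip_conn M q (Y i) l'" using lip_conn_exists[OF M(2) R order_refl qM Y[OF i]] by blast
    moreover have "norm (g 0) = lip_dist M q (Y i)" by (rule G(4)) simp
    ultimately have "norm (g 0) > 0" using lip_conn_norm_le[OF lip_dist_attained[OF M(1) l']] by linarith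
    then have "gR \<tau> - gL \<tau> \<noteq> 0" unfolding jump using n lam by simp
    then show "gR \<tau> \<noteq> gL \<tau>" by simp
  qed
qed

lemma F_Ck:
  assumes R: "locally_retractable k M" and k: "k \<ge> 2"
  shows "Ck_on k ({0..1} - t ` {1..n}) F"
  unfolding Ck_on_def
proof
  fix x assume x: "x \<in> {0..1} - t ` {1..n}"
  have T: "finite (t ` {1..n})" "t ` {1..n} \<noteq> {}" using n by auto
  define m1 m2 where "m1 = Min (t ` {1..n})" and "m2 = Max (t ` {1..n})"
  have m: "m1 \<in> t ` {1..n}" "m2 \<in> t ` {1..n}" using Min_in[OF T] Max_in[OF T] by (auto simp: m1_def m2_def)
  have m1: "m1 \<le> t j" and m2: "t j \<le> m2" if "j \<in> {1..n}" for j
    using that T by (auto simp: m1_def m2_def)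
  have m01: "0 < m1" "m1 < 1" "0 < m2" "m2 < 1" using m t(2) by auto
  consider "x = 0" | "x = 1" | "0 < x" "x < 1" using x by fastforce
  then show "\<exists>U g. open U \<and> x \<in> U \<and> Ck_open k U g \<and> (\<forall>y\<in>({0..1} - t ` {1..n}) \<inter> U. g y = F y)"
  proof cases
    case 1
    \<comment> \<open>The set is not open at 0. Since F is constant up to the first design point, a
      constant map is the required extension.\<close>
    show ?thesis
    proof (intro exI[of _ "{..<m1}"] exI[of _ "\<lambda>_. F m1"] conjI ballI)
      show "F m1 = F y" if "y \<in> ({0..1} - t ` {1..n}) \<inter> {..<m1}" for y
        by (rule F_constant_left[symmetric]) (use m1 m01 that in auto)
    qed (use 1 m01 in auto)
  next
    case 2
    show ?thesis
    proof (intro exI[of _ "{m2<..}"] exI[of _ "\<lambda>_. F m2"] conjI ballI)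
      show "F m2 = F y" if "y \<in> ({0..1} - t ` {1..n}) \<inter> {m2<..}" for y
        by (rule F_constant_right[symmetric]) (use m2 m01 that in auto)
    qed (use 2 m01 in auto)
  next
    case 3
    obtain d where d: "d > 0" "\<And>j. j \<in> {1..n} \<Longrightarrow> t j \<noteq> x \<Longrightarrow> d < \<bar>t j - x\<bar>" by (rule design_gap[of x]) (rule that)
    define a b where "a = max 0 (x - d)" and "b = min 1 (x + d)"
    have ab: "0 \<le> a" "a < x" "x < b" "b \<le> 1" using d(1) 3 by (auto simp: a_def b_def)
    have free: "t j \<notin> {a<..<b}" if "j \<in> {1..n}" for j
    proof -
      have "t j \<noteq> x" using x that by auto
      then show ?thesis using d(2)[OF that] by (auto simp: a_def b_def)
    qed
    obtain c where "lip_min M a b c F" by (rule F_lip_min[OF ab(1) _ ab(4) free]) (use ab in auto)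
    then have "Ck_open k {a<..<b} F" by (rule lip_min_Ck[OF _ R k]) (use ab in auto)
    then show ?thesis using ab by (intro exI[of _ "{a<..<b}"] exI[of _ F]) auto
  qed
qed

text \<open>On either side of every point the speed is almost everywhere equal to a constant on a
  short interval; finitely many such neighbourhoods cover the unit interval.\<close>

lemma esssup_finite: "esssup (lebesgue_on {0..1}) (\<lambda>s. ereal (norm (weak_derivative F s))) < \<infinity>"
proof -
  have loc: "\<exists>d>0. \<exists>C. negligible {s \<in> {0..1} \<inter> ball x d. norm (f s) > C}" if x: "x \<in> {0..1}" for x
  proof -
    obtain d where d: "d > 0" "\<And>j. j \<in> {1..n} \<Longrightarrow> t j \<noteq> x \<Longrightarrow> d < \<bar>t j - x\<bar>" by (rule design_gap[of x]) (rule that)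
    have "\<exists>C. negligible {s \<in> {max 0 (x - d)..x}. norm (f s) > C}"
    proof (cases "x = 0")
      case False
      have "t j \<notin> {max 0 (x - d)<..<x}" if "j \<in> {1..n}" for j using d(2)[OF that] by auto
      then obtain c where "negligible {s \<in> {max 0 (x - d)..x}. norm (f s) \<noteq> c}"
        using F_lip_min[of "max 0 (x - d)" x] False x d(1) by auto
      then have "negligible {s \<in> {max 0 (x - d)..x}. norm (f s) > c}" by (rule negligible_subset) auto
      then show ?thesis by blast
    next
      case True
      then show ?thesis using d(1) by (intro exI[of _ 0] negligible_subset[OF negligible_sing[of 0]]) auto
    qed
    moreover have "\<exists>C. negligible {s \<in> {x..min 1 (x + d)}. norm (f s) > C}"
    proof (cases "x = 1")
      case False
      have "t j \<notin> {x<..<min 1 (x + d)}" if "j \<in> {1..n}" for j using d(2)[OF that] by auto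
      then obtain c where "negligible {s \<in> {x..min 1 (x + d)}. norm (f s) \<noteq> c}"
        using F_lip_min[of x "min 1 (x + d)"] False x d(1) by auto
      then have "negligible {s \<in> {x..min 1 (x + d)}. norm (f s) > c}" by (rule negligible_subset) auto
      then show ?thesis by blast
    next
      case True
      then show ?thesis using d(1) by (intro exI[of _ 0] negligible_subset[OF negligible_sing[of 1]]) auto
    qed
    ultimately obtain C1 C2 where "negligible {s \<in> {max 0 (x - d)..x}. norm (f s) > C1}"
      "negligible {s \<in> {x..min 1 (x + d)}. norm (f s) > C2}" by blast
    then have "negligible ({s \<in> {max 0 (x - d)..x}. norm (f s) > C1} \<union> {s \<in> {x..min 1 (x + d)}. norm (f s) > C2})"
      by (rule negligible_Un)
    then have "negligible {s \<in> {0..1} \<inter> ball x d. norm (f s) > max C1 C2}"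
      by (rule negligible_subset) (auto simp: dist_real_def abs_if split: if_splits)
    then show ?thesis using d(1) by blast
  qed
  then obtain d C where dC: "\<And>x. x \<in> {0..1} \<Longrightarrow> d x > 0 \<and> negligible {s \<in> {0..1} \<inter> ball x (d x). norm (f s) > C x}"
    by metis
  have "{0..1::real} \<subseteq> (\<Union>x\<in>{0..1}. ball x (d x))" using dC by force
  then obtain X where X: "X \<subseteq> {0..1}" "finite X" "{0..1::real} \<subseteq> (\<Union>x\<in>X. ball x (d x))"
    using compactE_image[of "{0..1::real}" "{0..1}" "\<lambda>x. ball x (d x)"] by (metis compact_Icc open_ball)
  define K where "K = Max (insert 0 (C ` X))"
  have K: "C x \<le> K" if "x \<in> X" for x using that X(2) by (auto simp: K_def)
  have "negligible (\<Union>x\<in>X. {s \<in> {0..1} \<inter> ball x (d x). norm (f s) > C x})"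
    by (rule negligible_Union) (use X dC in auto)
  then have neg: "negligible {s \<in> {0..1}. norm (f s) > K}"
  proof (rule negligible_subset)
    show "{s \<in> {0..1}. norm (f s) > K} \<subseteq> (\<Union>x\<in>X. {s \<in> {0..1} \<inter> ball x (d x). norm (f s) > C x})"
    proof
      fix s assume s: "s \<in> {s \<in> {0..1}. norm (f s) > K}"
      then obtain x where x: "x \<in> X" "s \<in> ball x (d x)" using X(3) by blast
      then show "s \<in> (\<Union>x\<in>X. {s \<in> {0..1} \<inter> ball x (d x). norm (f s) > C x})"
        using s K[OF x(1)] by (intro UN_I[OF x(1)]) auto
    qed
  qed
  have "AE s in lebesgue. s \<in> {0..1} \<longrightarrow> norm (f s) \<le> K"
    using neg unfolding negligible_iff_null_sets by (rule AE_I') (auto simp: not_le)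
  then have "AE s in lebesgue_on {0..1}. ereal (norm (f s)) \<le> ereal K"
    by (subst AE_restrict_space_iff) auto
  moreover have "(\<lambda>s. ereal (norm (f s))) \<in> borel_measurable (lebesgue_on {0..1})"
    using H1_curve_L2_I[OF H1_F] by (auto simp: L2_I_def)
  ultimately have "esssup (lebesgue_on {0..1}) (\<lambda>s. ereal (norm (f s))) \<le> ereal K" by (intro esssup_I)
  then show ?thesis by (auto simp: f_def intro: order_le_less_trans)
qed

lemma endpoint_derivatives:
  "((\<lambda>s. vector_derivative F (at s)) \<longlongrightarrow> 0) (at_right 0)"
  "((\<lambda>s. vector_derivative F (at s)) \<longlongrightarrow> 0) (at_left 1)"
proof -
  have T: "finite (t ` {1..n})" "t ` {1..n} \<noteq> {}" using n by auto
  define m1 m2 where "m1 = Min (t ` {1..n})" and "m2 = Max (t ` {1..n})"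
  have m: "m1 \<in> t ` {1..n}" "m2 \<in> t ` {1..n}" using Min_in[OF T] Max_in[OF T] by (auto simp: m1_def m2_def)
  have m1: "m1 \<le> t j" and m2: "t j \<le> m2" if "j \<in> {1..n}" for j
    using that T by (auto simp: m1_def m2_def)
  have m01: "0 < m1" "m1 < 1" "0 < m2" "m2 < 1" using m t(2) by auto
  have z: "vector_derivative F (at s) = 0" if U: "open U" "s \<in> U" "\<And>x. x \<in> U \<Longrightarrow> F x = c" for s c and U :: "real set"
  proof (rule vector_derivative_at)
    show "(F has_vector_derivative 0) (at s)"
      by (rule has_vector_derivative_transform_within_open[OF has_vector_derivative_const[of c] U(1,2)]) (simp add: U(3))
  qed
  have "vector_derivative F (at s) = 0" if "s \<in> {0<..<m1}" for s
  proof (rule z[of "{0<..<m1}" s "F m1"])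
    show "F x = F m1" if "x \<in> {0<..<m1}" for x
      by (rule F_constant_left) (use m1 m01 that in auto)
  qed (use that in auto)
  then have "\<forall>\<^sub>F s in at_right 0. 0 = vector_derivative F (at s)"
    using m01 by (auto simp: eventually_at_right intro!: exI[of _ m1])
  then show "((\<lambda>s. vector_derivative F (at s)) \<longlongrightarrow> 0) (at_right 0)"
    by (rule Lim_transform_eventually[OF tendsto_const])
  have "vector_derivative F (at s) = 0" if "s \<in> {m2<..<1}" for s
  proof (rule z[of "{m2<..<1}" s "F m2"])
    show "F x = F m2" if "x \<in> {m2<..<1}" for x
      by (rule F_constant_right) (use m2 m01 that in auto)
  qed (use that in auto)
  then have "\<forall>\<^sub>F s in at_left 1. 0 = vector_derivative F (at s)"
    using m01 by (auto simp: eventually_at_left intro!: exI[of _ m2])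
  then show "((\<lambda>s. vector_derivative F (at s)) \<longlongrightarrow> 0) (at_left 1)"
    by (rule Lim_transform_eventually[OF tendsto_const])
qed

end

section \<open>The intervals between consecutive design points\<close>

lemma (in penalized_setup) gap_properties:
  assumes i: "i \<in> {1..<n}"
  shows "0 < order_stat t n i" "order_stat t n i < order_stat t n (i + 1)" "order_stat t n (i + 1) < 1"
    "\<And>j. j \<in> {1..n} \<Longrightarrow> t j \<notin> {order_stat t n i<..<order_stat t n (i + 1)}"
proof -
  define xs where "xs = sorted_list_of_set (t ` {1..n})"
  have len: "length xs = n" using card_image[OF t(1)] by (simp add: xs_def)
  have set: "set xs = t ` {1..n}" by (simp add: xs_def)
  have srt: "sorted xs" "distinct xs" unfolding xs_def by simp_all
  have lt: "xs ! j < xs ! k" if "j < k" "k < n" for j k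
    using sorted_nth_mono[OF srt(1), of j k] nth_eq_iff_index_eq[OF srt(2), of j k] that len by simp
  \<comment> \<open>Order statistics are counted from 1 and list positions from 0, so the gap with
    index \<open>i\<close> lies between the positions \<open>i - 1\<close> and
    \<open>i\<close>.\<close>
  have a: "order_stat t n i = xs ! (i - 1)" and b: "order_stat t n (i + 1) = xs ! i"
    by (simp_all add: order_stat_def xs_def)
  have "xs ! (i - 1) \<in> set xs" "xs ! i \<in> set xs" using i len by auto
  then show "0 < order_stat t n i" "order_stat t n (i + 1) < 1"
    using t(2) unfolding a b set by auto
  show "order_stat t n i < order_stat t n (i + 1)" unfolding a b using i by (intro lt) auto
  fix j assume "j \<in> {1..n}"
  then have "t j \<in> set xs" unfolding set by blast
  then obtain m where m: "m < n" "t j = xs ! m" using len by (metis in_set_conv_nth)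
  show "t j \<notin> {order_stat t n i<..<order_stat t n (i + 1)}"
  proof
    assume "t j \<in> {order_stat t n i<..<order_stat t n (i + 1)}"
    then have *: "xs ! (i - 1) < xs ! m" "xs ! m < xs ! i" unfolding a b m(2) by auto
    have "i - 1 < n" using i by auto
    then have "\<not> m < i - 1" using lt[of m "i - 1"] * by (meson less_asym)
    moreover have "\<not> i < m" using lt[of i m] * m(1) by (meson less_asym)
    moreover have "m \<noteq> i - 1" "m \<noteq> i" using * by auto
    ultimately show False by linarith
  qed
qed

lemma geodesic_data_geodesic_on_open:
  assumes G: "geodesic_data M a b \<gamma> g g2" and C: "Ck_open 2 {a<..<b} \<gamma>"
  shows "geodesic_on M {a<..<b} \<gamma>"
  unfolding geodesic_on_def
proof (intro conjI ballI)
  show "\<gamma> ` {a<..<b} \<subseteq> M" using geodesic_dataD(3)[OF G] by force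
  show "Ck_on 2 {a<..<b} \<gamma>" using C by (simp add: Ck_on_open_iff)
  fix t w assume t: "t \<in> {a<..<b}" and w: "w \<in> tangent_space M (\<gamma> t)"
  note d = geodesic_data_interior[OF G]
  have wi: "at s within {a<..<b} = at s" if "s \<in> {a<..<b}" for s using at_within_open[OF that] by simp
  have g: "vector_derivative \<gamma> (at s within {a<..<b}) = g s" if "s \<in> {a<..<b}" for s
    unfolding wi[OF that] by (rule vector_derivative_at[OF d(1)[OF that]])
  have "((\<lambda>s. vector_derivative \<gamma> (at s within {a<..<b})) has_vector_derivative g2 t) (at t)"
    by (rule has_vector_derivative_transform_within_open[OF d(2)[OF t] open_greaterThanLessThan t]) (rule g[symmetric])
  then have "vector_derivative (\<lambda>s. vector_derivative \<gamma> (at s within {a<..<b})) (at t within {a<..<b}) = g2 t"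
    unfolding wi[OF t] by (rule vector_derivative_at)
  then show "vector_derivative (\<lambda>s. vector_derivative \<gamma> (at s within {a<..<b})) (at t within {a<..<b}) \<bullet> w = 0"
    using geodesic_dataD(6)[OF G _ w] t by simp
qed

text \<open>Every curve of the variation is a competitor for F on \<open>{c..d}\<close>, so the
  energy has a minimum at 0. It is enough that a derivative exists there, which the Leibniz rule
  provides; its value follows from minimality.\<close>

lemma (in penalized_manifold) harmonic_on_free_interval:
  assumes ab: "0 \<le> a" "a < b" "b \<le> 1" and free: "\<And>i. i \<in> {1..n} \<Longrightarrow> t i \<notin> {a<..<b}"
    and C: "Ck_open 2 {a<..<b} F"
  shows "harmonic_map M a b F"
  unfolding harmonic_map_def
proof (intro conjI allI impI, goal_cases)
  case 1 show ?case using F_in ab by force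
next
  case 2 show ?case using C by (simp add: Ck_on_open_iff)
next
  case (3 \<Phi> e c d)
  then have e: "e > 0" and cd: "a < c" "c < d" "d < b" and \<Phi>: "Ck_on 2 ({-e<..<e} \<times> {a<..<b}) \<Phi>"
    and \<Phi>M: "\<Phi> ` ({-e<..<e} \<times> {a<..<b}) \<subseteq> M" and \<Phi>0: "\<And>x. x \<in> {a<..<b} \<Longrightarrow> \<Phi> (0, x) = F x"
    and \<Phi>out: "\<And>s x. s \<in> {-e<..<e} \<Longrightarrow> x \<in> {a<..<b} - {c..d} \<Longrightarrow> \<Phi> (s, x) = F x" by blast+
  define W where "W = {-e<..<e} \<times> {a<..<b}"
  have W: "open W" unfolding W_def by (intro open_Times) auto
  have C2: "Ck_open 2 W \<Phi>" using \<Phi> W unfolding W_def[symmetric] by (simp add: Ck_on_open_iff)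
  have C2': "Ck_open (Suc (Suc 0)) W \<Phi>" using C2 by (simp add: numeral_2_eq_2)
  note C1 = Ck_open_dird[OF C2']
  define v where "v s x = dird \<Phi> (0, 1) (s, x)" for s x
  define v' where "v' s x = dird (dird \<Phi> (0, 1)) (1, 0) (s, x)" for s x
  have inW: "(s, x) \<in> W" if "s \<in> {-e<..<e}" "x \<in> {c..d}" for s x using that cd by (auto simp: W_def)
  have vd: "((\<lambda>x. \<Phi> (s, x)) has_vector_derivative v s x) (at x within S)" if "(s, x) \<in> W" for s x S
    unfolding v_def
    by (rule has_vector_derivative_dird[OF C2', of "\<lambda>x. (s, x)" x])
      (use that in \<open>auto intro!: has_vector_derivative_Pair derivative_eq_intros\<close>)
  have v'd: "((\<lambda>s. v s x) has_vector_derivative v' s x) (at s within S)" if "(s, x) \<in> W" for s x S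
    unfolding v_def v'_def
    by (rule has_vector_derivative_dird[OF C1, of "\<lambda>s. (s, x)" s])
      (use that in \<open>auto intro!: has_vector_derivative_Pair derivative_eq_intros\<close>)
  have cv: "continuous_on ({-e<..<e} \<times> {c..d}) (\<lambda>p. v (fst p) (snd p))" "continuous_on ({-e<..<e} \<times> {c..d}) (\<lambda>p. v' (fst p) (snd p))"
    unfolding v_def v'_def using inW
    by (intro continuous_on_dird[OF C2'] continuous_on_dird[OF C1]; auto intro!: continuous_intros)+
  have vc: "continuous_on {c..d} (v s)" if "s \<in> {-e<..<e}" for s
  proof -
    have "continuous_on {c..d} (\<lambda>x. (s, x))" by (intro continuous_intros)
    moreover have "(\<lambda>x. (s, x)) ` {c..d} \<subseteq> {-e<..<e} \<times> {c..d}" using that by auto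
    ultimately show ?thesis using continuous_on_compose2[OF cv(1)] by fastforce
  qed
  define E where "E s = 1/2 * integral {c..d} (\<lambda>x. (norm (v s x))\<^sup>2)" for s
  have E: "dirichlet_energy {c..d} (\<lambda>x. \<Phi> (s, x)) = E s" if s: "s \<in> {-e<..<e}" for s
  proof -
    have "vector_derivative (\<lambda>x. \<Phi> (s, x)) (at x) = v s x" if "x \<in> {c..d}" for x
      by (rule vector_derivative_at[OF vd[OF inW[OF s that]]])
    then have "integral {c..d} (\<lambda>x. (norm (vector_derivative (\<lambda>x. \<Phi> (s, x)) (at x)))\<^sup>2) = integral {c..d} (\<lambda>x. (norm (v s x))\<^sup>2)"
      by (intro Henstock_Kurzweil_Integration.integral_cong) simp
    then show ?thesis by (simp add: dirichlet_energy_def E_def)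
  qed
  have "((\<lambda>s. integral (cbox c d) (\<lambda>x. (norm (v s x))\<^sup>2)) has_real_derivative
       integral (cbox c d) (\<lambda>x. 2 * (v 0 x \<bullet> v' 0 x))) (at 0 within {-e<..<e})"
  proof (rule leibniz_rule_field_derivative)
    show "((\<lambda>s. (norm (v s x))\<^sup>2) has_real_derivative 2 * (v s x \<bullet> v' s x)) (at s within {-e<..<e})"
      if "s \<in> {-e<..<e}" "x \<in> cbox c d" for s x
    proof -
      have sx: "(s, x) \<in> W" using that inW by simp
      have "((\<lambda>s. v s x \<bullet> v s x) has_derivative (\<lambda>h. v s x \<bullet> (h *\<^sub>R v' s x) + (h *\<^sub>R v' s x) \<bullet> v s x)) (at s within {-e<..<e})"
        using v'd[OF sx] unfolding has_vector_derivative_def by (intro has_derivative_inner)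
      moreover have "(\<lambda>h. v s x \<bullet> (h *\<^sub>R v' s x) + (h *\<^sub>R v' s x) \<bullet> v s x) = (*) (2 * (v s x \<bullet> v' s x))"
        by (auto simp: inner_commute)
      ultimately show ?thesis unfolding has_field_derivative_def power2_norm_eq_inner by simp
    qed
    show "(\<lambda>x. (norm (v s x))\<^sup>2) integrable_on cbox c d" if "s \<in> {-e<..<e}" for s
      unfolding box_real by (intro integrable_continuous_real continuous_intros vc[OF that])
    show "continuous_on ({-e<..<e} \<times> cbox c d) (\<lambda>(s, x). 2 * (v s x \<bullet> v' s x))"
      unfolding case_prod_unfold box_real by (intro continuous_intros cv)
  qed (use e in auto)
  then have "((\<lambda>s. integral {c..d} (\<lambda>x. (norm (v s x))\<^sup>2)) has_real_derivative
       integral {c..d} (\<lambda>x. 2 * (v 0 x \<bullet> v' 0 x))) (at 0)"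
    unfolding box_real by (subst (asm) at_within_open) (use e in auto)
  from DERIV_cmult[OF this, of "1/2"]
  obtain D where D: "(E has_real_derivative D) (at 0)" unfolding E_def[abs_def] by blast
  have Fcont: "isCont F x" if "x \<in> {a<..<b}" for x
  proof -
    have "{a<..<b} \<subseteq> {0..1}" using ab by auto
    from continuous_on_subset[OF F_continuous this] show ?thesis using that by (simp add: continuous_on_eq_continuous_at)
  qed
  have \<Phi>cont: "isCont (\<lambda>x. \<Phi> (s, x)) x" if "s \<in> {-e<..<e}" "x \<in> {a<..<b}" for s x
    by (rule has_vector_derivative_continuous[OF vd[of s x UNIV]]) (use that in \<open>auto simp: W_def\<close>)
  \<comment> \<open>The variation is known to be fixed outside the closed interval; the value at
    \<open>c\<close> follows by continuity from the left.\<close>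
  have endc: "\<Phi> (s, c) = F c" if s: "s \<in> {-e<..<e}" for s
  proof (rule tendsto_unique[OF trivial_limit_at_left_real])
    show "((\<lambda>x. \<Phi> (s, x)) \<longlongrightarrow> \<Phi> (s, c)) (at_left c)"
      using \<Phi>cont[OF s, of c] cd unfolding isCont_def by (auto intro: tendsto_within_subset)
    have "(F \<longlongrightarrow> F c) (at_left c)"
      using Fcont[of c] cd unfolding isCont_def by (auto intro: tendsto_within_subset)
    then show "((\<lambda>x. \<Phi> (s, x)) \<longlongrightarrow> F c) (at_left c)"
      by (rule Lim_transform_eventually)
        (use \<Phi>out[OF s] cd in \<open>auto simp: eventually_at_left intro!: exI[of _ a]\<close>)
  qed
  have endd: "\<Phi> (s, d) = F d" if s: "s \<in> {-e<..<e}" for s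
  proof (rule tendsto_unique[OF trivial_limit_at_right_real])
    show "((\<lambda>x. \<Phi> (s, x)) \<longlongrightarrow> \<Phi> (s, d)) (at_right d)"
      using \<Phi>cont[OF s, of d] cd unfolding isCont_def by (auto intro: tendsto_within_subset)
    have "(F \<longlongrightarrow> F d) (at_right d)"
      using Fcont[of d] cd unfolding isCont_def by (auto intro: tendsto_within_subset)
    then show "((\<lambda>x. \<Phi> (s, x)) \<longlongrightarrow> F d) (at_right d)"
      by (rule Lim_transform_eventually)
        (use \<Phi>out[OF s] cd in \<open>auto simp: eventually_at_right intro!: exI[of _ b]\<close>)
  qed
  have H: "H1_curve c d (\<lambda>x. \<Phi> (s, x)) (v s)" if s: "s \<in> {-e<..<e}" for s
    by (rule H1_curve_continuous_derivative[OF vd[OF inW[OF s]] vc[OF s]])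
  have e0: "0 \<in> {-e<..<e}" using e by simp
  have "H1_curve c d F (v 0)" by (rule H1_curve_cong[OF H[OF e0]]) (use \<Phi>0 cd in auto)
  then have f0: "integral {c..d} (\<lambda>x. (norm (f x))\<^sup>2) = integral {c..d} (\<lambda>x. (norm (v 0 x))\<^sup>2)"
    by (rule H1_curve_energy_unique[OF H1_curve_subinterval[OF H1_F], rotated 2]) (use cd ab in auto)
  have min: "E 0 \<le> E s" if s: "s \<in> {-e<..<e}" for s
  proof -
    have "integral {c..d} (\<lambda>x. (norm (f x))\<^sup>2) \<le> integral {c..d} (\<lambda>x. (norm (v s x))\<^sup>2)"
    proof (rule energy_minimal[OF _ _ _ H[OF s]])
      show "\<Phi> (s, x) \<in> M" if "x \<in> {c..d}" for x using \<Phi>M inW[OF s that] unfolding W_def by blast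
      show "\<Phi> (s, t i) = F (t i)" if "i \<in> {1..n}" "t i \<in> {c..d}" for i
        using free[OF that(1)] that(2) cd by auto
    qed (use endc[OF s] endd[OF s] cd ab in auto)
    then show ?thesis unfolding E_def f0 by simp
  qed
  have "D = 0" by (rule DERIV_local_min[OF D e]) (use min in \<open>auto simp: abs_less_iff\<close>)
  then have "(E has_real_derivative 0) (at 0)" using D by simp
  then show ?case
    by (rule has_field_derivative_transform_within_open[where S = "{-e<..<e}"]) (use e E in auto)
qed

lemma (in penalized_manifold) gap_geodesic:
  assumes i: "i \<in> {1..<n}"
  shows "harmonic_map M (order_stat t n i) (order_stat t n (i + 1)) F"
    "geodesic_on M (gap t n i) F" "\<exists>c. \<forall>s\<in>gap t n i. norm (vector_derivative F (at s)) = c"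
    "\<exists>g g2. geodesic_data M (order_stat t n i) (order_stat t n (i + 1)) F g g2"
    "\<And>k. locally_retractable k M \<Longrightarrow> k \<ge> 2 \<Longrightarrow> Ck_open k (gap t n i) F"
proof -
  define a b where "a = order_stat t n i" and "b = order_stat t n (i + 1)"
  have ab: "0 \<le> a" "a < b" "b \<le> 1" and free: "\<And>j. j \<in> {1..n} \<Longrightarrow> t j \<notin> {a<..<b}"
    using gap_properties[OF i] unfolding a_def b_def by auto
  have gp: "gap t n i = {a<..<b}" by (simp add: gap_def a_def b_def)
  obtain c where m: "lip_min M a b c F" by (rule F_lip_min[OF ab free])
  obtain g g2 where G: "geodesic_data M a b F g g2" "\<And>s. s \<in> {a<..<b} \<Longrightarrow> vector_derivative F (at s) = g s"
    by (rule lip_min_geodesic_data[OF m R order_refl ab(2)]) (rule that)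
  have C: "Ck_open 2 {a<..<b} F" by (rule lip_min_Ck[OF m R order_refl ab(2)])
  show "harmonic_map M (order_stat t n i) (order_stat t n (i + 1)) F"
    using harmonic_on_free_interval[OF ab free C] by (simp add: a_def b_def)
  show "geodesic_on M (gap t n i) F" unfolding gp by (rule geodesic_data_geodesic_on_open[OF G(1) C])
  show "\<exists>c. \<forall>s\<in>gap t n i. norm (vector_derivative F (at s)) = c"
  proof (intro exI ballI)
    fix s assume "s \<in> gap t n i"
    then show "norm (vector_derivative F (at s)) = c"
      unfolding gp using G(2) lip_min_speed[OF m G(1) R _ ab(2)] by simp
  qed
  show "\<exists>g g2. geodesic_data M (order_stat t n i) (order_stat t n (i + 1)) F g g2"
    using G(1) unfolding a_def b_def by blast
  show "Ck_open k (gap t n i) F" if "locally_retractable k M" "k \<ge> 2" for k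
    unfolding gp by (rule lip_min_Ck[OF m that ab(2)])
qed

text \<open>Compactness fails for the whole space, so the comparison is made directly with the
  affine interpolation of velocity \<open>v\<close>. The velocity of the minimizer has mean
  \<open>v\<close>, and an energy not above that of \<open>v\<close> forces it to equal
  \<open>v\<close> almost everywhere.\<close>

lemma (in penalized_setup) affine_on_gap:
  assumes M: "M = UNIV" and i: "i \<in> {1..<n}"
  shows "\<exists>p v. \<forall>s\<in>gap t n i. F s = p + s *\<^sub>R v"
proof -
  define a b where "a = order_stat t n i" and "b = order_stat t n (i + 1)"
  have ab: "0 \<le> a" "a < b" "b \<le> 1" and free: "\<And>j. j \<in> {1..n} \<Longrightarrow> t j \<notin> {a<..<b}"
    using gap_properties[OF i] unfolding a_def b_def by auto
  define v where "v = (1 / (b - a)) *\<^sub>R (F b - F a)"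
  have v: "(b - a) *\<^sub>R v = F b - F a" using ab by (simp add: v_def)
  have H: "H1_curve a b F f" using H1_curve_subinterval[OF H1_F] ab by auto
  have "H1_curve a b (\<lambda>s. F a + (s - a) *\<^sub>R v) (\<lambda>s. v)"
    by (rule H1_curve_continuous_derivative) (auto intro!: derivative_eq_intros)
  then have "integral {a..b} (\<lambda>s. (norm (f s))\<^sup>2) \<le> integral {a..b} (\<lambda>s. (norm v)\<^sup>2)"
  proof (rule energy_minimal[rotated 3])
    show "F a + (t j - a) *\<^sub>R v = F (t j)" if "j \<in> {1..n}" "t j \<in> {a..b}" for j
    proof -
      have "t j = a \<or> t j = b" using free[OF that(1)] that(2) by auto
      then show ?thesis using v by auto
    qed
  qed (use ab M v in auto)
  then have E: "integral {a..b} (\<lambda>s. (norm (f s))\<^sup>2) \<le> (b - a) * (norm v)\<^sup>2" using ab by simp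
  have fi: "(f has_integral (b - a) *\<^sub>R v) {a..b}" unfolding v by (rule H1_curveD(1)[OF H]) (use ab in auto)
  then have "((\<lambda>s. v \<bullet> f s) has_integral v \<bullet> ((b - a) *\<^sub>R v)) {a..b}"
    using has_integral_linear[OF fi bounded_linear_inner_right[of v]] by (simp add: o_def)
  from has_integral_add[OF has_integral_diff[OF integrable_integral[OF H1_curveD(2)[OF H]] has_integral_mult_right[OF this, of 2]]
      has_integral_const_real[of "(norm v)\<^sup>2" a b]]
  have "((\<lambda>s. (norm (f s))\<^sup>2 - 2 * (v \<bullet> f s) + (norm v)\<^sup>2) has_integral
      integral {a..b} (\<lambda>s. (norm (f s))\<^sup>2) - (b - a) * (norm v)\<^sup>2) {a..b}"
    using ab by (simp add: power2_norm_eq_inner algebra_simps)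
  moreover have "(norm (f s))\<^sup>2 - 2 * (v \<bullet> f s) + (norm v)\<^sup>2 = (norm (f s - v))\<^sup>2" for s
    by (simp add: power2_norm_eq_inner inner_diff_left inner_diff_right inner_commute)
  ultimately have d: "((\<lambda>s. (norm (f s - v))\<^sup>2) has_integral integral {a..b} (\<lambda>s. (norm (f s))\<^sup>2) - (b - a) * (norm v)\<^sup>2) {a..b}"
    by simp
  have "0 \<le> integral {a..b} (\<lambda>s. (norm (f s))\<^sup>2) - (b - a) * (norm v)\<^sup>2"
    by (rule has_integral_nonneg[OF d]) simp
  then have "((\<lambda>s. (norm (f s - v))\<^sup>2) has_integral 0) {a..b}" using d E by simp
  then have "negligible {s \<in> {a..b}. (norm (f s - v))\<^sup>2 \<noteq> 0}" by (rule has_integral_0_negligible) auto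
  then have neg: "negligible {s \<in> {a..b}. f s \<noteq> v}" by simp
  have "F s = (F a - a *\<^sub>R v) + s *\<^sub>R v" if s: "s \<in> {a<..<b}" for s
  proof -
    have "(f has_integral F s - F a) {a..s}" by (rule H1_curveD(1)[OF H]) (use s in auto)
    moreover have "((\<lambda>x. v) has_integral (s - a) *\<^sub>R v) {a..s}"
      using has_integral_const_real[of v a s] s by simp
    then have "(f has_integral (s - a) *\<^sub>R v) {a..s}"
      by (rule has_integral_spike[OF neg, rotated]) (use s in auto)
    ultimately have "F s - F a = (s - a) *\<^sub>R v" by (rule has_integral_unique)
    then show ?thesis by (simp add: algebra_simps)
  qed
  then show ?thesis unfolding gap_def a_def b_def by blast
qed

section \<open>Great circles\<close>

lemma tangent_space_sphere:
  fixes p w :: "'a::euclidean_space"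
  assumes p: "norm p = 1" and w: "p \<bullet> w = 0"
  shows "w \<in> tangent_space (sphere 0 1) p"
proof -
  \<comment> \<open>The central projection of the tangent line to the sphere.\<close>
  define \<gamma> where "\<gamma> s = (1 / sqrt (1 + s\<^sup>2 * (norm w)\<^sup>2)) *\<^sub>R (p + s *\<^sub>R w)" for s
  have n: "norm (p + s *\<^sub>R w) = sqrt (1 + s\<^sup>2 * (norm w)\<^sup>2)" for s
  proof -
    have "p \<bullet> p = 1" "w \<bullet> w = (norm w)\<^sup>2" using p by (simp_all add: dot_square_norm)
    then show ?thesis
      unfolding norm_eq_sqrt_inner[of "p + s *\<^sub>R w"]
      using w by (simp add: inner_add_left inner_add_right inner_commute power2_eq_square)
  qed
  have pos: "sqrt (1 + s\<^sup>2 * (norm w)\<^sup>2) > 0" for s by (simp add: add_pos_nonneg)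
  have sp: "\<gamma> s \<in> sphere 0 1" for s
    using n[of s] pos[of s] by (simp add: \<gamma>_def)
  have "((\<lambda>s. 1 / sqrt (1 + s\<^sup>2 * (norm w)\<^sup>2)) has_real_derivative 0) (at 0)"
    by (auto intro!: derivative_eq_intros)
  moreover have "((\<lambda>s. p + s *\<^sub>R w) has_vector_derivative w) (at 0)"
    by (auto intro!: derivative_eq_intros)
  ultimately have "(\<gamma> has_vector_derivative (1 / sqrt (1 + 0\<^sup>2 * (norm w)\<^sup>2)) *\<^sub>R w + 0 *\<^sub>R (p + 0 *\<^sub>R w)) (at 0)"
    unfolding \<gamma>_def[abs_def] by (rule has_vector_derivative_scaleR)
  then have "(\<gamma> has_vector_derivative w) (at 0)" by simp
  moreover have "\<gamma> 0 = p" by (simp add: \<gamma>_def)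
  ultimately show ?thesis
    unfolding tangent_space_def using sp by (intro CollectI exI[of _ \<gamma>] exI[of _ 1] conjI image_subsetI) simp_all
qed

text \<open>Differentiating the unit norm twice gives \<open>g2 = - c\<^sup>2 \<gamma>\<close>. For
  positive speed two explicit combinations of \<gamma> and its velocity then have derivative 0 and
  recover \<gamma>. For speed 0 connectedness forces dimension at least 2, which provides a second
  orthonormal vector.\<close>

lemma great_circle:
  fixes \<gamma> :: "real \<Rightarrow> 'a::euclidean_space"
  assumes G: "geodesic_data (sphere 0 1) a b \<gamma> g g2" and ab: "a < b" and conn: "connected (sphere (0::'a) 1)"
    and speed: "\<And>t. t \<in> {a..b} \<Longrightarrow> norm (g t) = c"
  shows "\<exists>u v w. norm u = 1 \<and> norm v = 1 \<and> u \<bullet> v = 0 \<and> w \<ge> 0 \<and>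
      (\<forall>s\<in>{a<..<b}. \<gamma> s = cos (w * s) *\<^sub>R u + sin (w * s) *\<^sub>R v)"
proof -
  note D = geodesic_dataD[OF G]
  have nt: "at t within {a..b} \<noteq> bot" if "t \<in> {a..b}" for t by (rule at_within_Icc_nontrivial[OF ab that])
  have n1: "\<gamma> t \<bullet> \<gamma> t = 1" if "t \<in> {a..b}" for t
    using D(3)[OF that] by (simp add: norm_eq_sqrt_inner)
  have inner_d: "((\<lambda>t. p t \<bullet> q t) has_vector_derivative p t \<bullet> q' + p' \<bullet> q t) (at t within S)"
    if "(p has_vector_derivative p') (at t within S)" "(q has_vector_derivative q') (at t within S)"
    for p q :: "real \<Rightarrow> 'a" and p' q' t S
    using has_derivative_inner[OF that[unfolded has_vector_derivative_def]]
    unfolding has_vector_derivative_def by (rule has_derivative_eq_rhs) (simp add: algebra_simps)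
  have fg: "\<gamma> t \<bullet> g t = 0" if t: "t \<in> {a..b}" for t
  proof -
    have "((\<lambda>t. 1) has_vector_derivative \<gamma> t \<bullet> g t + g t \<bullet> \<gamma> t) (at t within {a..b})"
      by (rule has_vector_derivative_transform[OF t n1[symmetric] inner_d[OF D(4)[OF t] D(4)[OF t]]])
    then have "\<gamma> t \<bullet> g t + g t \<bullet> \<gamma> t = 0"
      using vector_derivative_unique_within[OF nt[OF t]] has_vector_derivative_const by blast
    then show ?thesis by (simp add: inner_commute)
  qed
  have g2: "g2 t = - (c\<^sup>2) *\<^sub>R \<gamma> t" if t: "t \<in> {a..b}" for t
  proof -
    have "((\<lambda>t. 0) has_vector_derivative \<gamma> t \<bullet> g2 t + g t \<bullet> g t) (at t within {a..b})"
      by (rule has_vector_derivative_transform[OF t fg[symmetric] inner_d[OF D(4)[OF t] D(5)[OF t]]])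
    then have "\<gamma> t \<bullet> g2 t + g t \<bullet> g t = 0"
      using vector_derivative_unique_within[OF nt[OF t]] has_vector_derivative_const by blast
    then have gg: "\<gamma> t \<bullet> g2 t = - c\<^sup>2" using speed[OF t] by (simp add: power2_norm_eq_inner[symmetric])
    \<comment> \<open>The part of the acceleration orthogonal to \<gamma> is tangent to the sphere,
      and the acceleration is normal, so this part is orthogonal to itself.\<close>
    define w where "w = g2 t - (\<gamma> t \<bullet> g2 t) *\<^sub>R \<gamma> t"
    have w0: "\<gamma> t \<bullet> w = 0" using n1[OF t] by (simp add: w_def inner_diff_right)
    have "w \<in> tangent_space (sphere 0 1) (\<gamma> t)" by (rule tangent_space_sphere[OF _ w0]) (use D(3)[OF t] in simp)
    then have "g2 t \<bullet> w = 0" by (rule D(6)[OF t])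
    then have "w \<bullet> w = 0" using w0 by (simp add: w_def inner_diff_left)
    then show ?thesis using gg by (simp add: w_def eq_neg_iff_add_eq_0)
  qed
  show ?thesis
  proof (cases "c = 0")
    case True
    have "\<exists>u. \<forall>t\<in>{a..b}. \<gamma> t = u"
    proof (rule has_derivative_zero_constant)
      show "(\<gamma> has_derivative (\<lambda>h. 0)) (at t within {a..b})" if "t \<in> {a..b}" for t
        using D(4)[OF that] speed[OF that] True by (simp add: has_vector_derivative_def)
    qed simp
    then obtain u where u: "\<And>t. t \<in> {a..b} \<Longrightarrow> \<gamma> t = u" by blast
    have nu: "norm u = 1" using u[of a] D(3)[of a] ab by simp
    have "2 \<le> DIM('a)" using conn by (simp add: connected_sphere_eq)
    then obtain y where y: "y \<noteq> 0" "orthogonal u y" using orthogonal_to_vector_exists by blast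
    have "norm (y /\<^sub>R norm y) = 1" "u \<bullet> (y /\<^sub>R norm y) = 0" using y by (auto simp: orthogonal_def)
    then show ?thesis
      using nu u by (intro exI[of _ u] exI[of _ "y /\<^sub>R norm y"] exI[of _ 0]) auto
  next
    case False
    have cpos: "c > 0" using False speed[of a] ab norm_ge_zero[of "g a"] by auto
    \<comment> \<open>Rotating the pair of \<gamma> and \<open>g / c\<close> back by the angle
      \<open>c * s\<close> freezes uniform motion on a great circle.\<close>
    define A where "A s = cos (c * s) *\<^sub>R \<gamma> s - (sin (c * s) / c) *\<^sub>R g s" for s
    define B where "B s = sin (c * s) *\<^sub>R \<gamma> s + (cos (c * s) / c) *\<^sub>R g s" for s
    have cd: "((\<lambda>s. cos (c * s)) has_real_derivative - c * sin (c * s)) (at s within S)"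
      "((\<lambda>s. sin (c * s)) has_real_derivative c * cos (c * s)) (at s within S)"
      "((\<lambda>s. sin (c * s) / c) has_real_derivative cos (c * s)) (at s within S)"
      "((\<lambda>s. cos (c * s) / c) has_real_derivative - sin (c * s)) (at s within S)" for s S
      using cpos by (auto intro!: derivative_eq_intros)
    have Ad: "(A has_derivative (\<lambda>h. 0)) (at s within {a..b})" if s: "s \<in> {a..b}" for s
    proof -
      have "(A has_vector_derivative (cos (c * s) *\<^sub>R g s + (- c * sin (c * s)) *\<^sub>R \<gamma> s)
          - ((sin (c * s) / c) *\<^sub>R g2 s + cos (c * s) *\<^sub>R g s)) (at s within {a..b})"
        unfolding A_def[abs_def] by (intro has_vector_derivative_diff has_vector_derivative_scaleR cd D(4,5) s)
      moreover have "(cos (c * s) *\<^sub>R g s + (- c * sin (c * s)) *\<^sub>R \<gamma> s)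
          - ((sin (c * s) / c) *\<^sub>R g2 s + cos (c * s) *\<^sub>R g s) = 0"
        unfolding g2[OF s] using cpos by (simp add: power2_eq_square algebra_simps)
      ultimately show ?thesis by (simp add: has_vector_derivative_def)
    qed
    have Bd: "(B has_derivative (\<lambda>h. 0)) (at s within {a..b})" if s: "s \<in> {a..b}" for s
    proof -
      have "(B has_vector_derivative (sin (c * s) *\<^sub>R g s + (c * cos (c * s)) *\<^sub>R \<gamma> s)
          + ((cos (c * s) / c) *\<^sub>R g2 s + (- sin (c * s)) *\<^sub>R g s)) (at s within {a..b})"
        unfolding B_def[abs_def] by (intro has_vector_derivative_add has_vector_derivative_scaleR cd D(4,5) s)
      moreover have "(sin (c * s) *\<^sub>R g s + (c * cos (c * s)) *\<^sub>R \<gamma> s)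
          + ((cos (c * s) / c) *\<^sub>R g2 s + (- sin (c * s)) *\<^sub>R g s) = 0"
        unfolding g2[OF s] using cpos by (simp add: power2_eq_square algebra_simps)
      ultimately show ?thesis by (simp add: has_vector_derivative_def)
    qed
    obtain u where u: "\<And>s. s \<in> {a..b} \<Longrightarrow> A s = u"
      using has_derivative_zero_constant[OF convex_real_interval(5) Ad] by blast
    obtain v where v: "\<And>s. s \<in> {a..b} \<Longrightarrow> B s = v"
      using has_derivative_zero_constant[OF convex_real_interval(5) Bd] by blast
    have a: "a \<in> {a..b}" using ab by simp
    have gg: "g a \<bullet> g a = c * c" using speed[OF a] by (metis power2_eq_square power2_norm_eq_inner)
    note s2 = sin_cos_squared_add3[of "c * a"]
    have ip: "\<gamma> a \<bullet> \<gamma> a = 1" "\<gamma> a \<bullet> g a = 0" "g a \<bullet> \<gamma> a = 0" using n1[OF a] fg[OF a] by (auto simp: inner_commute)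
    have "A a \<bullet> A a = 1" "B a \<bullet> B a = 1" "A a \<bullet> B a = 0"
      unfolding A_def B_def using s2 cpos
      by (simp_all add: inner_add_left inner_add_right inner_diff_left inner_diff_right ip gg add.commute)
    then have uv: "norm u = 1" "norm v = 1" "u \<bullet> v = 0" using u[OF a] v[OF a] by (simp_all add: norm_eq_sqrt_inner)
    have "\<gamma> s = cos (c * s) *\<^sub>R u + sin (c * s) *\<^sub>R v" if "s \<in> {a<..<b}" for s
    proof -
      have "cos (c * s) *\<^sub>R A s + sin (c * s) *\<^sub>R B s = (cos (c * s) * cos (c * s) + sin (c * s) * sin (c * s)) *\<^sub>R \<gamma> s"
        unfolding A_def B_def scaleR_diff_right scaleR_add_right scaleR_left_distrib scaleR_scaleR
        by (simp add: mult.commute)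
      also have "cos (c * s) * cos (c * s) + sin (c * s) * sin (c * s) = 1"
        using sin_cos_squared_add[of "c * s"] by (simp add: power2_eq_square)
      also have "1 *\<^sub>R \<gamma> s = \<gamma> s" by simp
      finally show ?thesis using u[of s] v[of s] that by simp
    qed
    then show ?thesis using uv cpos by (intro exI[of _ u] exI[of _ v] exI[of _ c]) auto
  qed
qed

section \<open>Holomorphic extensions\<close>

text \<open>Complex vectors are functions \<open>'a \<Rightarrow> complex\<close> of which only the values on \<open>Basis\<close> matter.
  Instead of complex differentiability in several variables we use holomorphy along all holomorphic
  curves, which passes to compositions and to uniform limits at once.\<close>

definition cvec :: "'a::euclidean_space \<Rightarrow> 'a \<Rightarrow> complex" where
  "cvec x = (\<lambda>b. of_real (x \<bullet> b))"

definition polydisc :: "'a::euclidean_space \<Rightarrow> real \<Rightarrow> ('a \<Rightarrow> complex) set" where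
  "polydisc p r = {z. \<forall>b\<in>Basis. cmod (z b - cvec p b) < r}"

definition hol_bounded :: "(('a::euclidean_space \<Rightarrow> complex) \<Rightarrow> complex) \<Rightarrow> 'a \<Rightarrow> real \<Rightarrow> real \<Rightarrow> bool" where
  "hol_bounded g p r K \<longleftrightarrow> 0 < r \<and> (\<forall>z\<in>polydisc p r. cmod (g z) \<le> K) \<and>
     (\<forall>S \<zeta>. open S \<longrightarrow> (\<forall>b. (\<lambda>\<sigma>. \<zeta> \<sigma> b) holomorphic_on S) \<longrightarrow> (\<forall>\<sigma>\<in>S. \<zeta> \<sigma> \<in> polydisc p r) \<longrightarrow>
        (\<lambda>\<sigma>. g (\<zeta> \<sigma>)) holomorphic_on S)"

definition hol_ext :: "('a::euclidean_space \<Rightarrow> real) \<Rightarrow> (('a \<Rightarrow> complex) \<Rightarrow> complex) \<Rightarrow> 'a \<Rightarrow> real \<Rightarrow> bool" where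
  "hol_ext f g p r \<longleftrightarrow> (\<forall>x. cvec x \<in> polydisc p r \<longrightarrow> g (cvec x) = of_real (f x))"

lemma hol_boundedD:
  assumes "hol_bounded g p r K"
  shows "0 < r" "\<And>z. z \<in> polydisc p r \<Longrightarrow> cmod (g z) \<le> K"
    "\<And>S \<zeta>. open S \<Longrightarrow> (\<And>b. (\<lambda>\<sigma>. \<zeta> \<sigma> b) holomorphic_on S) \<Longrightarrow> (\<And>\<sigma>. \<sigma> \<in> S \<Longrightarrow> \<zeta> \<sigma> \<in> polydisc p r) \<Longrightarrow>
        (\<lambda>\<sigma>. g (\<zeta> \<sigma>)) holomorphic_on S"
  using assms unfolding hol_bounded_def by blast+

lemma polydiscD: "z \<in> polydisc p r \<Longrightarrow> b \<in> Basis \<Longrightarrow> cmod (z b - cvec p b) < r"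
  by (simp add: polydisc_def)

lemma polydisc_mono: "r \<le> r' \<Longrightarrow> z \<in> polydisc p r \<Longrightarrow> z \<in> polydisc p r'"
  by (force simp: polydisc_def)

lemma cvec_center: "0 < r \<Longrightarrow> cvec p \<in> polydisc p r"
  by (simp add: polydisc_def)

lemma polydisc_add:
  assumes "z \<in> polydisc p r" "\<And>b. b \<in> Basis \<Longrightarrow> cmod (w b) \<le> s"
  shows "(\<lambda>b. z b + w b) \<in> polydisc p (r + s)"
  unfolding polydisc_def
proof (intro CollectI ballI)
  fix b :: 'a assume b: "b \<in> Basis"
  have "cmod (z b + w b - cvec p b) \<le> cmod (z b - cvec p b) + cmod (w b)"
    using norm_triangle_ineq[of "z b - cvec p b" "w b"] by (simp add: algebra_simps)
  then show "cmod (z b + w b - cvec p b) < r + s"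
    using polydiscD[OF assms(1) b] assms(2)[OF b] by linarith
qed

lemma cvec_polydisc_iff: "cvec x \<in> polydisc p r \<longleftrightarrow> (\<forall>b\<in>Basis. \<bar>x \<bullet> b - p \<bullet> b\<bar> < r)"
  unfolding polydisc_def cvec_def by (simp flip: of_real_diff)

lemma open_box_polydisc: "open {x. cvec x \<in> polydisc p r}"
proof -
  have "{x. cvec x \<in> polydisc p r} = (\<Inter>b\<in>Basis. {x. \<bar>x \<bullet> b - p \<bullet> b\<bar> < r})"
    by (auto simp: cvec_polydisc_iff)
  moreover have "open {x. \<bar>x \<bullet> b - p \<bullet> b\<bar> < r}" for b
    by (intro open_Collect_less continuous_intros)
  ultimately show ?thesis by (simp add: open_INT)
qed

lemma hol_bounded_mono: "hol_bounded g p r K \<Longrightarrow> 0 < r' \<Longrightarrow> r' \<le> r \<Longrightarrow> K \<le> K' \<Longrightarrow> hol_bounded g p r' K'"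
  unfolding hol_bounded_def using polydisc_mono[of r' r _ p] by (meson order_trans)

lemma hol_ext_mono: "hol_ext f g p r \<Longrightarrow> r' \<le> r \<Longrightarrow> hol_ext f g p r'"
  unfolding hol_ext_def using polydisc_mono[of r' r _ p] by blast

lemma hol_bounded_nonneg: "hol_bounded g p r K \<Longrightarrow> 0 \<le> K"
  using hol_boundedD(1,2)[of g p r K] cvec_center[of r p] norm_ge_zero order_trans by blast

text \<open>Cauchy's inequality on circles of radius R/4 around points of the half disc bounds the
  n-th derivative by n! K (4/R)^n. The cases n = 1 and n = 2 give the constants
  \<open>4 * K / R\<close> and \<open>32 * K / R\<^sup>2\<close>.\<close>

lemma bounded_holomorphic_estimates:
  assumes h: "h holomorphic_on ball 0 R" and K: "\<And>\<tau>. \<tau> \<in> ball 0 R \<Longrightarrow> cmod (h \<tau>) \<le> K" and R: "0 < R"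
    and t: "cmod \<tau> \<le> R / 2"
  shows "cmod (deriv h \<tau>) \<le> 4 * K / R" "cmod (h \<tau> - h 0) \<le> 4 * K / R * cmod \<tau>"
    "cmod (h \<tau> - h 0 - \<tau> * deriv h 0) \<le> 32 * K / R\<^sup>2 * (cmod \<tau>)\<^sup>2"
proof -
  have c: "cmod ((deriv ^^ n) h \<sigma>) \<le> fact n * K / (R / 4) ^ n" if s: "cmod \<sigma> \<le> R / 2" for \<sigma> n
  proof (rule Cauchy_inequality)
    have sub: "cball \<sigma> (R / 4) \<subseteq> ball 0 R"
    proof
      fix x assume "x \<in> cball \<sigma> (R / 4)"
      then have "cmod (\<sigma> - x) \<le> R / 4" by (simp add: dist_norm)
      then have "cmod x \<le> R / 2 + R / 4" using s norm_triangle_ineq4[of \<sigma> "\<sigma> - x"] by simp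
      then show "x \<in> ball 0 R" using R by simp
    qed
    show "h holomorphic_on ball \<sigma> (R / 4)" by (rule holomorphic_on_subset[OF h]) (use sub ball_subset_cball in blast)
    show "continuous_on (cball \<sigma> (R / 4)) h"
      by (rule holomorphic_on_imp_continuous_on[OF holomorphic_on_subset[OF h sub]])
    show "cmod (h x) \<le> K" if "cmod (\<sigma> - x) = R / 4" for x
      using sub that by (intro K) (auto simp: dist_norm)
  qed (use R in simp)
  show 1: "cmod (deriv h \<tau>) \<le> 4 * K / R" using c[OF t, of 1] by (simp add: field_simps)
  have d: "((deriv ^^ n) h has_field_derivative (deriv ^^ Suc n) h x) (at x within cball 0 (R/2))"
    if "x \<in> cball 0 (R/2)" for n x
  proof -
    have "((deriv ^^ n) h has_field_derivative deriv ((deriv ^^ n) h) x) (at x)"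
      by (rule holomorphic_derivI[OF holomorphic_higher_deriv[OF h open_ball] open_ball]) (use that R in auto)
    then show ?thesis using has_field_derivative_at_within by fastforce
  qed
  have tc: "\<tau> \<in> cball 0 (R/2)" "0 \<in> cball 0 (R/2)" using t R by auto
  have "cmod (h \<tau> - h 0) \<le> 4 * K / R * cmod (\<tau> - 0)"
  proof (rule field_differentiable_bound[OF convex_cball[of 0 "R/2"] _ _ tc])
    show "(h has_field_derivative deriv h x) (at x within cball 0 (R/2))" if "x \<in> cball 0 (R/2)" for x
      using d[OF that, of 0] by simp
    show "cmod (deriv h x) \<le> 4 * K / R" if "x \<in> cball 0 (R/2)" for x
      using c[of x 1] that by (simp add: field_simps)
  qed
  then show "cmod (h \<tau> - h 0) \<le> 4 * K / R * cmod \<tau>" by simp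
  have "cmod ((deriv ^^ 0) h \<tau> - (\<Sum>i\<le>1. (deriv ^^ i) h 0 * (\<tau> - 0) ^ i / fact i)) \<le> (32 * K / R\<^sup>2) * cmod (\<tau> - 0) ^ Suc 1 / fact 1"
  proof (rule complex_Taylor[OF _ _ _ tc(2,1)])
    show "cmod ((deriv ^^ Suc 1) h x) \<le> 32 * K / R\<^sup>2" if "x \<in> cball 0 (R/2)" for x
      using c[of x 2] that by (simp add: power2_eq_square field_simps numeral_2_eq_2)
  qed (use d in auto)
  then show "cmod (h \<tau> - h 0 - \<tau> * deriv h 0) \<le> 32 * K / R\<^sup>2 * (cmod \<tau>)\<^sup>2"
    by (simp add: power2_eq_square algebra_simps)
qed

lemma hol_bounded_line:
  assumes g: "hol_bounded g p r K" and z: "z \<in> polydisc p (r/2)" and w: "\<And>b. b \<in> Basis \<Longrightarrow> cmod (w b) \<le> 1"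
  shows "(\<lambda>\<tau>. g (\<lambda>b. z b + \<tau> * w b)) holomorphic_on ball 0 (r/2)"
    "\<And>\<tau>. \<tau> \<in> ball 0 (r/2) \<Longrightarrow> (\<lambda>b. z b + \<tau> * w b) \<in> polydisc p r"
    "\<And>\<tau>. \<tau> \<in> ball 0 (r/2) \<Longrightarrow> cmod (g (\<lambda>b. z b + \<tau> * w b)) \<le> K"
proof -
  note G = hol_boundedD[OF g]
  show in_p: "(\<lambda>b. z b + \<tau> * w b) \<in> polydisc p r" if "\<tau> \<in> ball 0 (r/2)" for \<tau>
  proof -
    have "cmod (\<tau> * w b) \<le> r/2" if "b \<in> Basis" for b
    proof -
      have "cmod (\<tau> * w b) \<le> cmod \<tau> * 1" unfolding norm_mult by (rule mult_left_mono[OF w[OF that]]) simp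
      then show ?thesis using \<open>\<tau> \<in> ball 0 (r/2)\<close> by simp
    qed
    from polydisc_add[OF z, of "\<lambda>b. \<tau> * w b", OF this] show ?thesis by simp
  qed
  show "(\<lambda>\<tau>. g (\<lambda>b. z b + \<tau> * w b)) holomorphic_on ball 0 (r/2)"
    by (rule G(3)[OF open_ball _ in_p]) (auto intro!: holomorphic_intros)
  show "cmod (g (\<lambda>b. z b + \<tau> * w b)) \<le> K" if "\<tau> \<in> ball 0 (r/2)" for \<tau>
    by (rule G(2)[OF in_p[OF that]])
qed

text \<open>Points at distance at most r/4 are joined by a complex line, on which the one-variable
  estimate holds with radius r/2. For larger distances the trivial bound 2K is already of the
  claimed size.\<close>

lemma hol_bounded_Lipschitz:
  assumes g: "hol_bounded g p r K" and z: "z \<in> polydisc p (r/2)" "z' \<in> polydisc p (r/2)"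
    and d: "0 \<le> d" "\<And>b. b \<in> Basis \<Longrightarrow> cmod (z b - z' b) \<le> d"
  shows "cmod (g z - g z') \<le> 8 * K / r * d"
proof -
  have r: "0 < r" by (rule hol_boundedD(1)[OF g])
  have K: "0 \<le> K" by (rule hol_bounded_nonneg[OF g])
  have pos: "cmod (g z - g z') \<le> 8 * K / r * d" if d: "0 < d" "\<And>b. b \<in> Basis \<Longrightarrow> cmod (z b - z' b) \<le> d" for d
  proof (cases "d \<le> r/4")
    case True
    define w where "w b = (z b - z' b) / of_real d" for b
    have w: "cmod (w b) \<le> 1" if "b \<in> Basis" for b using d(2)[OF that] d(1) by (simp add: w_def norm_divide)
    define h where "h \<tau> = g (\<lambda>b. z' b + \<tau> * w b)" for \<tau>
    have "cmod (h (of_real d) - h 0) \<le> 4 * K / (r/2) * cmod (of_real d)"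
      by (rule bounded_holomorphic_estimates(2))
        (use hol_bounded_line[OF g z(2), of w] w r True d in \<open>auto simp: h_def\<close>)
    moreover have "h (of_real d) = g z" "h 0 = g z'" using d(1) by (simp_all add: h_def w_def)
    ultimately show ?thesis using d(1) by (simp add: field_simps)
  next
    case False
    have "z \<in> polydisc p r" "z' \<in> polydisc p r" using z polydisc_mono[of "r/2" r _ p] r by auto
    then have "cmod (g z - g z') \<le> K + K"
      using hol_boundedD(2)[OF g] by (intro order_trans[OF norm_triangle_ineq4] add_mono) auto
    also have "\<dots> = 8 * K / r * (r/4)" using r by simp
    also have "\<dots> \<le> 8 * K / r * d" using False K r by (intro mult_left_mono) auto
    finally show ?thesis .
  qed
  show ?thesis
  proof (cases "d = 0")
    case False then show ?thesis using pos[of d] d by simp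
  next
    \<comment> \<open>With \<open>d = 0\<close> the arguments agree on \<open>Basis\<close> but may
      differ elsewhere, so equality of the values is obtained by letting a positive bound tend to
      0.\<close>
    case True
    have "cmod (g z - g z') \<le> 8 * K / r * 0 + e" if e: "e > 0" for e
    proof -
      define d' where "d' = e * r / (8 * (K + 1))"
      have d': "d' > 0" using e r K by (simp add: d'_def)
      have "cmod (g z - g z') \<le> 8 * K / r * d'" using pos[OF d'] d(2) True d' by (meson less_imp_le order_trans)
      also have "\<dots> \<le> e" using e r K by (simp add: d'_def field_simps)
      finally show ?thesis by simp
    qed
    then have "cmod (g z - g z') \<le> 8 * K / r * 0" by (rule field_le_epsilon)
    then show ?thesis using True by simp
  qed
qed

definition ddir :: "(('a::euclidean_space \<Rightarrow> complex) \<Rightarrow> complex) \<Rightarrow> 'a \<Rightarrow> ('a \<Rightarrow> complex) \<Rightarrow> complex" where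
  "ddir g v z = deriv (\<lambda>\<tau>. g (\<lambda>b. z b + \<tau> * cvec v b)) 0"

lemma cvec_norm_le: "b \<in> Basis \<Longrightarrow> norm v \<le> 1 \<Longrightarrow> cmod (cvec v b) \<le> 1"
  using Basis_le_norm[of b v] by (simp add: cvec_def)

text \<open>Complex lines through the half polydisc have room for a disc of radius r/2, which turns
  the one-variable constants into \<open>128 * K / r\<^sup>2\<close> and
  \<open>8 * K / r\<close>.\<close>

lemma ddir_Taylor:
  assumes g: "hol_bounded g p r K" and z: "z \<in> polydisc p (r/2)" and v: "norm v \<le> 1" and t: "cmod \<tau> \<le> r/4"
  shows "cmod (g (\<lambda>b. z b + \<tau> * cvec v b) - g z - \<tau> * ddir g v z) \<le> 128 * K / r\<^sup>2 * (cmod \<tau>)\<^sup>2"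
    "cmod (ddir g v z) \<le> 8 * K / r"
proof -
  have r: "0 < r" by (rule hol_boundedD(1)[OF g])
  note L = hol_bounded_line[OF g z cvec_norm_le[OF _ v]]
  note E = bounded_holomorphic_estimates[OF L(1,3), where \<tau> = \<tau>]
  have "cmod (g (\<lambda>b. z b + \<tau> * cvec v b) - g (\<lambda>b. z b + 0 * cvec v b) - \<tau> * ddir g v z) \<le> 32 * K / (r/2)\<^sup>2 * (cmod \<tau>)\<^sup>2"
    unfolding ddir_def by (rule E(3)) (use r t in auto)
  then show "cmod (g (\<lambda>b. z b + \<tau> * cvec v b) - g z - \<tau> * ddir g v z) \<le> 128 * K / r\<^sup>2 * (cmod \<tau>)\<^sup>2"
    by (simp add: power_divide)
  have "cmod (ddir g v z) \<le> 4 * K / (r/2)"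
    unfolding ddir_def by (rule bounded_holomorphic_estimates(1)[OF L(1,3)]) (use r in auto)
  then show "cmod (ddir g v z) \<le> 8 * K / r" by simp
qed

text \<open>Along a holomorphic curve the directional derivative is a uniform limit of difference
  quotients, and each quotient is holomorphic because a shifted holomorphic curve is again one.
  Holomorphy along curves thus passes to derivatives.\<close>

lemma hol_bounded_ddir:
  assumes g: "hol_bounded g p r K" and v: "norm v \<le> 1"
  shows "hol_bounded (ddir g v) p (r/2) (8 * K / r)"
  unfolding hol_bounded_def
proof (intro conjI ballI allI impI)
  have r: "0 < r" by (rule hol_boundedD(1)[OF g])
  show "0 < r/2" using r by simp
  show "cmod (ddir g v z) \<le> 8 * K / r" if "z \<in> polydisc p (r/2)" for z
    by (rule ddir_Taylor(2)[OF g that v, of 0]) (use r in simp)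
  fix S :: "complex set" and \<zeta> assume S: "open S" and \<zeta>: "\<forall>b. (\<lambda>\<sigma>. \<zeta> \<sigma> b) holomorphic_on S"
    and in_p: "\<forall>\<sigma>\<in>S. \<zeta> \<sigma> \<in> polydisc p (r/2)"
  define u where "u j = r / (4 * real (Suc j))" for j :: nat
  have u: "0 < u j" "u j \<le> r/4" for j
    unfolding u_def by (rule divide_pos_pos frac_le | use r in simp)+
  have u3: "u j < r/2" for j by (rule order_le_less_trans[OF u(2)]) (use r in simp)
  define q where "q j \<sigma> = (g (\<lambda>b. \<zeta> \<sigma> b + of_real (u j) * cvec v b) - g (\<zeta> \<sigma>)) / of_real (u j)" for j \<sigma>
  define C where "C = 128 * K / r\<^sup>2"
  have C: "0 \<le> C" using hol_bounded_nonneg[OF g] by (simp add: C_def)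
  have dq: "cmod (q j \<sigma> - ddir g v (\<zeta> \<sigma>)) \<le> C * u j" if s: "\<sigma> \<in> S" for j \<sigma>
  proof -
    have "q j \<sigma> - ddir g v (\<zeta> \<sigma>) = (g (\<lambda>b. \<zeta> \<sigma> b + of_real (u j) * cvec v b) - g (\<zeta> \<sigma>) - of_real (u j) * ddir g v (\<zeta> \<sigma>)) / of_real (u j)"
      using u(1)[of j] by (simp add: q_def field_simps)
    then have "cmod (q j \<sigma> - ddir g v (\<zeta> \<sigma>)) = cmod (g (\<lambda>b. \<zeta> \<sigma> b + of_real (u j) * cvec v b) - g (\<zeta> \<sigma>) - of_real (u j) * ddir g v (\<zeta> \<sigma>)) / u j"
      using u(1)[of j] by (simp add: norm_divide)
    also have "\<dots> \<le> C * (u j)\<^sup>2 / u j"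
      using ddir_Taylor(1)[OF g bspec[OF in_p s] v, of "of_real (u j)"] u[of j]
      by (intro divide_right_mono) (auto simp: C_def)
    also have "\<dots> = C * u j" using u(1)[of j] by (simp add: power2_eq_square)
    finally show ?thesis .
  qed
  have "u \<longlonglongrightarrow> 0"
  proof -
    have "(\<lambda>j. (r/4) * inverse (real (Suc j))) \<longlonglongrightarrow> (r/4) * 0" by (intro tendsto_mult tendsto_const LIMSEQ_inverse_real_of_nat)
    then show ?thesis by (simp add: u_def[abs_def] field_simps)
  qed
  then have Cu: "(\<lambda>j. C * u j) \<longlonglongrightarrow> 0" using tendsto_mult_right_zero by blast
  have unif: "uniform_limit S q (\<lambda>\<sigma>. ddir g v (\<zeta> \<sigma>)) sequentially"
  proof (rule uniform_limitI)
    fix e :: real assume "e > 0"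
    then have "\<forall>\<^sub>F j in sequentially. C * u j < e" using order_tendstoD(2)[OF Cu] by blast
    then show "\<forall>\<^sub>F j in sequentially. \<forall>\<sigma>\<in>S. dist (q j \<sigma>) (ddir g v (\<zeta> \<sigma>)) < e"
    proof eventually_elim
      case (elim j)
      show ?case unfolding dist_norm
        by (intro ballI order_le_less_trans[OF dq elim])
    qed
  qed
  have hq: "q j holomorphic_on S" for j
  proof -
    have "(\<lambda>\<sigma>. g (\<lambda>b. \<zeta> \<sigma> b + of_real (u j) * cvec v b)) holomorphic_on S"
    proof (rule hol_boundedD(3)[OF g S])
      show "(\<lambda>\<sigma>. \<zeta> \<sigma> b + of_real (u j) * cvec v b) holomorphic_on S" for b
        using \<zeta> by (intro holomorphic_intros) auto
      show "(\<lambda>b. \<zeta> \<sigma> b + of_real (u j) * cvec v b) \<in> polydisc p r" if "\<sigma> \<in> S" for \<sigma>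
        by (rule hol_bounded_line(2)[OF g bspec[OF in_p that] cvec_norm_le[OF _ v]]) (use u[of j] u3[of j] in auto)
    qed
    moreover have "(\<lambda>\<sigma>. g (\<zeta> \<sigma>)) holomorphic_on S"
      by (rule hol_boundedD(3)[OF g S]) (use \<zeta> in_p polydisc_mono[of "r/2" r _ p] r in auto)
    ultimately show ?thesis unfolding q_def[abs_def] using u(1)[of j] by (intro holomorphic_intros) auto
  qed
  show "(\<lambda>\<sigma>. ddir g v (\<zeta> \<sigma>)) holomorphic_on S"
  proof (rule holomorphic_uniform_sequence[OF S hq])
    fix x assume "x \<in> S"
    then obtain d where d: "d > 0" "cball x d \<subseteq> S" using S open_contains_cball by meson
    show "\<exists>d>0. cball x d \<subseteq> S \<and> uniform_limit (cball x d) q (\<lambda>\<sigma>. ddir g v (\<zeta> \<sigma>)) sequentially"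
      using d uniform_limit_on_subset[OF unif d(2)] by blast
  qed
qed

text \<open>On real points the extension has real values. The Taylor estimate compares a real
  increment with \<open>s\<close> times the complex derivative, so the imaginary part is of order
  \<open>s\<close> for every small \<open>s\<close>, hence 0.\<close>

lemma holomorphic_real_direction:
  assumes g: "hol_bounded g p r K" and f: "hol_ext f g p r" and x: "cvec x \<in> polydisc p (r/2)"
    and v: "norm v \<le> 1" and s: "0 \<le> s" "s \<le> r/4"
  shows "\<bar>f (x + s *\<^sub>R v) - f x - s * Re (ddir g v (cvec x))\<bar> \<le> 128 * K / r\<^sup>2 * s\<^sup>2"
    and "Im (ddir g v (cvec x)) = 0"
proof -
  have r: "0 < r" by (rule hol_boundedD(1)[OF g])
  define C where "C = 128 * K / r\<^sup>2"
  have xr: "cvec x \<in> polydisc p r" using polydisc_mono[of "r/2" r "cvec x" p] x r by auto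
  have main: "cmod (of_real (f (x + s *\<^sub>R v) - f x) - of_real s * ddir g v (cvec x)) \<le> C * s\<^sup>2"
    if s: "0 \<le> s" "s \<le> r/4" for s
  proof -
    have e: "(\<lambda>b. cvec x b + of_real s * cvec v b) = cvec (x + s *\<^sub>R v)"
      by (rule ext) (simp add: cvec_def inner_add_left)
    have "(\<lambda>b. cvec x b + of_real s * cvec v b) \<in> polydisc p r"
      by (rule hol_bounded_line(2)[OF g x cvec_norm_le[OF _ v]]) (use s r in auto)
    then have "g (\<lambda>b. cvec x b + of_real s * cvec v b) = of_real (f (x + s *\<^sub>R v))"
      using f unfolding e hol_ext_def by blast
    moreover have "g (cvec x) = of_real (f x)" using f xr unfolding hol_ext_def by blast
    ultimately show ?thesis
      using ddir_Taylor(1)[OF g x v, of "of_real s"] s by (simp add: C_def)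
  qed
  show "\<bar>f (x + s *\<^sub>R v) - f x - s * Re (ddir g v (cvec x))\<bar> \<le> 128 * K / r\<^sup>2 * s\<^sup>2"
    using main[OF s] abs_Re_le_cmod[of "of_real (f (x + s *\<^sub>R v) - f x) - of_real s * ddir g v (cvec x)"]
    by (simp add: C_def)
  have "\<bar>Im (ddir g v (cvec x))\<bar> \<le> 0 + e" if e: "e > 0" for e
  proof -
    define s where "s = min (r/4) (e / (\<bar>C\<bar> + 1))"
    have s: "0 < s" "s \<le> r/4" unfolding s_def by (rule min_less_iff_conj[THEN iffD2] min.cobounded1 | use r e in simp)+
    have s3: "s * (\<bar>C\<bar> + 1) \<le> e" by (subst pos_le_divide_eq[symmetric]) (auto simp: s_def)
    have "s * \<bar>Im (ddir g v (cvec x))\<bar> \<le> C * s\<^sup>2"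
      using main[of s] abs_Im_le_cmod[of "of_real (f (x + s *\<^sub>R v) - f x) - of_real s * ddir g v (cvec x)"] s
      by (simp add: abs_mult)
    also have "\<dots> \<le> s * (s * (\<bar>C\<bar> + 1))" using s(1) abs_ge_self[of C] by (simp add: power2_eq_square)
    also have "\<dots> \<le> s * e" using s s3 by (intro mult_left_mono) auto
    finally show ?thesis using s(1) by simp
  qed
  then have "\<bar>Im (ddir g v (cvec x))\<bar> \<le> 0" by (rule field_le_epsilon)
  then show "Im (ddir g v (cvec x)) = 0" by simp
qed

lemma ddir_scale:
  assumes g: "hol_bounded g p r K" and z: "z \<in> polydisc p (r/2)" and v: "norm v \<le> 1"
  shows "ddir g (s *\<^sub>R v) z = of_real s * ddir g v z"
proof -
  have r: "0 < r" by (rule hol_boundedD(1)[OF g])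
  define h where "h \<tau> = g (\<lambda>b. z b + \<tau> * cvec v b)" for \<tau>
  have "(h has_field_derivative deriv h (of_real s * 0)) (at (of_real s * 0))"
    unfolding h_def by (rule holomorphic_derivI[OF hol_bounded_line(1)[OF g z cvec_norm_le[OF _ v]] open_ball]) (use r in auto)
  moreover have "((\<lambda>\<tau>. of_real s * \<tau>) has_field_derivative of_real s) (at 0)"
    by (auto intro!: derivative_eq_intros)
  ultimately have "((\<lambda>\<tau>. h (of_real s * \<tau>)) has_field_derivative deriv h (of_real s * 0) * of_real s) (at 0)"
    by (rule DERIV_chain2[where f = h and g = "\<lambda>\<tau>. of_real s * \<tau>"])
  then have "((\<lambda>\<tau>. h (of_real s * \<tau>)) has_field_derivative deriv h 0 * of_real s) (at 0)" by simp
  moreover have "(\<lambda>\<tau>. h (of_real s * \<tau>)) = (\<lambda>\<tau>. g (\<lambda>b. z b + \<tau> * cvec (s *\<^sub>R v) b))"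
    by (simp add: h_def cvec_def mult_ac)
  ultimately show ?thesis unfolding ddir_def by (simp add: DERIV_imp_deriv h_def[abs_def] mult.commute)
qed

text \<open>The directional estimates are uniform over unit directions, so only linearity of the
  candidate is at stake. Additivity follows from walking along \<open>v\<close> and then along
  \<open>w\<close>: the derivative along \<open>w\<close> is Lipschitz in the base point, and all
  errors are quadratic in \<open>s\<close>. The radius r/8 keeps the intermediate points inside the
  domains of these estimates.\<close>

lemma hol_has_derivative:
  assumes g: "hol_bounded g p r K" and f: "hol_ext f g p r" and x: "cvec x \<in> polydisc p (r/8)"
  shows "(f has_derivative (\<lambda>v. Re (ddir g v (cvec x)))) (at x)"
proof -
  have r: "0 < r" by (rule hol_boundedD(1)[OF g])
  have x2: "cvec x \<in> polydisc p (r/2)" and x4: "cvec x \<in> polydisc p (r/4)"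
    using polydisc_mono[of "r/8" _ "cvec x" p] x r by auto
  define D where "D v = Re (ddir g v (cvec x))" for v
  define C where "C = 128 * K / r\<^sup>2"
  have C: "0 \<le> C" using hol_bounded_nonneg[OF g] by (simp add: C_def)
  have D_scale_unit: "D (s *\<^sub>R v) = s * D v" if "norm v \<le> 1" for s v
    unfolding D_def ddir_scale[OF g x2 that] by simp
  have D_scale: "D (s *\<^sub>R v) = s * D v" for s v
  proof (cases "v = 0")
    case False
    define w where "w = v /\<^sub>R norm v"
    have w: "norm w \<le> 1" "v = norm v *\<^sub>R w" using False by (auto simp: w_def)
    have "D (s *\<^sub>R v) = D ((s * norm v) *\<^sub>R w)" using w(2) by (metis scaleR_scaleR)
    also have "\<dots> = s * (norm v * D w)" using D_scale_unit[OF w(1)] by simp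
    also have "norm v * D w = D v" using D_scale_unit[OF w(1), of "norm v"] w(2) by simp
    finally show ?thesis .
  qed (use D_scale_unit[of 0 0] D_scale_unit[of 0 s] in simp)
  have add_small: "D (v + w) = D v + D w" if vw: "norm v \<le> 1/2" "norm w \<le> 1/2" for v w
  proof -
    have n: "norm v \<le> 1" "norm w \<le> 1" "norm (v + w) \<le> 1" using vw norm_triangle_ineq[of v w] by auto
    note gw = hol_bounded_ddir[OF g n(2)]
    define L where "L = 8 * (8 * K / r) / (r/2)"
    have L: "0 \<le> L" using hol_bounded_nonneg[OF g] r by (simp add: L_def)
    have "\<bar>D (v + w) - D v - D w\<bar> \<le> 0 + e" if e: "e > 0" for e
    proof -
      define s where "s = min (r/8) (e / (3 * C + L + 1))"
      have s: "0 < s" "s \<le> r/8" unfolding s_def by (rule min_less_iff_conj[THEN iffD2] min.cobounded1 | use r e C L in simp)+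
      have s3: "s * (3 * C + L + 1) \<le> e" by (subst pos_le_divide_eq[symmetric]) (use C L in \<open>auto simp: s_def\<close>)
      have xs: "cvec (x + s *\<^sub>R v) \<in> polydisc p (r/4)"
      proof -
        have "cmod (of_real s * cvec v b) \<le> r/8" if "b \<in> Basis" for b
        proof -
          have "cmod (of_real s * cvec v b) \<le> s * 1"
            using cvec_norm_le[OF that n(1)] s(1) by (simp add: norm_mult)
          then show ?thesis using s(2) by simp
        qed
        from polydisc_add[OF x, of "\<lambda>b. of_real s * cvec v b", OF this]
        have "(\<lambda>b. cvec x b + of_real s * cvec v b) \<in> polydisc p (r/4)" by simp
        moreover have "(\<lambda>b. cvec x b + of_real s * cvec v b) = cvec (x + s *\<^sub>R v)"
          by (rule ext) (simp add: cvec_def inner_add_left)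
        ultimately show ?thesis by simp
      qed
      have xs2: "cvec (x + s *\<^sub>R v) \<in> polydisc p (r/2)" using polydisc_mono[of "r/4" "r/2" _ p] xs r by auto
      have s4: "s \<le> r/4" using s r by auto
      have a: "\<bar>f (x + s *\<^sub>R (v + w)) - f x - s * D (v + w)\<bar> \<le> C * s\<^sup>2"
        unfolding D_def C_def by (rule holomorphic_real_direction(1)[OF g f x2 n(3) less_imp_le[OF s(1)] s4])
      have b: "\<bar>f (x + s *\<^sub>R v) - f x - s * D v\<bar> \<le> C * s\<^sup>2"
        unfolding D_def C_def by (rule holomorphic_real_direction(1)[OF g f x2 n(1) less_imp_le[OF s(1)] s4])
      have c: "\<bar>f (x + s *\<^sub>R v + s *\<^sub>R w) - f (x + s *\<^sub>R v) - s * Re (ddir g w (cvec (x + s *\<^sub>R v)))\<bar> \<le> C * s\<^sup>2"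
        unfolding C_def by (rule holomorphic_real_direction(1)[OF g f xs2 n(2) less_imp_le[OF s(1)] s4])
      have "cmod (ddir g w (cvec (x + s *\<^sub>R v)) - ddir g w (cvec x)) \<le> L * s"
        unfolding L_def
      proof (rule hol_bounded_Lipschitz[OF gw])
        show "cvec (x + s *\<^sub>R v) \<in> polydisc p (r/2/2)" "cvec x \<in> polydisc p (r/2/2)" using xs x4 by simp_all
        show "cmod (cvec (x + s *\<^sub>R v) b - cvec x b) \<le> s" if "b \<in> Basis" for b
        proof -
          have "cmod (cvec (x + s *\<^sub>R v) b - cvec x b) = s * cmod (cvec v b)"
            using s(1) by (simp add: cvec_def inner_add_left norm_mult)
          also have "\<dots> \<le> s * 1" using cvec_norm_le[OF that n(1)] s(1) by (intro mult_left_mono) auto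
          finally show ?thesis by simp
        qed
      qed (use s in simp)
      then have d: "\<bar>Re (ddir g w (cvec (x + s *\<^sub>R v))) - D w\<bar> \<le> L * s"
        unfolding D_def using abs_Re_le_cmod order_trans by (metis minus_complex.simps(1))
      have "x + s *\<^sub>R (v + w) = x + s *\<^sub>R v + s *\<^sub>R w" by (simp add: scaleR_add_right)
      then have "s * \<bar>D (v + w) - D v - D w\<bar> = \<bar>- (f (x + s *\<^sub>R (v + w)) - f x - s * D (v + w)) + (f (x + s *\<^sub>R v) - f x - s * D v)
          + (f (x + s *\<^sub>R v + s *\<^sub>R w) - f (x + s *\<^sub>R v) - s * Re (ddir g w (cvec (x + s *\<^sub>R v))))
          + s * (Re (ddir g w (cvec (x + s *\<^sub>R v))) - D w)\<bar>"
        using s(1) abs_mult[of s "D (v + w) - D v - D w"] by (simp add: algebra_simps)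
      also have "\<dots> \<le> C * s\<^sup>2 + C * s\<^sup>2 + C * s\<^sup>2 + s * (L * s)"
      proof -
        have "\<bar>s * (Re (ddir g w (cvec (x + s *\<^sub>R v))) - D w)\<bar> \<le> s * (L * s)"
          using d s(1) by (simp add: abs_mult)
        then show ?thesis using a b c by linarith
      qed
      also have "\<dots> \<le> s * (s * (3 * C + L + 1))" using s(1) by (simp add: power2_eq_square algebra_simps)
      also have "\<dots> \<le> s * e" using s s3 by (intro mult_left_mono) auto
      finally show ?thesis using s(1) by simp
    qed
    then have "\<bar>D (v + w) - D v - D w\<bar> \<le> 0" by (rule field_le_epsilon)
    then show ?thesis by simp
  qed
  have D_add: "D (v + w) = D v + D w" for v w
  proof -
    define m where "m = 2 * (norm v + norm w + 1)"
    have m: "m > 0" unfolding m_def by (intro mult_pos_pos add_nonneg_pos add_nonneg_nonneg) auto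
    have le: "norm v \<le> 1/2 * m" "norm w \<le> 1/2 * m" unfolding m_def by simp_all
    have "norm (v /\<^sub>R m) = norm v / m" "norm (w /\<^sub>R m) = norm w / m" using m by (simp_all add: divide_inverse)
    then have "norm (v /\<^sub>R m) \<le> 1/2" "norm (w /\<^sub>R m) \<le> 1/2"
      using le m by (simp_all only: pos_divide_le_eq)
    from add_small[OF this] have "D ((1/m) *\<^sub>R (v + w)) = D ((1/m) *\<^sub>R v) + D ((1/m) *\<^sub>R w)"
      by (simp add: scaleR_add_right divide_inverse)
    then have "(1/m) * D (v + w) = (1/m) * (D v + D w)" unfolding D_scale by (simp add: distrib_left)
    then show ?thesis using m by simp
  qed
  have lin: "linear D" by (rule linearI) (simp_all add: D_add D_scale)
  have "(f has_derivative D) (at x within UNIV)"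
    unfolding has_derivative_within_alt
  proof (intro conjI allI impI)
    show "bounded_linear D" using lin linear_conv_bounded_linear by blast
    fix e :: real assume e: "e > 0"
    define d where "d = min (r/4) (e / (C + 1))"
    have d: "d > 0" "d \<le> r/4" unfolding d_def by (rule min_less_iff_conj[THEN iffD2] min.cobounded1 | use r e C in simp)+
    have d3: "d * (C + 1) \<le> e" by (subst pos_le_divide_eq[symmetric]) (use C in \<open>auto simp: d_def\<close>)
    have "norm (f y - f x - D (y - x)) \<le> e * norm (y - x)" if y: "norm (y - x) < d" for y
    proof (cases "y = x")
      case True
      then show ?thesis using linear_0[OF lin] by simp
    next
      case False
      define s v where "s = norm (y - x)" and "v = (y - x) /\<^sub>R norm (y - x)"
      have sv: "0 < s" "norm v \<le> 1" "s *\<^sub>R v = y - x" using False by (auto simp: s_def v_def)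
      have "\<bar>f (x + s *\<^sub>R v) - f x - s * D v\<bar> \<le> C * s\<^sup>2"
        unfolding D_def C_def using y d sv by (intro holomorphic_real_direction(1)[OF g f x2 sv(2)]) (auto simp: s_def)
      then have "norm (f y - f x - D (y - x)) \<le> C * s\<^sup>2" using D_scale[of s v] sv(3) by simp
      also have "\<dots> \<le> (d * (C + 1)) * s"
      proof -
        have "C * s \<le> (C + 1) * d" using C y sv(1) by (intro mult_mono) (auto simp: s_def)
        then show ?thesis using sv(1) by (simp add: power2_eq_square mult.commute mult.left_commute)
      qed
      also have "\<dots> \<le> e * s" using d3 sv(1) by (intro mult_right_mono) auto
      finally show ?thesis by (simp add: s_def)
    qed
    then show "\<exists>d>0. \<forall>y\<in>UNIV. norm (y - x) < d \<longrightarrow> norm (f y - f x - D (y - x)) \<le> e * norm (y - x)"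
      using d(1) by blast
  qed
  then show ?thesis by (simp add: D_def[abs_def])
qed

lemma hol_ext_dird:
  assumes g: "hol_bounded g p r K" and f: "hol_ext f g p r" and v: "norm v \<le> 1"
  shows "hol_ext (dird f v) (ddir g v) p (r/8)"
  unfolding hol_ext_def
proof (intro allI impI)
  fix x assume x: "cvec x \<in> polydisc p (r/8)"
  have r: "0 < r" by (rule hol_boundedD(1)[OF g])
  have x2: "cvec x \<in> polydisc p (r/2)" using polydisc_mono[of "r/8" _ "cvec x" p] x r by auto
  have "dird f v x = Re (ddir g v (cvec x))" using dird_eqI[OF hol_has_derivative[OF g f x]] .
  moreover have "Im (ddir g v (cvec x)) = 0"
    by (rule holomorphic_real_direction(2)[OF g f x2 v order_refl]) (use r in simp)
  ultimately show "ddir g v (cvec x) = of_real (dird f v x)" by (simp add: complex_eq_iff)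
qed

text \<open>Each differentiation passes to the extension \<open>ddir\<close> at the price of a
  factor 8 in the radius.\<close>

lemma hol_Ck:
  assumes "hol_bounded g p r K" "hol_ext f g p r"
  shows "Ck_open k {x. cvec x \<in> polydisc p (r / 8 ^ Suc k)} f"
  using assms
proof (induction k arbitrary: f g r K)
  case 0
  have "isCont f x" if "cvec x \<in> polydisc p (r/8)" for x
    using has_derivative_continuous[OF hol_has_derivative[OF 0 that]] .
  then show ?case by (auto intro: continuous_at_imp_continuous_on)
next
  case (Suc k)
  let ?U = "{x. cvec x \<in> polydisc p (r / 8 ^ Suc (Suc k))}"
  have r: "0 < r" by (rule hol_boundedD(1)[OF Suc.prems(1)])
  have sub: "cvec x \<in> polydisc p (r/8)" if "x \<in> ?U" for x
  proof -
    have "r / 8 ^ Suc (Suc k) \<le> r / 8" using r power_increasing[of 1 "Suc (Suc k)" "8::real"] by (intro divide_left_mono) auto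
    then show ?thesis using that polydisc_mono[of _ "r/8" "cvec x" p] by blast
  qed
  have b: "Ck_open k ?U (dird f b)" if "b \<in> Basis" for b
  proof -
    have nb: "norm b \<le> 1" using that by simp
    have "hol_bounded (ddir g b) p (r/8) (8 * K / r)"
      by (rule hol_bounded_mono[OF hol_bounded_ddir[OF Suc.prems(1) nb]]) (use r in auto)
    from Suc.IH[OF this hol_ext_dird[OF Suc.prems nb]] show ?thesis by (simp add: field_simps)
  qed
  show ?case
  proof (rule Ck_open_SucI[OF open_box_polydisc])
    fix x assume x: "x \<in> ?U"
    note d = hol_has_derivative[OF Suc.prems sub[OF x]]
    have "(\<lambda>v. Re (ddir g v (cvec x))) = (\<lambda>v. \<Sum>b\<in>Basis. (v \<bullet> b) *\<^sub>R dird f b x)"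
    proof
      fix v
      have "Re (ddir g v (cvec x)) = (\<Sum>b\<in>Basis. (v \<bullet> b) *\<^sub>R Re (ddir g b (cvec x)))"
        by (rule linear_Basis_expansion[OF has_derivative_linear[OF d]])
      then show "Re (ddir g v (cvec x)) = (\<Sum>b\<in>Basis. (v \<bullet> b) *\<^sub>R dird f b x)"
        using dird_eqI[OF d] by simp
    qed
    then show "(f has_derivative (\<lambda>v. \<Sum>b\<in>Basis. (v \<bullet> b) *\<^sub>R dird f b x)) (at x)" using d by simp
  next
    show "Ck_open k ?U (\<lambda>x. \<Sum>b\<in>Basis. (v \<bullet> b) *\<^sub>R dird f b x)" for v
      by (intro Ck_open_sum[OF open_box_polydisc] Ck_open_scaleR[OF open_box_polydisc] b Ck_open_const)
  qed
qed

section \<open>Functions with a bounded holomorphic extension near a point, and their closure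
  properties\<close>

definition holx :: "'a::euclidean_space \<Rightarrow> ('a \<Rightarrow> real) \<Rightarrow> bool" where
  "holx p f \<longleftrightarrow> (\<exists>g r K. hol_bounded g p r K \<and> hol_ext f g p r)"

lemma holxI: "hol_bounded g p r K \<Longrightarrow> hol_ext f g p r \<Longrightarrow> holx p f"
  unfolding holx_def by blast

lemma holx_family:
  assumes "finite I" "\<And>i. i \<in> I \<Longrightarrow> holx p (f i)"
  obtains g r K where "0 < r" "\<And>i. i \<in> I \<Longrightarrow> hol_bounded (g i) p r K" "\<And>i. i \<in> I \<Longrightarrow> hol_ext (f i) (g i) p r"
proof -
  have "\<exists>g r K. 0 < r \<and> (\<forall>i\<in>I. hol_bounded (g i) p r K \<and> hol_ext (f i) (g i) p r)"
    using assms
  proof (induction I rule: finite_induct)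
    case empty
    then show ?case by (intro exI[of _ "\<lambda>_ _. 0"] exI[of _ "1::real"]) auto
  next
    case (insert i I)
    obtain g r K where 1: "0 < r" "\<forall>j\<in>I. hol_bounded (g j) p r K \<and> hol_ext (f j) (g j) p r"
      using insert.IH insert.prems by auto
    obtain h s L where 2: "hol_bounded h p s L" "hol_ext (f i) h p s"
      using insert.prems[of i] unfolding holx_def by auto
    have s: "0 < s" by (rule hol_boundedD(1)[OF 2(1)])
    show ?case
    proof (rule exI[of _ "g(i := h)"], rule exI[of _ "min r s"], rule exI[of _ "max K L"], intro conjI ballI)
      show "0 < min r s" using 1 s by simp
      fix j assume j: "j \<in> insert i I"
      show "hol_bounded ((g(i := h)) j) p (min r s) (max K L)"
        using 1 2(1) s j by (cases "j = i") (auto intro: hol_bounded_mono)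
      show "hol_ext (f j) ((g(i := h)) j) p (min r s)"
        using 1 2(2) s j by (cases "j = i") (auto intro: hol_ext_mono)
    qed
  qed
  then show thesis using that by blast
qed

lemma holx_const: "holx p (\<lambda>_. c)"
  by (rule holxI[of "\<lambda>_. of_real c" p 1 "\<bar>c\<bar>"]) (auto simp: hol_bounded_def hol_ext_def)

lemma holx_add:
  assumes "holx p f" "holx p g" shows "holx p (\<lambda>x. f x + g x)"
proof -
  \<comment> \<open>Indexing the two functions by truth values lets \<open>holx_family\<close>
    supply one radius and one bound for both.\<close>
  obtain h r K where h: "\<And>i. i \<in> {True, False} \<Longrightarrow> hol_bounded (h i) p r K"
      "\<And>i. i \<in> {True, False} \<Longrightarrow> hol_ext (if i then f else g) (h i) p r"
    by (rule holx_family[of "{True, False}" p "\<lambda>i. if i then f else g"]) (use assms in auto)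
  note T = h[of True, simplified] and F = h[of False, simplified]
  show ?thesis
  proof (rule holxI[of "\<lambda>z. h True z + h False z" p r "K + K"])
    show "hol_bounded (\<lambda>z. h True z + h False z) p r (K + K)"
      unfolding hol_bounded_def
    proof (intro conjI ballI allI impI)
      show "0 < r" by (rule hol_boundedD(1)[OF T(1)])
      show "cmod (h True z + h False z) \<le> K + K" if "z \<in> polydisc p r" for z
        by (intro norm_triangle_mono hol_boundedD(2)[OF T(1)] hol_boundedD(2)[OF F(1)] that)
    qed (use hol_boundedD(3)[OF T(1)] hol_boundedD(3)[OF F(1)] in \<open>auto intro!: holomorphic_on_add\<close>)
    show "hol_ext (\<lambda>x. f x + g x) (\<lambda>z. h True z + h False z) p r"
      using T(2) F(2) by (simp add: hol_ext_def)
  qed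
qed

lemma holx_mult:
  assumes "holx p f" "holx p g" shows "holx p (\<lambda>x. f x * g x)"
proof -
  obtain h r K where h: "\<And>i. i \<in> {True, False} \<Longrightarrow> hol_bounded (h i) p r K"
      "\<And>i. i \<in> {True, False} \<Longrightarrow> hol_ext (if i then f else g) (h i) p r"
    by (rule holx_family[of "{True, False}" p "\<lambda>i. if i then f else g"]) (use assms in auto)
  note T = h[of True, simplified] and F = h[of False, simplified]
  show ?thesis
  proof (rule holxI[of "\<lambda>z. h True z * h False z" p r "K * K"])
    show "hol_bounded (\<lambda>z. h True z * h False z) p r (K * K)"
      unfolding hol_bounded_def
      using hol_boundedD[OF T(1)] hol_boundedD[OF F(1)] hol_bounded_nonneg[OF T(1)]
      by (auto simp: norm_mult intro!: mult_mono holomorphic_on_mult)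
    show "hol_ext (\<lambda>x. f x * g x) (\<lambda>z. h True z * h False z) p r"
      using T(2) F(2) by (simp add: hol_ext_def)
  qed
qed

lemma holx_diff:
  assumes "holx p f" "holx p g" shows "holx p (\<lambda>x. f x - g x)"
  using holx_add[OF assms(1) holx_mult[OF holx_const[of p "-1"] assms(2)]] by simp

lemma holx_cong:
  assumes f: "holx p f" and e: "0 < e" "\<And>x. x \<in> ball p e \<Longrightarrow> f' x = f x"
  shows "holx p f'"
proof -
  obtain g r K where g: "hol_bounded g p r K" "hol_ext f g p r" using f unfolding holx_def by blast
  \<comment> \<open>The divisor \<open>DIM('a) + 1\<close> makes the real points of the polydisc lie
    in the ball, by comparison with the sum norm.\<close>
  define s where "s = min r (e / (DIM('a) + 1))"
  have r: "0 < r" by (rule hol_boundedD(1)[OF g(1)])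
  have s: "0 < s" "s \<le> r" "s \<le> e / (DIM('a) + 1)"
    unfolding s_def by (rule min_less_iff_conj[THEN iffD2] min.cobounded1 min.cobounded2 | use r e in simp)+
  have "f' x = f x" if x: "cvec x \<in> polydisc p s" for x
  proof -
    have "norm (x - p) \<le> (\<Sum>b\<in>Basis. \<bar>(x - p) \<bullet> b\<bar>)" by (rule norm_le_l1)
    also have "\<dots> \<le> (\<Sum>b\<in>(Basis::'a set). s)"
      by (intro sum_mono) (use x in \<open>auto simp: cvec_polydisc_iff inner_diff_left intro: less_imp_le\<close>)
    also have "\<dots> = DIM('a) * s" by simp
    also have "\<dots> < (DIM('a) + 1) * s" using s(1) by simp
    also have "\<dots> \<le> e" using s(3) by (simp add: pos_le_divide_eq mult.commute)
    finally show ?thesis by (intro e) (simp add: dist_norm norm_minus_commute)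
  qed
  then have "hol_ext f' g p s" using hol_ext_mono[OF g(2) s(2)] by (simp add: hol_ext_def)
  then show ?thesis using hol_bounded_mono[OF g(1) s(1,2) order_refl] by (rule holxI[rotated])
qed

lemma holx_dird:
  assumes "holx p f" "norm v \<le> 1" shows "holx p (dird f v)"
proof -
  obtain g r K where g: "hol_bounded g p r K" "hol_ext f g p r" using assms(1) unfolding holx_def by blast
  have r: "0 < r" by (rule hol_boundedD(1)[OF g(1)])
  show ?thesis
    by (rule holxI[OF hol_bounded_mono[OF hol_bounded_ddir[OF g(1) assms(2)] _ _ order_refl] hol_ext_dird[OF g assms(2)]])
      (use r in auto)
qed

lemma holx_compose:
  fixes h :: "'b::euclidean_space \<Rightarrow> 'a::euclidean_space"
  assumes f: "holx (h p) f" and h: "\<And>b. b \<in> Basis \<Longrightarrow> holx p (\<lambda>x. h x \<bullet> b)"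
  shows "holx p (\<lambda>x. f (h x))"
proof -
  obtain g r K where g: "hol_bounded g (h p) r K" "hol_ext f g (h p) r" using f unfolding holx_def by blast
  obtain H s L where s: "0 < s" and H: "\<And>b. b \<in> Basis \<Longrightarrow> hol_bounded (H b) p s L"
      "\<And>b. b \<in> Basis \<Longrightarrow> hol_ext (\<lambda>x. h x \<bullet> b) (H b) p s"
    by (rule holx_family[OF finite_Basis, of p "\<lambda>b x. h x \<bullet> b"]) (rule h, assumption, rule that)
  have r: "0 < r" by (rule hol_boundedD(1)[OF g(1)])
  obtain b0 :: 'a where "b0 \<in> Basis" using nonempty_Basis by blast
  then have L: "0 \<le> L" using hol_bounded_nonneg[OF H(1)] by blast
  define C where "C = 8 * L / s"
  have C: "0 \<le> C" using L s by (simp add: C_def)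
  define d where "d = min (s / 2) (r / (C + 1))"
  have d: "0 < d" "d \<le> s / 2" unfolding d_def by (rule min_less_iff_conj[THEN iffD2] min.cobounded1 | use r s C in simp)+
  have d3: "d * (C + 1) \<le> r" by (subst pos_le_divide_eq[symmetric]) (use C in \<open>auto simp: d_def\<close>)
  have ds: "polydisc p d \<subseteq> polydisc p s" using polydisc_mono[of d s _ p] d s by auto
  \<comment> \<open>\<open>cvec\<close> assigns a number to every vector, not only to those in
    \<open>Basis\<close>. G is spread linearly over all vectors, so that it agrees with
    \<open>cvec (h x)\<close> as a function.\<close>
  define G where "G z v = (\<Sum>b\<in>Basis. of_real (b \<bullet> v) * H b z)" for z v
  have G_Basis: "G z b = H b z" if "b \<in> Basis" for z b
  proof -
    have "G z b = (\<Sum>c\<in>Basis. if c = b then H c z else 0)"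
      unfolding G_def by (intro sum.cong refl) (use that in \<open>auto simp: inner_Basis\<close>)
    then show ?thesis using that by simp
  qed
  have G_ext: "G (cvec x) = cvec (h x)" if x: "cvec x \<in> polydisc p s" for x
  proof
    fix v
    have "G (cvec x) v = (\<Sum>b\<in>Basis. of_real ((h x \<bullet> b) * (v \<bullet> b)))"
      unfolding G_def using H(2) x by (intro sum.cong refl) (auto simp: hol_ext_def inner_commute)
    then show "G (cvec x) v = cvec (h x) v"
      by (simp add: cvec_def euclidean_inner[of "h x" v] del: of_real_mult)
  qed
  have G_in: "G z \<in> polydisc (h p) r" if z: "z \<in> polydisc p d" for z
    unfolding polydisc_def
  proof (intro CollectI ballI)
    fix b :: 'a assume b: "b \<in> Basis"
    have Hp: "H b (cvec p) = cvec (h p) b"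
      using G_ext[OF cvec_center[OF s]] G_Basis[OF b, of "cvec p"] by simp
    have "cmod (H b z - H b (cvec p)) \<le> C * d"
      unfolding C_def
    proof (rule hol_bounded_Lipschitz[OF H(1)[OF b]])
      show "z \<in> polydisc p (s / 2)" by (rule polydisc_mono[OF d(2) z])
      show "cvec p \<in> polydisc p (s / 2)" using s by (simp add: cvec_center)
      show "cmod (z c - cvec p c) \<le> d" if "c \<in> Basis" for c using polydiscD[OF z that] by simp
    qed (use d in simp)
    also have "\<dots> < d * (C + 1)" using d(1) by (simp add: algebra_simps)
    finally show "cmod (G z b - cvec (h p) b) < r" using d3 G_Basis[OF b] Hp by simp
  qed
  show ?thesis
  proof (rule holxI[of "\<lambda>z. g (G z)" p d K])
    show "hol_bounded (\<lambda>z. g (G z)) p d K"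
      unfolding hol_bounded_def
    proof (intro conjI ballI allI impI)
      show "0 < d" by (rule d(1))
      show "cmod (g (G z)) \<le> K" if "z \<in> polydisc p d" for z by (rule hol_boundedD(2)[OF g(1) G_in[OF that]])
      fix S :: "complex set" and \<zeta>
      assume S: "open S" and hol: "\<forall>b. (\<lambda>\<sigma>. \<zeta> \<sigma> b) holomorphic_on S" and z: "\<forall>\<sigma>\<in>S. \<zeta> \<sigma> \<in> polydisc p d"
      show "(\<lambda>\<sigma>. g (G (\<zeta> \<sigma>))) holomorphic_on S"
      proof (rule hol_boundedD(3)[OF g(1) S])
        have "(\<lambda>\<sigma>. H b (\<zeta> \<sigma>)) holomorphic_on S" if "b \<in> Basis" for b
          by (rule hol_boundedD(3)[OF H(1)[OF that] S]) (use hol z ds in auto)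
        then show "(\<lambda>\<sigma>. G (\<zeta> \<sigma>) v) holomorphic_on S" for v
          unfolding G_def by (intro holomorphic_intros)
      qed (use z G_in in blast)
    qed
    show "hol_ext (\<lambda>x. f (h x)) (\<lambda>z. g (G z)) p d"
      unfolding hol_ext_def
    proof (intro allI impI)
      fix x assume x: "cvec x \<in> polydisc p d"
      then have e: "G (cvec x) = cvec (h x)" using G_ext ds by blast
      have "cvec (h x) \<in> polydisc (h p) r" using G_in[OF x] e by simp
      then show "g (G (cvec x)) = of_real (f (h x))" using g(2) e by (simp add: hol_ext_def)
    qed
  qed
qed

text \<open>Convergence at the single real corner point
  \<open>p + s *\<^sub>R (\<Sum>b\<in>Basis. b)\<close> is absolute, because \<open>has_sum\<close>
  is unconditional. This majorizes the complexified series on the whole polydisc of radius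
  \<open>s\<close>, and the Weierstrass test along the finite subsets of multi-indices gives a
  holomorphic sum.\<close>

lemma holx_real_analytic:
  fixes \<psi> :: "'b::euclidean_space \<Rightarrow> 'a::euclidean_space"
  assumes \<psi>: "real_analytic_on V \<psi>" and p: "p \<in> V"
  shows "holx p (\<lambda>x. \<psi> x \<bullet> e)"
proof -
  define A where "A = {\<alpha> :: 'b \<Rightarrow> nat. \<forall>b. b \<notin> Basis \<longrightarrow> \<alpha> b = 0}"
  obtain r :: real and c where r: "r > 0"
    and c: "\<And>x. x \<in> ball p r \<Longrightarrow> ((\<lambda>\<alpha>. (\<Prod>b\<in>Basis. ((x - p) \<bullet> b) ^ \<alpha> b) *\<^sub>R c \<alpha>) has_sum \<psi> x) A"
    using bspec[OF \<psi>[unfolded real_analytic_on_def] p] unfolding A_def by blast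
  define d where "d \<alpha> = c \<alpha> \<bullet> e" for \<alpha>
  have sum_e: "((\<lambda>\<alpha>. (\<Prod>b\<in>Basis. ((x - p) \<bullet> b) ^ \<alpha> b) * d \<alpha>) has_sum \<psi> x \<bullet> e) A" if "x \<in> ball p r" for x
    using has_sum_bounded_linear[OF bounded_linear_inner_left c[OF that], of e] by (simp add: d_def)
  define s where "s = r / (DIM('b) + 1)"
  have s: "0 < s" and sr: "DIM('b) * s < r" using r by (simp_all add: s_def field_simps)
  have in_ball: "x \<in> ball p r" if "\<And>b. b \<in> Basis \<Longrightarrow> \<bar>(x - p) \<bullet> b\<bar> \<le> s" for x
  proof -
    have "norm (x - p) \<le> (\<Sum>b\<in>Basis. \<bar>(x - p) \<bullet> b\<bar>)" by (rule norm_le_l1)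
    also have "\<dots> \<le> (\<Sum>b\<in>(Basis::'b set). s)" by (intro sum_mono that)
    finally show ?thesis using sr by (simp add: dist_norm norm_minus_commute)
  qed
  define M where "M \<alpha> = (\<Prod>b\<in>Basis. s ^ \<alpha> b) * \<bar>d \<alpha>\<bar>" for \<alpha> :: "'b \<Rightarrow> nat"
  have M: "M summable_on A"
  proof -
    define x where "x = p + s *\<^sub>R (\<Sum>b\<in>Basis. b)"
    have xb: "(x - p) \<bullet> b = s" if "b \<in> Basis" for b
      using that by (simp add: x_def inner_sum_left inner_Basis)
    have "x \<in> ball p r" by (rule in_ball) (use s xb in simp)
    note has_sum_imp_summable[OF sum_e[OF this]]
    then have "(\<lambda>\<alpha>. norm ((\<Prod>b\<in>Basis. ((x - p) \<bullet> b) ^ \<alpha> b) * d \<alpha>)) summable_on A"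
      by (rule summable_on_iff_abs_summable_on_real[THEN iffD1])
    moreover have "norm ((\<Prod>b\<in>Basis. ((x - p) \<bullet> b) ^ \<alpha> b) * d \<alpha>) = M \<alpha>" for \<alpha>
    proof -
      have "(\<Prod>b\<in>Basis. ((x - p) \<bullet> b) ^ \<alpha> b) = (\<Prod>b\<in>Basis. s ^ \<alpha> b)"
        by (intro prod.cong refl) (simp add: xb)
      moreover have "0 \<le> (\<Prod>b\<in>(Basis::'b set). s ^ \<alpha> b)" using s by (intro prod_nonneg) simp
      ultimately show ?thesis by (simp add: M_def abs_mult)
    qed
    ultimately show ?thesis by simp
  qed
  define T where "T z \<alpha> = (\<Prod>b\<in>Basis. (z b - cvec p b) ^ \<alpha> b) * complex_of_real (d \<alpha>)" for z :: "'b \<Rightarrow> complex" and \<alpha>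
  have T: "norm (T z \<alpha>) \<le> M \<alpha>" if "z \<in> polydisc p s" for z \<alpha>
  proof -
    have "norm (\<Prod>b\<in>Basis. (z b - cvec p b) ^ \<alpha> b) \<le> (\<Prod>b\<in>Basis. s ^ \<alpha> b)"
      unfolding prod_norm[symmetric] norm_power
      by (intro prod_mono conjI power_mono zero_le_power norm_ge_zero)
        (use polydiscD[OF that] less_imp_le in blast)
    then show ?thesis by (simp add: T_def M_def norm_mult mult_right_mono)
  qed
  have T_abs: "(\<lambda>\<alpha>. norm (T z \<alpha>)) summable_on A" if "z \<in> polydisc p s" for z
    using T[OF that] by (intro summable_on_comparison_test[OF M]) auto
  have T_sum: "(T z has_sum infsum (T z) A) A" if "z \<in> polydisc p s" for z
    using abs_summable_summable[OF T_abs[OF that]] by (rule has_sum_infsum)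
  show ?thesis
  proof (rule holxI[of "\<lambda>z. infsum (T z) A" p s "infsum M A"])
    show "hol_bounded (\<lambda>z. infsum (T z) A) p s (infsum M A)"
      unfolding hol_bounded_def
    proof (intro conjI ballI allI impI)
      show "0 < s" by (rule s)
      show "cmod (infsum (T z) A) \<le> infsum M A" if "z \<in> polydisc p s" for z
        by (rule order_trans[OF norm_infsum_bound[OF T_abs[OF that]] infsum_mono[OF T_abs[OF that] M T[OF that]]])
      fix S :: "complex set" and \<zeta>
      assume S: "open S" and hol: "\<forall>b. (\<lambda>\<sigma>. \<zeta> \<sigma> b) holomorphic_on S" and z: "\<forall>\<sigma>\<in>S. \<zeta> \<sigma> \<in> polydisc p s"
      have U: "uniform_limit S (\<lambda>X \<sigma>. \<Sum>\<alpha>\<in>X. T (\<zeta> \<sigma>) \<alpha>) (\<lambda>\<sigma>. infsum (T (\<zeta> \<sigma>)) A) (finite_subsets_at_top A)"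
        by (rule Weierstrass_m_test_general'[OF _ _ M]) (use z T T_sum in auto)
      have "(\<lambda>\<sigma>. \<Sum>\<alpha>\<in>X. T (\<zeta> \<sigma>) \<alpha>) holomorphic_on S" for X
        unfolding T_def by (intro holomorphic_intros) (use hol in auto)
      note holX = this
      have "(\<lambda>\<sigma>. infsum (T (\<zeta> \<sigma>)) A) field_differentiable (at x)" if x: "x \<in> S" for x
      proof -
        obtain e where e: "0 < e" "cball x e \<subseteq> S" using S x open_contains_cball by meson
        have "(\<lambda>\<sigma>. infsum (T (\<zeta> \<sigma>)) A) holomorphic_on ball x e"
        proof (rule holomorphic_uniform_limit[OF always_eventually uniform_limit_on_subset[OF U e(2)] finite_subsets_at_top_neq_bot])
          have "ball x e \<subseteq> S" using e ball_subset_cball by blast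
          then show "\<forall>X. continuous_on (cball x e) (\<lambda>\<sigma>. \<Sum>\<alpha>\<in>X. T (\<zeta> \<sigma>) \<alpha>) \<and> (\<lambda>\<sigma>. \<Sum>\<alpha>\<in>X. T (\<zeta> \<sigma>) \<alpha>) holomorphic_on ball x e"
            using holX holomorphic_on_subset[OF _ e(2)] holomorphic_on_subset[of _ S "ball x e"] holomorphic_on_imp_continuous_on by blast
        qed
        then show ?thesis using e by (meson centre_in_ball holomorphic_on_imp_differentiable_at open_ball)
      qed
      then show "(\<lambda>\<sigma>. infsum (T (\<zeta> \<sigma>)) A) holomorphic_on S"
        by (simp add: holomorphic_on_def field_differentiable_at_within)
    qed
    show "hol_ext (\<lambda>x. \<psi> x \<bullet> e) (\<lambda>z. infsum (T z) A) p s"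
      unfolding hol_ext_def
    proof (intro allI impI)
      fix x assume x: "cvec x \<in> polydisc p s"
      have "x \<in> ball p r" by (rule in_ball) (use x in \<open>auto simp: cvec_polydisc_iff inner_diff_left intro: less_imp_le\<close>)
      from has_sum_of_real[OF sum_e[OF this], where 'a = complex]
      have "(T (cvec x) has_sum of_real (\<psi> x \<bullet> e)) A"
        by (simp add: T_def[abs_def] cvec_def inner_diff_left)
      then show "infsum (T (cvec x)) A = of_real (\<psi> x \<bullet> e)" by (rule infsumI)
    qed
  qed
qed

section \<open>Retractions onto real analytic submanifolds\<close>

lemma real_analytic_Ck:
  fixes \<phi> :: "'b::euclidean_space \<Rightarrow> 'a::euclidean_space"
  assumes \<phi>: "real_analytic_on U \<phi>" and U: "open U"
  shows "Ck_open k U \<phi>"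
proof (rule Ck_open_componentwise[OF U])
  fix e :: 'a
  show "Ck_open k U (\<lambda>x. \<phi> x \<bullet> e)"
  proof (rule Ck_open_local)
    fix x assume x: "x \<in> U"
    obtain g r K where g: "hol_bounded g x r K" "hol_ext (\<lambda>x. \<phi> x \<bullet> e) g x r"
      using holx_real_analytic[OF \<phi> x] unfolding holx_def by blast
    have r: "0 < r" by (rule hol_boundedD(1)[OF g(1)])
    show "\<exists>V. open V \<and> x \<in> V \<and> Ck_open k V (\<lambda>x. \<phi> x \<bullet> e)"
      by (intro exI[of _ "{y. cvec y \<in> polydisc x (r / 8 ^ Suc k)}"] conjI open_box_polydisc hol_Ck[OF g])
        (use r in \<open>simp add: cvec_center\<close>)
  qed
qed

text \<open>An extension is claimed near the base point alone, where one power series of each chart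
  suffices. The linear projection between the charts is moved to the other side of the inner product
  by its adjoint.\<close>

lemma real_analytic_retraction:
  fixes M :: "'a::euclidean_space set"
  assumes M: "submanifold real_analytic_on M" and p: "p \<in> M" and k: "k \<ge> 1"
  obtains P r where "local_retraction k M P p r" "\<And>v. holx p (\<lambda>x. P x \<bullet> v)"
    "\<And>u v. dird P u p \<bullet> v = u \<bullet> dird P v p"
proof (rule submanifold_chart[OF M p])
  fix U V \<phi> \<psi> E
  assume *: "open U" "p \<in> U" "open V" "homeomorphism U V \<phi> \<psi>" "real_analytic_on U \<phi>"
      "real_analytic_on V \<psi>" "subspace E" "\<phi> ` (U \<inter> M) = V \<inter> E"
  show thesis
  proof (rule retraction_of_chart[OF p *(2,1,3,4) real_analytic_Ck[OF *(5,1)] real_analytic_Ck[OF *(6,3)] k *(7,8)])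
    fix \<pi> r
    assume \<pi>: "linear \<pi>" "\<pi> (\<phi> p) = \<phi> p" and R: "local_retraction k M (\<lambda>x. \<psi> (\<pi> (\<phi> x))) p r"
      and sym: "\<And>u v. dird (\<lambda>x. \<psi> (\<pi> (\<phi> x))) u p \<bullet> v = u \<bullet> dird (\<lambda>x. \<psi> (\<pi> (\<phi> x))) v p"
    have pV: "\<pi> (\<phi> p) \<in> V" using * \<pi>(2) unfolding homeomorphism_def by auto
    have "holx p (\<lambda>x. \<pi> (\<phi> x) \<bullet> b)" for b
    proof -
      have "holx p (\<lambda>x. \<phi> x \<bullet> adjoint \<pi> b)" by (rule holx_real_analytic[OF *(5,2)])
      then show ?thesis using adjoint_works[OF \<pi>(1)] by simp
    qed
    then have "holx p (\<lambda>x. \<psi> (\<pi> (\<phi> x)) \<bullet> v)" for v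
      by (rule holx_compose[of "\<lambda>x. \<pi> (\<phi> x)" p "\<lambda>y. \<psi> y \<bullet> v", OF holx_real_analytic[OF *(6) pV]])
    then show thesis using that[OF R _ sym] by blast
  qed
qed

section \<open>Analyticity of geodesics\<close>

text \<open>One component of the right side of the geodesic equation: linear in the acceleration
  \<open>a\<close>, quadratic in the velocity \<open>V\<close>, with coefficients depending on the
  position \<open>z\<close>.\<close>

definition qode :: "('a::euclidean_space \<Rightarrow> ('a \<Rightarrow> complex) \<Rightarrow> complex) \<Rightarrow> ('a \<Rightarrow> 'a \<Rightarrow> ('a \<Rightarrow> complex) \<Rightarrow> complex) \<Rightarrow>
    ('a \<Rightarrow> complex) \<Rightarrow> ('a \<Rightarrow> complex) \<Rightarrow> ('a \<Rightarrow> complex) \<Rightarrow> complex" where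
  "qode s h z V a = (\<Sum>c\<in>Basis. s c z * a c) + (\<Sum>c\<in>Basis. \<Sum>d\<in>Basis. h c d z * (V c * V d))"

lemma norm_mult_diff_le:
  fixes x y :: complex
  assumes "cmod x \<le> X" "cmod y' \<le> Y" "cmod (x - x') \<le> e" "cmod (y - y') \<le> f"
  shows "cmod (x * y - x' * y') \<le> X * f + e * Y"
proof -
  have "x * y - x' * y' = x * (y - y') + (x - x') * y'" by (simp add: algebra_simps)
  then have "cmod (x * y - x' * y') \<le> cmod x * cmod (y - y') + cmod (x - x') * cmod y'"
    by (metis norm_mult norm_triangle_ineq)
  also have "\<dots> \<le> X * f + e * Y"
    using assms order_trans[OF norm_ge_zero assms(1)] order_trans[OF norm_ge_zero assms(3)]
    by (intro add_mono mult_mono) auto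
  finally show ?thesis .
qed

text \<open>The coefficient of the acceleration vanishes at the base point, so it is bounded by a
  multiple of the distance \<rho>. The error \<open>E\<close> of the acceleration is therefore
  multiplied by a factor that can be made small; the errors \<open>e\<close> and \<open>f\<close> of
  position and velocity gain smallness from integration.\<close>

lemma qode_diff:
  fixes p :: "'a::euclidean_space"
  defines "N \<equiv> real DIM('a)"
  assumes s: "\<And>c. c \<in> Basis \<Longrightarrow> hol_bounded (s c) p r K" "\<And>c. c \<in> Basis \<Longrightarrow> s c (cvec p) = 0"
    and h: "\<And>c d. c \<in> Basis \<Longrightarrow> d \<in> Basis \<Longrightarrow> hol_bounded (h c d) p r K"
    and z: "z \<in> polydisc p (r/2)" "z' \<in> polydisc p (r/2)"
    and \<rho>: "0 \<le> \<rho>" "\<And>c. c \<in> Basis \<Longrightarrow> cmod (z c - cvec p c) \<le> \<rho>"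
    and e: "0 \<le> e" "\<And>c. c \<in> Basis \<Longrightarrow> cmod (z c - z' c) \<le> e"
    and V: "\<And>c. c \<in> Basis \<Longrightarrow> cmod (V c) \<le> B" "\<And>c. c \<in> Basis \<Longrightarrow> cmod (V' c) \<le> B"
    and f: "0 \<le> f" "\<And>c. c \<in> Basis \<Longrightarrow> cmod (V c - V' c) \<le> f"
    and a: "\<And>c. c \<in> Basis \<Longrightarrow> cmod (a' c) \<le> A" "\<And>c. c \<in> Basis \<Longrightarrow> cmod (a c - a' c) \<le> E"
  shows "cmod (qode s h z V a - qode s h z' V' a') \<le>
    N * (8 * K / r * \<rho> * E + 8 * K / r * e * A) + N * (N * (K * (B * f + f * B) + 8 * K / r * e * (B * B)))"
proof -
  have r: "0 < r" using hol_boundedD(1)[OF s(1)] nonempty_Basis by blast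
  have rz: "z \<in> polydisc p r" using polydisc_mono[of "r/2" r _ p] z r by auto
  have B: "0 \<le> B" using V(1) nonempty_Basis norm_ge_zero order_trans by blast
  have 1: "cmod (s c z * a c - s c z' * a' c) \<le> 8 * K / r * \<rho> * E + 8 * K / r * e * A" if c: "c \<in> Basis" for c
  proof (rule norm_mult_diff_le[OF _ a(1)[OF c] _ a(2)[OF c]])
    have "cmod (s c z - s c (cvec p)) \<le> 8 * K / r * \<rho>"
      by (rule hol_bounded_Lipschitz[OF s(1)[OF c] z(1) _ \<rho>]) (use r in \<open>simp_all add: cvec_center\<close>)
    then show "cmod (s c z) \<le> 8 * K / r * \<rho>" by (simp add: s(2)[OF c])
    show "cmod (s c z - s c z') \<le> 8 * K / r * e" by (rule hol_bounded_Lipschitz[OF s(1)[OF c] z e])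
  qed
  have 2: "cmod (h c d z * (V c * V d) - h c d z' * (V' c * V' d)) \<le> K * (B * f + f * B) + 8 * K / r * e * (B * B)"
    if c: "c \<in> Basis" and d: "d \<in> Basis" for c d
  proof (rule norm_mult_diff_le)
    show "cmod (h c d z) \<le> K" by (rule hol_boundedD(2)[OF h[OF c d] rz])
    show "cmod (V' c * V' d) \<le> B * B" unfolding norm_mult by (intro mult_mono V c d B norm_ge_zero)
    show "cmod (h c d z - h c d z') \<le> 8 * K / r * e" by (rule hol_bounded_Lipschitz[OF h[OF c d] z e])
    show "cmod (V c * V d - V' c * V' d) \<le> B * f + f * B"
      by (rule norm_mult_diff_le[OF V(1)[OF c] V(2)[OF d] f(2)[OF c] f(2)[OF d]])
  qed
  have e: "qode s h z V a - qode s h z' V' a' = (\<Sum>c\<in>Basis. s c z * a c - s c z' * a' c) +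
      (\<Sum>c\<in>Basis. \<Sum>d\<in>Basis. h c d z * (V c * V d) - h c d z' * (V' c * V' d))"
    unfolding qode_def sum_subtractf by (simp add: algebra_simps)
  have "cmod (qode s h z V a - qode s h z' V' a') \<le> (\<Sum>c\<in>(Basis::'a set). 8 * K / r * \<rho> * E + 8 * K / r * e * A) +
      (\<Sum>c\<in>(Basis::'a set). \<Sum>d\<in>(Basis::'a set). K * (B * f + f * B) + 8 * K / r * e * (B * B))"
    unfolding e by (intro norm_triangle_mono sum_norm_le 1 2)
  then show ?thesis by (simp add: N_def)
qed

lemma qode_bound:
  fixes p :: "'a::euclidean_space"
  defines "N \<equiv> real DIM('a)"
  assumes s: "\<And>c. c \<in> Basis \<Longrightarrow> hol_bounded (s c) p r K" "\<And>c. c \<in> Basis \<Longrightarrow> s c (cvec p) = 0"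
    and h: "\<And>c d. c \<in> Basis \<Longrightarrow> d \<in> Basis \<Longrightarrow> hol_bounded (h c d) p r K"
    and z: "z \<in> polydisc p (r/2)"
    and \<rho>: "0 \<le> \<rho>" "\<And>c. c \<in> Basis \<Longrightarrow> cmod (z c - cvec p c) \<le> \<rho>"
    and V: "0 \<le> B" "\<And>c. c \<in> Basis \<Longrightarrow> cmod (V c) \<le> B"
    and a: "\<And>c. c \<in> Basis \<Longrightarrow> cmod (a c) \<le> A"
  shows "cmod (qode s h z V a) \<le> N * (8 * K / r * \<rho> * A) + N * (N * (K * (B * B + B * B)))"
proof -
  \<comment> \<open>Comparison with zero velocity and zero acceleration at the same position, where
    the right side vanishes.\<close>
  have "cmod (qode s h z V a - qode s h z (\<lambda>_. 0) (\<lambda>_. 0)) \<le>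
    N * (8 * K / r * \<rho> * A + 8 * K / r * 0 * 0) + N * (N * (K * (B * B + B * B) + 8 * K / r * 0 * (B * B)))"
    unfolding N_def by (rule qode_diff[OF s h z z \<rho>]) (use V a in auto)
  then show ?thesis by (simp add: qode_def)
qed

lemma qode_holomorphic:
  assumes s: "\<And>c. c \<in> Basis \<Longrightarrow> hol_bounded (s c) p r K"
    and h: "\<And>c d. c \<in> Basis \<Longrightarrow> d \<in> Basis \<Longrightarrow> hol_bounded (h c d) p r K"
    and S: "open S" and Z: "\<And>b. (\<lambda>\<sigma>. Z \<sigma> b) holomorphic_on S" "\<And>\<sigma>. \<sigma> \<in> S \<Longrightarrow> Z \<sigma> \<in> polydisc p r"
    and V: "\<And>b. b \<in> Basis \<Longrightarrow> (\<lambda>\<sigma>. V \<sigma> b) holomorphic_on S"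
    and a: "\<And>b. b \<in> Basis \<Longrightarrow> (\<lambda>\<sigma>. a \<sigma> b) holomorphic_on S"
  shows "(\<lambda>\<sigma>. qode s h (Z \<sigma>) (V \<sigma>) (a \<sigma>)) holomorphic_on S"
  unfolding qode_def
  by (intro holomorphic_intros V a hol_boundedD(3)[OF s S Z] hol_boundedD(3)[OF h S Z])

section \<open>Growth bounds, comparison on the real line, and primitives on a disc\<close>

lemma vector_derivative_norm_bound:
  fixes f :: "real \<Rightarrow> 'b::real_normed_vector"
  assumes "convex S" "\<And>x. x \<in> S \<Longrightarrow> (f has_vector_derivative f' x) (at x within S)"
    "\<And>x. x \<in> S \<Longrightarrow> norm (f' x) \<le> B" "x \<in> S" "y \<in> S"
  shows "norm (f x - f y) \<le> B * \<bar>x - y\<bar>"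
proof -
  have "onorm (\<lambda>h. h *\<^sub>R f' x) \<le> B" if "x \<in> S" for x
    by (rule onorm_le) (simp add: mult.commute[of _ "norm (f' x)"] mult_right_mono assms(3)[OF that])
  then show ?thesis
    using differentiable_bound[OF assms(1) assms(2)[unfolded has_vector_derivative_def], of B x y] assms(4,5) by simp
qed

lemma real_line_comparison:
  fixes f :: "complex \<Rightarrow> complex" and F :: "real \<Rightarrow> 'a::real_inner"
  assumes f: "\<And>\<sigma>. \<sigma> \<in> ball (of_real t0) \<delta> \<Longrightarrow> (f has_field_derivative f' \<sigma>) (at \<sigma>)"
    and F: "\<And>s. \<bar>s - t0\<bar> < \<delta> \<Longrightarrow> (F has_vector_derivative G s) (at s)"
    and close: "\<And>s. \<bar>s - t0\<bar> < \<delta> \<Longrightarrow> cmod (f' (of_real s) - of_real (G s \<bullet> b)) \<le> E"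
    and init: "f (of_real t0) = of_real (F t0 \<bullet> b)" and s: "\<bar>s - t0\<bar> < \<delta>"
  shows "cmod (f (of_real s) - of_real (F s \<bullet> b)) \<le> \<delta> * E"
proof -
  define S where "S = {t0 - \<delta><..<t0 + \<delta>}"
  have S: "s \<in> S \<longleftrightarrow> \<bar>s - t0\<bar> < \<delta>" for s by (auto simp: S_def)
  have d: "((\<lambda>s. f (of_real s) - of_real (F s \<bullet> b)) has_vector_derivative f' (of_real s) - of_real (G s \<bullet> b)) (at s within S)"
    if s: "s \<in> S" for s
  proof -
    have "((\<lambda>s. f (of_real s)) has_vector_derivative f' (of_real s)) (at s)"
      by (rule has_vector_derivative_real_field, rule f) (use s S in \<open>auto simp: dist_norm norm_minus_commute simp flip: of_real_diff\<close>)
    moreover have "((\<lambda>s. complex_of_real (F s \<bullet> b)) has_vector_derivative of_real (G s \<bullet> b)) (at s)"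
      using bounded_linear.has_vector_derivative[OF bounded_linear_compose[OF bounded_linear_of_real bounded_linear_inner_left] F] s S
      by blast
    ultimately show ?thesis by (rule has_vector_derivative_at_within[OF has_vector_derivative_diff])
  qed
  have "norm ((f (of_real s) - of_real (F s \<bullet> b)) - (f (of_real t0) - of_real (F t0 \<bullet> b))) \<le> E * \<bar>s - t0\<bar>"
    by (rule vector_derivative_norm_bound[OF _ d, where B = E]) (use S s close in \<open>auto simp: S_def\<close>)
  also have "\<dots> \<le> E * \<delta>"
    using close[OF s] order_trans[OF norm_ge_zero] s by (intro mult_left_mono) auto
  finally show ?thesis by (simp add: init mult.commute)
qed

lemma holomorphic_growth:
  fixes f :: "complex \<Rightarrow> complex"
  assumes "\<And>\<sigma>. \<sigma> \<in> ball c \<delta> \<Longrightarrow> (f has_field_derivative f' \<sigma>) (at \<sigma>)"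
    and "\<And>\<sigma>. \<sigma> \<in> ball c \<delta> \<Longrightarrow> cmod (f' \<sigma>) \<le> A" and s: "\<sigma> \<in> ball c \<delta>"
  shows "cmod (f \<sigma> - f c) \<le> \<delta> * A"
proof -
  have d: "0 < \<delta>" using s zero_le_dist[of c \<sigma>] unfolding mem_ball by linarith
  have "cmod (f \<sigma> - f c) \<le> A * cmod (\<sigma> - c)"
    by (rule field_differentiable_bound[OF convex_ball[of c \<delta>] has_field_derivative_at_within[OF assms(1)] assms(2) s])
      (use d in auto)
  also have "\<dots> \<le> A * \<delta>"
    using assms(2)[OF s] order_trans[OF norm_ge_zero] s by (intro mult_left_mono) (auto simp: dist_norm norm_minus_commute)
  finally show ?thesis by (simp add: mult.commute)
qed

lemma holomorphic_primitive:
  assumes "a holomorphic_on ball c \<delta>" "0 < \<delta>"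
  obtains f where "f c = x" "\<And>\<sigma>. \<sigma> \<in> ball c \<delta> \<Longrightarrow> (f has_field_derivative a \<sigma>) (at \<sigma>)"
proof -
  obtain g where g: "\<And>\<sigma>. \<sigma> \<in> ball c \<delta> \<Longrightarrow> (g has_field_derivative a \<sigma>) (at \<sigma> within ball c \<delta>)"
    by (rule holomorphic_convex_primitive'[OF convex_ball open_ball assms(1)]) (rule that)
  show thesis
  proof (rule that[of "\<lambda>\<sigma>. g \<sigma> + (x - g c)"])
    fix \<sigma> assume s: "\<sigma> \<in> ball c \<delta>"
    have "(g has_field_derivative a \<sigma>) (at \<sigma>)" using g[OF s] at_within_open[OF s open_ball] by simp
    then show "((\<lambda>\<sigma>. g \<sigma> + (x - g c)) has_field_derivative a \<sigma>) (at \<sigma>)"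
      by (auto intro!: derivative_eq_intros)
  qed simp
qed

text \<open>Outside \<open>I\<close> the values are set to 0, because curves in a polydisc are
  required to be holomorphic at every index.\<close>

lemma holomorphic_primitives:
  assumes "\<And>b. b \<in> I \<Longrightarrow> (\<lambda>\<sigma>. a \<sigma> b) holomorphic_on ball c \<delta>" "0 < \<delta>"
  obtains f where "\<And>b. b \<in> I \<Longrightarrow> f c b = x b" "\<And>\<sigma> b. \<sigma> \<in> ball c \<delta> \<Longrightarrow> b \<in> I \<Longrightarrow> ((\<lambda>\<sigma>. f \<sigma> b) has_field_derivative a \<sigma> b) (at \<sigma>)"
    "\<And>\<sigma> b. b \<notin> I \<Longrightarrow> f \<sigma> b = 0"
proof -
  have "\<forall>b\<in>I. \<exists>f. f c = x b \<and> (\<forall>\<sigma>\<in>ball c \<delta>. (f has_field_derivative a \<sigma> b) (at \<sigma>))"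
    by (intro ballI, rule holomorphic_primitive[OF assms(1) assms(2)]) blast+
  then obtain f where f: "\<forall>b\<in>I. f b c = x b \<and> (\<forall>\<sigma>\<in>ball c \<delta>. (f b has_field_derivative a \<sigma> b) (at \<sigma>))"
    unfolding bchoice_iff by blast
  have f': "f b c = x b" "\<sigma> \<in> ball c \<delta> \<Longrightarrow> (f b has_field_derivative a \<sigma> b) (at \<sigma>)" if "b \<in> I" for b \<sigma>
    using f that by blast+
  show thesis by (rule that[of "\<lambda>\<sigma> b. if b \<in> I then f b \<sigma> else 0"]) (simp_all add: f' del: mem_ball)
qed

lemma small_radius:
  assumes "\<delta>0 > 0"
  obtains \<delta> :: real where "0 < \<delta>" "\<delta> \<le> \<delta>0" "\<delta> \<le> 1" "\<delta> * \<bar>x\<bar> \<le> 1" "\<delta> * \<bar>y\<bar> \<le> 1" "\<delta> * \<bar>z\<bar> \<le> 1" "\<delta> * \<bar>w\<bar> \<le> 1"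
proof -
  define Q where "Q = \<bar>x\<bar> + \<bar>y\<bar> + \<bar>z\<bar> + \<bar>w\<bar> + 1"
  have Q: "0 < Q" "1 \<le> Q" by (simp_all add: Q_def)
  define \<delta> where "\<delta> = min \<delta>0 (1 / Q)"
  have d: "0 < \<delta>" "\<delta> \<le> \<delta>0" "\<delta> \<le> 1 / Q"
    unfolding \<delta>_def by (rule min_less_iff_conj[THEN iffD2] min.cobounded1 min.cobounded2 | use assms Q in simp)+
  have dQ: "\<delta> * Q \<le> 1" using d(3) Q(1) by (simp add: pos_le_divide_eq)
  have le: "\<delta> * u \<le> 1" if "u \<le> Q" for u
    using mult_left_mono[OF that less_imp_le[OF d(1)]] dQ by linarith
  have "\<delta> \<le> 1" using le[OF Q(2)] by simp
  then show thesis by (rule that[OF d(1,2)]; intro le) (simp_all add: Q_def)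
qed

text \<open>The equation is implicit in the acceleration, but \<open>S\<close> vanishes at \<open>F t0\<close> and is a contraction nearby.
  The accelerations of the Picard iterates stay bounded on a complex disc and converge to the
  real acceleration on the real segment; a locally uniform limit of the iterates exists by Montel's
  theorem, so no uniqueness theory for the complex equation is needed.\<close>

lemma holomorphic_ode:
  fixes F g g2 :: "real \<Rightarrow> 'a::euclidean_space"
  assumes \<delta>0: "\<delta>0 > 0"
    and F: "\<And>\<tau>. \<bar>\<tau> - t0\<bar> < \<delta>0 \<Longrightarrow> (F has_vector_derivative g \<tau>) (at \<tau>)"
    and g: "\<And>\<tau>. \<bar>\<tau> - t0\<bar> < \<delta>0 \<Longrightarrow> (g has_vector_derivative g2 \<tau>) (at \<tau>)"
    and bd: "\<And>\<tau>. \<bar>\<tau> - t0\<bar> < \<delta>0 \<Longrightarrow> norm (g \<tau>) \<le> B0" "\<And>\<tau>. \<bar>\<tau> - t0\<bar> < \<delta>0 \<Longrightarrow> norm (g2 \<tau>) \<le> A0"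
    and S: "\<And>b c. b \<in> Basis \<Longrightarrow> c \<in> Basis \<Longrightarrow> holx (F t0) (S b c)"
      "\<And>b c. b \<in> Basis \<Longrightarrow> c \<in> Basis \<Longrightarrow> S b c (F t0) = 0"
    and H: "\<And>b c d. b \<in> Basis \<Longrightarrow> c \<in> Basis \<Longrightarrow> d \<in> Basis \<Longrightarrow> holx (F t0) (H b c d)"
    and eq: "\<And>\<tau> b. \<bar>\<tau> - t0\<bar> < \<delta>0 \<Longrightarrow> b \<in> Basis \<Longrightarrow> g2 \<tau> \<bullet> b =
      (\<Sum>c\<in>Basis. S b c (F \<tau>) * (g2 \<tau> \<bullet> c)) + (\<Sum>c\<in>Basis. \<Sum>d\<in>Basis. H b c d (F \<tau>) * ((g \<tau> \<bullet> c) * (g \<tau> \<bullet> d)))"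
  obtains \<delta> f where "\<delta> > 0" "\<And>b. b \<in> Basis \<Longrightarrow> f b holomorphic_on ball (of_real t0) \<delta>"
    "\<And>b \<tau>. b \<in> Basis \<Longrightarrow> \<bar>\<tau> - t0\<bar> < \<delta> \<Longrightarrow> f b (of_real \<tau>) = of_real (F \<tau> \<bullet> b)"
proof -
  define p where "p = F t0"
  obtain s0 r1 K1 where s0: "0 < r1" "\<And>i. i \<in> Basis \<times> Basis \<Longrightarrow> hol_bounded (s0 i) p r1 K1"
      "\<And>i. i \<in> Basis \<times> Basis \<Longrightarrow> hol_ext (S (fst i) (snd i)) (s0 i) p r1"
    by (rule holx_family[of "Basis \<times> Basis" p "\<lambda>i. S (fst i) (snd i)"]) (use S p_def in auto)
  obtain h0 r2 K2 where h0: "0 < r2" "\<And>i. i \<in> Basis \<times> Basis \<times> Basis \<Longrightarrow> hol_bounded (h0 i) p r2 K2"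
      "\<And>i. i \<in> Basis \<times> Basis \<times> Basis \<Longrightarrow> hol_ext (H (fst i) (fst (snd i)) (snd (snd i))) (h0 i) p r2"
    by (rule holx_family[of "Basis \<times> Basis \<times> Basis" p "\<lambda>i. H (fst i) (fst (snd i)) (snd (snd i))"]) (use H p_def in auto)
  define r K where "r = min r1 r2" and "K = max K1 K2"
  have r: "0 < r" using s0(1) h0(1) by (simp add: r_def)
  define s h where "s b c = s0 (b, c)" and "h b c d = h0 (b, c, d)" for b c d
  have s: "hol_bounded (s b c) p r K" and sx: "hol_ext (S b c) (s b c) p r" if "b \<in> Basis" "c \<in> Basis" for b c
    using hol_bounded_mono[OF s0(2), of "(b, c)" r K] hol_ext_mono[OF s0(3), of "(b, c)" r] that r
    by (auto simp: r_def K_def s_def)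
  have h: "hol_bounded (h b c d) p r K" and hx: "hol_ext (H b c d) (h b c d) p r"
    if "b \<in> Basis" "c \<in> Basis" "d \<in> Basis" for b c d
    using hol_bounded_mono[OF h0(2), of "(b, c, d)" r K] hol_ext_mono[OF h0(3), of "(b, c, d)" r] that r
    by (auto simp: r_def K_def h_def)
  have sp: "s b c (cvec p) = 0" if "b \<in> Basis" "c \<in> Basis" for b c
    using sx[OF that] S(2)[OF that] cvec_center[OF r, of p] by (simp add: hol_ext_def p_def)
  obtain b0 :: 'a where b0: "b0 \<in> Basis" using nonempty_Basis by blast
  have K: "0 \<le> K" by (rule hol_bounded_nonneg[OF s[OF b0 b0]])
  define N where "N = real DIM('a)"
  have N: "0 \<le> N" by (simp add: N_def)
  define L where "L = 8 * K / r"
  have L: "0 \<le> L" using K r by (simp add: L_def)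
  \<comment> \<open>Bound for the complex velocities: \<open>B0\<close> at the centre, and at most 1
    more on a disc with \<open>\<delta> * A \<le> 1\<close>.\<close>
  define B where "B = \<bar>B0\<bar> + 1"
  have B: "0 \<le> B" "B0 \<le> B" "B0 + 1 \<le> B" by (auto simp: B_def)
  \<comment> \<open>Chosen to be reproduced by the iteration: the linear term contributes at most
    \<open>A / 4\<close> and the quadratic one at most \<open>A / 2\<close>. Adding
    \<open>\<bar>A0\<bar>\<close> includes the real acceleration.\<close>
  define A where "A = 2 * (N * (N * (K * (B * B + B * B)))) + \<bar>A0\<bar>"
  have NK: "0 \<le> N * (N * (K * (B * B + B * B)))" using N K B by (intro mult_nonneg_nonneg add_nonneg_nonneg) auto
  have A: "0 \<le> A" "A0 \<le> A" "2 * (N * (N * (K * (B * B + B * B)))) \<le> A" using NK unfolding A_def by linarith+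
  \<comment> \<open>Collects what position and velocity errors of size \<open>\<delta> * E\<close>
    contribute to the next acceleration error, per unit of \<open>\<delta> * E\<close>.\<close>
  define C1 where "C1 = N * (L * A) + N * (N * (K * (B + B) + L * (B * B)))"
  have C1: "0 \<le> C1" unfolding C1_def using N L A B K by (intro mult_nonneg_nonneg add_nonneg_nonneg) auto
  \<comment> \<open>The four products control, in this order, the growth of the velocity, the
    distance travelled relative to r, the contraction factor of the implicit term, and the
    integrated errors. The last two give 1/4 each, so every step halves the error.\<close>
  obtain \<delta> where \<delta>: "0 < \<delta>" "\<delta> \<le> \<delta>0" "\<delta> \<le> 1" "\<delta> * \<bar>A\<bar> \<le> 1" "\<delta> * \<bar>4 * B / r\<bar> \<le> 1" "\<delta> * \<bar>4 * N * L * B\<bar> \<le> 1" "\<delta> * \<bar>4 * C1\<bar> \<le> 1"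
    by (rule small_radius[OF \<delta>0]) (rule that)
  define \<rho> where "\<rho> = \<delta> * B"
  have \<rho>: "0 \<le> \<rho>" using \<delta> B by (simp add: \<rho>_def)
  have \<rho>r: "\<rho> < r / 2"
  proof -
    have "\<rho> * 4 / r \<le> 1" using \<delta>(5) B r by (simp add: \<rho>_def)
    then have "\<rho> * 4 \<le> r" using r by (simp add: pos_divide_le_eq)
    then show ?thesis using r by linarith
  qed
  have NL: "N * (L * \<rho>) \<le> 1/4"
  proof -
    have "0 \<le> 4 * N * L * B" using N L B by simp
    then have "4 * (N * (L * \<rho>)) \<le> 1" using \<delta>(6) by (simp add: \<rho>_def abs_of_nonneg mult_ac)
    then show ?thesis by simp
  qed
  have C1d: "\<delta> * C1 \<le> 1/4" using \<delta>(7) C1 by simp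
  have dA: "\<delta> * A \<le> 1" using \<delta>(4) A by simp
  define D where "D = ball (complex_of_real t0) \<delta>"
  have real_D: "complex_of_real \<tau> \<in> D \<longleftrightarrow> \<bar>\<tau> - t0\<bar> < \<delta>" for \<tau>
    by (simp add: D_def dist_norm abs_minus_commute flip: of_real_diff)
  have t0D: "complex_of_real t0 \<in> D" using real_D \<delta>(1) by simp
  have F': "(F has_vector_derivative g \<tau>) (at \<tau>)" and g': "(g has_vector_derivative g2 \<tau>) (at \<tau>)"
    if "\<bar>\<tau> - t0\<bar> < \<delta>" for \<tau> using that \<delta>(2) by (auto intro: F g)
  have bnd: "cmod (cvec (g \<tau>) b) \<le> B" "cmod (cvec (g2 \<tau>) b) \<le> A" if "\<bar>\<tau> - t0\<bar> < \<delta>" "b \<in> Basis" for \<tau> b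
    using bd[of \<tau>] that \<delta>(2) Basis_le_norm[OF that(2), of "g \<tau>"] Basis_le_norm[OF that(2), of "g2 \<tau>"] A B
    by (simp_all add: cvec_def)
  have Fp: "cmod (cvec (F \<tau>) b - cvec p b) \<le> \<rho>" if "\<bar>\<tau> - t0\<bar> < \<delta>" "b \<in> Basis" for \<tau> b
  proof -
    have "norm (F \<tau> - F t0) \<le> B * \<bar>\<tau> - t0\<bar>"
    proof (rule vector_derivative_norm_bound[where S = "{t0 - \<delta><..<t0 + \<delta>}" and f' = g])
      fix x assume x: "x \<in> {t0 - \<delta><..<t0 + \<delta>}"
      then have x': "\<bar>x - t0\<bar> < \<delta>" by auto
      show "(F has_vector_derivative g x) (at x within {t0 - \<delta><..<t0 + \<delta>})"
        by (rule has_vector_derivative_at_within[OF F'[OF x']])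
      show "norm (g x) \<le> B" using bd(1)[of x] x' \<delta>(2) B by simp
    qed (use that \<delta>(1) in auto)
    also have "\<dots> \<le> B * \<delta>" using B that by (intro mult_left_mono) auto
    finally have "norm (F \<tau> - p) \<le> \<rho>" by (simp add: p_def \<rho>_def mult.commute)
    then have "\<bar>(F \<tau> - p) \<bullet> b\<bar> \<le> \<rho>" using Basis_le_norm[OF that(2), of "F \<tau> - p"] by linarith
    then show ?thesis by (simp add: cvec_def inner_diff_left flip: of_real_diff)
  qed
  have F_in: "cvec (F \<tau>) \<in> polydisc p (r / 2)" if "\<bar>\<tau> - t0\<bar> < \<delta>" for \<tau>
    using Fp[OF that] \<rho>r by (force simp: polydisc_def)
  have eqC: "cvec (g2 \<tau>) b = qode (s b) (h b) (cvec (F \<tau>)) (cvec (g \<tau>)) (cvec (g2 \<tau>))"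
    if t: "\<bar>\<tau> - t0\<bar> < \<delta>" and b: "b \<in> Basis" for \<tau> b
  proof -
    have "cvec (F \<tau>) \<in> polydisc p r" using polydisc_mono[of "r/2" r _ p] F_in[OF t] r by auto
    then have "s b c (cvec (F \<tau>)) = of_real (S b c (F \<tau>))" "d \<in> Basis \<Longrightarrow> h b c d (cvec (F \<tau>)) = of_real (H b c d (F \<tau>))"
      if "c \<in> Basis" for c d using sx[OF b that] hx[OF b that] by (auto simp: hol_ext_def)
    then have "qode (s b) (h b) (cvec (F \<tau>)) (cvec (g \<tau>)) (cvec (g2 \<tau>)) =
      of_real ((\<Sum>c\<in>Basis. S b c (F \<tau>) * (g2 \<tau> \<bullet> c)) + (\<Sum>c\<in>Basis. \<Sum>d\<in>Basis. H b c d (F \<tau>) * ((g \<tau> \<bullet> c) * (g \<tau> \<bullet> d))))"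
      by (simp add: qode_def cvec_def cong: sum.cong)
    also have "\<dots> = cvec (g2 \<tau>) b" using eq[of \<tau> b] t b \<delta>(2) by (simp add: cvec_def)
    finally show ?thesis by simp
  qed
  \<comment> \<open>\<open>E\<close> measures the acceleration on the real segment only; on the
    complex disc mere boundedness is kept. Positions vanish outside \<open>Basis\<close>, so that
    they are holomorphic at every index.\<close>
  define Inv where "Inv E Z V a \<longleftrightarrow> (\<forall>b\<in>Basis. (\<lambda>\<sigma>. a \<sigma> b) holomorphic_on D \<and> (\<forall>\<sigma>\<in>D. cmod (a \<sigma> b) \<le> A) \<and>
      V (of_real t0) b = cvec (g t0) b \<and> Z (of_real t0) b = cvec p b \<and>
      (\<forall>\<sigma>\<in>D. ((\<lambda>\<sigma>. V \<sigma> b) has_field_derivative a \<sigma> b) (at \<sigma>)) \<and>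
      (\<forall>\<sigma>\<in>D. ((\<lambda>\<sigma>. Z \<sigma> b) has_field_derivative V \<sigma> b) (at \<sigma>)) \<and>
      (\<forall>\<tau>. \<bar>\<tau> - t0\<bar> < \<delta> \<longrightarrow> cmod (a (of_real \<tau>) b - cvec (g2 \<tau>) b) \<le> E)) \<and> (\<forall>\<sigma>. \<forall>b. b \<notin> Basis \<longrightarrow> Z \<sigma> b = 0)"
    for E :: real and Z V a :: "complex \<Rightarrow> 'a \<Rightarrow> complex"
  have make: "\<exists>Z V. Inv E Z V a"
    if a: "\<And>b. b \<in> Basis \<Longrightarrow> (\<lambda>\<sigma>. a \<sigma> b) holomorphic_on D" "\<And>b \<sigma>. b \<in> Basis \<Longrightarrow> \<sigma> \<in> D \<Longrightarrow> cmod (a \<sigma> b) \<le> A"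
      "\<And>b \<tau>. b \<in> Basis \<Longrightarrow> \<bar>\<tau> - t0\<bar> < \<delta> \<Longrightarrow> cmod (a (of_real \<tau>) b - cvec (g2 \<tau>) b) \<le> E" for a E
  proof -
    obtain V where V: "\<And>b. b \<in> Basis \<Longrightarrow> V (of_real t0) b = cvec (g t0) b"
        "\<And>\<sigma> b. \<sigma> \<in> D \<Longrightarrow> b \<in> Basis \<Longrightarrow> ((\<lambda>\<sigma>. V \<sigma> b) has_field_derivative a \<sigma> b) (at \<sigma>)"
      by (rule holomorphic_primitives[of Basis a "of_real t0" \<delta> "cvec (g t0)", OF a(1)[unfolded D_def] \<delta>(1), folded D_def])
        (assumption | rule that)+
    have Vh: "(\<lambda>\<sigma>. V \<sigma> b) holomorphic_on D" if "b \<in> Basis" for b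
      using V(2)[OF _ that] unfolding D_def holomorphic_on_open[OF open_ball] by blast
    obtain Z where Z: "\<And>b. b \<in> Basis \<Longrightarrow> Z (of_real t0) b = cvec p b"
        "\<And>\<sigma> b. \<sigma> \<in> D \<Longrightarrow> b \<in> Basis \<Longrightarrow> ((\<lambda>\<sigma>. Z \<sigma> b) has_field_derivative V \<sigma> b) (at \<sigma>)"
        "\<And>\<sigma> b. b \<notin> Basis \<Longrightarrow> Z \<sigma> b = 0"
      by (rule holomorphic_primitives[of Basis V "of_real t0" \<delta> "cvec p", OF Vh[unfolded D_def] \<delta>(1), folded D_def])
        (assumption | rule that)+
    have "Inv E Z V a" unfolding Inv_def using a V Z by simp
    then show ?thesis by blast
  qed
  have InvD: "(\<lambda>\<sigma>. a \<sigma> b) holomorphic_on D" "\<And>\<sigma>. \<sigma> \<in> D \<Longrightarrow> cmod (a \<sigma> b) \<le> A"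
      "(\<lambda>\<sigma>. V \<sigma> b) holomorphic_on D" "\<And>\<sigma>. \<sigma> \<in> D \<Longrightarrow> cmod (V \<sigma> b) \<le> B"
      "\<And>\<sigma>. \<sigma> \<in> D \<Longrightarrow> cmod (Z \<sigma> b - cvec p b) \<le> \<rho>"
      "\<And>\<tau>. \<bar>\<tau> - t0\<bar> < \<delta> \<Longrightarrow> cmod (a (of_real \<tau>) b - cvec (g2 \<tau>) b) \<le> E"
      "\<And>\<tau>. \<bar>\<tau> - t0\<bar> < \<delta> \<Longrightarrow> cmod (V (of_real \<tau>) b - cvec (g \<tau>) b) \<le> \<delta> * E"
      "\<And>\<tau>. \<bar>\<tau> - t0\<bar> < \<delta> \<Longrightarrow> cmod (Z (of_real \<tau>) b - cvec (F \<tau>) b) \<le> \<delta> * (\<delta> * E)"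
    if I: "Inv E Z V a" and b: "b \<in> Basis" for E Z V a b
  proof -
    note I' = bspec[OF conjunct1[OF I[unfolded Inv_def]] b]
    show "(\<lambda>\<sigma>. a \<sigma> b) holomorphic_on D" and aA: "\<And>\<sigma>. \<sigma> \<in> D \<Longrightarrow> cmod (a \<sigma> b) \<le> A"
      and close: "\<And>\<tau>. \<bar>\<tau> - t0\<bar> < \<delta> \<Longrightarrow> cmod (a (of_real \<tau>) b - cvec (g2 \<tau>) b) \<le> E"
      using I' by blast+
    have dV: "\<And>\<sigma>. \<sigma> \<in> D \<Longrightarrow> ((\<lambda>\<sigma>. V \<sigma> b) has_field_derivative a \<sigma> b) (at \<sigma>)"
      and dZ: "\<And>\<sigma>. \<sigma> \<in> D \<Longrightarrow> ((\<lambda>\<sigma>. Z \<sigma> b) has_field_derivative V \<sigma> b) (at \<sigma>)"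
      and V0: "V (of_real t0) b = cvec (g t0) b" and Z0: "Z (of_real t0) b = cvec p b" using I' by blast+
    show "(\<lambda>\<sigma>. V \<sigma> b) holomorphic_on D" using dV unfolding D_def holomorphic_on_open[OF open_ball] by blast
    show VB: "cmod (V \<sigma> b) \<le> B" if "\<sigma> \<in> D" for \<sigma>
    proof -
      have "cmod (V \<sigma> b - V (of_real t0) b) \<le> \<delta> * A"
        by (rule holomorphic_growth[OF dV[unfolded D_def] aA[unfolded D_def] that[unfolded D_def]])
      moreover have "cmod (cvec (g t0) b) \<le> B0"
        using bd(1)[of t0] \<delta>0 Basis_le_norm[OF b, of "g t0"] by (simp add: cvec_def)
      ultimately show ?thesis
        using norm_triangle_sub[of "V \<sigma> b" "V (of_real t0) b"] dA B V0 by simp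
    qed
    show "cmod (Z \<sigma> b - cvec p b) \<le> \<rho>" if "\<sigma> \<in> D" for \<sigma>
      using holomorphic_growth[OF dZ[unfolded D_def] VB[unfolded D_def] that[unfolded D_def]] Z0 by (simp add: \<rho>_def)
    show closeV: "cmod (V (of_real \<tau>) b - cvec (g \<tau>) b) \<le> \<delta> * E" if "\<bar>\<tau> - t0\<bar> < \<delta>" for \<tau>
      unfolding cvec_def
      by (rule real_line_comparison[OF dV[unfolded D_def] g' close[unfolded cvec_def] V0[unfolded cvec_def] that])
    show "cmod (Z (of_real \<tau>) b - cvec (F \<tau>) b) \<le> \<delta> * (\<delta> * E)" if "\<bar>\<tau> - t0\<bar> < \<delta>" for \<tau>
      unfolding cvec_def
      by (rule real_line_comparison[OF dZ[unfolded D_def] F' closeV[unfolded cvec_def] Z0[unfolded cvec_def p_def] that])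
  qed
  have Inv_Z: "(\<lambda>\<sigma>. Z \<sigma> b) holomorphic_on D" "\<And>\<sigma>. \<sigma> \<in> D \<Longrightarrow> Z \<sigma> \<in> polydisc p (r / 2)"
    if I: "Inv E Z V a" for E Z V a b
  proof -
    show "(\<lambda>\<sigma>. Z \<sigma> b) holomorphic_on D"
    proof (cases "b \<in> Basis")
      case True
      then show ?thesis using I unfolding Inv_def D_def holomorphic_on_open[OF open_ball] by blast
    next
      case False
      then have "Z \<sigma> b = 0" for \<sigma> using I unfolding Inv_def by blast
      then show ?thesis by simp
    qed
    show "Z \<sigma> \<in> polydisc p (r / 2)" if "\<sigma> \<in> D" for \<sigma>
      using InvD(5)[OF I _ that] \<rho>r by (force simp: polydisc_def)
  qed
  have step: "\<exists>Z' V' a'. Inv (E / 2) Z' V' a'" if I: "Inv E Z V a" and E: "0 \<le> E" for E Z V a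
  proof -
    define a' where "a' \<sigma> b = qode (s b) (h b) (Z \<sigma>) (V \<sigma>) (a \<sigma>)" for \<sigma> b
    have "\<exists>Z' V'. Inv (E / 2) Z' V' a'"
    proof (rule make)
      fix b :: 'a assume b: "b \<in> Basis"
      have in_r: "Z \<sigma> \<in> polydisc p r" if "\<sigma> \<in> D" for \<sigma> using polydisc_mono[of "r/2" r _ p] Inv_Z(2)[OF I that] r by auto
      show "(\<lambda>\<sigma>. a' \<sigma> b) holomorphic_on D"
        unfolding a'_def
        by (rule qode_holomorphic[OF s[OF b] h[OF b] _ Inv_Z(1)[OF I] in_r InvD(3)[OF I] InvD(1)[OF I]])
          (auto simp: D_def)
      show "cmod (a' \<sigma> b) \<le> A" if \<sigma>: "\<sigma> \<in> D" for \<sigma>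
      proof -
        have "cmod (a' \<sigma> b) \<le> N * (L * \<rho> * A) + N * (N * (K * (B * B + B * B)))"
          unfolding a'_def N_def L_def
          by (rule qode_bound[OF s[OF b] sp[OF b] h[OF b] Inv_Z(2)[OF I \<sigma>] \<rho> InvD(5)[OF I _ \<sigma>] B(1) InvD(4)[OF I _ \<sigma>] InvD(2)[OF I _ \<sigma>]])
        also have "N * (L * \<rho> * A) \<le> 1/4 * A" using mult_right_mono[OF NL A(1)] by (simp add: mult_ac)
        finally show ?thesis using A by linarith
      qed
      show "cmod (a' (of_real \<tau>) b - cvec (g2 \<tau>) b) \<le> E / 2" if \<tau>: "\<bar>\<tau> - t0\<bar> < \<delta>" for \<tau>
      proof -
        have \<sigma>: "of_real \<tau> \<in> D" using real_D \<tau> by simp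
        have dE: "0 \<le> \<delta> * E" "\<delta> * (\<delta> * E) \<le> \<delta> * E"
          using \<delta>(1,3) E mult_right_mono[of \<delta> 1 "\<delta> * E"] by auto
        have "cmod (a' (of_real \<tau>) b - cvec (g2 \<tau>) b) \<le> N * (L * \<rho> * E + L * (\<delta> * E) * A)
            + N * (N * (K * (B * (\<delta> * E) + (\<delta> * E) * B) + L * (\<delta> * E) * (B * B)))"
          unfolding a'_def eqC[OF \<tau> b] N_def L_def
          by (rule qode_diff[OF s[OF b] sp[OF b] h[OF b] Inv_Z(2)[OF I \<sigma>] F_in[OF \<tau>] \<rho> InvD(5)[OF I _ \<sigma>] dE(1)
              order_trans[OF InvD(8)[OF I _ \<tau>] dE(2)] InvD(4)[OF I _ \<sigma>] bnd(1)[OF \<tau>] dE(1) InvD(7)[OF I _ \<tau>] bnd(2)[OF \<tau>] InvD(6)[OF I _ \<tau>]])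
        also have "\<dots> = N * (L * \<rho>) * E + \<delta> * C1 * E" by (simp add: C1_def algebra_simps)
        also have "\<dots> \<le> 1/4 * E + 1/4 * E" by (intro add_mono mult_right_mono NL C1d E)
        finally show ?thesis by simp
      qed
    qed
    then show ?thesis by blast
  qed
  have "\<exists>Z V a. Inv (A / 2 ^ n) Z V a" for n :: nat
  proof (induction n)
    case 0
    \<comment> \<open>The iteration starts with acceleration 0, whose error on the real segment is
      at most A.\<close>
    have "\<exists>Z V. Inv A Z V (\<lambda>_ _. 0)" by (rule make) (use A bnd(2) in auto)
    then show ?case by auto
  next
    case (Suc n)
    then obtain Z V a where "Inv (A / 2 ^ n) Z V a" by blast
    then have "\<exists>Z V a. Inv (A / 2 ^ n / 2) Z V a" by (rule step) (use A in simp)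
    then show ?case by (simp add: mult.commute)
  qed
  then obtain Z V a where I: "\<And>n. Inv (A / 2 ^ n) (Z n) (V n) (a n)" by metis
  have lim0: "(\<lambda>n. A / 2 ^ n) \<longlonglongrightarrow> 0" by real_asymp
  have lim: "(\<lambda>n. Z n (of_real \<tau>) b) \<longlonglongrightarrow> of_real (F \<tau> \<bullet> b)" if \<tau>: "\<bar>\<tau> - t0\<bar> < \<delta>" and b: "b \<in> Basis" for \<tau> b
  proof -
    have "cmod (Z n (of_real \<tau>) b - of_real (F \<tau> \<bullet> b)) \<le> A / 2 ^ n" for n
    proof -
      have e: "0 \<le> A / 2 ^ n" using A by simp
      have "\<delta> * (\<delta> * (A / 2 ^ n)) \<le> 1 * (1 * (A / 2 ^ n))"
        by (intro mult_mono \<delta>(3) e order_refl mult_nonneg_nonneg less_imp_le[OF \<delta>(1)]) auto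
      then show ?thesis using InvD(8)[OF I b \<tau>, of n] by (simp add: cvec_def)
    qed
    then have "(\<lambda>n. Z n (of_real \<tau>) b - of_real (F \<tau> \<bullet> b)) \<longlonglongrightarrow> 0"
      by (intro tendsto_norm_zero_cancel[OF tendsto_sandwich[OF _ _ tendsto_const lim0]]) auto
    then show ?thesis using LIM_zero_iff by blast
  qed
  have "\<forall>b\<in>Basis. \<exists>f. f holomorphic_on D \<and> (\<forall>\<tau>. \<bar>\<tau> - t0\<bar> < \<delta> \<longrightarrow> f (of_real \<tau>) = of_real (F \<tau> \<bullet> b))"
  proof
    fix b :: 'a assume b: "b \<in> Basis"
    \<comment> \<open>Complex convergence is needed for a subsequence only, since on the real
      segment the whole sequence already tends to F and fixes the limit there.\<close>
    obtain f q where f: "f holomorphic_on D" "strict_mono (q :: nat \<Rightarrow> nat)" "\<And>x. x \<in> D \<Longrightarrow> (\<lambda>n. Z (q n) x b) \<longlonglongrightarrow> f x"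
    proof (rule Montel[of D "range (\<lambda>n \<sigma>. Z n \<sigma> b)" "\<lambda>n \<sigma>. Z n \<sigma> b"])
      show "open D" by (simp add: D_def)
      show "\<And>h. h \<in> range (\<lambda>n \<sigma>. Z n \<sigma> b) \<Longrightarrow> h holomorphic_on D" using Inv_Z(1)[OF I] by auto
      fix K assume "K \<subseteq> D"
      then have "cmod (Z n z b) \<le> cmod (cvec p b) + \<rho>" if "z \<in> K" for n z
        using InvD(5)[OF I b, of z n] that norm_triangle_sub[of "Z n z b" "cvec p b"] by fastforce
      then show "\<exists>B. \<forall>h\<in>range (\<lambda>n \<sigma>. Z n \<sigma> b). \<forall>z\<in>K. cmod (h z) \<le> B" by blast
    qed auto
    have "f (of_real \<tau>) = of_real (F \<tau> \<bullet> b)" if "\<bar>\<tau> - t0\<bar> < \<delta>" for \<tau>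
    proof (rule LIMSEQ_unique[OF f(3)])
      show "of_real \<tau> \<in> D" using real_D that by simp
      show "(\<lambda>n. Z (q n) (of_real \<tau>) b) \<longlonglongrightarrow> of_real (F \<tau> \<bullet> b)"
        using LIMSEQ_subseq_LIMSEQ[OF lim[OF that b] f(2)] by (simp add: o_def)
    qed
    then show "\<exists>f. f holomorphic_on D \<and> (\<forall>\<tau>. \<bar>\<tau> - t0\<bar> < \<delta> \<longrightarrow> f (of_real \<tau>) = of_real (F \<tau> \<bullet> b))" using f(1) by blast
  qed
  then obtain f where "\<forall>b\<in>Basis. f b holomorphic_on D \<and> (\<forall>\<tau>. \<bar>\<tau> - t0\<bar> < \<delta> \<longrightarrow> f b (of_real \<tau>) = of_real (F \<tau> \<bullet> b))"
    unfolding bchoice_iff by blast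
  then show thesis using that[OF \<delta>(1), of f] unfolding D_def by blast
qed

section \<open>From holomorphic extensions back to real power series, and analyticity of
  geodesics\<close>

lemma real_power_series_of_holomorphic:
  fixes F :: "real \<Rightarrow> 'a::euclidean_space"
  assumes \<delta>: "\<delta> > 0" and f: "\<And>b. b \<in> Basis \<Longrightarrow> f b holomorphic_on ball (of_real t0) \<delta>"
    and e: "\<And>b \<tau>. b \<in> Basis \<Longrightarrow> \<bar>\<tau> - t0\<bar> < \<delta> \<Longrightarrow> f b (of_real \<tau>) = of_real (F \<tau> \<bullet> b)"
  obtains c where "\<And>\<tau>. \<bar>\<tau> - t0\<bar> < \<delta> \<Longrightarrow> ((\<lambda>n. (\<tau> - t0) ^ n *\<^sub>R c n) has_sum F \<tau>) (UNIV :: nat set)"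
proof -
  define k where "k b n = (deriv ^^ n) (f b) (of_real t0) / fact n" for b n
  have sums: "(\<lambda>n. k b n * of_real (\<tau> - t0) ^ n) sums of_real (F \<tau> \<bullet> b)" if "b \<in> Basis" "\<bar>\<tau> - t0\<bar> < \<delta>" for b \<tau>
    using holomorphic_power_series[OF f[OF that(1)], of "of_real \<tau>"] that e[OF that]
    by (simp add: k_def dist_norm norm_minus_commute flip: of_real_diff)
  have comp: "((\<lambda>n. (\<tau> - t0) ^ n * Re (k b n)) has_sum (F \<tau> \<bullet> b)) UNIV" if b: "b \<in> Basis" and \<tau>: "\<bar>\<tau> - t0\<bar> < \<delta>" for b \<tau>
  proof -
    \<comment> \<open>A point farther from the centre at which the series still converges; this
      makes the series absolutely convergent at \<tau>, as \<open>has_sum\<close> demands.\<close>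
    define x where "x = t0 + (\<bar>\<tau> - t0\<bar> + \<delta>) / 2"
    have x: "\<bar>x - t0\<bar> < \<delta>" "\<bar>\<tau> - t0\<bar> < \<bar>x - t0\<bar>" using \<tau> by (auto simp: x_def)
    have "summable (\<lambda>n. norm (k b n * of_real (\<tau> - t0) ^ n))"
      by (rule powser_insidea[OF sums_summable[OF sums[OF b x(1)]]]) (use x(2) in \<open>simp flip: of_real_diff\<close>)
    from norm_summable_imp_has_sum[OF this sums[OF b \<tau>]]
    have "((\<lambda>n. Re (k b n * of_real (\<tau> - t0) ^ n)) has_sum Re (of_real (F \<tau> \<bullet> b))) UNIV"
      by (rule has_sum_bounded_linear[OF bounded_linear_Re])
    then show ?thesis by (simp add: mult.commute flip: of_real_power of_real_diff)
  qed
  show thesis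
  proof (rule that[of "\<lambda>n. \<Sum>b\<in>Basis. Re (k b n) *\<^sub>R b"])
    fix \<tau> assume \<tau>: "\<bar>\<tau> - t0\<bar> < \<delta>"
    have "((\<lambda>n. \<Sum>b\<in>B. ((\<tau> - t0) ^ n * Re (k b n)) *\<^sub>R b) has_sum (\<Sum>b\<in>B. (F \<tau> \<bullet> b) *\<^sub>R b)) UNIV"
      if "finite B" "B \<subseteq> Basis" for B
      using that
    proof (induction B rule: finite_induct)
      case (insert b B)
      have "((\<lambda>n. ((\<tau> - t0) ^ n * Re (k b n)) *\<^sub>R b) has_sum (F \<tau> \<bullet> b) *\<^sub>R b) UNIV"
        using has_sum_bounded_linear[OF bounded_linear_scaleR_left comp[OF _ \<tau>]] insert.prems by auto
      from has_sum_add[OF this insert.IH] insert show ?case by simp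
    qed simp
    from this[OF finite_Basis order_refl]
    show "((\<lambda>n. (\<tau> - t0) ^ n *\<^sub>R (\<Sum>b\<in>Basis. Re (k b n) *\<^sub>R b)) has_sum F \<tau>) UNIV"
      by (simp add: scaleR_sum_right euclidean_representation)
  qed
qed

lemma real_analytic_on_real_line:
  fixes F :: "real \<Rightarrow> 'a::euclidean_space"
  assumes "\<And>t0. t0 \<in> I \<Longrightarrow> \<exists>\<delta>>0. \<exists>c. \<forall>\<tau>. \<bar>\<tau> - t0\<bar> < \<delta> \<longrightarrow> ((\<lambda>n. (\<tau> - t0) ^ n *\<^sub>R c n) has_sum F \<tau>) (UNIV :: nat set)"
  shows "real_analytic_on I F"
  unfolding real_analytic_on_def
proof (intro ballI)
  fix t0 assume "t0 \<in> I"
  then obtain \<delta> :: real and c where \<delta>: "\<delta> > 0"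
    and c: "\<And>\<tau>. \<bar>\<tau> - t0\<bar> < \<delta> \<Longrightarrow> ((\<lambda>n. (\<tau> - t0) ^ n *\<^sub>R c n) has_sum F \<tau>) (UNIV :: nat set)" using assms by blast
  \<comment> \<open>On the real line \<open>Basis\<close> is the singleton of 1, so a multi-index
    amounts to the single exponent \<open>\<alpha> 1\<close>.\<close>
  have bij: "bij_betw (\<lambda>\<alpha>. \<alpha> 1) {\<alpha> :: real \<Rightarrow> nat. \<forall>b. b \<notin> Basis \<longrightarrow> \<alpha> b = 0} UNIV"
    by (rule bij_betw_byWitness[where f' = "\<lambda>n b. if b = 1 then n else 0"]) (auto simp: fun_eq_iff)
  show "\<exists>r>0. \<exists>c. \<forall>x\<in>ball t0 r.
      ((\<lambda>\<alpha>. (\<Prod>b\<in>Basis. ((x - t0) \<bullet> b) ^ \<alpha> b) *\<^sub>R c \<alpha>) has_sum F x) {\<alpha>. \<forall>b. b \<notin> Basis \<longrightarrow> \<alpha> b = 0}"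
  proof (intro exI[of _ \<delta>] exI[of _ "\<lambda>\<alpha>. c (\<alpha> 1)"] conjI ballI)
    fix x assume "x \<in> ball t0 \<delta>"
    then have "\<bar>x - t0\<bar> < \<delta>" by (simp add: dist_real_def abs_minus_commute)
    from has_sum_reindex_bij_betw[OF bij, THEN iffD2, OF c[OF this]]
    show "((\<lambda>\<alpha>. (\<Prod>b\<in>Basis. ((x - t0) \<bullet> b) ^ \<alpha> b) *\<^sub>R c (\<alpha> 1)) has_sum F x) {\<alpha>. \<forall>b. b \<notin> Basis \<longrightarrow> \<alpha> b = 0}" by simp
  qed (rule \<delta>)
qed

text \<open>Subtracting the normality equation from the differentiated tangency relation leaves, as
  coefficient of the acceleration, the derivative of P minus its transpose. By the choice of
  retraction this coefficient vanishes at \<open>\<gamma> t0\<close>, which is what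
  \<open>holomorphic_ode\<close> requires of S.\<close>

lemma geodesic_real_analytic:
  assumes G: "geodesic_data M a b \<gamma> g g2" and M: "submanifold real_analytic_on M"
  shows "real_analytic_on {a<..<b} \<gamma>"
proof (rule real_analytic_on_real_line)
  fix t0 assume t0: "t0 \<in> {a<..<b}"
  let ?p = "\<gamma> t0"
  have pM: "?p \<in> M" using geodesic_dataD(3)[OF G] t0 by auto
  obtain P r where PR: "local_retraction 2 M P ?p r" and PX: "\<And>v. holx ?p (\<lambda>x. P x \<bullet> v)"
      and sym: "\<And>u v. dird P u ?p \<bullet> v = u \<bullet> dird P v ?p"
    by (rule real_analytic_retraction[OF M pM, of 2]) (simp, rule that)
  have r: "0 < r" and P2: "Ck_open 2 (ball ?p r) P" using PR unfolding local_retraction_def by auto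
  note d = geodesic_data_interior[OF G]
  have cont: "isCont \<gamma> t0" using has_vector_derivative_continuous[OF d(1)[OF t0]] .
  have cont_g: "isCont g t0" using has_vector_derivative_continuous[OF d(2)[OF t0]] .
  have cont_g2: "isCont g2 t0"
    by (rule continuous_on_interior[OF geodesic_dataD(2)[OF G]]) (use t0 in simp)
  have "\<forall>\<^sub>F s in at t0. s \<in> {a<..<b} \<and> dist (\<gamma> s) (\<gamma> t0) < r \<and> dist (g s) (g t0) < 1 \<and> dist (g2 s) (g2 t0) < 1"
    by (intro eventually_conj eventually_at_in_open' tendstoD[OF isContD[OF cont]] tendstoD[OF isContD[OF cont_g]]
        tendstoD[OF isContD[OF cont_g2]]) (use t0 r in auto)
  then obtain \<delta>0 where \<delta>0: "\<delta>0 > 0" and near0: "\<And>s. s \<noteq> t0 \<Longrightarrow> dist s t0 < \<delta>0 \<Longrightarrow>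
      s \<in> {a<..<b} \<and> dist (\<gamma> s) (\<gamma> t0) < r \<and> dist (g s) (g t0) < 1 \<and> dist (g2 s) (g2 t0) < 1"
    unfolding eventually_at by auto
  have near: "s \<in> {a<..<b}" "\<gamma> s \<in> ball ?p r" "norm (g s) \<le> norm (g t0) + 1" "norm (g2 s) \<le> norm (g2 t0) + 1"
    if "\<bar>s - t0\<bar> < \<delta>0" for s
  proof -
    have *: "s \<in> {a<..<b} \<and> dist (\<gamma> s) (\<gamma> t0) < r \<and> dist (g s) (g t0) < 1 \<and> dist (g2 s) (g2 t0) < 1"
      using near0[of s] that t0 r by (cases "s = t0") (auto simp: dist_real_def)
    then show "s \<in> {a<..<b}" "\<gamma> s \<in> ball ?p r" by (auto simp: dist_commute)
    show "norm (g s) \<le> norm (g t0) + 1" "norm (g2 s) \<le> norm (g2 t0) + 1"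
      using * norm_triangle_sub[of "g s" "g t0"] norm_triangle_sub[of "g2 s" "g2 t0"] by (auto simp: dist_norm)
  qed
  define I where "I = {t0 - \<delta>0<..<t0 + \<delta>0}"
  have I: "s \<in> I \<longleftrightarrow> \<bar>s - t0\<bar> < \<delta>0" for s by (auto simp: I_def)
  note equation = geodesic_equation[OF _ PR order_refl, of I \<gamma> g g2]
  define S where "S b c x = dird P c x \<bullet> b - dird P b x \<bullet> c" for b c x
  define H where "H b c e x = dird (dird P c) e x \<bullet> b" for b c e x
  obtain \<delta> f where f: "\<delta> > 0" "\<And>b. b \<in> Basis \<Longrightarrow> f b holomorphic_on ball (of_real t0) \<delta>"
    "\<And>b \<tau>. b \<in> Basis \<Longrightarrow> \<bar>\<tau> - t0\<bar> < \<delta> \<Longrightarrow> f b (of_real \<tau>) = of_real (\<gamma> \<tau> \<bullet> b)"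
  proof (rule holomorphic_ode[OF \<delta>0 d(1)[OF near(1)] d(2)[OF near(1)] near(3,4), where S = S and H = H])
    have inner_dird: "dird P c x \<bullet> b = dird (\<lambda>x. P x \<bullet> b) c x" if "x \<in> ball ?p r" for b c x
    proof -
      have "(P has_derivative (\<lambda>v. dird P v x)) (at x)"
        using has_derivative_dird P2 that by (metis numeral_2_eq_2)
      then have "((\<lambda>x. P x \<bullet> b) has_derivative (\<lambda>v. dird P v x \<bullet> b)) (at x)"
        by (rule has_derivative_inner_left)
      then show ?thesis using dird_eqI by metis
    qed
    have hD: "holx ?p (\<lambda>x. dird P c x \<bullet> b)" if "c \<in> Basis" for b c
      by (rule holx_cong[OF holx_dird[OF PX[of b], of c] r inner_dird]) (use that in auto)
    show "holx ?p (S b c)" if "b \<in> Basis" "c \<in> Basis" for b c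
      unfolding S_def by (intro holx_diff hD that)
    show "S b c ?p = 0" if "b \<in> Basis" "c \<in> Basis" for b c
      using sym[of c b] by (simp add: S_def inner_commute)
    have inner_dird2: "dird (dird P c) e x \<bullet> b = dird (\<lambda>x. dird P c x \<bullet> b) e x" if "x \<in> ball ?p r" for b c e x
    proof -
      have "Ck_open (Suc 0) (ball ?p r) (dird P c)" using Ck_open_dird P2 by (metis numeral_2_eq_2)
      then have "(dird P c has_derivative (\<lambda>v. dird (dird P c) v x)) (at x)"
        using has_derivative_dird that by blast
      then have "((\<lambda>x. dird P c x \<bullet> b) has_derivative (\<lambda>v. dird (dird P c) v x \<bullet> b)) (at x)"
        by (rule has_derivative_inner_left)
      then show ?thesis using dird_eqI by metis
    qed
    show "holx ?p (H b c e)" if "b \<in> Basis" "c \<in> Basis" "e \<in> Basis" for b c e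
      unfolding H_def
      by (rule holx_cong[OF holx_dird[OF hD[of c b], of e] r inner_dird2]) (use that in auto)
    fix \<tau> and b :: 'a assume \<tau>: "\<bar>\<tau> - t0\<bar> < \<delta>0" and b: "b \<in> Basis"
    have eqs: "dird_adj P (\<gamma> \<tau>) (g2 \<tau>) = 0" "g2 \<tau> - dird P (g2 \<tau>) (\<gamma> \<tau>) = dird (dird P (g \<tau>)) (g \<tau>) (\<gamma> \<tau>)"
      by (rule equation; (use I near \<tau> in \<open>simp add: I_def\<close>; fail)?;
          use I near d geodesic_dataD(3,6)[OF G] \<tau> in \<open>force intro: less_imp_le\<close>)+
    have adj: "g2 \<tau> \<bullet> dird P b (\<gamma> \<tau>) = 0"
    proof -
      have "dird_adj P (\<gamma> \<tau>) (g2 \<tau>) \<bullet> b = g2 \<tau> \<bullet> dird P b (\<gamma> \<tau>)"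
        unfolding dird_adj_def using b by (simp add: inner_sum_left inner_Basis if_distrib cong: if_cong)
      then show ?thesis using eqs(1) by simp
    qed
    have "dird P (g2 \<tau>) (\<gamma> \<tau>) = (\<Sum>c\<in>Basis. (g2 \<tau> \<bullet> c) *\<^sub>R dird P c (\<gamma> \<tau>))"
      by (rule dird_expand[OF P2[unfolded numeral_2_eq_2] near(2)[OF \<tau>]])
    then have 1: "dird P (g2 \<tau>) (\<gamma> \<tau>) \<bullet> b = (\<Sum>c\<in>Basis. (dird P c (\<gamma> \<tau>) \<bullet> b) * (g2 \<tau> \<bullet> c))"
      by (simp add: inner_sum_left mult.commute)
    have 2: "g2 \<tau> \<bullet> dird P b (\<gamma> \<tau>) = (\<Sum>c\<in>Basis. (dird P b (\<gamma> \<tau>) \<bullet> c) * (g2 \<tau> \<bullet> c))"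
      by (simp add: euclidean_inner[of "g2 \<tau>" "dird P b (\<gamma> \<tau>)"] mult.commute)
    have 3: "dird (dird P (g \<tau>)) (g \<tau>) (\<gamma> \<tau>) \<bullet> b =
        (\<Sum>c\<in>Basis. \<Sum>e\<in>Basis. H b c e (\<gamma> \<tau>) * ((g \<tau> \<bullet> c) * (g \<tau> \<bullet> e)))"
      unfolding H_def by (subst dird_dird_expand2[OF open_ball P2 near(2)[OF \<tau>]]) (simp add: inner_sum_left mult_ac)
    show "g2 \<tau> \<bullet> b = (\<Sum>c\<in>Basis. S b c (\<gamma> \<tau>) * (g2 \<tau> \<bullet> c)) +
        (\<Sum>c\<in>Basis. \<Sum>e\<in>Basis. H b c e (\<gamma> \<tau>) * ((g \<tau> \<bullet> c) * (g \<tau> \<bullet> e)))"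
      unfolding 3[symmetric] eqs(2)[symmetric] S_def left_diff_distrib sum_subtractf 1[symmetric] 2[symmetric] adj
      by (simp add: inner_diff_left)
  qed (assumption | rule that)+
  obtain c where "\<And>\<tau>. \<bar>\<tau> - t0\<bar> < \<delta> \<Longrightarrow> ((\<lambda>n. (\<tau> - t0) ^ n *\<^sub>R c n) has_sum \<gamma> \<tau>) (UNIV :: nat set)"
    by (rule real_power_series_of_holomorphic[OF f]) (assumption | rule that)+
  then show "\<exists>\<delta>>0. \<exists>c. \<forall>\<tau>. \<bar>\<tau> - t0\<bar> < \<delta> \<longrightarrow> ((\<lambda>n. (\<tau> - t0) ^ n *\<^sub>R c n) has_sum \<gamma> \<tau>) (UNIV :: nat set)"
    using f(1) by blast
qed

section \<open>Assembly of regularity, jump condition, geodesic pieces and end derivatives\<close>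

theorem theorem5p3:
  fixes M :: "'a::euclidean_space set"
    and F :: "real \<Rightarrow> 'a" and Y :: "nat \<Rightarrow> 'a" and t :: "nat \<Rightarrow> real"
    and n k :: nat and lam :: real
  assumes k: "k \<ge> 2"
    and M: "submanifold (Ck_on k) M" "compact M" "connected M"
    and n: "n \<ge> 1"
    and t: "inj_on t {1..n}" "\<And>i. i \<in> {1..n} \<Longrightarrow> 0 < t i \<and> t i < 1"
    and Y: "\<And>i. i \<in> {1..n} \<Longrightarrow> Y i \<in> M"
    and lam: "lam > 0"
    and F: "is_penalized_minimizer M n t Y lam F"
    and inj: "\<And>i. i \<in> {1..n} \<Longrightarrow> ereal (geo_dist M (F (t i)) (Y i)) < inj_radius M"
  shows
    "(Ck_on k ({0..1} - t ` {1..n}) F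
     \<and> (submanifold smooth_on M \<longrightarrow> (\<forall>i\<in>{1..<n}. smooth_on (gap t n i) F))
     \<and> (submanifold real_analytic_on M \<longrightarrow> (\<forall>i\<in>{1..<n}. real_analytic_on (gap t n i) F)))
     \<and> (esssup (lebesgue_on {0..1}) (\<lambda>s. ereal (norm (weak_derivative F s))) < \<infinity>
     \<and> (\<forall>i\<in>{1..n}. continuous (at (t i)) F \<and>
          (\<exists>vp vm. ((\<lambda>s. vector_derivative F (at s)) \<longlongrightarrow> vp) (at_right (t i)) \<and>
                   ((\<lambda>s. vector_derivative F (at s)) \<longlongrightarrow> vm) (at_left (t i)) \<and>
                   vp - vm = - (1 / (real n * lam)) *\<^sub>R riem_log M (F (t i)) (Y i) \<and>
                   vp - vm \<in> tangent_space M (F (t i)) \<and>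
                   (F (t i) \<noteq> Y i \<longrightarrow> vp \<noteq> vm))))
     \<and> ((\<forall>i\<in>{1..<n}.
        harmonic_map M (order_stat t n i) (order_stat t n (i + 1)) F
        \<and> geodesic_on M (gap t n i) F
        \<and> (\<exists>c. \<forall>s\<in>gap t n i. norm (vector_derivative F (at s)) = c)
        \<and> (M = sphere 0 1 \<longrightarrow>
             (\<exists>u v w. norm u = 1 \<and> norm v = 1 \<and> u \<bullet> v = 0 \<and> w \<ge> 0 \<and>
                (\<forall>s\<in>gap t n i. F s = cos (w * s) *\<^sub>R u + sin (w * s) *\<^sub>R v))))
     \<and> (\<forall>Z (G :: real \<Rightarrow> 'a). is_penalized_minimizer UNIV n t Z lam G \<longrightarrow>
          (\<forall>i\<in>{1..<n}. \<exists>p v. \<forall>s\<in>gap t n i. G s = p + s *\<^sub>R v)))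
     \<and> (((\<lambda>s. vector_derivative F (at s)) \<longlongrightarrow> 0) (at_right 0)
     \<and> ((\<lambda>s. vector_derivative F (at s)) \<longlongrightarrow> 0) (at_left 1))"
proof -
  have Rk: "locally_retractable k M" by (rule submanifold_locally_retractable[OF M(1)]) (use k in simp)
  interpret penalized_manifold M F Y t n lam
    by unfold_locales (use n t lam F M(2,3) Y locally_retractable_mono[OF Rk k] in auto)
  have gp: "gap t n i = {order_stat t n i<..<order_stat t n (i + 1)}" "open (gap t n i)" for i
    by (simp_all add: gap_def)
  have smooth: "smooth_on (gap t n i) F" if S: "submanifold smooth_on M" and i: "i \<in> {1..<n}" for i
    unfolding smooth_on_def
  proof
    fix l
    \<comment> \<open>The regularity lemma starts at class 2; lower classes follow from it by
      monotonicity.\<close>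
    have "submanifold (Ck_on (max 2 l)) M" using S unfolding submanifold_def smooth_on_def by meson
    then have "locally_retractable (max 2 l) M" by (rule submanifold_locally_retractable) simp
    from gap_geodesic(5)[OF i this] have "Ck_on (max 2 l) (gap t n i) F"
      unfolding Ck_on_open_iff[OF gp(2)] by simp
    then show "Ck_on l (gap t n i) F" by (rule Ck_on_mono) simp
  qed
  have analytic: "real_analytic_on (gap t n i) F" if S: "submanifold real_analytic_on M" and i: "i \<in> {1..<n}" for i
  proof -
    obtain g g2 where "geodesic_data M (order_stat t n i) (order_stat t n (i + 1)) F g g2"
      using gap_geodesic(4)[OF i] by blast
    from geodesic_real_analytic[OF this S] show ?thesis unfolding gp(1) .
  qed
  have cont: "continuous (at (t i)) F" if i: "i \<in> {1..n}" for i
    by (rule continuous_on_interior[OF F_continuous]) (use t(2)[OF i] in simp)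
  have jump: "\<exists>vp vm. ((\<lambda>s. vector_derivative F (at s)) \<longlongrightarrow> vp) (at_right (t i)) \<and>
      ((\<lambda>s. vector_derivative F (at s)) \<longlongrightarrow> vm) (at_left (t i)) \<and>
      vp - vm = - (1 / (real n * lam)) *\<^sub>R riem_log M (F (t i)) (Y i) \<and>
      vp - vm \<in> tangent_space M (F (t i)) \<and> (F (t i) \<noteq> Y i \<longrightarrow> vp \<noteq> vm)" if i: "i \<in> {1..n}" for i
    by (rule derivative_jump[OF i inj[OF i]]) blast
  have circle: "\<exists>u v w. norm u = 1 \<and> norm v = 1 \<and> u \<bullet> v = 0 \<and> w \<ge> 0 \<and>
      (\<forall>s\<in>gap t n i. F s = cos (w * s) *\<^sub>R u + sin (w * s) *\<^sub>R v)"
    if S: "M = sphere 0 1" and i: "i \<in> {1..<n}" for i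
  proof -
    obtain g g2 where G: "geodesic_data M (order_stat t n i) (order_stat t n (i + 1)) F g g2"
      using gap_geodesic(4)[OF i] by blast
    have conn: "connected (sphere (0::'a) 1)" using M(2) S by simp
    show ?thesis
      unfolding gp(1)
      by (rule great_circle[OF G[unfolded S] gap_properties(2)[OF i] conn])
        (rule geodesic_data_constant_speed[OF G Rk _ gap_properties(2)[OF i]], use k in simp)
  qed
  have affine: "\<exists>p v. \<forall>s\<in>gap t n i. G s = p + s *\<^sub>R v"
    if Z: "is_penalized_minimizer UNIV n t Z lam G" and i: "i \<in> {1..<n}" for Z and G :: "real \<Rightarrow> 'a" and i
  proof -
    \<comment> \<open>The Euclidean clause concerns minimizers into the whole space, which is not
      compact, so the locale without manifold assumptions is interpreted.\<close>
    interpret U: penalized_setup UNIV G Z t n lam by unfold_locales (use n t lam Z in auto)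
    show ?thesis by (rule U.affine_on_gap[OF refl i])
  qed
  show ?thesis
    by (intro conjI impI ballI allI F_Ck[OF Rk k] smooth analytic esssup_finite cont jump gap_geodesic(1-3)
        circle affine endpoint_derivatives)
qed

end
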